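(* Let $A$ and $B$ be JBW algebras such that $A$ has no direct summand of Type $I_2$. Let $\varphi: AS(A)\to AS(B)$ be a bijection such that for all $C,D\in AS(A)$: $C\subseteq D$ iff $\varphi(C)\subseteq\varphi(D)$, and $C\perp D$ iff $\varphi(C)\perp\varphi(D)$. Then there is a unique Jordan isomorphism $\psi: A\to B$ such that $\varphi(C)=\psi(C)$ for all $C\in AS(A)$.
   Context: A JB algebra is a real Banach algebra $(A,\circ)$ with a commutative product satisfying $a\circ(b\circ a^2)=(a\circ b)\circ a^2$, $\|a^2\|\le\|a^2+b^2\|$, $\|a\|^2=\|a^2\|$; a JBW algebra is a JB algebra that is a dual Banach space. $AS(A)$ denotes the set of all associative JB subalgebras (norm-closed subalgebras with associative product, not required to contain the unit, including $\{0\}$) of $A$, ordered by inclusion. Two elements $C,D\in AS(A)$ are orthogonal, $C\perp D$, if $x\circ y=0$ for all $x\in C$, $y\in D$. A Jordan isomorphism is a bijective linear map preserving $\circ$. "Type $I_2$" refers to the standard type decomposition of JBW algebras; the Type $I_2$ factors are the spin factors $V_n=H_n\oplus\mathbb{R}$, $\dim H_n\ge 2$. *)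

theory Defs
  imports "HOL-Analysis.Analysis"
begin

definition JB_algebra :: "('a::banach \<Rightarrow> 'a \<Rightarrow> 'a) \<Rightarrow> bool" where
  "JB_algebra jm \<longleftrightarrow>
     (\<forall>a b c. jm (a + b) c = jm a c + jm b c) \<and>
     (\<forall>r a b. jm (r *\<^sub>R a) b = r *\<^sub>R jm a b) \<and>
     (\<forall>a b. jm a b = jm b a) \<and>
     (\<forall>a b. norm (jm a b) \<le> norm a * norm b) \<and>
     (\<forall>a b. jm a (jm b (jm a a)) = jm (jm a b) (jm a a)) \<and>
     (\<forall>a b. norm (jm a a) \<le> norm (jm a a + jm b b)) \<and>
     (\<forall>a. (norm a)\<^sup>2 = norm (jm a a))"

text \<open>V is a predual: a closed subspace of the dual such that the canonical map
  from the space into the dual of V is an isometric (linear) bijection.\<close>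

definition predual :: "('a::real_normed_vector \<Rightarrow>\<^sub>L real) set \<Rightarrow> bool" where
  "predual V \<longleftrightarrow> subspace V \<and> closed V \<and>
     (\<forall>x::'a. norm x = (SUP f\<in>{f\<in>V. norm f \<le> 1}. \<bar>blinfun_apply f x\<bar>)) \<and>
     (\<forall>g :: ('a \<Rightarrow>\<^sub>L real) \<Rightarrow> real.
        ((\<forall>f\<in>V. \<forall>h\<in>V. g (f + h) = g f + g h) \<and>
         (\<forall>c. \<forall>f\<in>V. g (c *\<^sub>R f) = c * g f) \<and>
         (\<exists>K. \<forall>f\<in>V. \<bar>g f\<bar> \<le> K * norm f))
        \<longrightarrow> (\<exists>x. \<forall>f\<in>V. g f = blinfun_apply f x))"

definition JBW_algebra :: "('a::banach \<Rightarrow> 'a \<Rightarrow> 'a) \<Rightarrow> bool" where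
  "JBW_algebra jm \<longleftrightarrow> JB_algebra jm \<and> (\<exists>V :: ('a \<Rightarrow>\<^sub>L real) set. predual V)"

definition AS :: "('a::banach \<Rightarrow> 'a \<Rightarrow> 'a) \<Rightarrow> 'a set set" where
  "AS jm = {C. subspace C \<and> closed C \<and> (\<forall>x\<in>C. \<forall>y\<in>C. jm x y \<in> C) \<and>
               (\<forall>x\<in>C. \<forall>y\<in>C. \<forall>z\<in>C. jm (jm x y) z = jm x (jm y z))}"

definition orth_sub :: "('a \<Rightarrow> 'a \<Rightarrow> 'a::zero) \<Rightarrow> 'a set \<Rightarrow> 'a set \<Rightarrow> bool" where
  "orth_sub jm C D \<longleftrightarrow> (\<forall>x\<in>C. \<forall>y\<in>D. jm x y = 0)"

definition jordan_iso :: "('a::real_vector \<Rightarrow> 'a \<Rightarrow> 'a) \<Rightarrow> ('b::real_vector \<Rightarrow> 'b \<Rightarrow> 'b) \<Rightarrow> ('a \<Rightarrow> 'b) \<Rightarrow> bool" where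
  "jordan_iso jA jB \<psi> \<longleftrightarrow> bij \<psi> \<and> linear \<psi> \<and> (\<forall>x y. \<psi> (jA x y) = jB (\<psi> x) (\<psi> y))"

definition is_proj :: "('a \<Rightarrow> 'a \<Rightarrow> 'a) \<Rightarrow> 'a \<Rightarrow> bool" where
  "is_proj jm p \<longleftrightarrow> jm p p = p"

definition proj_le :: "('a \<Rightarrow> 'a \<Rightarrow> 'a) \<Rightarrow> 'a \<Rightarrow> 'a \<Rightarrow> bool" where
  "proj_le jm p q \<longleftrightarrow> jm p q = p"

definition central :: "('a \<Rightarrow> 'a \<Rightarrow> 'a) \<Rightarrow> 'a \<Rightarrow> bool" where
  "central jm z \<longleftrightarrow> (\<forall>a c. jm z (jm a c) = jm a (jm z c))"

definition central_proj :: "('a \<Rightarrow> 'a \<Rightarrow> 'a) \<Rightarrow> 'a \<Rightarrow> bool" where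
  "central_proj jm z \<longleftrightarrow> is_proj jm z \<and> central jm z"

definition Uop :: "('a::real_vector \<Rightarrow> 'a \<Rightarrow> 'a) \<Rightarrow> 'a \<Rightarrow> 'a \<Rightarrow> 'a" where
  "Uop jm p x = 2 *\<^sub>R jm p (jm p x) - jm (jm p p) x"

definition abelian_proj :: "('a::real_vector \<Rightarrow> 'a \<Rightarrow> 'a) \<Rightarrow> 'a \<Rightarrow> bool" where
  "abelian_proj jm p \<longleftrightarrow> is_proj jm p \<and>
     (\<forall>x\<in>range (Uop jm p). \<forall>y\<in>range (Uop jm p). \<forall>z\<in>range (Uop jm p).
        jm (jm x y) z = jm x (jm y z))"

definition central_support :: "('a \<Rightarrow> 'a \<Rightarrow> 'a) \<Rightarrow> 'a \<Rightarrow> 'a \<Rightarrow> bool" where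
  "central_support jm p z \<longleftrightarrow> central_proj jm z \<and> proj_le jm p z \<and>
     (\<forall>w. central_proj jm w \<and> proj_le jm p w \<longrightarrow> proj_le jm z w)"

text \<open>A direct summand zA (z a nonzero central projection) is of type I_2 iff
  z is the sum of two orthogonal abelian projections each with central support z.\<close>

definition has_type_I2_summand :: "('a::real_vector \<Rightarrow> 'a \<Rightarrow> 'a) \<Rightarrow> bool" where
  "has_type_I2_summand jm \<longleftrightarrow> (\<exists>z p q. z \<noteq> 0 \<and> central_proj jm z \<and>
     abelian_proj jm p \<and> abelian_proj jm q \<and> jm p q = 0 \<and> p + q = z \<and>
     central_support jm p z \<and> central_support jm q z)"

end

theory Submission
  imports Defs
begin

text \<open>
  Minimal nonzero associative subalgebras are the lines \<open>\<real>p\<close> spanned by idempotents, so \<open>\<phi>\<close> induces a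
  bijection \<open>\<theta>\<close> between the idempotents that preserves orthogonality, hence orthogonal sums. To see that
  \<open>\<theta>\<close> extends linearly, compare the compressions \<open>U s p\<close> and \<open>U (\<theta> s) (\<theta> p)\<close> on small corners \<open>s\<close>: without
  a summand of type \<open>I\<^sub>2\<close> there is, below any corner on which \<open>U s p\<close> is not trivial, a copy of the symmetric
  three by three matrices containing the relevant part of \<open>p\<close>, and a measure on the lines of three-space that
  is concentrated at one pole is the square of the height. So both compressions are close to the same
  scalar, \<open>\<theta>\<close> preserves norms of linear combinations, and it extends to an isometry \<open>\<psi>\<close>, which preserves
  squares because elements are limits of orthogonal combinations. Finally \<open>\<psi>\<inverse> \<phi>\<close> is an order
  automorphism fixing all lines \<open>\<real>p\<close>; the subalgebra generated by a positive \<open>f\<close> is squeezed between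
  closed spans of spectral idempotents of \<open>f\<close> for two disjoint dense sets of levels, so it is fixed too.
\<close>

section \<open>Jordan identities and Peirce decomposition\<close>

text \<open>No continuity of \<phi> or \<theta> is available, and \<theta> is additive only on
  finitely many orthogonal summands, so its linear extension has to be forced by inequalities. A
  corner is shrunk until a compression is nearly scalar; it remains to show that both algebras see
  the same scalar. The lower bound is the accessible one: an idempotent whose compression is exactly
  a scalar dominates a line of three-space of that height. An upper bound for \<open>p\<close> is
  obtained as a lower bound for an idempotent orthogonal to \<open>p\<close>, constructed by a
  dilation. The third dimension is what makes this work: in the plane, orthogonality merely pairs
  each line with one other line, and nothing relates the values on different pairs; a summand of
  type \<open>I\<^sub>2\<close> leaves exactly this freedom. The predual enters through two
  consequences, a unit and suprema of bounded increasing sequences. Such suprema leave the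
  norm-closed algebra generated by an element, which is why its spectral idempotents overshoot that
  algebra and two disjoint sets of levels are needed to cut the excess off.\<close>

lemma vec_eqI:
  fixes x y :: "'a::real_vector"
  assumes "\<And>f::'a \<Rightarrow> real. \<lbrakk>\<And>a b. f (a + b) = f a + f b; \<And>a b. f (a - b) = f a - f b;
    \<And>c a. f (c *\<^sub>R a) = c * f a; \<And>a. f (- a) = - f a; f 0 = 0\<rbrakk> \<Longrightarrow> f x = f y"
  shows "x = y"
proof (rule ccontr)
  assume "x \<noteq> y"
  then have "independent {x - y}" by simp
  then obtain g :: "'a \<Rightarrow> real" where g: "linear g" "\<forall>z\<in>{x - y}. g z = 1"
    using linear_independent_extend[of "{x - y}" "\<lambda>_. 1::real"] by auto
  have "g x = g y"
    by (rule assms) (simp_all add: linear_add linear_diff linear_scale linear_neg linear_0 g(1))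
  with g show False by (simp add: linear_diff)
qed

text \<open>Testing on functionals turns a linear consequence of a vector equation into real
  arithmetic for the simplifier. This and the variants with two or three premises carry most Jordan
  computations below.\<close>

lemma vec_lin1:
  fixes x y :: "'a::real_vector"
  assumes h: "l1 = (r1::'a)"
  assumes "\<And>f::'a \<Rightarrow> real. \<lbrakk>\<And>a b. f (a + b) = f a + f b; \<And>a b. f (a - b) = f a - f b;
    \<And>c a. f (c *\<^sub>R a) = c * f a; \<And>a. f (- a) = - f a; f 0 = 0; f l1 = f r1\<rbrakk> \<Longrightarrow> f x = f y"
  shows "x = y"
  by (rule vec_eqI) (rule assms(2); simp add: h)

lemma vec_lin2:
  fixes x y :: "'a::real_vector"
  assumes h: "l1 = (r1::'a)" "l2 = (r2::'a)"
  assumes "\<And>f::'a \<Rightarrow> real. \<lbrakk>\<And>a b. f (a + b) = f a + f b; \<And>a b. f (a - b) = f a - f b;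
    \<And>c a. f (c *\<^sub>R a) = c * f a; \<And>a. f (- a) = - f a; f 0 = 0; f l1 = f r1; f l2 = f r2\<rbrakk>
    \<Longrightarrow> f x = f y"
  shows "x = y"
  by (rule vec_eqI) (rule assms(3); simp add: h)

lemma vec_lin3:
  fixes x y :: "'a::real_vector"
  assumes h: "l1 = (r1::'a)" "l2 = (r2::'a)" "l3 = (r3::'a)"
  assumes "\<And>f::'a \<Rightarrow> real. \<lbrakk>\<And>a b. f (a + b) = f a + f b; \<And>a b. f (a - b) = f a - f b;
    \<And>c a. f (c *\<^sub>R a) = c * f a; \<And>a. f (- a) = - f a; f 0 = 0; f l1 = f r1; f l2 = f r2;
    f l3 = f r3\<rbrakk> \<Longrightarrow> f x = f y"
  shows "x = y"
  by (rule vec_eqI) (rule assms(4); simp add: h)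

lemma subspace_closure:
  fixes V :: "'x::real_normed_vector set"
  assumes "subspace V"
  shows "subspace (closure V)"
proof (rule subspaceI)
  show "0 \<in> closure V" using assms closure_subset subspace_0 by blast
  show "x + y \<in> closure V" if xy: "x \<in> closure V" "y \<in> closure V" for x y
  proof -
    obtain f g where f: "\<And>n. f n \<in> V" "f \<longlonglongrightarrow> x" and g: "\<And>n. g n \<in> V" "g \<longlonglongrightarrow> y"
      using xy unfolding closure_sequential by blast
    have "(\<lambda>n. f n + g n) \<longlonglongrightarrow> x + y" using f(2) g(2) by (rule tendsto_add)
    then show ?thesis unfolding closure_sequential
      using f(1) g(1) subspace_add[OF assms] by (intro exI[of _ "\<lambda>n. f n + g n"]) auto
  qed
  show "c *\<^sub>R x \<in> closure V" if x: "x \<in> closure V" for c x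
  proof -
    obtain f where f: "\<And>n. f n \<in> V" "f \<longlonglongrightarrow> x" using x unfolding closure_sequential by blast
    have "(\<lambda>n. c *\<^sub>R f n) \<longlonglongrightarrow> c *\<^sub>R x" using f(2) by (intro tendsto_intros)
    then show ?thesis unfolding closure_sequential
      using f(1) subspace_scale[OF assms] by (intro exI[of _ "\<lambda>n. c *\<^sub>R f n"]) auto
  qed
qed

section \<open>Polarised forms of the Jordan identity\<close>

locale jb =
  fixes jm :: "'a::banach \<Rightarrow> 'a \<Rightarrow> 'a" (infixl "\<odot>" 70)
  assumes JB: "JB_algebra jm"
begin

lemma comm: "a \<odot> b = b \<odot> a"
  and jordan: "a \<odot> (b \<odot> (a \<odot> a)) = (a \<odot> b) \<odot> (a \<odot> a)"
  and norm_sq_le: "norm (a \<odot> a) \<le> norm (a \<odot> a + b \<odot> b)"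
  and norm_sq: "norm (a \<odot> a) = (norm a)\<^sup>2"
  and norm_mult_le: "norm (a \<odot> b) \<le> norm a * norm b"
  using JB unfolding JB_algebra_def by metis+

sublocale bounded_bilinear jm
proof
  fix a b c :: 'a and r :: real
  show add: "(a + b) \<odot> c = a \<odot> c + b \<odot> c" for a b c
    using JB unfolding JB_algebra_def by metis
  show "a \<odot> (b + c) = a \<odot> b + a \<odot> c"
    using add comm by metis
  show sc: "(r *\<^sub>R a) \<odot> b = r *\<^sub>R (a \<odot> b)" for a b r
    using JB unfolding JB_algebra_def by metis
  show "a \<odot> (r *\<^sub>R b) = r *\<^sub>R (a \<odot> b)"
    using sc comm by metis
  show "\<exists>K. \<forall>a b. norm (a \<odot> b) \<le> norm a * norm b * K"
    using norm_mult_le by (intro exI[of _ 1]) simp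
qed

lemmas bil = add_left add_right diff_left diff_right scaleR_left scaleR_right
  minus_left minus_right zero_left zero_right

text \<open>The identity at \<open>a + c\<close> minus the one at \<open>a - c\<close> keeps the
  terms of odd degree in \<open>c\<close>; removing twice the identity at \<open>c\<close> leaves
  twice the part linear in \<open>c\<close>.\<close>

lemma jordan_lin2:
  "c \<odot> (b \<odot> (a \<odot> a)) + 2 *\<^sub>R (a \<odot> (b \<odot> (a \<odot> c)))
     = (c \<odot> b) \<odot> (a \<odot> a) + 2 *\<^sub>R ((a \<odot> b) \<odot> (a \<odot> c))"
  apply (rule vec_lin3[OF jordan[of "a + c" b] jordan[of "a - c" b] jordan[of c b]])
  by (simp only: bil comm[of c a])

text \<open>Polarisation in the remaining quadratic variable: the value at \<open>a + d\<close>
  minus the values at \<open>a\<close> and at \<open>d\<close>.\<close>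

lemma jordan_lin:
  "a \<odot> (b \<odot> (c \<odot> d)) + c \<odot> (b \<odot> (a \<odot> d)) + d \<odot> (b \<odot> (a \<odot> c))
     = (a \<odot> b) \<odot> (c \<odot> d) + (c \<odot> b) \<odot> (a \<odot> d) + (d \<odot> b) \<odot> (a \<odot> c)"
  apply (rule vec_lin3[OF jordan_lin2[of c b "a + d"] jordan_lin2[of c b a] jordan_lin2[of c b d]])
  by (simp add: bil comm[of d a] comm[of d c] comm[of c a] algebra_simps)

text \<open>Read as operators acting on \<open>x\<close>: the commutators of each of
  \<open>a\<close>, \<open>c\<close>, \<open>d\<close> with the product of the other two add up to
  zero.\<close>

lemma jordan_comm:
  "a \<odot> ((c \<odot> d) \<odot> x) + c \<odot> ((a \<odot> d) \<odot> x) + d \<odot> ((a \<odot> c) \<odot> x)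
     = (c \<odot> d) \<odot> (a \<odot> x) + (a \<odot> d) \<odot> (c \<odot> x) + (a \<odot> c) \<odot> (d \<odot> x)"
  using jordan_lin[of a x c d] by (simp add: comm)

text \<open>Read as operators acting on \<open>x\<close>: multiplication by
  \<open>(a \<odot> c) \<odot> b\<close> is expressed through multiplications by shorter products.
  \<open>oc_step\<close> uses this as a recursion.\<close>

lemma jordan_triple:
  "a \<odot> (b \<odot> (c \<odot> x)) + c \<odot> (b \<odot> (a \<odot> x)) + ((a \<odot> c) \<odot> b) \<odot> x
     = (a \<odot> b) \<odot> (c \<odot> x) + (c \<odot> b) \<odot> (a \<odot> x) + (a \<odot> c) \<odot> (b \<odot> x)"
  using jordan_lin[of a b c x] by (simp add: comm)

section \<open>Operator commutation and power associativity\<close>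

text \<open>Stronger than associativity inside a subalgebra: \<open>a\<close> and \<open>b\<close>
  may be moved past each other in front of an arbitrary outside element.\<close>

definition oc :: "'a \<Rightarrow> 'a \<Rightarrow> bool"
  where "oc a b \<longleftrightarrow> (\<forall>x. a \<odot> (b \<odot> x) = b \<odot> (a \<odot> x))"

lemma ocD: "oc a b \<Longrightarrow> a \<odot> (b \<odot> x) = b \<odot> (a \<odot> x)"
  by (simp add: oc_def)

lemma oc_sym: "oc a b \<longleftrightarrow> oc b a"
  by (auto simp: oc_def)

lemma oc_sq: "oc a (a \<odot> a)"
  unfolding oc_def using jordan by (metis comm)

lemma oc_step:
  assumes "oc b a" "oc b (a \<odot> a)" "oc b y" "oc b (a \<odot> y)"
  shows "oc b (a \<odot> (a \<odot> y))"
  unfolding oc_def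
proof
  fix x
  have r: "(a \<odot> (a \<odot> y)) \<odot> x = (a \<odot> a) \<odot> (y \<odot> x) + 2 *\<^sub>R ((a \<odot> y) \<odot> (a \<odot> x))
      - a \<odot> (a \<odot> (y \<odot> x)) - y \<odot> (a \<odot> (a \<odot> x))" for x
    by (rule vec_lin1[OF jordan_triple[of a a y x]]) (simp add: comm[of y a] comm[of "a \<odot> y" a])
  show "b \<odot> (a \<odot> (a \<odot> y) \<odot> x) = a \<odot> (a \<odot> y) \<odot> (b \<odot> x)"
    unfolding r by (simp only: bil assms[THEN ocD])
qed

text \<open>\<open>pw a n\<close> is the power with exponent \<open>n + 1\<close>; no unit is
  available yet, so the sequence starts at \<open>a\<close>.\<close>

primrec pw :: "'a \<Rightarrow> nat \<Rightarrow> 'a" where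
  "pw a 0 = a"
| "pw a (Suc n) = a \<odot> pw a n"

text \<open>The induction carries two consecutive powers, since \<open>oc_step\<close> raises the
  exponent by two and asks for commutation with the power in between.\<close>

lemma oc_pw:
  assumes "oc b a" "oc b (a \<odot> a)"
  shows "oc b (pw a n)"
proof -
  have "oc b (pw a n) \<and> oc b (pw a (Suc n))"
    by (induction n) (use assms oc_step in auto)
  then show ?thesis ..
qed

lemma oc_pw_pw: "oc (pw a m) (pw a n)"
proof -
  have 1: "oc a (pw a m)" for m
    by (rule oc_pw) (auto simp: oc_sq, simp add: oc_def)
  have 2: "oc (a \<odot> a) (pw a m)" for m
    by (rule oc_pw) (auto simp: oc_sq oc_sym[of "a \<odot> a" a], simp add: oc_def)
  show ?thesis
    by (rule oc_pw) (use 1 2 oc_sym in blast)+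
qed

lemma pw_mult: "pw a m \<odot> pw a n = pw a (Suc (m + n))"
proof (induction n)
  case (Suc n)
  have "pw a m \<odot> pw a (Suc n) = a \<odot> (pw a m \<odot> pw a n)"
    using oc_pw_pw[of a m 0] by (simp add: ocD)
  then show ?case using Suc by simp
qed (simp add: comm)

text \<open>Operator commutation is demanded in place of associativity because a check on pairs of
  generators suffices for it (\<open>oca_closure_span\<close>); \<open>oca_assoc\<close> recovers
  associativity.\<close>

definition oca :: "'a set \<Rightarrow> bool"
  where "oca S \<longleftrightarrow> subspace S \<and> closed S \<and> (\<forall>x\<in>S. \<forall>y\<in>S. x \<odot> y \<in> S) \<and> (\<forall>x\<in>S. \<forall>y\<in>S. oc x y)"

lemma closure_span_subset:
  fixes V :: "'a set"
  shows "subspace V \<Longrightarrow> closed V \<Longrightarrow> T \<subseteq> V \<Longrightarrow> closure (span T) \<subseteq> V"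
  by (simp add: closure_minimal span_minimal)

lemma closed_eq_cont:
  "continuous_on UNIV f \<Longrightarrow> continuous_on UNIV g \<Longrightarrow> closed {x::'a. f x = (g x::'a)}"
  by (rule closed_Collect_eq)

lemma cont_mult [continuous_intros]:
  "continuous_on S f \<Longrightarrow> continuous_on S g \<Longrightarrow> continuous_on S (\<lambda>x. f x \<odot> g x)"
  by (rule continuous_on)

lemma oc_closed_subspace: "subspace {x. oc x y}" "closed {x. oc x y}"
proof -
  show "subspace {x. oc x y}"
    unfolding subspace_def oc_def by (auto simp: bil)
  have "{x. oc x y} = (\<Inter>z. {x. x \<odot> (y \<odot> z) = y \<odot> (x \<odot> z)})"
    by (auto simp: oc_def)
  moreover have "closed {x. x \<odot> (y \<odot> z) = y \<odot> (x \<odot> z)}" for z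
    by (intro closed_eq_cont continuous_intros)
  ultimately show "closed {x. oc x y}" by (metis (no_types, lifting) closed_INT)
qed

text \<open>In each argument the required property cuts out a closed subspace, so it extends from
  \<open>T\<close> to the closed span in one argument and then, by symmetry, in the other.\<close>

lemma oca_closure_span:
  assumes m: "\<And>x y. x \<in> T \<Longrightarrow> y \<in> T \<Longrightarrow> x \<odot> y \<in> closure (span T)"
    and c: "\<And>x y. x \<in> T \<Longrightarrow> y \<in> T \<Longrightarrow> oc x y"
  shows "oca (closure (span T))"
proof -
  let ?C = "closure (span T)"
  have sub: "subspace ?C" by (rule subspace_closure) simp
  have ms: "subspace {x. x \<odot> y \<in> ?C}" for y
    using sub unfolding subspace_def by (auto simp: bil)
  have mc: "closed {x. x \<odot> y \<in> ?C}" for y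
  proof -
    have "closed ((\<lambda>x. x \<odot> y) -` ?C)"
      by (rule closed_vimage) (auto intro!: continuous_intros)
    then show ?thesis by (simp add: vimage_def)
  qed
  have 1: "x \<odot> y \<in> ?C" if "x \<in> ?C" "y \<in> T" for x y
    using closure_span_subset[OF ms mc, of T y] m that by blast
  have 2: "x \<odot> y \<in> ?C" if "x \<in> ?C" "y \<in> ?C" for x y
  proof -
    have "T \<subseteq> {y. y \<odot> x \<in> ?C}" using 1[OF that(1)] comm by auto
    then show ?thesis using closure_span_subset[OF ms mc, of T x] that(2) comm by auto
  qed
  have 3: "oc x y" if "x \<in> ?C" "y \<in> T" for x y
    using closure_span_subset[OF oc_closed_subspace, of T y] c that by blast
  have 4: "oc x y" if "x \<in> ?C" "y \<in> ?C" for x y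
  proof -
    have "T \<subseteq> {y. oc y x}" using 3[OF that(1)] oc_sym by auto
    then show ?thesis using closure_span_subset[OF oc_closed_subspace, of T x] that(2) oc_sym by auto
  qed
  show ?thesis using sub 2 4 by (simp add: oca_def)
qed

lemma oca_subspace: "oca S \<Longrightarrow> subspace S"
  and oca_closed: "oca S \<Longrightarrow> closed S"
  and oca_mult: "oca S \<Longrightarrow> x \<in> S \<Longrightarrow> y \<in> S \<Longrightarrow> x \<odot> y \<in> S"
  and oca_oc: "oca S \<Longrightarrow> x \<in> S \<Longrightarrow> y \<in> S \<Longrightarrow> oc x y"
  by (auto simp: oca_def)

lemma oca_lcomm: "oca S \<Longrightarrow> x \<in> S \<Longrightarrow> y \<in> S \<Longrightarrow> x \<odot> (y \<odot> z) = y \<odot> (x \<odot> z)"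
  using oca_oc ocD by blast

lemma oca_assoc: "oca S \<Longrightarrow> x \<in> S \<Longrightarrow> y \<in> S \<Longrightarrow> z \<in> S \<Longrightarrow> (x \<odot> y) \<odot> z = x \<odot> (y \<odot> z)"
  using oca_lcomm[of S z x y] by (simp add: comm)

lemma oca_AS: "oca S \<Longrightarrow> S \<in> AS jm"
  unfolding AS_def using oca_assoc by (auto simp: oca_def)

lemma oca_lin:
  assumes "oca S"
  shows "0 \<in> S" "x \<in> S \<Longrightarrow> y \<in> S \<Longrightarrow> x + y \<in> S" "x \<in> S \<Longrightarrow> y \<in> S \<Longrightarrow> x - y \<in> S"
    "x \<in> S \<Longrightarrow> c *\<^sub>R x \<in> S" "x \<in> S \<Longrightarrow> - x \<in> S"
  using oca_subspace[OF assms]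
  by (auto simp: subspace_0 subspace_add subspace_diff subspace_scale subspace_neg)

section \<open>Quadratic maps and the Peirce spaces of an idempotent\<close>

text \<open>For the symmetrised product of an associative algebra this is
  \<open>a x a\<close>.\<close>

definition U :: "'a \<Rightarrow> 'a \<Rightarrow> 'a"
  where "U a x = 2 *\<^sub>R (a \<odot> (a \<odot> x)) - (a \<odot> a) \<odot> x"

lemma U_eq_Uop: "U a x = Uop jm a x"
  by (simp add: U_def Uop_def)

lemma U_lin: "U a (x + y) = U a x + U a y" "U a (x - y) = U a x - U a y"
  "U a (c *\<^sub>R x) = c *\<^sub>R U a x" "U a 0 = 0" "U a (- x) = - U a x"
  by (auto simp: U_def bil algebra_simps)

lemma U_sum: "U a (sum f S) = (\<Sum>i\<in>S. U a (f i))"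
  by (induction S rule: infinite_finite_induct) (auto simp: U_lin)

text \<open>Peirce components of an idempotent: \<open>U p x\<close>, \<open>H p x\<close> and \<open>Z p x\<close> lie in the eigenspaces
  of multiplication by \<open>p\<close> for the eigenvalues 1, 1/2 and 0.\<close>

definition H :: "'a \<Rightarrow> 'a \<Rightarrow> 'a"
  where "H p x = 4 *\<^sub>R (p \<odot> x) - 4 *\<^sub>R (p \<odot> (p \<odot> x))"

definition Z :: "'a \<Rightarrow> 'a \<Rightarrow> 'a"
  where "Z p x = x - U p x - H p x"

lemma H_lin: "H a (x + y) = H a x + H a y" "H a (x - y) = H a x - H a y"
  "H a (c *\<^sub>R x) = c *\<^sub>R H a x" "H a 0 = 0" "H a (- x) = - H a x"
  by (auto simp: H_def bil algebra_simps)

lemma peirce_split: "x = U p x + H p x + Z p x"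
  by (simp add: Z_def)

context
  fixes p assumes p: "p \<odot> p = p"
begin

text \<open>Multiplication by an idempotent is annihilated by \<open>2 t^3 - 3 t^2 + t\<close>, with
  roots 0, 1/2 and 1; \<open>U\<close>, \<open>H\<close> and \<open>Z\<close> are the corresponding
  Lagrange projections.\<close>

lemma peirce_cubic: "2 *\<^sub>R (p \<odot> (p \<odot> (p \<odot> x))) = 3 *\<^sub>R (p \<odot> (p \<odot> x)) - p \<odot> x"
  by (rule vec_lin1[OF jordan_triple[of p p p x]]) (simp add: p)

lemma U_idem: "U p x = 2 *\<^sub>R (p \<odot> (p \<odot> x)) - p \<odot> x"
  by (simp add: U_def p)

lemma U_E1: "p \<odot> U p x = U p x"
  unfolding U_idem by (rule vec_lin1[OF peirce_cubic[of x]]) (simp add: bil)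

lemma H_Eh: "p \<odot> H p x = (1/2) *\<^sub>R H p x"
  unfolding H_def by (rule vec_lin1[OF peirce_cubic[of x]]) (simp add: bil)

lemma Z_E0: "p \<odot> Z p x = 0"
  unfolding Z_def U_idem H_def by (rule vec_lin1[OF peirce_cubic[of x]]) (simp add: bil)

lemma oc_E1: "p \<odot> a = a \<Longrightarrow> oc p a"
  unfolding oc_def
  apply (intro allI)
  subgoal for x
    by (rule vec_lin1[OF jordan_comm[of a p p x]]) (simp add: p comm[of a p])
  done

lemma oc_E0: "p \<odot> a = 0 \<Longrightarrow> oc p a"
  unfolding oc_def
  apply (intro allI)
  subgoal for x
    by (rule vec_lin1[OF jordan_comm[of a p p x]]) (simp add: p comm[of a p] bil)
  done

lemma E1_E1: "p \<odot> a = a \<Longrightarrow> p \<odot> b = b \<Longrightarrow> p \<odot> (a \<odot> b) = a \<odot> b"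
  using ocD[OF oc_E1, of a b] by simp

lemma E1_E0: "p \<odot> a = a \<Longrightarrow> p \<odot> b = 0 \<Longrightarrow> a \<odot> b = 0"
  using ocD[OF oc_E1, of a b] ocD[OF oc_E0, of b a] by (simp add: bil comm)

lemma E0_E0: "p \<odot> a = 0 \<Longrightarrow> p \<odot> b = 0 \<Longrightarrow> p \<odot> (a \<odot> b) = 0"
  using ocD[OF oc_E0, of a b] by (simp add: bil)

lemma E1_Eh: "p \<odot> a = a \<Longrightarrow> p \<odot> x = (1/2) *\<^sub>R x \<Longrightarrow> p \<odot> (a \<odot> x) = (1/2) *\<^sub>R (a \<odot> x)"
  using ocD[OF oc_E1, of a x] by (simp add: bil)

lemma E0_Eh: "p \<odot> a = 0 \<Longrightarrow> p \<odot> x = (1/2) *\<^sub>R x \<Longrightarrow> p \<odot> (a \<odot> x) = (1/2) *\<^sub>R (a \<odot> x)"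
  using ocD[OF oc_E0, of a x] by (simp add: bil)

lemma Eh_Eh: "p \<odot> x = (1/2) *\<^sub>R x \<Longrightarrow> p \<odot> y = (1/2) *\<^sub>R y \<Longrightarrow> p \<odot> (p \<odot> (x \<odot> y)) = p \<odot> (x \<odot> y)"
  by (rule vec_lin1[OF jordan_lin[of p p x y]]) (simp add: bil p comm[of y x] comm[of x p] comm[of y p])

lemma oc_E1_E0: "p \<odot> a = a \<Longrightarrow> p \<odot> b = 0 \<Longrightarrow> oc a b"
  unfolding oc_def
  apply (intro allI)
  subgoal for x
    by (rule vec_lin1[OF jordan_comm[of a b p x]]) (simp add: bil E1_E0 comm[of b p] comm[of a p])
  done

text \<open>On the half space, twice the multiplication by \<open>a\<close> depends on
  \<open>a\<close> as a homomorphism into operators with the symmetrised product; the half space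
  behaves like an off-diagonal block.\<close>

lemma E1_special:
  "p \<odot> a = a \<Longrightarrow> p \<odot> b = b \<Longrightarrow> p \<odot> x = (1/2) *\<^sub>R x \<Longrightarrow> (a \<odot> b) \<odot> x = a \<odot> (b \<odot> x) + b \<odot> (a \<odot> x)"
  apply (rule vec_lin1[OF jordan_lin[of b a x p]])
  apply (simp add: bil comm[of x p] comm[of b p] E1_Eh comm[of b a] comm[of "a \<odot> x" b] comm[of x a] comm[of x])
  done

lemma Eh_cube: "p \<odot> x = (1/2) *\<^sub>R x \<Longrightarrow> x \<odot> (p \<odot> (x \<odot> x)) = (1/2) *\<^sub>R (x \<odot> (x \<odot> x))"
  using jordan[of x p] by (simp add: bil comm[of x p])

lemma Eh_cube_lin:
  "p \<odot> x = (1/2) *\<^sub>R x \<Longrightarrow> p \<odot> z = (1/2) *\<^sub>R z \<Longrightarrow>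
    z \<odot> (p \<odot> (x \<odot> x)) + 2 *\<^sub>R (x \<odot> (p \<odot> (x \<odot> z))) = (1/2) *\<^sub>R (z \<odot> (x \<odot> x)) + x \<odot> (x \<odot> z)"
  using jordan_lin2[of z p x] by (simp add: bil comm[of x p] comm[of z p])

lemma Eh_E1_square: "p \<odot> a = a \<Longrightarrow> p \<odot> z = (1/2) *\<^sub>R z \<Longrightarrow> p \<odot> (z \<odot> (z \<odot> a)) = (1/2) *\<^sub>R (a \<odot> (z \<odot> z))"
  apply (rule vec_lin1[OF jordan_lin[of a z z p]])
  apply (simp add: bil comm[of z p] comm[of a p] comm[of a z] comm[of "z \<odot> z" a] comm[of "z \<odot> a" z])
  done

text \<open>Multiplication by an element of the 1-space acts as a derivation on products of half
  space elements, compressed to the 1-space.\<close>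

lemma Eh_derivation:
  assumes "p \<odot> a = a" "p \<odot> y = (1/2) *\<^sub>R y" "p \<odot> z = (1/2) *\<^sub>R z"
  shows "p \<odot> (y \<odot> (a \<odot> z)) + p \<odot> ((a \<odot> y) \<odot> z) = a \<odot> (y \<odot> z)"
  apply (rule vec_lin2[OF jordan_lin[of a y z p] jordan_lin[of a z y p]])
  apply (simp only: bil assms comm[of z p] comm[of y p] comm[of a p] comm[of z y] comm[of "a \<odot> y" z] comm[of "a \<odot> z" y]
      comm[of y a] comm[of z a] comm[of "y \<odot> z" a])
  done

lemma U_of_E1: "p \<odot> a = a \<Longrightarrow> U p a = a"
  by (simp add: U_idem scaleR_2)
lemma U_of_Eh: "p \<odot> x = (1/2) *\<^sub>R x \<Longrightarrow> U p x = 0"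
  by (simp add: U_idem bil)
lemma U_of_E0: "p \<odot> b = 0 \<Longrightarrow> U p b = 0"
  by (simp add: U_idem bil)
lemma U_even: "p \<odot> (p \<odot> b) = p \<odot> b \<Longrightarrow> U p b = p \<odot> b"
  by (simp add: U_idem scaleR_2)
lemma H_of_E1: "p \<odot> a = a \<Longrightarrow> H p a = 0"
  by (simp add: H_def)
lemma H_of_Eh: "p \<odot> x = (1/2) *\<^sub>R x \<Longrightarrow> H p x = x"
  unfolding H_def by (rule vec_eqI) (simp add: bil)
lemma H_of_E0: "p \<odot> b = 0 \<Longrightarrow> H p b = 0"
  by (simp add: H_def bil)

lemma even_split: "p \<odot> (p \<odot> b) = p \<odot> b \<Longrightarrow> p \<odot> (b - p \<odot> b) = 0"
  by (simp add: bil)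

text \<open>Elements without half component, called even below, form a direct sum of two orthogonal
  algebras, and multiplication by \<open>p\<close> projects onto one of them.\<close>

lemma even_mult:
  assumes "p \<odot> (p \<odot> a) = p \<odot> a" "p \<odot> (p \<odot> b) = p \<odot> b"
  shows "p \<odot> (a \<odot> b) = (p \<odot> a) \<odot> (p \<odot> b)" "p \<odot> (p \<odot> (a \<odot> b)) = p \<odot> (a \<odot> b)"
proof -
  have z: "p \<odot> (a - p \<odot> a) = 0" "p \<odot> (b - p \<odot> b) = 0" using assms even_split by auto
  have ab: "a \<odot> b = (p \<odot> a) \<odot> (p \<odot> b) + (a - p \<odot> a) \<odot> (b - p \<odot> b)"
    using E1_E0[OF assms(1) z(2)] E1_E0[OF assms(2) z(1)] by (simp add: bil comm)
  show "p \<odot> (a \<odot> b) = (p \<odot> a) \<odot> (p \<odot> b)"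
    unfolding ab add_right using E1_E1[OF assms] E0_E0[OF z] by simp
  then show "p \<odot> (p \<odot> (a \<odot> b)) = p \<odot> (a \<odot> b)"
    using E1_E1[OF assms] by simp
qed

lemma oc_even: "p \<odot> (p \<odot> a) = p \<odot> a \<Longrightarrow> oc p a"
proof -
  assume a: "p \<odot> (p \<odot> a) = p \<odot> a"
  have "oc p (p \<odot> a)" "oc p (a - p \<odot> a)"
    using oc_E1[OF a] oc_E0[OF even_split[OF a]] by auto
  then have "p \<odot> ((p \<odot> a + (a - p \<odot> a)) \<odot> x) = (p \<odot> a + (a - p \<odot> a)) \<odot> (p \<odot> x)" for x
    by (simp only: add_left add_right ocD[OF \<open>oc p (p \<odot> a)\<close>] ocD[OF \<open>oc p (a - p \<odot> a)\<close>])
  then show ?thesis by (simp add: oc_def)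
qed

text \<open>Associatively, \<open>p (a p a) p = (p a p)^2\<close>. In \<open>dilation\<close> this
  identity recognises an idempotent.\<close>

lemma U_U_idem: "U p (U a p) = U p a \<odot> U p a"
proof -
  define a1 ah a0 where "a1 = U p a" and "ah = H p a" and "a0 = Z p a"
  have a: "a = a1 + ah + a0" using peirce_split a1_def ah_def a0_def by metis
  have e: "p \<odot> a1 = a1" "p \<odot> ah = (1/2) *\<^sub>R ah" "p \<odot> a0 = 0"
    by (simp_all add: a1_def ah_def a0_def U_E1 H_Eh Z_E0)
  have pa: "a \<odot> p = a1 + (1/2) *\<^sub>R ah" using comm[of a p] arg_cong[OF a, of "jm p"] by (simp add: bil e)
  have m: "p \<odot> (a1 \<odot> a1) = a1 \<odot> a1" "p \<odot> (a1 \<odot> ah) = (1/2) *\<^sub>R (a1 \<odot> ah)"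
    "p \<odot> (a0 \<odot> ah) = (1/2) *\<^sub>R (a0 \<odot> ah)" "a1 \<odot> a0 = 0" "p \<odot> (a0 \<odot> a0) = 0"
    "p \<odot> (p \<odot> (ah \<odot> ah)) = p \<odot> (ah \<odot> ah)"
    using e E1_E1 E1_Eh E0_Eh E1_E0 E0_E0 Eh_Eh by auto
  have aa: "a \<odot> a = a1 \<odot> a1 + ah \<odot> ah + a0 \<odot> a0 + 2 *\<^sub>R (a1 \<odot> ah) + 2 *\<^sub>R (a0 \<odot> ah)"
    unfolding a using m(4) by (simp add: bil comm[of ah a1] comm[of ah a0] comm[of a0 a1] scaleR_2)
  have apa: "a \<odot> (a1 + (1/2) *\<^sub>R ah) = a1 \<odot> a1 + (3/2) *\<^sub>R (a1 \<odot> ah) + (1/2) *\<^sub>R (ah \<odot> ah) + (1/2) *\<^sub>R (a0 \<odot> ah)"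
    unfolding a by (rule vec_eqI) (simp add: bil comm[of ah a1] comm[of a0 a1] m(4) field_simps)
  have Uap: "U a p = 2 *\<^sub>R (a1 \<odot> a1) + 3 *\<^sub>R (a1 \<odot> ah) + ah \<odot> ah + a0 \<odot> ah - p \<odot> (a \<odot> a)"
    unfolding U_def pa comm[of "a \<odot> a" p] apa by (rule vec_eqI) simp
  have "U p (p \<odot> (a \<odot> a)) = a1 \<odot> a1 + p \<odot> (ah \<odot> ah)"
    unfolding aa by (simp add: bil m U_lin U_of_Eh U_of_E1)
  then have "U p (U a p) = a1 \<odot> a1"
    unfolding Uap by (simp add: U_lin U_of_E1 U_of_Eh m U_even scaleR_2)
  then show ?thesis by (simp add: a1_def)
qed

end

text \<open>A case of the fundamental formula: associatively
  \<open>r (n a n) r = (r n r) a (r n r)\<close> when \<open>r a r = a\<close>. Idempotency of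
  \<open>n\<close> gives the relation for \<open>r \<odot> (z \<odot> z)\<close> by which the half
  component \<open>z\<close> drops out.\<close>

lemma U_fundamental_idem:
  assumes r: "r \<odot> r = r" and n: "n \<odot> n = n" and a: "r \<odot> a = a"
  shows "U r (U n a) = U (U r n) a"
proof -
  define h z k where "h = U r n" and "z = H r n" and "k = Z r n"
  have nn: "n = h + z + k" using peirce_split h_def z_def k_def by metis
  have e: "r \<odot> h = h" "r \<odot> z = (1/2) *\<^sub>R z" "r \<odot> k = 0"
    by (simp_all add: h_def z_def k_def U_E1 H_Eh Z_E0 r)
  have m: "r \<odot> (h \<odot> h) = h \<odot> h" "r \<odot> (h \<odot> z) = (1/2) *\<^sub>R (h \<odot> z)"
    "r \<odot> (k \<odot> z) = (1/2) *\<^sub>R (k \<odot> z)" "h \<odot> k = 0" "r \<odot> (k \<odot> k) = 0"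
    "r \<odot> (r \<odot> (z \<odot> z)) = r \<odot> (z \<odot> z)"
    using e by (simp_all add: E1_E1[OF r] E1_Eh[OF r] E0_Eh[OF r] E1_E0[OF r] E0_E0[OF r] Eh_Eh[OF r])
  have n2: "n \<odot> n = h \<odot> h + z \<odot> z + k \<odot> k + 2 *\<^sub>R (h \<odot> z) + 2 *\<^sub>R (k \<odot> z)"
    unfolding nn using m(4) by (simp add: bil comm[of z h] comm[of z k] comm[of k h] scaleR_2)
  have "U r (n \<odot> n) = h \<odot> h + r \<odot> (z \<odot> z)"
    unfolding n2 using r m by (simp add: U_lin U_of_E1 U_of_Eh U_of_E0 U_even)
  then have hz: "r \<odot> (z \<odot> z) = h - h \<odot> h" using n h_def by (metis add_diff_cancel_left')
  have ka: "k \<odot> a = 0" using E1_E0[OF r a e(3)] by (simp add: comm)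
  have ma: "r \<odot> (h \<odot> a) = h \<odot> a" "r \<odot> (z \<odot> a) = (1/2) *\<^sub>R (z \<odot> a)"
    "r \<odot> (h \<odot> (h \<odot> a)) = h \<odot> (h \<odot> a)"
    "r \<odot> (h \<odot> (z \<odot> a)) = (1/2) *\<^sub>R (h \<odot> (z \<odot> a))"
    "r \<odot> (k \<odot> (z \<odot> a)) = (1/2) *\<^sub>R (k \<odot> (z \<odot> a))"
    "r \<odot> (z \<odot> (h \<odot> a)) = (1/2) *\<^sub>R (z \<odot> (h \<odot> a))"
    "k \<odot> (h \<odot> a) = 0"
    using e a by (simp_all add: E1_E1[OF r] E1_Eh[OF r] E0_Eh[OF r] E1_E0[OF r] comm[of z a] comm[of z "h \<odot> a"]
      comm[of k "h \<odot> a"])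
  have e4: "r \<odot> (r \<odot> (z \<odot> (z \<odot> a))) = r \<odot> (z \<odot> (z \<odot> a))"
    using Eh_Eh[OF r e(2) ma(2)] .
  have azz: "a \<odot> (z \<odot> z) = a \<odot> (r \<odot> (z \<odot> z))"
    using E1_E0[OF r a, of "z \<odot> z - r \<odot> (z \<odot> z)"] m(6) by (simp add: bil)
  have "r \<odot> (z \<odot> (z \<odot> a)) = (1/2) *\<^sub>R (a \<odot> (h - h \<odot> h))"
    using Eh_E1_square[OF r a e(2)] azz hz by simp
  moreover have na: "n \<odot> a = h \<odot> a + z \<odot> a" unfolding nn by (simp add: bil ka)
  have nna: "n \<odot> (n \<odot> a) = h \<odot> (h \<odot> a) + h \<odot> (z \<odot> a) + z \<odot> (h \<odot> a) + z \<odot> (z \<odot> a) + k \<odot> (z \<odot> a)"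
    unfolding na unfolding nn by (simp add: bil ma)
  have Una: "U n a = 2 *\<^sub>R (h \<odot> (h \<odot> a) + h \<odot> (z \<odot> a) + z \<odot> (h \<odot> a) + z \<odot> (z \<odot> a) + k \<odot> (z \<odot> a))
      - (h \<odot> a + z \<odot> a)"
    unfolding U_def n nna[symmetric] na[symmetric] ..
  have "U r (U n a) = 2 *\<^sub>R (h \<odot> (h \<odot> a)) + 2 *\<^sub>R (r \<odot> (z \<odot> (z \<odot> a))) - h \<odot> a"
    unfolding Una using r ma e4 by (simp add: U_lin U_of_E1 U_of_Eh U_even scaleR_add_right)
  ultimately have "U r (U n a) = 2 *\<^sub>R (h \<odot> (h \<odot> a)) + a \<odot> (h - h \<odot> h) - h \<odot> a" by simp
  then show ?thesis unfolding h_def[symmetric] U_def[of h] by (simp add: bil comm[of a])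
qed

text \<open>The generator \<open>u\<close> serves as a local unit: \<open>u = \<one>\<close> or
  another idempotent gives a unital algebra, \<open>u = 0\<close> the algebra without adjoined unit
  that is relevant for \<open>AS\<close>.\<close>

definition gen :: "'a \<Rightarrow> 'a \<Rightarrow> 'a set"
  where "gen u a = closure (span (insert u (range (pw a))))"

lemma pw_E1: "u \<odot> u = u \<Longrightarrow> u \<odot> a = a \<Longrightarrow> u \<odot> pw a n = pw a n"
  by (induction n) (auto simp: E1_E1)

lemma oca_gen:
  assumes u: "u \<odot> u = u" and a: "u \<odot> a = a \<or> u = 0"
  shows "oca (gen u a)"
  unfolding gen_def
proof (rule oca_closure_span)
  have uc: "oc u (pw a n)" for n
    using a oc_E1[OF u pw_E1[OF u]] by (auto simp: oc_def bil)
  fix x y assume x: "x \<in> insert u (range (pw a))" and y: "y \<in> insert u (range (pw a))"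
  show "oc x y"
    using x y uc oc_pw_pw oc_sym by (auto simp: oc_def[of u u])
  have "x \<odot> y \<in> insert 0 (insert u (range (pw a)))"
  proof -
    have uw: "u \<odot> pw a n \<in> insert 0 (range (pw a))" "pw a n \<odot> u \<in> insert 0 (range (pw a))" for n
      using a pw_E1[OF u, of a n] comm[of u "pw a n"] by (auto simp: bil)
    have ww: "pw a m \<odot> pw a n \<in> range (pw a)" for m n
      unfolding pw_mult by (rule rangeI)
    show ?thesis using x y u uw ww by blast
  qed
  moreover have "insert 0 (insert u (range (pw a))) \<subseteq> span (insert u (range (pw a)))"
    using span_superset[of "insert u (range (pw a))"] span_0[of "insert u (range (pw a))"] by simp
  ultimately show "x \<odot> y \<in> closure (span (insert u (range (pw a))))"
    by (rule subsetD[OF closure_subset, OF subsetD[rotated]])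
qed

lemma gen_unit: "u \<in> gen u a" and gen_self: "a \<in> gen u a"
proof -
  have "insert u (range (pw a)) \<subseteq> gen u a"
    unfolding gen_def using closure_subset span_superset by (rule subset_trans[rotated])
  moreover have "a = pw a 0" by simp
  ultimately show "u \<in> gen u a" "a \<in> gen u a" using rangeI[of "pw a" 0] by auto
qed

lemma gen_minimal:
  assumes "subspace V" "closed V" "\<And>x y. x \<in> V \<Longrightarrow> y \<in> V \<Longrightarrow> x \<odot> y \<in> V" "u \<in> V" "a \<in> V"
  shows "gen u a \<subseteq> V"
proof -
  have "pw a n \<in> V" for n by (induction n) (use assms in auto)
  then show ?thesis unfolding gen_def using assms by (intro closure_span_subset) auto
qed

end

section \<open>Existence of the unit\<close>

context jb
begin

lemma sq_diff: "a \<odot> a - b \<odot> b = (a - b) \<odot> (a + b)"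
  by (simp add: bil comm[of b a])

text \<open>With a unit the equation would read \<open>(1 - y)^2 = 1 - x\<close>; in this form it
  needs none. The iteration from \<open>y\<close> to \<open>(x + y^2) / 2\<close> is dominated,
  increments included, by the scalar iteration from \<open>t\<close> to
  \<open>(1 + t^2) / 2\<close>, which increases and stays below 1.\<close>

lemma sqrt_iteration:
  assumes S: "oca S" and x: "x \<in> S" "norm x \<le> 1"
  obtains y where "y \<in> S" "norm y \<le> 1" "2 *\<^sub>R y - y \<odot> y = x"
proof -
  define y where "y = rec_nat 0 (\<lambda>_ y. (1/2) *\<^sub>R (x + y \<odot> y))"
  define t where "t = rec_nat (0::real) (\<lambda>_ t. (1 + t * t) / 2)"
  have y0: "y 0 = 0" "\<And>n. y (Suc n) = (1/2) *\<^sub>R (x + y n \<odot> y n)" by (simp_all add: y_def)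
  have t0: "t 0 = 0" "\<And>n. t (Suc n) = (1 + t n * t n) / 2" by (simp_all add: t_def)
  have t01: "0 \<le> t n \<and> t n \<le> 1" for n
    by (induction n) (auto simp: t0 mult_le_one)
  have yS: "y n \<in> S" for n
    by (induction n) (auto simp: y0 intro!: oca_lin[OF S] oca_mult[OF S] x)
  have yt: "norm (y n) \<le> t n" for n
  proof (induction n)
    case (Suc n)
    have "norm (y (Suc n)) \<le> (norm x + norm (y n \<odot> y n)) / 2"
      unfolding y0 using norm_triangle_ineq[of x "y n \<odot> y n"] by simp
    also have "norm (y n \<odot> y n) \<le> t n * t n"
      unfolding norm_sq power2_eq_square using Suc by (simp add: mult_mono t01)
    finally show ?case using x by (simp add: t0)
  qed (simp add: y0 t0)
  have tm: "t n \<le> t (Suc n)" for n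
    unfolding t0 using zero_le_power2[of "t n - 1"] by (simp add: power2_eq_square algebra_simps)
  have d: "norm (y (Suc n) - y n) \<le> t (Suc n) - t n" for n
  proof (induction n)
    case 0 then show ?case using x by (simp add: y0 t0 bil)
  next
    case (Suc n)
    have "y (Suc (Suc n)) - y (Suc n) = (1/2) *\<^sub>R ((y (Suc n) - y n) \<odot> (y (Suc n) + y n))"
      unfolding sq_diff[symmetric] y0(2)[of "Suc n"] by (subst (3) y0(2)) (simp add: algebra_simps)
    then have "norm (y (Suc (Suc n)) - y (Suc n)) \<le> (norm (y (Suc n) - y n) * norm (y (Suc n) + y n)) / 2"
      using norm_mult_le[of "y (Suc n) - y n" "y (Suc n) + y n"] by simp
    also have "\<dots> \<le> ((t (Suc n) - t n) * (t (Suc n) + t n)) / 2"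
      using Suc yt[of n] yt[of "Suc n"] norm_triangle_ineq[of "y (Suc n)" "y n"]
      by (intro divide_right_mono mult_mono order_trans[OF norm_triangle_ineq] add_mono)
         (use norm_ge_zero tm in \<open>auto\<close>)
    also have "\<dots> = t (Suc (Suc n)) - t (Suc n)"
      unfolding t0(2)[of "Suc n"] by (subst (5) t0(2)) (simp add: field_simps)
    finally show ?case .
  qed
  have "incseq t" using tm by (simp add: incseq_SucI)
  then have "convergent t"
    using t01 incseq_convergent[of t 1] by (metis convergentI)
  then have "Cauchy t" by (simp add: Cauchy_convergent_iff)
  have dd: "norm (y (n + k) - y n) \<le> t (n + k) - t n" for n k
  proof (induction k)
    case (Suc k)
    have "norm (y (n + Suc k) - y n) \<le> norm (y (Suc (n + k)) - y (n + k)) + norm (y (n + k) - y n)"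
      using norm_triangle_ineq[of "y (Suc (n + k)) - y (n + k)" "y (n + k) - y n"] by simp
    then show ?case using Suc d[of "n + k"] by simp
  qed simp
  have "Cauchy y"
  proof (rule metric_CauchyI)
    fix e :: real assume "e > 0"
    then obtain M where M: "\<And>m n. m \<ge> M \<Longrightarrow> n \<ge> M \<Longrightarrow> dist (t m) (t n) < e"
      using \<open>Cauchy t\<close> metric_CauchyD by metis
    have *: "dist (y m) (y n) < e" if "m \<ge> n" "n \<ge> M" for m n
    proof -
      have "norm (y m - y n) \<le> t m - t n" using dd[of n "m - n"] that by simp
      also have "\<dots> < e" using M[of m n] that by (simp add: dist_real_def)
      finally show ?thesis by (simp add: dist_norm)
    qed
    show "\<exists>M. \<forall>m\<ge>M. \<forall>n\<ge>M. dist (y m) (y n) < e"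
      using * by (metis dist_commute nle_le)
  qed
  then obtain l where l: "y \<longlonglongrightarrow> l" using convergent_def Cauchy_convergent_iff by blast
  have "(\<lambda>n. (1/2) *\<^sub>R (x + y n \<odot> y n)) \<longlonglongrightarrow> (1/2) *\<^sub>R (x + l \<odot> l)"
    by (intro tendsto_intros tendsto l)
  moreover have "(\<lambda>n. y (Suc n)) \<longlonglongrightarrow> l" using l LIMSEQ_Suc by blast
  ultimately have "l = (1/2) *\<^sub>R (x + l \<odot> l)" using LIMSEQ_unique by (simp add: y0(2))
  then have "2 *\<^sub>R l = x + l \<odot> l" by (metis (no_types) scaleR_scaleR scaleR_one nonzero_mult_div_cancel_left times_divide_eq_right zero_neq_numeral mult.right_neutral)
  then have "2 *\<^sub>R l - l \<odot> l = x" by simp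
  moreover have "l \<in> S" using closed_sequentially[OF oca_closed[OF S]] yS l by blast
  moreover have "norm l \<le> 1"
    using tendsto_norm[OF l] by (rule LIMSEQ_le_const2) (use yt t01 order_trans in blast)
  ultimately show ?thesis using that by blast
qed

lemma cube_zero:
  assumes "x \<odot> (x \<odot> x) = 0"
  shows "x = 0"
proof -
  have "(x \<odot> x) \<odot> (x \<odot> x) = x \<odot> (x \<odot> (x \<odot> x))"
    using pw_mult[of x 1 1] by (simp add: numeral_2_eq_2 numeral_3_eq_3)
  then have "norm ((x \<odot> x) \<odot> (x \<odot> x)) = 0" using assms by (simp add: bil)
  then show ?thesis by (simp add: norm_sq)
qed

text \<open>By \<open>Eh_cube\<close> the two Peirce parts of the square contribute equally to the
  cube of \<open>x\<close>; if one of them is absent, the cube vanishes.\<close>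

lemma Eh_zero:
  assumes p: "p \<odot> p = p" and x: "p \<odot> x = (1/2) *\<^sub>R x" and z: "p \<odot> (x \<odot> x) = 0 \<or> p \<odot> (x \<odot> x) = x \<odot> x"
  shows "x = 0"
proof (rule cube_zero)
  show "x \<odot> (x \<odot> x) = 0"
    using z
  proof
    assume "p \<odot> (x \<odot> x) = x \<odot> x"
    then have "x \<odot> (x \<odot> x) = (1/2) *\<^sub>R (x \<odot> (x \<odot> x))" using Eh_cube[OF p x] by simp
    then have "(1/2) *\<^sub>R (x \<odot> (x \<odot> x)) = 0" by (rule vec_lin1) simp
    then show ?thesis by simp
  qed (use Eh_cube[OF p x] in \<open>simp add: bil\<close>)
qed

text \<open>Squaring leads from \<open>p + y\<close> to \<open>p + y^2\<close> and so on, always of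
  norm at most 2, while the norm is squared each time; a norm above 1 would grow without
  bound.\<close>

lemma norm_orth_idem:
  assumes p: "p \<odot> p = p" and y: "p \<odot> y = 0" "norm y \<le> 1"
  shows "norm (p + y) \<le> 1"
proof (rule ccontr)
  define w where "w = rec_nat y (\<lambda>_ y. y \<odot> y)"
  have w0: "w 0 = y" "\<And>n. w (Suc n) = w n \<odot> w n" by (simp_all add: w_def)
  have np: "norm p \<le> 1"
  proof -
    have "(norm p)\<^sup>2 = norm p" using norm_sq[of p] p by simp
    then show ?thesis by (auto simp: power2_eq_square)
  qed
  have wz: "p \<odot> w n = 0 \<and> norm (w n) \<le> 1" for n
    by (induction n) (auto simp: w0 y E0_E0[OF p] norm_sq power_le_one)
  have "norm (p + w n) = norm (p + y) ^ (2 ^ n)" for n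
  proof (induction n)
    case (Suc n)
    have "p + w (Suc n) = (p + w n) \<odot> (p + w n)"
      using wz[of n] p by (simp add: bil w0 comm[of "w n" p])
    then show ?case using Suc by (simp add: norm_sq power_mult[symmetric] mult.commute)
  qed (simp add: w0)
  moreover have "norm (p + w n) \<le> 2" for n
    using norm_triangle_ineq[of p "w n"] np wz[of n] by linarith
  ultimately have b: "norm (p + y) ^ (2 ^ n) \<le> 2" for n by metis
  assume "\<not> norm (p + y) \<le> 1"
  then have g: "norm (p + y) > 1" by simp
  then obtain k where k: "2 < norm (p + y) ^ k" using real_arch_pow by blast
  have "norm (p + y) ^ k \<le> norm (p + y) ^ (2 ^ k)"
    using g by (intro power_increasing) auto
  with k b[of k] show False by simp
qed

text \<open>\<open>u\<close> is the midpoint of \<open>q = (3 u - u^3) / 2\<close> and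
  \<open>(u + u^3) / 2\<close>, so extremality gives \<open>q = u\<close>, that is
  \<open>u^3 = u\<close>. The work is the norm bound for \<open>q\<close>: with
  \<open>v = u^2\<close>, \<open>1 - q^2 = (1 - v)^2 (1 - v / 4)\<close> is a square.\<close>

lemma extreme_cube:
  assumes n: "norm u \<le> 1"
    and ex: "\<And>y z. norm y \<le> 1 \<Longrightarrow> norm z \<le> 1 \<Longrightarrow> u = (1/2) *\<^sub>R (y + z) \<Longrightarrow> y = u"
  shows "u \<odot> (u \<odot> u) = u"
proof -
  let ?S = "gen 0 u"
  have S: "oca ?S" by (rule oca_gen) (auto simp: bil)
  have u: "u \<in> ?S" by (rule gen_self)
  define v where "v = u \<odot> u"
  have v: "v \<in> ?S" using S u by (simp add: v_def oca_mult)
  have nv: "norm v \<le> 1" using n by (simp add: v_def norm_sq power_le_one)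
  \<comment> \<open>Formally \<open>1 - y\<close> is the square root of \<open>1 - v / 4\<close>,
    and \<open>1 - m = (1 - v) (1 - y)\<close> is that of \<open>1 - q^2\<close>.\<close>
  obtain y where y: "y \<in> ?S" "2 *\<^sub>R y - y \<odot> y = (1/4) *\<^sub>R v"
    using sqrt_iteration[OF S, of "(1/4) *\<^sub>R v"] oca_lin(4)[OF S v] nv by auto
  define m where "m = v + y - v \<odot> y"
  have m: "m \<in> ?S" using S v y by (simp add: m_def oca_mult oca_lin)
  define q where "q = (3/2) *\<^sub>R u - (1/2) *\<^sub>R (u \<odot> v)"
  have q: "q \<in> ?S" using S u v by (simp add: q_def oca_mult oca_lin)
  note as = oca_assoc[OF S] and lc = oca_lcomm[OF S] and mu = oca_mult[OF S] and li = oca_lin[OF S]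
  have vu: "u \<odot> (u \<odot> z) = v \<odot> z" if "z \<in> ?S" for z
    using as[OF u u that] by (simp add: v_def)
  have qq: "q \<odot> q = (9/4) *\<^sub>R v - (3/2) *\<^sub>R (v \<odot> v) + (1/4) *\<^sub>R (v \<odot> (v \<odot> v))"
  proof -
    have a: "u \<odot> (u \<odot> v) = v \<odot> v" using vu v by simp
    have b: "(u \<odot> v) \<odot> u = v \<odot> v" using a by (simp add: comm)
    have c: "(u \<odot> v) \<odot> (u \<odot> v) = v \<odot> (v \<odot> v)"
    proof -
      have "(u \<odot> v) \<odot> (u \<odot> v) = u \<odot> (v \<odot> (u \<odot> v))" using as[OF u v] mu u v by simp
      also have "\<dots> = u \<odot> (u \<odot> (v \<odot> v))" using lc[OF v u] by simp
      finally show ?thesis using vu mu v by simp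
    qed
    have uu: "u \<odot> u = v" by (simp add: v_def)
    show ?thesis unfolding q_def by (rule vec_eqI) (simp add: bil a b c uu; simp add: field_simps)
  qed
  have mm: "2 *\<^sub>R m - m \<odot> m = q \<odot> q"
  proof -
    have yy: "y \<odot> y = 2 *\<^sub>R y - (1/4) *\<^sub>R v" using y(2) by (rule vec_lin1) simp
    have a: "v \<odot> (v \<odot> y) = (v \<odot> v) \<odot> y" using as v y by simp
    have b: "y \<odot> (v \<odot> y) = 2 *\<^sub>R (v \<odot> y) - (1/4) *\<^sub>R (v \<odot> v)"
    proof -
      have "y \<odot> (v \<odot> y) = v \<odot> (y \<odot> y)" using lc[OF y(1) v] .
      then show ?thesis unfolding yy by (simp add: bil)
    qed
    have c: "(v \<odot> y) \<odot> (v \<odot> y) = 2 *\<^sub>R ((v \<odot> v) \<odot> y) - (1/4) *\<^sub>R (v \<odot> (v \<odot> v))"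
    proof -
      have "(v \<odot> y) \<odot> (v \<odot> y) = v \<odot> (y \<odot> (v \<odot> y))" using as[OF v y(1)] mu v y by simp
      then show ?thesis unfolding b using a by (simp add: bil)
    qed
    have d: "(v \<odot> y) \<odot> v = (v \<odot> v) \<odot> y" "(v \<odot> y) \<odot> y = 2 *\<^sub>R (v \<odot> y) - (1/4) *\<^sub>R (v \<odot> v)"
      using a b by (simp_all add: comm)
    show ?thesis unfolding qq m_def
      by (rule vec_eqI) (simp add: bil a b c d yy comm[of y v]; simp add: field_simps)
  qed
  \<comment> \<open>A factor \<open>z\<close> stands in for the missing unit:
    \<open>(q z)^2 + ((1 - m) z)^2 = z^2\<close>, and the norm axiom for sums of squares
    applies.\<close>
  have bound: "norm (q \<odot> z) \<le> norm z" if z: "z \<in> ?S" for z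
  proof -
    have zz: "z \<odot> z \<in> ?S" using mu z by simp
    have 1: "(q \<odot> z) \<odot> (q \<odot> z) = (q \<odot> q) \<odot> (z \<odot> z)"
    proof -
      have "(q \<odot> z) \<odot> (q \<odot> z) = q \<odot> (z \<odot> (q \<odot> z))" using as[OF q z] mu q z by simp
      also have "\<dots> = q \<odot> (q \<odot> (z \<odot> z))" using lc[OF z q] by simp
      finally show ?thesis using as[OF q q zz] by simp
    qed
    have 2: "(m \<odot> z) \<odot> (m \<odot> z) = (m \<odot> m) \<odot> (z \<odot> z)"
    proof -
      have "(m \<odot> z) \<odot> (m \<odot> z) = m \<odot> (z \<odot> (m \<odot> z))" using as[OF m z] mu m z by simp
      also have "\<dots> = m \<odot> (m \<odot> (z \<odot> z))" using lc[OF z m] by simp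
      finally show ?thesis using as[OF m m zz] by simp
    qed
    have 3: "(m \<odot> z) \<odot> z = m \<odot> (z \<odot> z)" "z \<odot> (m \<odot> z) = m \<odot> (z \<odot> z)"
      using as[OF m z z] by (simp_all add: comm)
    have "(q \<odot> z) \<odot> (q \<odot> z) + (z - m \<odot> z) \<odot> (z - m \<odot> z) = z \<odot> z"
      unfolding 1 mm[symmetric] by (rule vec_eqI) (simp add: bil 2 3)
    then have "norm ((q \<odot> z) \<odot> (q \<odot> z)) \<le> norm (z \<odot> z)" using norm_sq_le by metis
    then show ?thesis by (simp add: norm_sq)
  qed
  have nq: "norm q \<le> 1"
  proof -
    have "norm q * norm q \<le> norm q" using bound[OF q] by (simp add: norm_sq power2_eq_square)
    then show ?thesis using mult_strict_left_mono[of 1 "norm q" "norm q"] by fastforce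
  qed
  have nr: "norm ((1/2) *\<^sub>R u + (1/2) *\<^sub>R (u \<odot> v)) \<le> 1"
  proof -
    have "norm (u \<odot> v) \<le> 1" using norm_mult_le[of u v] n nv by (smt (verit) mult_le_one norm_ge_zero)
    then show ?thesis using n norm_triangle_ineq[of "(1/2) *\<^sub>R u" "(1/2) *\<^sub>R (u \<odot> v)"] by simp
  qed
  have "q = u"
  proof (rule ex[OF nq nr])
    show "u = (1/2) *\<^sub>R (q + ((1/2) *\<^sub>R u + (1/2) *\<^sub>R (u \<odot> v)))"
      unfolding q_def by (rule vec_eqI) simp
  qed
  then show ?thesis unfolding q_def v_def[symmetric] by (rule vec_lin1) simp
qed

text \<open>For \<open>p = u^2\<close> the 0-space vanishes, since a \<open>b\<close> of norm at
  most 1 in it makes \<open>u\<close> the midpoint of \<open>u + b\<close> and \<open>u - b\<close>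
  inside the ball. Then squares of half space elements lie in the 1-space, and
  \<open>Eh_zero\<close> removes the half space too.\<close>

lemma unit_from_extreme:
  assumes n: "norm u \<le> 1"
    and ex: "\<And>y z. norm y \<le> 1 \<Longrightarrow> norm z \<le> 1 \<Longrightarrow> u = (1/2) *\<^sub>R (y + z) \<Longrightarrow> y = u"
  shows "(u \<odot> u) \<odot> a = a"
proof -
  define p where "p = u \<odot> u"
  have pu: "p \<odot> u = u" using extreme_cube[OF assms] by (simp add: p_def comm)
  have p: "p \<odot> p = p"
    using pw_mult[of u 1 1] extreme_cube[OF assms] by (simp add: p_def numeral_2_eq_2 numeral_3_eq_3)
  have small: "b = 0" if pb: "p \<odot> b = 0" and nb: "norm b \<le> 1" for b
  proof -
    have ub: "u \<odot> b = 0" using E1_E0[OF p pu pb] .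
    have 1: "norm (u + c) \<le> 1" if c: "p \<odot> c = 0" "norm c \<le> 1" for c
    proof -
      have uc: "u \<odot> c = 0" using E1_E0[OF p pu c(1)] .
      have "(u + c) \<odot> (u + c) = p + c \<odot> c" using uc by (simp add: bil p_def comm[of c u])
      moreover have "norm (p + c \<odot> c) \<le> 1"
        using c by (intro norm_orth_idem p E0_E0) (auto simp: norm_sq power_le_one)
      ultimately have "(norm (u + c))\<^sup>2 \<le> 1" by (metis norm_sq)
      then show ?thesis by (simp add: power_le_one_iff abs_square_le_1)
    qed
    have "u = (1/2) *\<^sub>R ((u + b) + (u + - b))" by (rule vec_eqI) simp
    from ex[OF 1 1 this] have "u + b = u" using pb nb by (simp add: bil)
    then show ?thesis by simp
  qed
  have E0: "b = 0" if pb: "p \<odot> b = 0" for b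
  proof -
    have "(1 / (norm b + 1)) *\<^sub>R b = 0"
    proof (rule small)
      have "norm b / (norm b + 1) \<le> 1" by (rule divide_le_eq_1[THEN iffD2]) (smt (verit) norm_ge_zero)
      then show "norm ((1 / (norm b + 1)) *\<^sub>R b) \<le> 1" by (simp add: abs_of_nonneg add_nonneg_nonneg)
    qed (simp add: bil pb)
    then show ?thesis using norm_ge_zero[of b] by auto
  qed
  have Eh: "x = 0" if x: "p \<odot> x = (1/2) *\<^sub>R x" for x
  proof (rule Eh_zero[OF p x], rule disjI2)
    have "p \<odot> (x \<odot> x - p \<odot> (x \<odot> x)) = 0" using even_split[OF p Eh_Eh[OF p x x]] .
    then have "x \<odot> x - p \<odot> (x \<odot> x) = 0" by (rule E0)
    then show "p \<odot> (x \<odot> x) = x \<odot> x" by simp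
  qed
  have "a = U p a" using peirce_split[of a p] Eh[OF H_Eh[OF p]] E0[OF Z_E0[OF p]] by simp
  then show ?thesis using U_E1[OF p] p_def by metis
qed

end

subsection \<open>Weak-star compactness\<close>

text \<open>Points become functions on the dual, set to 0 off \<open>V\<close>, so that the
  weak-star topology is the product topology of a function type.\<close>

definition wemb :: "('a::real_normed_vector \<Rightarrow>\<^sub>L real) set \<Rightarrow> 'a \<Rightarrow> ('a \<Rightarrow>\<^sub>L real) \<Rightarrow> real"
  where "wemb V x = (\<lambda>f. if f \<in> V then blinfun_apply f x else 0)"

lemma predual_norm_le:
  fixes V :: "('a::real_normed_vector \<Rightarrow>\<^sub>L real) set"
  assumes V: "predual V" and M: "\<And>f. f \<in> V \<Longrightarrow> \<bar>blinfun_apply f x\<bar> \<le> M * norm f" "M \<ge> 0"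
  shows "norm x \<le> M"
proof -
  have "norm x = (SUP f\<in>{f\<in>V. norm f \<le> 1}. \<bar>blinfun_apply f x\<bar>)"
    using V unfolding predual_def by blast
  also have "\<dots> \<le> M"
  proof (rule cSUP_least)
    have "0 \<in> V" using V unfolding predual_def using subspace_0 by blast
    then show "{f \<in> V. norm f \<le> 1} \<noteq> {}" by (metis (mono_tags, lifting) empty_iff mem_Collect_eq norm_zero zero_le_one)
    fix f assume "f \<in> {f \<in> V. norm f \<le> 1}"
    then show "\<bar>blinfun_apply f x\<bar> \<le> M" using M(1)[of f] M(2) mult_left_le[of "norm f" M] by auto
  qed
  finally show ?thesis .
qed

lemma wemb_inj:
  assumes V: "predual V"
  shows "inj (wemb V)"
proof (rule injI)
  fix x y assume e: "wemb V x = wemb V y"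
  have "norm (x - y) \<le> 0"
  proof (rule predual_norm_le[OF V])
    fix f assume f: "f \<in> V"
    have "wemb V x f = wemb V y f" using e by simp
    then show "\<bar>blinfun_apply f (x - y)\<bar> \<le> 0 * norm f" using f by (simp add: wemb_def blinfun.diff_right)
  qed simp
  then show "x = y" by simp
qed

text \<open>Banach-Alaoglu: the image is cut out of a product of compact intervals by vanishing off
  \<open>V\<close> and linearity on \<open>V\<close>. The predual property turns each such function
  into a point, and the norm formula puts that point into the ball.\<close>

lemma wemb_ball_compact_closed:
  fixes V :: "('a::real_normed_vector \<Rightarrow>\<^sub>L real) set"
  assumes V: "predual V"
  shows "compact (wemb V ` cball c M) \<and> closed (wemb V ` cball c M)"
proof (cases "M \<ge> 0")
  case M: True
  let ?g = "\<lambda>f. if f \<in> V then blinfun_apply f c else 0"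
  let ?P = "PiE UNIV (\<lambda>f::'a \<Rightarrow>\<^sub>L real. {?g f - M * norm f .. ?g f + M * norm f})"
  have cP: "compact ?P"
    using compactin_PiE[of "\<lambda>_. euclideanreal" UNIV "\<lambda>f. {?g f - M * norm f .. ?g f + M * norm f}"]
    by (simp add: euclidean_product_topology compactin_euclidean_iff)
  have clP: "closed ?P"
  proof -
    have "?P = (\<Inter>f. {\<phi>. ?g f - M * norm f \<le> \<phi> f} \<inter> {\<phi>. \<phi> f \<le> ?g f + M * norm f})"
      by (simp add: PiE_UNIV_domain Pi_def set_eq_iff)
    moreover have "closed {\<phi>. ?g f - M * norm f \<le> \<phi> f}" "closed {\<phi>. \<phi> f \<le> ?g f + M * norm f}" for f
      by (intro closed_Collect_le continuous_intros continuous_on_product_coordinates)+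
    ultimately show ?thesis by (metis (no_types, lifting) closed_INT closed_Int)
  qed
  let ?A = "\<Inter>f\<in>-V. {\<phi>::('a \<Rightarrow>\<^sub>L real) \<Rightarrow> real. \<phi> f = 0}"
  let ?B = "\<Inter>f\<in>V. \<Inter>h\<in>V. {\<phi>::('a \<Rightarrow>\<^sub>L real) \<Rightarrow> real. \<phi> (f + h) = \<phi> f + \<phi> h}"
  let ?C = "\<Inter>c. \<Inter>f\<in>V. {\<phi>::('a \<Rightarrow>\<^sub>L real) \<Rightarrow> real. \<phi> (c *\<^sub>R f) = c * \<phi> f}"
  have sV: "subspace V" using V unfolding predual_def by blast
  have cl: "closed ?A" "closed ?B" "closed ?C"
    by (intro closed_INT ballI allI closed_Collect_eq continuous_intros continuous_on_product_coordinates)+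
  have "wemb V ` cball c M = ?P \<inter> (?A \<inter> ?B \<inter> ?C)"
  proof (intro subset_antisym subsetI)
    fix \<phi> assume "\<phi> \<in> wemb V ` cball c M"
    then obtain x where x: "norm (x - c) \<le> M" "\<phi> = wemb V x"
      by (metis dist_norm imageE mem_cball norm_minus_commute)
    have "\<bar>blinfun_apply f x - blinfun_apply f c\<bar> \<le> M * norm f" for f :: "'a \<Rightarrow>\<^sub>L real"
    proof -
      have "\<bar>blinfun_apply f (x - c)\<bar> \<le> norm f * norm (x - c)" using norm_blinfun[of f "x - c"] by simp
      also have "\<dots> \<le> norm f * M" using x by (simp add: mult_left_mono)
      finally show ?thesis by (simp add: blinfun.diff_right mult.commute)
    qed
    then have "\<phi> f \<in> {?g f - M * norm f .. ?g f + M * norm f}" for f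
      unfolding x wemb_def using M by (auto simp: abs_le_iff algebra_simps)
    then have "\<phi> \<in> ?P" by auto
    moreover have "\<phi> \<in> ?A \<inter> ?B \<inter> ?C"
      unfolding x wemb_def using sV
      by (auto simp: subspace_add subspace_scale blinfun.add_left blinfun.scaleR_left)
    ultimately show "\<phi> \<in> ?P \<inter> (?A \<inter> ?B \<inter> ?C)" by blast
  next
    fix \<phi> assume \<phi>: "\<phi> \<in> ?P \<inter> (?A \<inter> ?B \<inter> ?C)"
    have b: "\<bar>\<phi> f - ?g f\<bar> \<le> M * norm f" for f
    proof -
      have "\<phi> f \<in> {?g f - M * norm f .. ?g f + M * norm f}" using \<phi> PiE_mem by fast
      then show ?thesis by (simp add: abs_le_iff)
    qed
    have "\<exists>K. \<forall>f\<in>V. \<bar>\<phi> f\<bar> \<le> K * norm f"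
    proof (intro exI[of _ "M + norm c"] ballI)
      fix f assume f: "f \<in> V"
      have "\<bar>blinfun_apply f c\<bar> \<le> norm c * norm f" using norm_blinfun[of f c] by (simp add: mult.commute)
      then show "\<bar>\<phi> f\<bar> \<le> (M + norm c) * norm f" using b[of f] f by (simp add: algebra_simps)
    qed
    moreover have "\<forall>f\<in>V. \<forall>h\<in>V. \<phi> (f + h) = \<phi> f + \<phi> h" "\<forall>c. \<forall>f\<in>V. \<phi> (c *\<^sub>R f) = c * \<phi> f"
      using \<phi> by auto
    ultimately obtain x where x: "\<forall>f\<in>V. \<phi> f = blinfun_apply f x"
      using V unfolding predual_def by blast
    have "norm (x - c) \<le> M"
    proof (rule predual_norm_le[OF V _ M])
      fix f assume "f \<in> V"
      then show "\<bar>blinfun_apply f (x - c)\<bar> \<le> M * norm f" using b[of f] x by (simp add: blinfun.diff_right)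
    qed
    moreover have "\<phi> = wemb V x" using x \<phi> by (auto simp: wemb_def)
    ultimately show "\<phi> \<in> wemb V ` cball c M" by (auto simp: dist_norm norm_minus_commute)
  qed
  moreover have c3: "closed (?A \<inter> ?B \<inter> ?C)" by (intro closed_Int cl)
  ultimately show ?thesis using compact_Int_closed[OF cP c3] closed_Int[OF clP c3] by (simp only: simp_thms)
qed simp

lemmas wemb_ball_compact = wemb_ball_compact_closed[THEN conjunct1]
  and wemb_ball_closed = wemb_ball_compact_closed[THEN conjunct2]

text \<open>Suprema will be found as common points of order intervals, which are balls of the order
  unit norm.\<close>

lemma cball_fip:
  fixes V :: "('a::real_normed_vector \<Rightarrow>\<^sub>L real) set" and c :: "'i \<Rightarrow> 'a"
  assumes V: "predual V" and fin: "\<And>J. finite J \<Longrightarrow> J \<subseteq> I \<Longrightarrow> \<exists>x. \<forall>i\<in>J. x \<in> cball (c i) (r i)"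
    and "i0 \<in> I"
  shows "\<exists>x. \<forall>i\<in>I. x \<in> cball (c i) (r i)"
proof -
  have "wemb V ` cball (c i0) (r i0) \<inter> (\<Inter>i\<in>I. wemb V ` cball (c i) (r i)) \<noteq> {}"
  proof (rule compact_imp_fip_image)
    show "compact (wemb V ` cball (c i0) (r i0))" by (rule wemb_ball_compact[OF V])
    show "closed (wemb V ` cball (c i) (r i))" for i
      by (rule wemb_ball_closed[OF V])
    fix J assume J: "finite J" "J \<subseteq> I"
    obtain x where "\<forall>i\<in>insert i0 J. x \<in> cball (c i) (r i)" using fin[of "insert i0 J"] J assms(3) by blast
    then have "wemb V x \<in> wemb V ` cball (c i0) (r i0) \<inter> (\<Inter>i\<in>J. wemb V ` cball (c i) (r i))" by blast
    then show "wemb V ` cball (c i0) (r i0) \<inter> (\<Inter>i\<in>J. wemb V ` cball (c i) (r i)) \<noteq> {}" by blast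
  qed
  then obtain \<phi> where \<phi>: "\<phi> \<in> wemb V ` cball (c i0) (r i0)" "\<And>i. i \<in> I \<Longrightarrow> \<phi> \<in> wemb V ` cball (c i) (r i)" by blast
  then obtain x where x: "\<phi> = wemb V x" by blast
  have "x \<in> cball (c i) (r i)" if "i \<in> I" for i
    using \<phi>(2)[OF that] inj_image_mem_iff[OF wemb_inj[OF V]] x by blast
  then show ?thesis by blast
qed

text \<open>The Krein-Milman argument, for midpoints: if a functional in \<open>V\<close> took two
  values on a minimal weak-star closed face, its maximum points would form a smaller one.\<close>

lemma ball_extreme_point:
  fixes V :: "('a::real_normed_vector \<Rightarrow>\<^sub>L real) set"
  assumes V: "predual V"
  obtains u :: 'a where "norm u \<le> 1"
    "\<And>y z. norm y \<le> 1 \<Longrightarrow> norm z \<le> 1 \<Longrightarrow> u = (1/2) *\<^sub>R (y + z) \<Longrightarrow> y = u"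
proof -
  let ?w = "wemb V"
  define face where "face A \<longleftrightarrow> (\<forall>x\<in>A. \<forall>y z. norm y \<le> 1 \<longrightarrow> norm z \<le> 1 \<longrightarrow> x = (1/2) *\<^sub>R (y + z) \<longrightarrow> y \<in> A \<and> z \<in> A)"
    for A :: "'a set"
  define F where "F = {A. A \<noteq> {} \<and> A \<subseteq> cball 0 1 \<and> closed (?w ` A) \<and> face A}"
  have inj: "inj ?w" by (rule wemb_inj[OF V])
  have B: "cball 0 1 \<in> F"
    unfolding F_def face_def using wemb_ball_closed[OF V] by auto
  have comp: "compact (?w ` A)" if "A \<in> F" for A
  proof -
    have "?w ` A = ?w ` cball 0 1 \<inter> ?w ` A" using that unfolding F_def by blast
    then show ?thesis using wemb_ball_compact[OF V, of 0 1] that unfolding F_def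
      by (metis (no_types, lifting) compact_Int_closed mem_Collect_eq)
  qed
  \<comment> \<open>Zorn's lemma yields maximal elements; passing to complements makes the minimal
    faces maximal.\<close>
  have "\<exists>M\<in>uminus ` F. \<forall>X\<in>uminus ` F. M \<subseteq> X \<longrightarrow> X = M"
  proof (rule subset_Zorn_nonempty)
    show "uminus ` F \<noteq> {}" using B by blast
    fix \<C> assume ne: "\<C> \<noteq> {}" and ch: "subset.chain (uminus ` F) \<C>"
    define D where "D = uminus ` \<C>"
    have DF: "D \<subseteq> F" using ch unfolding D_def subset_chain_def by auto
    have Dne: "D \<noteq> {}" using ne by (simp add: D_def)
    have Dch: "A \<subseteq> A' \<or> A' \<subseteq> A" if "A \<in> D" "A' \<in> D" for A A'
      using ch that unfolding D_def subset_chain_def by (metis Compl_subset_Compl_iff imageE)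
    obtain A0 where A0: "A0 \<in> D" using Dne by blast
    have min: "\<exists>A\<in>D. \<forall>A'\<in>J. A \<subseteq> A'" if "finite J" "J \<subseteq> D" for J
      using that
    proof (induction J)
      case empty then show ?case using A0 by blast
    next
      case (insert A' J)
      then obtain A where A: "A \<in> D" "\<forall>A'\<in>J. A \<subseteq> A'" by (meson insert_subset)
      have "A' \<in> D" using insert.prems by simp
      from Dch[OF A(1) this] show ?case
      proof
        assume "A \<subseteq> A'"
        then show ?thesis using A by (intro bexI[of _ A]) auto
      next
        assume "A' \<subseteq> A"
        then show ?thesis using A(2) \<open>A' \<in> D\<close> by (intro bexI[of _ A']) auto
      qed
    qed
    have "?w ` A0 \<inter> (\<Inter>A\<in>D. ?w ` A) \<noteq> {}"
    proof (rule compact_imp_fip_image)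
      show "compact (?w ` A0)" using comp A0 DF by blast
      show "closed (?w ` A)" if "A \<in> D" for A using that DF unfolding F_def by blast
      fix J assume J: "finite J" "J \<subseteq> D"
      then obtain A where A: "A \<in> D" "\<forall>A'\<in>insert A0 J. A \<subseteq> A'" using min[of "insert A0 J"] A0 by blast
      have "A \<noteq> {}" using A(1) DF unfolding F_def by blast
      then show "?w ` A0 \<inter> (\<Inter>A\<in>J. ?w ` A) \<noteq> {}" using A(2) by blast
    qed
    then obtain \<phi> where "\<phi> \<in> ?w ` A0" "\<forall>A\<in>D. \<phi> \<in> ?w ` A" by blast
    then obtain x where x: "\<forall>A\<in>D. x \<in> A" using inj_image_mem_iff[OF inj] by (metis imageE)
    have "\<Inter>D \<in> F"
    proof -
      have "?w ` \<Inter>D = (\<Inter>A\<in>D. ?w ` A)" using image_INT[of ?w UNIV D "\<lambda>x. x"] inj A0 by auto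
      moreover have "closed (\<Inter>A\<in>D. ?w ` A)" using DF unfolding F_def by (intro closed_INT) blast
      moreover have "face (\<Inter>D)" using DF unfolding F_def face_def by blast
      moreover have "\<Inter>D \<subseteq> cball 0 1" using A0 DF unfolding F_def by blast
      ultimately show ?thesis unfolding F_def using x by auto
    qed
    moreover have "\<Union>\<C> = - \<Inter>D" unfolding D_def by auto
    ultimately show "\<Union>\<C> \<in> uminus ` F" by blast
  qed
  then obtain A where A: "A \<in> F" and Amin: "\<And>X. X \<in> F \<Longrightarrow> X \<subseteq> A \<Longrightarrow> X = A" by auto
  have single: "x = y" if xy: "x \<in> A" "y \<in> A" for x y
  proof (rule ccontr)
    assume "x \<noteq> y"
    then have "?w x \<noteq> ?w y" using inj injD by metis
    then obtain f where f: "f \<in> V" "blinfun_apply f x \<noteq> blinfun_apply f y" unfolding wemb_def by meson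
    have "\<exists>\<phi>\<in>?w ` A. \<forall>\<psi>\<in>?w ` A. \<psi> f \<le> \<phi> f"
      by (rule continuous_attains_sup[OF comp[OF A]]) (use xy in \<open>auto intro: continuous_on_subset[OF continuous_on_product_coordinates]\<close>)
    then obtain x0 where x0: "x0 \<in> A" "\<And>z. z \<in> A \<Longrightarrow> blinfun_apply f z \<le> blinfun_apply f x0"
      using f(1) by (auto simp: wemb_def)
    define A' where "A' = {z \<in> A. blinfun_apply f z = blinfun_apply f x0}"
    have "?w ` A' = ?w ` A \<inter> {\<phi>. \<phi> f = blinfun_apply f x0}"
      unfolding A'_def using f(1) by (auto simp: wemb_def)
    moreover have "closed (?w ` A)" using A unfolding F_def by blast
    moreover have "closed {\<phi>::('a \<Rightarrow>\<^sub>L real) \<Rightarrow> real. \<phi> f = blinfun_apply f x0}"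
      by (intro closed_Collect_eq continuous_intros continuous_on_product_coordinates)
    ultimately have "closed (?w ` A')" by (metis closed_Int)
    moreover have "face A'"
      unfolding face_def
    proof (intro ballI allI impI)
      fix a y z assume a: "a \<in> A'" and n: "norm y \<le> 1" "norm z \<le> 1" and e: "a = (1/2) *\<^sub>R (y + z)"
      have yz: "y \<in> A" "z \<in> A" using A a n e unfolding F_def face_def A'_def by blast+
      have "blinfun_apply f a = (blinfun_apply f y + blinfun_apply f z) / 2"
        unfolding e by (simp add: blinfun.add_right blinfun.scaleR_right)
      then show "y \<in> A' \<and> z \<in> A'" using yz x0(2)[OF yz(1)] x0(2)[OF yz(2)] a unfolding A'_def by auto
    qed
    ultimately have "A' \<in> F" using A x0 unfolding F_def A'_def by blast
    then have "A' = A" using Amin A'_def by blast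
    then have "x \<in> A'" "y \<in> A'" using xy by auto
    then show False using f(2) unfolding A'_def by auto
  qed
  obtain u where u: "u \<in> A" using A unfolding F_def by blast
  show ?thesis
  proof (rule that)
    show "norm u \<le> 1" using u A unfolding F_def by auto
    fix y z assume "norm y \<le> 1" "norm z \<le> 1" "u = (1/2) *\<^sub>R (y + z)"
    then show "y = u" using single u A unfolding F_def face_def by blast
  qed
qed

lemma (in jb) predual_imp_unit:
  assumes "predual (V :: ('a \<Rightarrow>\<^sub>L real) set)"
  shows "\<exists>e. \<forall>a. e \<odot> a = a"
proof -
  obtain u :: 'a where "norm u \<le> 1"
    "\<And>y z. norm y \<le> 1 \<Longrightarrow> norm z \<le> 1 \<Longrightarrow> u = (1/2) *\<^sub>R (y + z) \<Longrightarrow> y = u"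
    using ball_extreme_point[OF assms] by blast
  then show ?thesis using unit_from_extreme by blast
qed

section \<open>Order structure\<close>

locale jbu = jb jm for jm :: "'a::banach \<Rightarrow> 'a \<Rightarrow> 'a" (infixl "\<odot>" 70) +
  fixes one :: 'a ("\<one>")
  assumes unit: "\<one> \<odot> a = a"
begin

lemma unit_right: "a \<odot> \<one> = a"
  using unit comm by metis

lemma norm_idem_le: "r \<odot> r = r \<Longrightarrow> norm r \<le> 1"
proof -
  assume "r \<odot> r = r"
  then have "(norm r)\<^sup>2 = norm r" using norm_sq[of r] by simp
  then show ?thesis by (auto simp: power2_eq_square)
qed

lemma norm_one_le: "norm \<one> \<le> 1"
  using norm_idem_le unit by blast

text \<open>Square roots and inverses are taken relative to a local unit \<open>r\<close>, so that
  the calculus also applies inside the corner of an idempotent.\<close>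

definition loc_unit :: "'a \<Rightarrow> 'a set \<Rightarrow> bool"
  where "loc_unit r S \<longleftrightarrow> oca S \<and> r \<in> S \<and> (\<forall>s\<in>S. r \<odot> s = s)"

lemma loc_unitD:
  assumes "loc_unit r S"
  shows "oca S" "r \<in> S" "s \<in> S \<Longrightarrow> r \<odot> s = s" "r \<odot> r = r" "norm r \<le> 1"
  using assms norm_idem_le unfolding loc_unit_def by auto

lemma loc_unit_gen:
  assumes r: "r \<odot> r = r" "r \<odot> a = a"
  shows "loc_unit r (gen r a)"
proof -
  have "gen r a \<subseteq> {x. r \<odot> x = x}"
  proof (rule gen_minimal)
    show "subspace {x. r \<odot> x = x}" unfolding subspace_def by (auto simp: bil)
    show "closed {x. r \<odot> x = x}" by (intro closed_eq_cont continuous_intros)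
  qed (use r E1_E1 in auto)
  then show ?thesis unfolding loc_unit_def using oca_gen[of r a] r gen_unit by auto
qed

lemma loc_unit_gen1: "loc_unit \<one> (gen \<one> a)"
  by (rule loc_unit_gen) (auto simp: unit)

lemma oca_mult4:
  assumes S: "oca S" "a \<in> S" "b \<in> S" "c \<in> S" "d \<in> S"
  shows "(a \<odot> b) \<odot> (c \<odot> d) = (a \<odot> c) \<odot> (b \<odot> d)"
proof -
  have "(a \<odot> b) \<odot> (c \<odot> d) = a \<odot> (b \<odot> (c \<odot> d))" using S by (simp add: oca_assoc oca_mult)
  also have "\<dots> = a \<odot> (c \<odot> (b \<odot> d))" using oca_lcomm[of S b c] S by simp
  also have "\<dots> = (a \<odot> c) \<odot> (b \<odot> d)" using S by (simp add: oca_assoc oca_mult)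
  finally show ?thesis .
qed

lemma loc_sqrt:
  assumes S: "loc_unit r S" and x: "x \<in> S" "norm x \<le> 1"
  obtains b y where "b \<in> S" "b \<odot> b = r - x" "b = r - y" "y \<in> S" "norm y \<le> 1"
proof -
  obtain y where y: "y \<in> S" "norm y \<le> 1" "2 *\<^sub>R y - y \<odot> y = x"
    using sqrt_iteration loc_unitD(1)[OF S] x by blast
  have ry: "r \<odot> y = y" "y \<odot> r = y" using loc_unitD(3)[OF S y(1)] comm by auto
  have "(r - y) \<odot> (r - y) = r - x"
    unfolding y(3)[symmetric] by (simp add: bil ry loc_unitD(4)[OF S] scaleR_2)
  then show ?thesis using that[of "r - y" y] y loc_unitD(1,2)[OF S] oca_lin(3) by blast
qed

lemma loc_sq_bound:
  assumes S: "loc_unit r S" and b: "b \<in> S" "norm b \<le> 1"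
  shows "norm (r - b \<odot> b) \<le> 1"
proof -
  have "b \<odot> b \<in> S" "norm (b \<odot> b) \<le> 1"
    using b loc_unitD(1)[OF S] by (auto simp: oca_mult norm_sq power_le_one)
  then obtain c where c: "c \<odot> c = r - b \<odot> b" using loc_sqrt[OF S] by metis
  have "norm (c \<odot> c) \<le> norm (c \<odot> c + b \<odot> b)" by (rule norm_sq_le)
  then show ?thesis using loc_unitD(5)[OF S] by (simp add: c)
qed

section \<open>The cone of squares and the order unit norm\<close>

definition pos :: "'a \<Rightarrow> bool" where "pos a \<longleftrightarrow> (\<exists>b. a = b \<odot> b)"

lemma pos_sq: "pos (b \<odot> b)" by (auto simp: pos_def)

lemma pos_0: "pos 0" using pos_sq[of 0] by (simp add: bil)

lemma pos_scale: "pos a \<Longrightarrow> c \<ge> 0 \<Longrightarrow> pos (c *\<^sub>R a)"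
  unfolding pos_def
  apply (elim exE)
  subgoal for b by (rule exI[of _ "sqrt c *\<^sub>R b"]) (simp add: bil)
  done

text \<open>Together with \<open>pos_norm\<close> this describes squares by a norm condition, from
  which stability under sums and closedness follow at once; neither is visible from the
  definition.\<close>

lemma posI_norm:
  assumes "norm (K *\<^sub>R \<one> - a) \<le> K"
  shows "pos a"
proof (cases "K = 0")
  case True
  then show ?thesis using assms pos_0 by simp
next
  case False
  then have K: "K > 0" using assms norm_ge_zero[of "K *\<^sub>R \<one> - a"] by linarith
  define x where "x = \<one> - (1/K) *\<^sub>R a"
  have "norm x = (1/K) * norm (K *\<^sub>R \<one> - a)"
  proof -
    have "x = (1/K) *\<^sub>R (K *\<^sub>R \<one> - a)" using K by (simp add: x_def scaleR_diff_right)
    then show ?thesis using K by simp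
  qed
  then have "norm x \<le> 1" using assms K by (simp add: divide_le_eq)
  then obtain b where "b \<odot> b = \<one> - x" using loc_sqrt[OF loc_unit_gen1 gen_self] by metis
  then have "pos ((1/K) *\<^sub>R a)" using pos_sq[of b] by (simp add: x_def)
  then have "pos (K *\<^sub>R ((1/K) *\<^sub>R a))" by (rule pos_scale) (use K in simp)
  then show ?thesis using K by simp
qed

lemma pos_norm: "pos a \<Longrightarrow> norm (norm a *\<^sub>R \<one> - a) \<le> norm a"
proof -
  assume "pos a"
  then obtain b where b: "a = b \<odot> b" by (auto simp: pos_def)
  show ?thesis
  proof (cases "b = 0")
    case False
    define c where "c = (1 / norm b) *\<^sub>R b"
    have "norm (\<one> - c \<odot> c) \<le> 1"
      by (rule loc_sq_bound[OF loc_unit_gen1 gen_self]) (simp add: c_def False)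
    moreover have "norm a *\<^sub>R \<one> - a = norm a *\<^sub>R (\<one> - c \<odot> c)"
      using False by (simp add: c_def b bil norm_sq scaleR_diff_right power2_eq_square)
    ultimately show ?thesis by (simp add: mult_left_le)
  qed (simp add: b bil)
qed

lemma pos_iff_norm: "pos a \<longleftrightarrow> norm (norm a *\<^sub>R \<one> - a) \<le> norm a"
  using posI_norm pos_norm by blast

lemma pos_add: "pos a \<Longrightarrow> pos b \<Longrightarrow> pos (a + b)"
proof (rule posI_norm[of "norm a + norm b"])
  assume "pos a" "pos b"
  then have "norm (norm a *\<^sub>R \<one> - a) \<le> norm a" "norm (norm b *\<^sub>R \<one> - b) \<le> norm b" using pos_norm by auto
  then show "norm ((norm a + norm b) *\<^sub>R \<one> - (a + b)) \<le> norm a + norm b"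
    using norm_triangle_ineq[of "norm a *\<^sub>R \<one> - a" "norm b *\<^sub>R \<one> - b"]
    by (simp add: scaleR_add_left algebra_simps)
qed

lemma pos_antisym: "pos a \<Longrightarrow> pos (- a) \<Longrightarrow> a = 0"
proof -
  assume "pos a" "pos (- a)"
  then obtain b c where bc: "a = b \<odot> b" "- a = c \<odot> c" by (auto simp: pos_def)
  have "norm (b \<odot> b) \<le> norm (b \<odot> b + c \<odot> c)" by (rule norm_sq_le)
  then show ?thesis using bc by (metis add.right_inverse norm_le_zero_iff norm_zero)
qed

lemma pos_closed: "closed {a. pos a}"
  unfolding pos_iff_norm by (intro closed_Collect_le continuous_intros)

lemma pos_limit: "(\<And>n. pos (f n)) \<Longrightarrow> f \<longlonglongrightarrow> a \<Longrightarrow> pos a"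
  using closed_sequentially[OF pos_closed, of f a] by simp

lemma pos_sum: "(\<And>i. i \<in> I \<Longrightarrow> pos (f i)) \<Longrightarrow> pos (sum f I)"
  by (induction I rule: infinite_finite_induct) (auto simp: pos_0 pos_add)

definition le :: "'a \<Rightarrow> 'a \<Rightarrow> bool" (infix "\<sqsubseteq>" 50) where "a \<sqsubseteq> b \<longleftrightarrow> pos (b - a)"

lemma le_refl [simp]: "a \<sqsubseteq> a" by (simp add: le_def pos_0)
lemma le_trans [trans]: "a \<sqsubseteq> b \<Longrightarrow> b \<sqsubseteq> c \<Longrightarrow> a \<sqsubseteq> c"
  unfolding le_def using pos_add[of "b - a" "c - b"] by simp
lemma le_antisym: "a \<sqsubseteq> b \<Longrightarrow> b \<sqsubseteq> a \<Longrightarrow> a = b"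
  unfolding le_def using pos_antisym[of "b - a"] by simp
lemma le_add: "a \<sqsubseteq> b \<Longrightarrow> c \<sqsubseteq> d \<Longrightarrow> a + c \<sqsubseteq> b + d"
  unfolding le_def using pos_add[of "b - a" "d - c"] by (simp add: algebra_simps)
lemma le_scale: "a \<sqsubseteq> b \<Longrightarrow> c \<ge> 0 \<Longrightarrow> c *\<^sub>R a \<sqsubseteq> c *\<^sub>R b"
  unfolding le_def using pos_scale[of "b - a" c] by (simp add: scaleR_diff_right)
lemma le_neg: "a \<sqsubseteq> b \<Longrightarrow> - b \<sqsubseteq> - a"
  unfolding le_def by simp
lemma le_diff: "a \<sqsubseteq> b \<Longrightarrow> d \<sqsubseteq> c \<Longrightarrow> a - c \<sqsubseteq> b - d"
  using le_add[of a b "- c" "- d"] le_neg[of d c] by simp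
lemma pos_le: "pos a \<longleftrightarrow> 0 \<sqsubseteq> a" by (simp add: le_def)
lemma le_scale_left: "pos a \<Longrightarrow> c \<le> d \<Longrightarrow> c *\<^sub>R a \<sqsubseteq> d *\<^sub>R a"
  unfolding le_def using pos_scale[of a "d - c"] by (simp add: scaleR_diff_left)

lemma pos_one: "pos \<one>" using pos_sq[of \<one>] by (simp add: unit)
lemma pos_idem: "p \<odot> p = p \<Longrightarrow> pos p" using pos_sq[of p] by simp

lemma le_eps:
  assumes "\<And>\<epsilon>. \<epsilon> > 0 \<Longrightarrow> a \<sqsubseteq> b + \<epsilon> *\<^sub>R c"
  shows "a \<sqsubseteq> b"
  unfolding le_def
proof (rule pos_limit)
  show "pos (b + (1 / real (Suc n)) *\<^sub>R c - a)" for n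
    using assms[of "1 / real (Suc n)"] by (simp add: le_def)
  have "(\<lambda>n. 1 / real (Suc n)) \<longlonglongrightarrow> 0" using LIMSEQ_inverse_real_of_nat by (simp add: inverse_eq_divide)
  then have "(\<lambda>n. b + (1 / real (Suc n)) *\<^sub>R c - a) \<longlonglongrightarrow> b + 0 *\<^sub>R c - a"
    by (intro tendsto_intros)
  then show "(\<lambda>n. b + (1 / real (Suc n)) *\<^sub>R c - a) \<longlonglongrightarrow> b - a" by simp
qed

lemma loc_pos_sqrt:
  assumes S: "loc_unit r S" and a: "a \<in> S" "pos a"
  obtains b where "b \<in> S" "b \<odot> b = a" "pos b"
proof (cases "a = 0")
  case True
  then show ?thesis using that[of 0] oca_lin(1)[OF loc_unitD(1)[OF S]] pos_0 by (simp add: bil)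
next
  case False
  let ?K = "norm a"
  have K: "?K > 0" using False by simp
  have ra: "r \<odot> a = a" using loc_unitD(3)[OF S a(1)] .
  have "?K *\<^sub>R r - a = r \<odot> (?K *\<^sub>R \<one> - a)" by (simp add: bil unit_right ra)
  then have "norm (?K *\<^sub>R r - a) \<le> norm r * norm (?K *\<^sub>R \<one> - a)" using norm_mult_le by metis
  also have "\<dots> \<le> 1 * ?K" using loc_unitD(5)[OF S] pos_norm[OF a(2)] by (intro mult_mono) auto
  finally have n: "norm (?K *\<^sub>R r - a) \<le> ?K" by simp
  define x where "x = r - (1/?K) *\<^sub>R a"
  have "x = (1/?K) *\<^sub>R (?K *\<^sub>R r - a)" using K by (simp add: x_def scaleR_diff_right)
  then have "norm x = norm (?K *\<^sub>R r - a) / ?K" by simp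
  then have nx: "norm x \<le> 1" using n K by (simp add: divide_le_eq)
  have xS: "x \<in> S" using S a loc_unitD[OF S] by (simp add: x_def oca_lin)
  obtain b y where b: "b \<in> S" "b \<odot> b = r - x" "b = r - y" "y \<in> S" "norm y \<le> 1" using loc_sqrt[OF S xS nx] by metis
  \<comment> \<open>\<open>b = r - y\<close> with \<open>y\<close> in the unit ball, so the square
    root construction applies once more and shows that \<open>b\<close> is itself a square.\<close>
  obtain c where c: "c \<odot> c = r - y" using loc_sqrt[OF S b(4,5)] by metis
  show ?thesis
  proof (rule that[of "sqrt ?K *\<^sub>R b"])
    show "sqrt ?K *\<^sub>R b \<in> S" using b(1) loc_unitD(1)[OF S] by (simp add: oca_lin)
    show "sqrt ?K *\<^sub>R b \<odot> sqrt ?K *\<^sub>R b = a" using K by (simp add: bil b(2) x_def)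
    show "pos (sqrt ?K *\<^sub>R b)" using c b(3) pos_sq[of c] by (simp add: pos_scale)
  qed
qed

lemma loc_pos_mult:
  assumes S: "loc_unit r S" and a: "a \<in> S" "pos a" and b: "b \<in> S" "pos b"
  shows "pos (a \<odot> b)"
proof -
  obtain c where c: "c \<in> S" "c \<odot> c = a" using loc_pos_sqrt[OF S a] by metis
  obtain d where d: "d \<in> S" "d \<odot> d = b" using loc_pos_sqrt[OF S b] by metis
  have "a \<odot> b = (c \<odot> d) \<odot> (c \<odot> d)" using oca_mult4[OF loc_unitD(1)[OF S] c(1) c(1) d(1) d(1)] c d by simp
  then show ?thesis by (simp add: pos_sq)
qed

text \<open>For the converse, \<open>1 - c\<close> and \<open>1 + c\<close> are positive and
  commute, so \<open>1 - c^2\<close> is a square \<open>d^2\<close>; the norm axiom for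
  \<open>c^2 + d^2 = 1\<close> bounds \<open>c\<close>.\<close>

lemma norm_le_iff:
  assumes "M \<ge> 0"
  shows "norm a \<le> M \<longleftrightarrow> - (M *\<^sub>R \<one>) \<sqsubseteq> a \<and> a \<sqsubseteq> M *\<^sub>R \<one>"
proof
  assume n: "norm a \<le> M"
  show "- (M *\<^sub>R \<one>) \<sqsubseteq> a \<and> a \<sqsubseteq> M *\<^sub>R \<one>"
    unfolding le_def by (intro conjI posI_norm[of M]) (use n in \<open>simp_all\<close>)
next
  assume a: "- (M *\<^sub>R \<one>) \<sqsubseteq> a \<and> a \<sqsubseteq> M *\<^sub>R \<one>"
  show "norm a \<le> M"
  proof (cases "M = 0")
    case True
    then show ?thesis using a pos_antisym[of a] by (simp add: le_def)
  next
    case False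
    then have M: "M > 0" using assms by simp
    define c where "c = (1/M) *\<^sub>R a"
    let ?S = "gen \<one> c"
    note S = loc_unit_gen1[of c]
    have cS: "c \<in> ?S" by (rule gen_self)
    have "pos ((1/M) *\<^sub>R (M *\<^sub>R \<one> - a))" "pos ((1/M) *\<^sub>R (a - - (M *\<^sub>R \<one>)))"
      using a M pos_scale unfolding le_def by auto
    then have p: "pos (\<one> - c)" "pos (\<one> + c)"
      using M by (simp_all add: c_def scaleR_diff_right scaleR_add_right add.commute)
    have m: "\<one> - c \<in> ?S" "\<one> + c \<in> ?S" using loc_unitD(1,2)[OF S] cS by (auto simp: oca_lin)
    have "pos ((\<one> - c) \<odot> (\<one> + c))" using loc_pos_mult[OF S m(1) p(1) m(2) p(2)] .
    then obtain d where d: "\<one> - c \<odot> c = d \<odot> d" by (auto simp: pos_def bil unit unit_right)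
    have "norm (c \<odot> c) \<le> norm (c \<odot> c + d \<odot> d)" by (rule norm_sq_le)
    moreover have "c \<odot> c + d \<odot> d = \<one>" unfolding d[symmetric] by simp
    ultimately have "norm (c \<odot> c) \<le> 1" using norm_one_le by simp
    then have "norm c \<le> 1" by (simp add: norm_sq abs_square_le_1)
    then show ?thesis using M by (simp add: c_def divide_le_eq)
  qed
qed

lemma le_norm: "a \<sqsubseteq> norm a *\<^sub>R \<one>" "- (norm a *\<^sub>R \<one>) \<sqsubseteq> a"
  using norm_le_iff[of "norm a" a] by auto

lemma norm_mono: "pos a \<Longrightarrow> a \<sqsubseteq> b \<Longrightarrow> norm a \<le> norm b"
proof -
  assume a: "pos a" "a \<sqsubseteq> b"
  have "- (norm b *\<^sub>R \<one>) \<sqsubseteq> 0" using pos_scale[OF pos_one norm_ge_zero] by (simp add: le_def)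
  then have "- (norm b *\<^sub>R \<one>) \<sqsubseteq> a" using a(1) le_trans unfolding pos_le by blast
  moreover have "a \<sqsubseteq> norm b *\<^sub>R \<one>" using a(2) le_norm(1)[of b] le_trans by blast
  ultimately show ?thesis using norm_le_iff[of "norm b" a] by simp
qed

section \<open>Inverses, and positive and negative parts\<close>

text \<open>A Neumann series: for \<open>x = r - k / M\<close> of norm below 1 the equation
  \<open>y = r + x \<odot> y\<close> has a solution, and \<open>y / M\<close> inverts
  \<open>k\<close>. The norm bound holds because \<open>k - \<delta> r\<close> is a square, which
  makes \<open>x\<close> a multiple by \<open>s < 1\<close> of some
  \<open>r - d \<odot> d\<close>.\<close>

lemma loc_inverse:
  assumes S: "loc_unit r S" and k: "k \<in> S" "\<delta> > 0" "\<delta> *\<^sub>R r \<sqsubseteq> k"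
  obtains k' where "k' \<in> S" "k \<odot> k' = r" "pos k'" "k' \<sqsubseteq> (1/\<delta>) *\<^sub>R r"
proof -
  note D = loc_unitD[OF S] and li = oca_lin[OF loc_unitD(1)[OF S]] and mu = oca_mult[OF loc_unitD(1)[OF S]]
  have "k - \<delta> *\<^sub>R r \<in> S" "pos (k - \<delta> *\<^sub>R r)" using k D by (auto simp: li le_def)
  then obtain c where c: "c \<in> S" "c \<odot> c = k - \<delta> *\<^sub>R r" using loc_pos_sqrt[OF S] by metis
  \<comment> \<open>The summand \<open>2 * \<delta>\<close> yields
    \<open>M * s = norm k + \<delta>\<close>, which dominates the norm of
    \<open>k - \<delta> r\<close>, that is the squared norm of \<open>c\<close>.\<close>
  define M where "M = norm k + 2 * \<delta>"
  define s where "s = 1 - \<delta> / M"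
  have M: "M > 0" using k(2) by (simp add: M_def add_nonneg_pos)
  have s: "0 < s" "s < 1" "M * s = norm k + \<delta>"
  proof -
    have Mk: "M > \<delta>" using k(2) norm_ge_zero[of k] unfolding M_def by linarith
    show "0 < s" "s < 1" using M Mk k(2) by (auto simp: s_def)
    have "M * s = M - \<delta>" using M by (simp add: s_def right_diff_distrib)
    then show "M * s = norm k + \<delta>" by (simp add: M_def)
  qed
  define x where "x = r - (1/M) *\<^sub>R k"
  have xS: "x \<in> S" using k D by (simp add: x_def li)
  have nx: "norm x \<le> s"
  proof -
    define d where "d = (1 / sqrt (M * s)) *\<^sub>R c"
    have Ms: "M * s > 0" using M s(1) by (rule mult_pos_pos)
    have "(norm c)\<^sup>2 \<le> norm k + \<delta>"
    proof -
      have "(norm c)\<^sup>2 = norm (k - \<delta> *\<^sub>R r)" using c(2) norm_sq[of c] by simp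
      also have "\<dots> \<le> norm k + \<delta> * norm r" using norm_triangle_ineq4[of k "\<delta> *\<^sub>R r"] k(2) by simp
      also have "\<dots> \<le> norm k + \<delta>" using D(5) k(2) by (simp add: mult_left_le)
      finally show ?thesis .
    qed
    then have "norm c \<le> sqrt (M * s)" using s(3) by (simp add: real_le_rsqrt)
    then have "norm d \<le> 1" using Ms by (simp add: d_def divide_le_eq)
    then have "norm (r - d \<odot> d) \<le> 1" using loc_sq_bound[OF S, of d] c(1) by (simp add: d_def li)
    moreover have "x = s *\<^sub>R (r - d \<odot> d)"
    proof -
      have "s *\<^sub>R (d \<odot> d) = (s / (M * s)) *\<^sub>R (c \<odot> c)" using Ms by (simp add: d_def bil)
      then have "s *\<^sub>R (d \<odot> d) = (1/M) *\<^sub>R (k - \<delta> *\<^sub>R r)" unfolding c(2) using s(1) by simp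
      then show ?thesis unfolding x_def scaleR_diff_right[of s]
        by (rule vec_lin1) (simp add: s_def; simp add: algebra_simps diff_divide_distrib)
    qed
    ultimately show ?thesis using s by (simp add: mult_left_le)
  qed
  have "\<exists>!y\<in>S. r + x \<odot> y = y"
  proof (rule Banach_fix[of S s "\<lambda>y. r + x \<odot> y"])
    show "complete S" using oca_closed[OF D(1)] by (simp add: complete_eq_closed)
    show "S \<noteq> {}" using D(2) by blast
    show "(\<lambda>y. r + x \<odot> y) ` S \<subseteq> S" using D(2) xS by (auto simp: li mu)
    show "dist (r + x \<odot> y) (r + x \<odot> z) \<le> s * dist y z" for y z
    proof -
      have "dist (r + x \<odot> y) (r + x \<odot> z) = norm (x \<odot> (y - z))" by (simp add: dist_norm bil)
      also have "\<dots> \<le> norm x * norm (y - z)" by (rule norm_mult_le)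
      also have "\<dots> \<le> s * norm (y - z)" using nx by (simp add: mult_right_mono)
      finally show ?thesis by (simp add: dist_norm)
    qed
  qed (use s in auto)
  then obtain y where y: "y \<in> S" "r + x \<odot> y = y" by blast
  define k' where "k' = (1/M) *\<^sub>R y"
  have k'S: "k' \<in> S" using y by (simp add: k'_def li)
  have ry: "r \<odot> y = y" using D(3)[OF y(1)] .
  have "x \<odot> y = y - (1/M) *\<^sub>R (k \<odot> y)" by (simp add: x_def bil ry)
  then have kk': "k \<odot> k' = r" using y(2) by (simp add: k'_def bil)
  have rk': "r \<odot> k' = k'" using D(3)[OF k'S] .
  have "pos (\<delta> *\<^sub>R r)" using pos_scale[OF pos_idem[OF D(4)]] k(2) by simp
  then have pk: "pos k" using k(3) le_trans unfolding pos_le by blast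
  obtain b where b: "b \<in> S" "b \<odot> b = k" using loc_pos_sqrt[OF S k(1) pk] by metis
  have "(b \<odot> k') \<odot> (b \<odot> k') = k'"
  proof -
    have "(b \<odot> k') \<odot> (b \<odot> k') = k \<odot> (k' \<odot> k')" using oca_mult4[OF D(1) b(1) k'S b(1) k'S] b(2) by simp
    also have "\<dots> = (k \<odot> k') \<odot> k'" using oca_assoc[OF D(1) k(1) k'S k'S] by simp
    finally show ?thesis by (simp add: kk' rk')
  qed
  then have pk': "pos k'" by (metis pos_sq)
  have "pos ((1/\<delta>) *\<^sub>R ((k - \<delta> *\<^sub>R r) \<odot> k'))"
    using k(2) loc_pos_mult[OF S \<open>k - \<delta> *\<^sub>R r \<in> S\<close> \<open>pos (k - \<delta> *\<^sub>R r)\<close> k'S pk'] by (simp add: pos_scale)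
  moreover have "(1/\<delta>) *\<^sub>R ((k - \<delta> *\<^sub>R r) \<odot> k') = (1/\<delta>) *\<^sub>R r - k'"
    using k(2) by (simp add: bil kk' rk' scaleR_diff_right)
  ultimately have "k' \<sqsubseteq> (1/\<delta>) *\<^sub>R r" by (simp add: le_def)
  then show ?thesis using that k'S kk' pk' by blast
qed

text \<open>\<open>t - s\<close> is \<open>t^2 - s^2\<close> times the inverse of
  \<open>t + s\<close>, and that inverse is positive.\<close>

lemma le_of_sq_le:
  assumes S: "loc_unit \<one> S" and s: "s \<in> S" "pos s" and t: "t \<in> S" "\<delta> > 0" "\<delta> *\<^sub>R \<one> \<sqsubseteq> t"
    and le: "s \<odot> s \<sqsubseteq> t \<odot> t"
  shows "s \<sqsubseteq> t"
proof -
  note D = loc_unitD[OF S] and li = oca_lin[OF loc_unitD(1)[OF S]] and mu = oca_mult[OF loc_unitD(1)[OF S]]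
  have st: "t + s \<in> S" "\<delta> *\<^sub>R \<one> \<sqsubseteq> t + s" using s t li le_add[of "\<delta> *\<^sub>R \<one>" t 0 s] by (auto simp: pos_le)
  obtain k where k: "k \<in> S" "(t + s) \<odot> k = \<one>" "pos k" using loc_inverse[OF S st(1) t(2) st(2)] by metis
  have "t \<odot> t - s \<odot> s \<in> S" using s t by (simp add: li mu)
  then have "pos ((t \<odot> t - s \<odot> s) \<odot> k)" using loc_pos_mult[OF S _ _ k(1,3)] le by (simp add: le_def)
  moreover have "(t \<odot> t - s \<odot> s) \<odot> k = t - s"
  proof -
    have "(t \<odot> t - s \<odot> s) \<odot> k = ((t - s) \<odot> (t + s)) \<odot> k" by (simp add: sq_diff)
    also have "\<dots> = (t - s) \<odot> ((t + s) \<odot> k)" using oca_assoc[OF D(1)] s t k by (simp add: li)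
    finally show ?thesis by (simp add: k(2) unit_right)
  qed
  ultimately show ?thesis by (simp add: le_def)
qed

text \<open>With \<open>y\<close> as the modulus of \<open>a\<close>, the parts are
  \<open>(y + a) / 2\<close> and \<open>(y - a) / 2\<close>; the point is their positivity. It is
  shown up to \<epsilon>, replacing \<open>y\<close> by the invertible square root \<open>z\<close>
  of \<open>a^2 + \<epsilon>^2\<close>.\<close>

lemma pos_neg_parts:
  assumes S: "loc_unit \<one> S" and a: "a \<in> S"
  obtains w v where "w \<in> S" "v \<in> S" "pos w" "pos v" "w \<odot> v = 0" "a = w - v"
proof -
  note D = loc_unitD[OF S] and li = oca_lin[OF loc_unitD(1)[OF S]] and mu = oca_mult[OF loc_unitD(1)[OF S]]
  have aa: "a \<odot> a \<in> S" using a mu by simp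
  obtain y where y: "y \<in> S" "y \<odot> y = a \<odot> a" "pos y" using loc_pos_sqrt[OF S aa pos_sq] by metis
  have main: "pos (y + b)" if b: "b \<in> S" "b \<odot> b = a \<odot> a" for b
  proof -
    have "0 \<sqsubseteq> (y + b) + \<epsilon> *\<^sub>R \<one>" if e: "\<epsilon> > 0" for \<epsilon>
    proof -
      define k where "k = a \<odot> a + (\<epsilon> * \<epsilon>) *\<^sub>R \<one>"
      have kS: "k \<in> S" using aa D by (simp add: k_def li)
      have ek: "(\<epsilon> * \<epsilon>) *\<^sub>R \<one> \<sqsubseteq> k" by (simp add: k_def le_def pos_sq)
      have pk: "pos k" unfolding k_def by (intro pos_add pos_sq pos_scale pos_one) (use e in simp)
      obtain z where z: "z \<in> S" "z \<odot> z = k" "pos z" using loc_pos_sqrt[OF S kS pk] by metis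
      obtain k' where k': "k' \<in> S" "k \<odot> k' = \<one>" "pos k'" using loc_inverse[OF S kS _ ek] e by (metis mult_pos_pos)
      have zb: "z \<odot> b = b \<odot> z" by (rule comm)
      \<comment> \<open>As \<open>z^2 = b^2 + \<epsilon>^2\<close>, the product
        \<open>(z + b) z\<close> is half of \<open>(z + b)^2\<close> plus a positive constant;
        multiplying by the positive inverse \<open>z \<odot> k'\<close> of \<open>z\<close> keeps
        the sign.\<close>
      have 1: "(z + b) \<odot> z = (1/2) *\<^sub>R ((z + b) \<odot> (z + b)) + ((\<epsilon> * \<epsilon>)/2) *\<^sub>R \<one>"
        by (rule vec_eqI) (simp add: bil zb z(2) k_def b(2); simp add: field_simps)
      then have p1: "pos ((z + b) \<odot> z)" using e by (simp add: pos_add pos_sq pos_scale pos_one)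
      have "pos (((z + b) \<odot> z) \<odot> (z \<odot> k'))"
        by (rule loc_pos_mult[OF S _ p1]) (use b z k' in \<open>auto simp: li mu intro!: loc_pos_mult[OF S]\<close>)
      moreover have "((z + b) \<odot> z) \<odot> (z \<odot> k') = z + b"
      proof -
        have "((z + b) \<odot> z) \<odot> (z \<odot> k') = (z + b) \<odot> (z \<odot> (z \<odot> k'))"
          using oca_assoc[OF D(1)] b z k' by (simp add: li mu)
        also have "z \<odot> (z \<odot> k') = \<one>" using oca_assoc[OF D(1) z(1) z(1) k'(1)] z k' by simp
        finally show ?thesis by (simp add: unit_right)
      qed
      ultimately have pzb: "pos (z + b)" by simp
      have "z \<sqsubseteq> y + \<epsilon> *\<^sub>R \<one>"
      proof (rule le_of_sq_le[OF S z(1,3) _ e])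
        show "y + \<epsilon> *\<^sub>R \<one> \<in> S" using y D by (simp add: li)
        show "\<epsilon> *\<^sub>R \<one> \<sqsubseteq> y + \<epsilon> *\<^sub>R \<one>" using y by (simp add: le_def)
        have "(y + \<epsilon> *\<^sub>R \<one>) \<odot> (y + \<epsilon> *\<^sub>R \<one>) - z \<odot> z = (2 * \<epsilon>) *\<^sub>R y"
          by (rule vec_eqI) (simp add: bil unit unit_right y(2) z(2) k_def; simp add: algebra_simps)
        then show "z \<odot> z \<sqsubseteq> (y + \<epsilon> *\<^sub>R \<one>) \<odot> (y + \<epsilon> *\<^sub>R \<one>)" using e y by (simp add: le_def pos_scale)
      qed
      then have "z + b \<sqsubseteq> (y + b) + \<epsilon> *\<^sub>R \<one>" by (simp add: le_def algebra_simps)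
      then show ?thesis using pzb le_trans pos_le by blast
    qed
    then have "0 \<sqsubseteq> y + b" by (rule le_eps)
    then show ?thesis by (simp add: pos_le)
  qed
  show ?thesis
  proof (rule that[of "(1/2) *\<^sub>R (y + a)" "(1/2) *\<^sub>R (y - a)"])
    show "pos ((1/2) *\<^sub>R (y + a))" "pos ((1/2) *\<^sub>R (y - a))"
      using main[of a] main[of "- a"] a by (auto simp: pos_scale li bil)
    show "(1/2) *\<^sub>R (y + a) \<odot> (1/2) *\<^sub>R (y - a) = 0"
      using sq_diff[of y a] y(2) by (simp add: bil comm[of a y])
    show "a = (1/2) *\<^sub>R (y + a) - (1/2) *\<^sub>R (y - a)" by (rule vec_eqI) (simp; simp add: field_simps)
  qed (use a y in \<open>auto simp: li\<close>)
qed

subsection \<open>Reflections and positivity of the Peirce compression\<close>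

text \<open>The quadratic map of the symmetry \<open>2 p - \<one>\<close>: a sign change on the half
  space.\<close>

definition refl :: "'a \<Rightarrow> 'a \<Rightarrow> 'a" where "refl p x = x - 2 *\<^sub>R H p x"

lemma refl_lin: "refl p (x + y) = refl p x + refl p y" "refl p (x - y) = refl p x - refl p y"
  "refl p (c *\<^sub>R x) = c *\<^sub>R refl p x" "refl p 0 = 0" "refl p (- x) = - refl p x"
  by (auto simp: refl_def H_lin algebra_simps)

lemma H_even: "p \<odot> (p \<odot> x) = p \<odot> x \<Longrightarrow> H p x = 0"
  by (simp add: H_def)

context
  fixes p assumes p: "p \<odot> p = p"
begin

lemma even_Eh:
  assumes "p \<odot> (p \<odot> a) = p \<odot> a" "p \<odot> x = (1/2) *\<^sub>R x"
  shows "p \<odot> (a \<odot> x) = (1/2) *\<^sub>R (a \<odot> x)"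
  using ocD[OF oc_even[OF p assms(1)], of x] assms(2) by (simp add: bil)

lemma even_part: "p \<odot> (p \<odot> (x - H p x)) = p \<odot> (x - H p x)"
  by (simp add: bil H_Eh[OF p]) (rule vec_lin1[OF peirce_cubic[OF p, of x]], simp add: H_def bil; simp add: field_simps)

lemma H_even_iff: "H p x = 0 \<longleftrightarrow> p \<odot> (p \<odot> x) = p \<odot> x"
  unfolding H_def by (auto simp flip: scaleR_diff_right)

text \<open>Even elements and the half space grade the algebra by the integers modulo 2, and a sign
  change on the odd part respects products.\<close>

lemma refl_mult: "refl p (x \<odot> y) = refl p x \<odot> refl p y"
proof -
  define a where "a = x - H p x" define b where "b = y - H p y"
  define h where "h = H p x" define k where "k = H p y"
  have e: "p \<odot> (p \<odot> a) = p \<odot> a" "p \<odot> (p \<odot> b) = p \<odot> b" "p \<odot> h = (1/2) *\<^sub>R h" "p \<odot> k = (1/2) *\<^sub>R k"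
    using even_part H_Eh[OF p] by (auto simp: a_def b_def h_def k_def)
  have xy: "x = a + h" "y = b + k" by (auto simp: a_def b_def h_def k_def)
  have r: "refl p x = a - h" "refl p y = b - k"
    by (simp_all add: refl_def a_def b_def h_def k_def scaleR_2)
  have H: "H p (x \<odot> y) = a \<odot> k + h \<odot> b"
    unfolding xy using even_mult(2)[OF p e(1,2)] Eh_Eh[OF p e(3,4)] even_Eh[OF e(1,4)] even_Eh[OF e(2,3)]
    by (simp add: bil H_lin H_even H_of_Eh[OF p] comm[of h b])
  show ?thesis unfolding r unfolding refl_def H unfolding xy by (simp add: bil scaleR_2 algebra_simps)
qed

lemma refl_refl: "refl p (refl p x) = x"
  by (simp add: refl_def H_lin H_of_Eh[OF p H_Eh[OF p]] scaleR_2)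

lemma refl_pos: "pos x \<Longrightarrow> pos (refl p x)"
  unfolding pos_def using refl_mult by metis

lemma refl_le: "x \<sqsubseteq> y \<Longrightarrow> refl p x \<sqsubseteq> refl p y"
  unfolding le_def using refl_pos[of "y - x"] by (simp add: refl_lin)

lemma refl_even: "refl p x = x \<longleftrightarrow> p \<odot> (p \<odot> x) = p \<odot> x"
  using H_even_iff[of x] by (auto simp: refl_def)

lemma gen_even:
  assumes u: "p \<odot> (p \<odot> u) = p \<odot> u" and a: "p \<odot> (p \<odot> a) = p \<odot> a" and x: "x \<in> gen u a"
  shows "p \<odot> (p \<odot> x) = p \<odot> x"
proof -
  have "gen u a \<subseteq> {x. p \<odot> (p \<odot> x) = p \<odot> x}"
  proof (rule gen_minimal)
    show "subspace {x. p \<odot> (p \<odot> x) = p \<odot> x}" unfolding subspace_def by (auto simp: bil)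
    show "closed {x. p \<odot> (p \<odot> x) = p \<odot> x}" by (intro closed_eq_cont continuous_intros)
  qed (use u a even_mult[OF p] in auto)
  then show ?thesis using x by auto
qed

text \<open>Averaging \<open>a\<close> with its reflection shows that the even part \<open>E\<close>
  is positive. Its square root is even again, and multiplication by \<open>p\<close> is
  multiplicative on even elements.\<close>

lemma U_pos: "pos a \<Longrightarrow> pos (U p a)"
proof -
  assume a: "pos a"
  define E where "E = a - H p a"
  have ev: "p \<odot> (p \<odot> E) = p \<odot> E" using even_part by (simp add: E_def)
  have "pos ((1/2) *\<^sub>R (a + refl p a))" using a refl_pos by (simp add: pos_add pos_scale)
  moreover have "(1/2) *\<^sub>R (a + refl p a) = E" unfolding E_def refl_def by (rule vec_eqI) (simp; simp add: field_simps)
  ultimately have "pos E" by simp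
  then obtain c where c: "c \<in> gen \<one> E" "c \<odot> c = E" using loc_pos_sqrt[OF loc_unit_gen1 gen_self] by metis
  have ce: "p \<odot> (p \<odot> c) = p \<odot> c" by (rule gen_even[OF _ ev c(1)]) (simp add: unit_right p)
  have "U p a = U p E" by (simp add: E_def U_lin U_of_Eh[OF p H_Eh[OF p]])
  also have "\<dots> = p \<odot> E" using U_even[OF p ev] .
  also have "\<dots> = (p \<odot> c) \<odot> (p \<odot> c)" using even_mult(1)[OF p ce ce] c(2) by simp
  finally show ?thesis by (simp add: pos_sq)
qed

lemma U_le: "a \<sqsubseteq> b \<Longrightarrow> U p a \<sqsubseteq> U p b"
  unfolding le_def using U_pos[of "b - a"] by (simp add: U_lin)

lemma U_one: "U p \<one> = p" by (simp add: U_idem[OF p] unit_right p scaleR_2)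

lemma U_norm: "norm (U p a) \<le> norm a"
proof -
  have "pos (\<one> - p)" by (rule pos_idem) (simp add: bil unit unit_right p)
  then have 1: "norm a *\<^sub>R p \<sqsubseteq> norm a *\<^sub>R \<one>" by (intro le_scale) (simp_all add: le_def)
  have "U p a \<sqsubseteq> norm a *\<^sub>R p" using U_le[OF le_norm(1)[of a]] by (simp add: U_lin U_one)
  moreover have "- (norm a *\<^sub>R p) \<sqsubseteq> U p a" using U_le[OF le_norm(2)[of a]] by (simp add: U_lin U_one)
  ultimately have "U p a \<sqsubseteq> norm a *\<^sub>R \<one>" "- (norm a *\<^sub>R \<one>) \<sqsubseteq> U p a"
    using le_trans[OF _ 1] le_trans[OF le_neg[OF 1]] by blast+
  then show ?thesis using norm_le_iff[of "norm a" "U p a"] by simp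
qed

end

end

section \<open>Suprema and spectral approximation\<close>

context jbu
begin

definition is_sup :: "(nat \<Rightarrow> 'a) \<Rightarrow> 'a \<Rightarrow> bool"
  where "is_sup a e \<longleftrightarrow> (\<forall>n. a n \<sqsubseteq> e) \<and> (\<forall>u. (\<forall>n. a n \<sqsubseteq> u) \<longrightarrow> e \<sqsubseteq> u)"

definition incr :: "(nat \<Rightarrow> 'a) \<Rightarrow> bool"
  where "incr a \<longleftrightarrow> (\<forall>n. a n \<sqsubseteq> a (Suc n))"

lemma incr_le: "incr a \<Longrightarrow> m \<le> n \<Longrightarrow> a m \<sqsubseteq> a n"
proof (induction n)
  case (Suc n)
  show ?case
  proof (cases "m = Suc n")
    case False
    then have "a m \<sqsubseteq> a n" using Suc by simp
    then show ?thesis using Suc.prems(1) le_trans unfolding incr_def by blast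
  qed simp
qed simp

text \<open>The sum of the positive elements \<open>x (1 - x)\<close> and
  \<open>(x - \<epsilon> b / 2)^2\<close>, divided by \<epsilon>.\<close>

lemma mult_bound:
  assumes x: "pos x" "x \<sqsubseteq> \<one>" and e: "\<epsilon> > 0"
  shows "b \<odot> x \<sqsubseteq> (1/\<epsilon>) *\<^sub>R x + (\<epsilon>/4) *\<^sub>R (b \<odot> b)"
proof -
  have S: "loc_unit \<one> (gen \<one> x)" "x \<in> gen \<one> x" by (rule loc_unit_gen1, rule gen_self)
  have "\<one> - x \<in> gen \<one> x" using oca_lin(3)[OF loc_unitD(1)[OF S(1)] loc_unitD(2)[OF S(1)] S(2)] .
  then have "pos (x \<odot> (\<one> - x))" using loc_pos_mult[OF S(1) S(2) x(1)] x(2) by (simp add: le_def)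
  then have "pos (x \<odot> (\<one> - x) + (x - (\<epsilon>/2) *\<^sub>R b) \<odot> (x - (\<epsilon>/2) *\<^sub>R b))" using pos_add pos_sq by blast
  moreover have "x \<odot> (\<one> - x) + (x - (\<epsilon>/2) *\<^sub>R b) \<odot> (x - (\<epsilon>/2) *\<^sub>R b)
      = x - \<epsilon> *\<^sub>R (b \<odot> x) + (\<epsilon> * \<epsilon> / 4) *\<^sub>R (b \<odot> b)"
    by (rule vec_eqI) (simp add: bil unit_right comm[of x b]; simp add: field_simps)
  ultimately have "pos ((1/\<epsilon>) *\<^sub>R (x - \<epsilon> *\<^sub>R (b \<odot> x) + (\<epsilon> * \<epsilon> / 4) *\<^sub>R (b \<odot> b)))" using e by (simp add: pos_scale)
  moreover have "(1/\<epsilon>) *\<^sub>R (x - \<epsilon> *\<^sub>R (b \<odot> x) + (\<epsilon> * \<epsilon> / 4) *\<^sub>R (b \<odot> b))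
      = (1/\<epsilon>) *\<^sub>R x + (\<epsilon>/4) *\<^sub>R (b \<odot> b) - b \<odot> x"
    using e by (simp add: scaleR_add_right scaleR_diff_right)
  ultimately show ?thesis by (simp add: le_def)
qed

text \<open>Multiplication is order continuous along bounded increasing sequences: by the previous bound,
  \<open>b \<odot> (e - a n)\<close> is dominated by a multiple of \<open>e - a n\<close> up to an arbitrarily small error.\<close>

lemma sup_mult_le:
  assumes s: "is_sup a e" "incr a" and a: "\<And>n. pos (a n)" "\<And>n. a n \<sqsubseteq> \<one>"
    and k: "\<And>n. n \<ge> m \<Longrightarrow> b \<odot> a n \<sqsubseteq> k"
  shows "b \<odot> e \<sqsubseteq> k"
proof (rule le_eps[of _ _ "(1/4) *\<^sub>R (b \<odot> b)"])
  fix \<epsilon> :: real assume e: "\<epsilon> > 0"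
  define c where "c = b \<odot> e - k - (\<epsilon>/4) *\<^sub>R (b \<odot> b)"
  have e1: "e \<sqsubseteq> \<one>" using s a(2) unfolding is_sup_def by blast
  have *: "a n \<sqsubseteq> e - \<epsilon> *\<^sub>R c" if n: "n \<ge> m" for n
  proof -
    have p: "pos (e - a n)" using s(1) unfolding is_sup_def le_def by blast
    have "e - a n \<sqsubseteq> \<one>" using le_diff[OF e1, of 0 "a n"] a(1) by (simp add: pos_le)
    then have 1: "b \<odot> (e - a n) \<sqsubseteq> (1/\<epsilon>) *\<^sub>R (e - a n) + (\<epsilon>/4) *\<^sub>R (b \<odot> b)" by (rule mult_bound[OF p _ e])
    have "b \<odot> (e - a n) + b \<odot> a n \<sqsubseteq> (1/\<epsilon>) *\<^sub>R (e - a n) + (\<epsilon>/4) *\<^sub>R (b \<odot> b) + k"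
      using le_add[OF 1 k[OF n]] .
    then have "c \<sqsubseteq> (1/\<epsilon>) *\<^sub>R (e - a n)" unfolding c_def le_def by (simp add: bil algebra_simps)
    then have "\<epsilon> *\<^sub>R c \<sqsubseteq> \<epsilon> *\<^sub>R ((1/\<epsilon>) *\<^sub>R (e - a n))" by (rule le_scale) (use e in simp)
    then have "\<epsilon> *\<^sub>R c \<sqsubseteq> e - a n" using e by simp
    then show ?thesis unfolding le_def by (simp add: algebra_simps)
  qed
  have "a n \<sqsubseteq> e - \<epsilon> *\<^sub>R c" for n
    using *[of "max m n"] incr_le[OF s(2), of n "max m n"] le_trans by auto
  then have "e \<sqsubseteq> e - \<epsilon> *\<^sub>R c" using s(1) unfolding is_sup_def by blast
  then have "pos ((1/\<epsilon>) *\<^sub>R (- (\<epsilon> *\<^sub>R c)))" using e unfolding le_def by (intro pos_scale) auto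
  then have "pos (- c)" using e by simp
  then show "b \<odot> e \<sqsubseteq> k + \<epsilon> *\<^sub>R ((1/4) *\<^sub>R (b \<odot> b))" unfolding c_def le_def by (simp add: algebra_simps)
qed

lemma le_sup_mult:
  assumes s: "is_sup a e" "incr a" and a: "\<And>n. pos (a n)" "\<And>n. a n \<sqsubseteq> \<one>"
    and k: "\<And>n. n \<ge> m \<Longrightarrow> k \<sqsubseteq> b \<odot> a n"
  shows "k \<sqsubseteq> b \<odot> e"
proof -
  have "(- b) \<odot> e \<sqsubseteq> - k"
    by (rule sup_mult_le[OF s a, of m]) (use le_neg[OF k] in \<open>simp add: bil\<close>)
  then show ?thesis using le_neg by (fastforce simp: bil)
qed

lemma sup_mult_eq:
  assumes s: "is_sup a e" "incr a" and a: "\<And>n. pos (a n)" "\<And>n. a n \<sqsubseteq> \<one>"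
    and k: "\<And>n. b \<odot> a n = k"
  shows "b \<odot> e = k"
  using sup_mult_le[OF s a, of 0 b k] le_sup_mult[OF s a, of 0 k b] k le_antisym by simp

text \<open>The reflection is an order automorphism that fixes every \<open>a n\<close>, hence it
  fixes their supremum.\<close>

lemma sup_even:
  assumes p: "p \<odot> p = p" and s: "is_sup a e" and a: "\<And>n. p \<odot> (p \<odot> a n) = p \<odot> a n"
  shows "p \<odot> (p \<odot> e) = p \<odot> e"
proof -
  have r: "refl p (a n) = a n" for n using refl_even[OF p] a by blast
  have 1: "a n \<sqsubseteq> refl p e" for n
    using refl_le[OF p, of "a n" e] s r unfolding is_sup_def by simp
  then have le: "e \<sqsubseteq> refl p e" using s unfolding is_sup_def by blast
  then have "refl p e \<sqsubseteq> e" using refl_le[OF p le] refl_refl[OF p] by simp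
  then show ?thesis using le le_antisym refl_even[OF p] by blast
qed

lemma compl_idem: "p \<odot> p = p \<Longrightarrow> (\<one> - p) \<odot> (\<one> - p) = \<one> - p"
  by (simp add: bil unit unit_right)

end

text \<open>Monotone completeness is the form in which the predual is used from here on.\<close>

locale jbw = jbu jm one for jm :: "'a::banach \<Rightarrow> 'a \<Rightarrow> 'a" (infixl "\<odot>" 70) and one :: 'a ("\<one>") +
  assumes sup_exists: "\<And>a u. incr a \<Longrightarrow> (\<And>n. a n \<sqsubseteq> u) \<Longrightarrow> \<exists>e. is_sup a e"
begin

section \<open>Support idempotents and spectral decomposition\<close>

text \<open>\<open>e\<close> is the support of \<open>w\<close>, the supremum of
  \<open>a n = n w / (1 + n w)\<close>. It may lie outside the norm-closed algebra \<open>S\<close>,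
  so the approximating sequence is exported together with the action of \<open>e\<close> on
  \<open>S\<close>.\<close>

lemma support:
  assumes S: "loc_unit \<one> S" and w: "w \<in> S" "pos w"
  obtains e a where "e \<odot> e = e" "is_sup a e" "incr a" "\<And>n. a n \<in> S" "\<And>n. pos (a n)" "\<And>n. a n \<sqsubseteq> \<one>"
    "\<And>n. a n \<sqsubseteq> real n *\<^sub>R w" "\<And>x C. x \<in> S \<Longrightarrow> pos x \<Longrightarrow> x \<sqsubseteq> C *\<^sub>R w \<Longrightarrow> e \<odot> x = x"
    "\<And>v n. v \<in> S \<Longrightarrow> w \<odot> v = 0 \<Longrightarrow> a n \<odot> v = 0" "\<And>v. v \<in> S \<Longrightarrow> w \<odot> v = 0 \<Longrightarrow> e \<odot> v = 0"
proof -
  note D = loc_unitD[OF S] and li = oca_lin[OF loc_unitD(1)[OF S]] and mu = oca_mult[OF loc_unitD(1)[OF S]]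
  note as = oca_assoc[OF loc_unitD(1)[OF S]] and lc = oca_lcomm[OF loc_unitD(1)[OF S]]
  have ex: "\<exists>k. k \<in> S \<and> (\<one> + real n *\<^sub>R w) \<odot> k = \<one> \<and> pos k \<and> k \<sqsubseteq> \<one>" for n
  proof -
    have 1: "\<one> + real n *\<^sub>R w \<in> S" using w D by (simp add: li)
    have 2: "1 *\<^sub>R \<one> \<sqsubseteq> \<one> + real n *\<^sub>R w" using w by (simp add: le_def pos_scale)
    show ?thesis using loc_inverse[OF S 1 zero_less_one 2] by (metis div_by_1 scaleR_one)
  qed
  define i where "i n = (SOME k. k \<in> S \<and> (\<one> + real n *\<^sub>R w) \<odot> k = \<one> \<and> pos k \<and> k \<sqsubseteq> \<one>)" for n
  have i: "i n \<in> S" "(\<one> + real n *\<^sub>R w) \<odot> i n = \<one>" "pos (i n)" "i n \<sqsubseteq> \<one>" for n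
    unfolding i_def using someI_ex[OF ex[of n]] by blast+
  define a where "a n = \<one> - i n" for n
  have aw: "a n = real n *\<^sub>R (w \<odot> i n)" for n
    using i(2)[of n] unfolding a_def bil unit by (metis add_diff_cancel_left')
  have aS: "a n \<in> S" for n using i D by (simp add: a_def li)
  have wi: "w \<odot> i n \<in> S" "pos (w \<odot> i n)" for n using w i loc_pos_mult[OF S] by (auto simp: mu)
  have pa: "pos (a n)" for n unfolding aw using wi by (simp add: pos_scale)
  have a1: "a n \<sqsubseteq> \<one>" for n using i by (simp add: a_def le_def)
  have inc: "incr a"
    unfolding incr_def
  proof
    fix n
    let ?j = "i (Suc n)"
    have "i n = i n \<odot> ((\<one> + real (Suc n) *\<^sub>R w) \<odot> ?j)" by (simp only: i unit_right)
    also have "\<dots> = i n \<odot> ((\<one> + real n *\<^sub>R w) \<odot> ?j) + i n \<odot> (w \<odot> ?j)"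
      by (simp add: bil scaleR_add_left)
    also have "i n \<odot> ((\<one> + real n *\<^sub>R w) \<odot> ?j) = ?j"
    proof -
      have "i n \<odot> ((\<one> + real n *\<^sub>R w) \<odot> ?j) = (i n \<odot> (\<one> + real n *\<^sub>R w)) \<odot> ?j"
        using as[of "i n" "\<one> + real n *\<^sub>R w" ?j] i w D by (simp add: li)
      then show ?thesis using i(2)[of n] by (simp add: comm[of "i n"] unit)
    qed
    finally have "i n - ?j = i n \<odot> (w \<odot> ?j)" by (metis add_diff_cancel_left')
    then have "pos (i n - ?j)" using loc_pos_mult[OF S i(1) i(3) wi] by simp
    then show "a n \<sqsubseteq> a (Suc n)" by (simp add: a_def le_def)
  qed
  obtain e where e: "is_sup a e" using sup_exists[OF inc a1] by blast
  have anw: "a n \<sqsubseteq> real n *\<^sub>R w" for n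
  proof -
    have "pos (w \<odot> (\<one> - i n))" using loc_pos_mult[OF S w] i[of n] D by (simp add: le_def li)
    then have "w \<odot> i n \<sqsubseteq> w" by (simp add: le_def bil unit_right)
    then show ?thesis unfolding aw by (rule le_scale) simp
  qed
  have ex: "e \<odot> x = x" if x: "x \<in> S" "pos x" "x \<sqsubseteq> C *\<^sub>R w" for x C
  proof -
    define K where "K = \<bar>C\<bar> + 1"
    have K: "K > 0" "x \<sqsubseteq> K *\<^sub>R w"
      using le_trans[OF x(3) le_scale_left[OF w(2)], of K] by (auto simp: K_def)
    have xa: "x \<odot> a n = x - x \<odot> i n" for n by (simp add: a_def bil unit_right)
    have xi: "pos (x \<odot> i n)" for n using loc_pos_mult[OF S x(1,2) i(1,3)] .
    \<comment> \<open>\<open>x\<close> is at most \<open>K w\<close>, and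
      \<open>n w / (1 + n w)\<close> is at most 1, so the defect \<open>x \<odot> i n\<close> is of
      order \<open>1 / n\<close>.\<close>
    have up: "x \<odot> i n \<sqsubseteq> (K / real n) *\<^sub>R \<one>" if n: "n > 0" for n
    proof -
      have "pos ((K *\<^sub>R w - x) \<odot> i n)" using loc_pos_mult[OF S _ _ i(1,3)] K(2) x w by (simp add: le_def li)
      then have "x \<odot> i n \<sqsubseteq> K *\<^sub>R (w \<odot> i n)" by (simp add: le_def bil)
      moreover have "real n *\<^sub>R (w \<odot> i n) \<sqsubseteq> \<one>" using a1 aw by metis
      then have "(K / real n) *\<^sub>R (real n *\<^sub>R (w \<odot> i n)) \<sqsubseteq> (K / real n) *\<^sub>R \<one>" by (rule le_scale) (use K in simp)
      then have "K *\<^sub>R (w \<odot> i n) \<sqsubseteq> (K / real n) *\<^sub>R \<one>" using n by simp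
      ultimately show ?thesis by (rule le_trans)
    qed
    have "x \<odot> e \<sqsubseteq> x"
      by (rule sup_mult_le[OF e inc pa a1, of 0]) (simp add: xa le_def xi)
    moreover have "x \<sqsubseteq> x \<odot> e"
    proof (rule le_eps[of _ _ \<one>])
      fix \<epsilon> :: real assume ep: "\<epsilon> > 0"
      obtain m where m: "real m > K / \<epsilon>" "m > 0"
        using reals_Archimedean2 by (metis K(1) ep divide_pos_pos of_nat_0_less_iff order_less_trans)
      have "x - \<epsilon> *\<^sub>R \<one> \<sqsubseteq> x \<odot> e"
      proof (rule le_sup_mult[OF e inc pa a1, of m])
        fix n assume n: "n \<ge> m"
        then have "K / real n \<le> \<epsilon>" using m ep by (simp add: field_simps) (smt (verit) mult_left_mono of_nat_le_iff)
        then have "(K / real n) *\<^sub>R \<one> \<sqsubseteq> \<epsilon> *\<^sub>R \<one>" by (rule le_scale_left[OF pos_one])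
        then have "x \<odot> i n \<sqsubseteq> \<epsilon> *\<^sub>R \<one>" using up[of n] n m le_trans by (metis less_le_trans)
        then show "x - \<epsilon> *\<^sub>R \<one> \<sqsubseteq> x \<odot> a n" unfolding xa le_def by simp
      qed
      then show "x \<sqsubseteq> x \<odot> e + \<epsilon> *\<^sub>R \<one>" unfolding le_def by (simp add: algebra_simps)
    qed
    ultimately show ?thesis using le_antisym comm by metis
  qed
  have ea: "e \<odot> a n = a n" for n using ex[OF aS pa anw] .
  have "e \<odot> e \<sqsubseteq> e"
    by (rule sup_mult_le[OF e inc pa a1, of 0]) (use e in \<open>simp add: ea is_sup_def\<close>)
  moreover have "a k \<sqsubseteq> e \<odot> e" for k
    by (rule le_sup_mult[OF e inc pa a1, of k]) (use incr_le[OF inc] in \<open>simp add: ea\<close>)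
  then have "e \<sqsubseteq> e \<odot> e" using e unfolding is_sup_def by blast
  ultimately have ee: "e \<odot> e = e" by (rule le_antisym)
  have av: "a n \<odot> v = 0" if v: "v \<in> S" "w \<odot> v = 0" for v n
  proof -
    have "(w \<odot> i n) \<odot> v = i n \<odot> (w \<odot> v)" using as[OF i(1) w(1) v(1), of n] by (simp add: comm[of w])
    then show ?thesis unfolding aw by (simp add: bil v(2))
  qed
  have ev: "e \<odot> v = 0" if v: "v \<in> S" "w \<odot> v = 0" for v
    using sup_mult_eq[OF e inc pa a1, of v 0] av[OF v] by (simp add: comm[of v])
  show ?thesis by (rule that[OF ee e inc aS pa a1 anw ex av ev])
qed

text \<open>The parts \<open>w\<close>, \<open>v\<close> and the support \<open>e\<close> of
  \<open>w\<close> are formed with the unit and need not lie in the corner of \<open>f\<close>. They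
  are all even for \<open>f\<close>, so multiplication by \<open>f\<close> moves them there and
  preserves products.\<close>

lemma spectral_split:
  assumes f: "f \<odot> f = f" and a: "f \<odot> a = a"
  obtains e where "e \<odot> e = e" "f \<odot> e = e" "e \<odot> (e \<odot> a) = e \<odot> a" "pos (e \<odot> a)" "a - e \<odot> a \<sqsubseteq> 0"
proof -
  let ?S = "gen \<one> a"
  note S = loc_unit_gen1[of a]
  obtain w v where wv: "w \<in> ?S" "v \<in> ?S" "pos w" "pos v" "w \<odot> v = 0" "a = w - v"
    using pos_neg_parts[OF S gen_self] by metis
  obtain e b where e: "e \<odot> e = e" "is_sup b e" "\<And>n. b n \<in> ?S"
      "\<And>x C. x \<in> ?S \<Longrightarrow> pos x \<Longrightarrow> x \<sqsubseteq> C *\<^sub>R w \<Longrightarrow> e \<odot> x = x" "\<And>v. v \<in> ?S \<Longrightarrow> w \<odot> v = 0 \<Longrightarrow> e \<odot> v = 0"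
    using support[OF S wv(1,3)] by metis
  have ew: "e \<odot> w = w" using e(4)[OF wv(1,3), of 1] by simp
  have ev: "e \<odot> v = 0" using e(5)[OF wv(2,5)] .
  have fe: "f \<odot> (f \<odot> x) = f \<odot> x" if "x \<in> ?S" for x
    by (rule gen_even[OF f _ _ that]) (simp_all add: unit_right f a)
  have fee: "f \<odot> (f \<odot> e) = f \<odot> e" by (rule sup_even[OF f e(2)]) (use fe e(3) in blast)
  have m: "(f \<odot> e) \<odot> (f \<odot> x) = f \<odot> (e \<odot> x)" if "f \<odot> (f \<odot> x) = f \<odot> x" for x
    using even_mult(1)[OF f fee that] by simp
  have eaw: "e \<odot> a = w" by (simp add: wv(6) bil ew ev)
  have 1: "(f \<odot> e) \<odot> a = f \<odot> w"
    using m[of a] by (simp only: a eaw simp_thms)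
  have 2: "(f \<odot> e) \<odot> (f \<odot> w) = f \<odot> w" using m[OF fe[OF wv(1)]] by (simp add: ew)
  have pf: "pos (f \<odot> x)" if "x \<in> ?S" "pos x" for x
    using U_pos[OF f that(2)] U_even[OF f fe[OF that(1)]] by simp
  show ?thesis
  proof (rule that[of "f \<odot> e"])
    show "(f \<odot> e) \<odot> (f \<odot> e) = f \<odot> e" using m[OF fee] e(1) by simp
    show "f \<odot> (f \<odot> e) = f \<odot> e" by (rule fee)
    show "(f \<odot> e) \<odot> ((f \<odot> e) \<odot> a) = (f \<odot> e) \<odot> a" unfolding 1 by (rule 2)
    show "pos ((f \<odot> e) \<odot> a)" unfolding 1 using pf wv by blast
    have "f \<odot> w - f \<odot> v = a" using a wv(6) diff_right by metis
    then have "a - f \<odot> w = - (f \<odot> v)" by (metis add_diff_cancel_left' diff_add_cancel minus_diff_eq)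
    then show "a - (f \<odot> e) \<odot> a \<sqsubseteq> 0" unfolding 1 using pf[OF wv(2,4)] by (simp add: le_def)
  qed
qed

text \<open>Splitting the corner by the spectral idempotent of \<open>a\<close> at the midpoint
  halves the interval on both pieces, and the induction hypothesis applies to each.\<close>

lemma spectral_bisection:
  assumes "f \<odot> f = f" "f \<odot> a = a" "\<alpha> *\<^sub>R f \<sqsubseteq> a" "a \<sqsubseteq> \<beta> *\<^sub>R f"
  shows "\<exists>P lo. finite P \<and> (\<forall>p\<in>P. p \<odot> p = p \<and> p \<noteq> 0 \<and> f \<odot> p = p \<and> p \<odot> (p \<odot> a) = p \<odot> a \<and>
      lo p *\<^sub>R p \<sqsubseteq> p \<odot> a \<and> p \<odot> a \<sqsubseteq> (lo p + (\<beta> - \<alpha>) / 2 ^ k) *\<^sub>R p) \<and>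
      (\<forall>p\<in>P. \<forall>q\<in>P. p \<noteq> q \<longrightarrow> p \<odot> q = 0) \<and> \<Sum>P = f"
  using assms
proof (induction k arbitrary: f a \<alpha> \<beta>)
  case 0
  show ?case
  proof (cases "f = 0")
    case True
    then show ?thesis by (intro exI[of _ "{}"]) auto
  next
    case False
    then show ?thesis using 0 by (intro exI[of _ "{f}"] exI[of _ "\<lambda>_. \<alpha>"]) auto
  qed
next
  case (Suc k)
  note f = Suc.prems(1) and a = Suc.prems(2)
  define m where "m = (\<alpha> + \<beta>) / 2"
  define b where "b = a - m *\<^sub>R f"
  have fb: "f \<odot> b = b" by (simp add: b_def bil f a)
  obtain e where e: "e \<odot> e = e" "f \<odot> e = e" "e \<odot> (e \<odot> b) = e \<odot> b" "pos (e \<odot> b)" "b - e \<odot> b \<sqsubseteq> 0"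
    using spectral_split[OF f fb] by metis
  have ef: "e \<odot> f = e" using e(2) comm by metis
  have eb: "e \<odot> b = e \<odot> a - m *\<^sub>R e" by (simp add: b_def bil ef)
  have ea: "e \<odot> (e \<odot> a) = e \<odot> a" using e(3) unfolding eb by (simp add: bil e(1))
  define g where "g = f - e"
  have g: "g \<odot> g = g" "f \<odot> g = g" "e \<odot> g = 0" "g \<odot> e = 0"
    by (simp_all add: g_def bil f e ef)
  have fea: "f \<odot> (e \<odot> a) = e \<odot> a" using E1_E1[OF f e(2) a] .
  have ga: "g \<odot> a = a - e \<odot> a" by (simp add: g_def bil a)
  have gga: "g \<odot> (g \<odot> a) = g \<odot> a" unfolding ga by (simp add: g_def bil a fea ea)
  have e_g: "e \<odot> (g \<odot> a) = 0" unfolding ga by (simp add: bil ea)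
  have g_e: "g \<odot> (e \<odot> a) = 0" by (simp add: g_def bil fea ea)
  have le1: "m *\<^sub>R e \<sqsubseteq> e \<odot> a" using e(4) unfolding eb le_def .
  have le2: "e \<odot> a \<sqsubseteq> \<beta> *\<^sub>R e"
    using U_le[OF e(1) Suc.prems(4)] U_even[OF e(1) ea] U_even[OF e(1), of f] by (simp add: U_lin ef e(1))
  obtain P1 lo1 where P1: "finite P1" "\<forall>p\<in>P1. p \<odot> p = p \<and> p \<noteq> 0 \<and> e \<odot> p = p \<and>
      p \<odot> (p \<odot> (e \<odot> a)) = p \<odot> (e \<odot> a) \<and> lo1 p *\<^sub>R p \<sqsubseteq> p \<odot> (e \<odot> a) \<and>
      p \<odot> (e \<odot> a) \<sqsubseteq> (lo1 p + (\<beta> - m) / 2 ^ k) *\<^sub>R p"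
      "\<forall>p\<in>P1. \<forall>q\<in>P1. p \<noteq> q \<longrightarrow> p \<odot> q = 0" "\<Sum>P1 = e"
    using Suc.IH[OF e(1) ea le1 le2] by (elim exE conjE) (rule that; assumption)
  have le3: "\<alpha> *\<^sub>R g \<sqsubseteq> g \<odot> a"
    using U_le[OF g(1) Suc.prems(3)] U_even[OF g(1) gga] U_even[OF g(1), of f] by (simp add: U_lin comm[of g f] g)
  have le4: "g \<odot> a \<sqsubseteq> m *\<^sub>R g"
    using e(5) unfolding eb ga by (simp add: le_def b_def g_def algebra_simps)
  obtain P2 lo2 where P2: "finite P2" "\<forall>p\<in>P2. p \<odot> p = p \<and> p \<noteq> 0 \<and> g \<odot> p = p \<and>
      p \<odot> (p \<odot> (g \<odot> a)) = p \<odot> (g \<odot> a) \<and> lo2 p *\<^sub>R p \<sqsubseteq> p \<odot> (g \<odot> a) \<and>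
      p \<odot> (g \<odot> a) \<sqsubseteq> (lo2 p + (m - \<alpha>) / 2 ^ k) *\<^sub>R p"
      "\<forall>p\<in>P2. \<forall>q\<in>P2. p \<noteq> q \<longrightarrow> p \<odot> q = 0" "\<Sum>P2 = g"
    using Suc.IH[OF g(1) gga le3 le4] by (elim exE conjE) (rule that; assumption)
  have h: "(\<beta> - m) / 2 ^ k = (\<beta> - \<alpha>) / 2 ^ Suc k" "(m - \<alpha>) / 2 ^ k = (\<beta> - \<alpha>) / 2 ^ Suc k"
    by (simp_all add: m_def field_simps)
  have aeg: "a = e \<odot> a + g \<odot> a" by (simp add: ga)
  have pa1: "p \<odot> a = p \<odot> (e \<odot> a)" "e \<odot> p = p" if "p \<in> P1" for p
  proof -
    show ep: "e \<odot> p = p" using P1(2) that by blast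
    show "p \<odot> a = p \<odot> (e \<odot> a)" using E1_E0[OF e(1) ep e_g] aeg add_right[of p "e \<odot> a" "g \<odot> a"] by simp
  qed
  have pa2: "p \<odot> a = p \<odot> (g \<odot> a)" "g \<odot> p = p" "e \<odot> p = 0" if "p \<in> P2" for p
  proof -
    show gp: "g \<odot> p = p" using P2(2) that by blast
    show "p \<odot> a = p \<odot> (g \<odot> a)" using E1_E0[OF g(1) gp g_e] aeg add_right[of p "e \<odot> a" "g \<odot> a"] by simp
    show "e \<odot> p = 0" using E1_E0[OF g(1) gp g(4)] comm by metis
  qed
  have disj: "P1 \<inter> P2 = {}" using pa1(2) pa2(3) P1(2) by fastforce
  have fp: "f \<odot> p = p" if "p \<in> P1 \<union> P2" for p
  proof -
    have "f \<odot> p = e \<odot> p + g \<odot> p" by (simp add: g_def bil)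
    moreover have "p \<in> P1 \<Longrightarrow> g \<odot> p = 0" using E1_E0[OF e(1) pa1(2) g(3)] comm by metis
    ultimately show ?thesis using that pa1 pa2 by auto
  qed
  have cross: "p \<odot> q = 0" if "p \<in> P1" "q \<in> P2" for p q
    using E1_E0[OF e(1) pa1(2)[OF that(1)] pa2(3)[OF that(2)]] .
  define lo where "lo p = (if p \<in> P1 then lo1 p else lo2 p)" for p
  show ?case
  proof (intro exI[of _ "P1 \<union> P2"] exI[of _ lo] conjI ballI impI)
    show "finite (P1 \<union> P2)" using P1 P2 by simp
    show "\<Sum>(P1 \<union> P2) = f" using sum.union_disjoint[OF P1(1) P2(1) disj, of "\<lambda>x. x"] P1 P2 by (simp add: g_def)
    show "p \<odot> q = 0" if "p \<in> P1 \<union> P2" "q \<in> P1 \<union> P2" "p \<noteq> q" for p q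
      using that cross[of p q] cross[of q p] P1(3) P2(3) comm[of p q] by auto
    fix p assume p: "p \<in> P1 \<union> P2"
    show "f \<odot> p = p" using fp p .
    show "p \<odot> p = p" "p \<noteq> 0" using p P1(2) P2(2) by auto
    show "p \<odot> (p \<odot> a) = p \<odot> a" using p P1(2) P2(2) pa1 pa2 by auto
    show "lo p *\<^sub>R p \<sqsubseteq> p \<odot> a" using p P1(2) P2(2) pa1 pa2 by (auto simp: lo_def)
    show "p \<odot> a \<sqsubseteq> (lo p + (\<beta> - \<alpha>) / 2 ^ Suc k) *\<^sub>R p"
      using p P1(2) P2(2) pa1 pa2 disj unfolding h by (auto simp: lo_def)
  qed
qed

lemma spectral_approx:
  assumes f: "f \<odot> f = f" and a: "f \<odot> a = a" and \<eta>: "\<eta> > 0"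
  shows "\<exists>P lo. finite P \<and> (\<forall>p\<in>P. p \<odot> p = p \<and> p \<noteq> 0 \<and> f \<odot> p = p \<and> p \<odot> (p \<odot> a) = p \<odot> a \<and>
      lo p *\<^sub>R p \<sqsubseteq> p \<odot> a \<and> p \<odot> a \<sqsubseteq> (lo p + \<eta>) *\<^sub>R p) \<and>
      (\<forall>p\<in>P. \<forall>q\<in>P. p \<noteq> q \<longrightarrow> p \<odot> q = 0) \<and> \<Sum>P = f"
proof -
  let ?M = "norm a"
  have b: "- ?M *\<^sub>R f \<sqsubseteq> a" "a \<sqsubseteq> ?M *\<^sub>R f"
    using U_le[OF f le_norm(2)[of a]] U_le[OF f le_norm(1)[of a]] by (simp_all add: U_lin U_one f U_of_E1[OF f a])
  obtain k where k: "(?M - - ?M) / 2 ^ k < \<eta>"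
  proof -
    obtain k where "2 * ?M / \<eta> < 2 ^ k" using real_arch_pow[of 2 "2 * ?M / \<eta>"] by auto
    then show ?thesis using that[of k] \<eta> by (simp add: field_simps)
  qed
  obtain P lo where P: "finite P"
    "\<forall>p\<in>P. p \<odot> p = p \<and> p \<noteq> 0 \<and> f \<odot> p = p \<and> p \<odot> (p \<odot> a) = p \<odot> a \<and>
      lo p *\<^sub>R p \<sqsubseteq> p \<odot> a \<and> p \<odot> a \<sqsubseteq> (lo p + (?M - - ?M) / 2 ^ k) *\<^sub>R p"
    "\<forall>p\<in>P. \<forall>q\<in>P. p \<noteq> q \<longrightarrow> p \<odot> q = 0" "\<Sum>P = f"
    using spectral_bisection[OF f a b, of k] by (elim exE conjE) (rule that; assumption)
  have "p \<odot> a \<sqsubseteq> (lo p + \<eta>) *\<^sub>R p" if p: "p \<in> P" for p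
  proof -
    have "(lo p + (?M - - ?M) / 2 ^ k) *\<^sub>R p \<sqsubseteq> (lo p + \<eta>) *\<^sub>R p"
      using k P(2) p pos_idem by (intro le_scale_left) auto
    moreover have "p \<odot> a \<sqsubseteq> (lo p + (?M - - ?M) / 2 ^ k) *\<^sub>R p" using P(2) p by simp
    ultimately show ?thesis by (rule le_trans[rotated])
  qed
  then show ?thesis using P by (intro exI[of _ P] exI[of _ lo]) simp
qed

lemma norm_le_corner:
  assumes p: "p \<odot> p = p" and x: "- (M *\<^sub>R p) \<sqsubseteq> x" "x \<sqsubseteq> M *\<^sub>R p" and M: "M \<ge> 0"
  shows "norm x \<le> M"
proof -
  have "pos (\<one> - p)" using pos_idem[OF compl_idem[OF p]] .
  then have 1: "M *\<^sub>R p \<sqsubseteq> M *\<^sub>R \<one>" by (intro le_scale) (simp_all add: le_def M)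
  show ?thesis using norm_le_iff[OF M, of x] le_trans[OF x(2) 1] le_trans[OF le_neg[OF 1] x(1)] by blast
qed

lemma corner_norm_le:
  assumes p: "p \<odot> p = p" and x: "p \<odot> x = x" "norm x \<le> M"
  shows "- (M *\<^sub>R p) \<sqsubseteq> x" "x \<sqsubseteq> M *\<^sub>R p"
proof -
  have "M \<ge> 0" using x(2) norm_ge_zero order_trans by blast
  then have "- (M *\<^sub>R \<one>) \<sqsubseteq> x" "x \<sqsubseteq> M *\<^sub>R \<one>" using norm_le_iff[of M x] x by auto
  from U_le[OF p this(1)] U_le[OF p this(2)] show "- (M *\<^sub>R p) \<sqsubseteq> x" "x \<sqsubseteq> M *\<^sub>R p"
    by (simp_all add: U_lin U_one p U_of_E1[OF p x(1)])
qed

lemma corner_scalar_le: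
  assumes p: "p \<odot> p = p" "p \<noteq> 0" and le: "c *\<^sub>R p \<sqsubseteq> d *\<^sub>R p"
  shows "c \<le> d"
proof (rule ccontr)
  assume "\<not> c \<le> d"
  then have "pos ((1/(c - d)) *\<^sub>R (d *\<^sub>R p - c *\<^sub>R p))" using le by (intro pos_scale) (auto simp: le_def)
  moreover have "(1/(c - d)) *\<^sub>R (d *\<^sub>R p - c *\<^sub>R p) = - p"
  proof -
    have "(d - c) / (c - d) = -1" using \<open>\<not> c \<le> d\<close> by (simp add: field_simps)
    then show ?thesis by (simp add: scaleR_diff_left[symmetric])
  qed
  ultimately show False using pos_antisym[OF pos_idem[OF p(1)]] p(2) by simp
qed

text \<open>If all lower values of a spectral partition had modulus below
  \<open>norm a - \<eta>\<close>, summing over the partition would bound \<open>norm a\<close>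
  strictly below itself.\<close>

lemma approx_scalar:
  assumes f: "f \<odot> f = f" "f \<noteq> 0" and a: "f \<odot> a = a" and \<eta>: "\<eta> > 0"
  obtains p \<kappa> where "p \<odot> p = p" "p \<noteq> 0" "f \<odot> p = p" "p \<odot> (p \<odot> a) = p \<odot> a"
    "norm (p \<odot> a - \<kappa> *\<^sub>R p) \<le> \<eta>" "\<bar>\<kappa>\<bar> \<ge> norm a - \<eta>"
proof -
  obtain P lo where P0: "finite P" "\<forall>p\<in>P. p \<odot> p = p \<and> p \<noteq> 0 \<and> f \<odot> p = p \<and> p \<odot> (p \<odot> a) = p \<odot> a \<and>
      lo p *\<^sub>R p \<sqsubseteq> p \<odot> a \<and> p \<odot> a \<sqsubseteq> (lo p + \<eta>) *\<^sub>R p"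
      "\<forall>p\<in>P. \<forall>q\<in>P. p \<noteq> q \<longrightarrow> p \<odot> q = 0" "\<Sum>P = f"
    using spectral_approx[OF f(1) a \<eta>] by (elim exE conjE) (rule that; assumption)
  have P: "finite P" "\<And>p. p \<in> P \<Longrightarrow> p \<odot> p = p" "\<And>p. p \<in> P \<Longrightarrow> p \<noteq> 0"
    "\<And>p. p \<in> P \<Longrightarrow> f \<odot> p = p" "\<And>p. p \<in> P \<Longrightarrow> p \<odot> (p \<odot> a) = p \<odot> a"
    "\<And>p. p \<in> P \<Longrightarrow> lo p *\<^sub>R p \<sqsubseteq> p \<odot> a" "\<And>p. p \<in> P \<Longrightarrow> p \<odot> a \<sqsubseteq> (lo p + \<eta>) *\<^sub>R p"
    "\<And>p q. p \<in> P \<Longrightarrow> q \<in> P \<Longrightarrow> p \<noteq> q \<Longrightarrow> p \<odot> q = 0" "\<Sum>P = f"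
    using P0 by simp_all
  have bd: "norm (p \<odot> a - lo p *\<^sub>R p) \<le> \<eta>" if p: "p \<in> P" for p
  proof (rule norm_le_corner[OF P(2)[OF p]])
    show "p \<odot> a - lo p *\<^sub>R p \<sqsubseteq> \<eta> *\<^sub>R p" using P(7)[OF p] by (simp add: le_def scaleR_add_left algebra_simps)
    have "pos (\<eta> *\<^sub>R p)" using pos_scale[OF pos_idem[OF P(2)[OF p]]] \<eta> by simp
    then have "- (\<eta> *\<^sub>R p) \<sqsubseteq> 0" by (simp add: le_def)
    moreover have "0 \<sqsubseteq> p \<odot> a - lo p *\<^sub>R p" using P(6)[OF p] by (simp add: le_def)
    ultimately show "- (\<eta> *\<^sub>R p) \<sqsubseteq> p \<odot> a - lo p *\<^sub>R p" by (rule le_trans)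
  qed (use \<eta> in simp)
  have "\<exists>p\<in>P. \<bar>lo p\<bar> \<ge> norm a - \<eta>"
  proof (rule ccontr)
    assume "\<not> ?thesis"
    then have c: "\<And>p. p \<in> P \<Longrightarrow> \<bar>lo p\<bar> < norm a - \<eta>" by auto
    define M where "M = Max (insert 0 ((\<lambda>p. \<bar>lo p\<bar>) ` P))"
    have M: "M \<ge> 0" "\<And>p. p \<in> P \<Longrightarrow> \<bar>lo p\<bar> \<le> M" using P(1) by (auto simp: M_def)
    have "P \<noteq> {}" using P(9) f(2) by auto
    then obtain p0 where "p0 \<in> P" by blast
    then have "norm a - \<eta> > 0" using c[of p0] by linarith
    then have Mlt: "M < norm a - \<eta>" using c P(1) unfolding M_def by (subst Max_less_iff) auto
    have asum: "a = (\<Sum>p\<in>P. p \<odot> a)" using sum_left[of "\<lambda>x. x" P a] a P(9) by simp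
    have up: "a \<sqsubseteq> (M + \<eta>) *\<^sub>R f"
    proof -
      have "pos (\<Sum>p\<in>P. ((M + \<eta>) *\<^sub>R p - p \<odot> a))"
      proof (rule pos_sum)
        fix p assume p: "p \<in> P"
        have "(lo p + \<eta>) *\<^sub>R p \<sqsubseteq> (M + \<eta>) *\<^sub>R p" using M(2)[OF p] by (intro le_scale_left pos_idem P(2) p) auto
        then show "pos ((M + \<eta>) *\<^sub>R p - p \<odot> a)" using le_trans[OF P(7)[OF p]] unfolding le_def by blast
      qed
      then show ?thesis unfolding le_def sum_subtractf asum[symmetric] by (simp add: scaleR_sum_right[symmetric] P(9))
    qed
    have lw: "- ((M + \<eta>) *\<^sub>R f) \<sqsubseteq> a"
    proof -
      have "pos (\<Sum>p\<in>P. (p \<odot> a + (M + \<eta>) *\<^sub>R p))"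
      proof (rule pos_sum)
        fix p assume p: "p \<in> P"
        have "(- (M + \<eta>)) *\<^sub>R p \<sqsubseteq> lo p *\<^sub>R p" using M(2)[OF p] \<eta> by (intro le_scale_left pos_idem P(2) p) auto
        from le_trans[OF this P(6)[OF p]] show "pos (p \<odot> a + (M + \<eta>) *\<^sub>R p)"
          unfolding le_def by (simp only: scaleR_minus_left diff_minus_eq_add)
      qed
      then show ?thesis unfolding le_def sum.distrib asum[symmetric] by (simp add: scaleR_sum_right[symmetric] P(9))
    qed
    have "norm a \<le> M + \<eta>" using norm_le_corner[OF f(1) lw up] M \<eta> by simp
    then show False using Mlt by simp
  qed
  then obtain p where "p \<in> P" "\<bar>lo p\<bar> \<ge> norm a - \<eta>" by blast
  then show ?thesis using that[of p "lo p"] P bd by blast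
qed

lemma approx_simple:
  assumes f: "f \<odot> f = f" and a: "f \<odot> a = a" and \<eta>: "\<eta> > 0"
  obtains P c where "finite P" "\<And>p. p \<in> P \<Longrightarrow> p \<odot> p = p" "\<And>p. p \<in> P \<Longrightarrow> f \<odot> p = p"
    "\<And>p. p \<in> P \<Longrightarrow> p \<odot> (p \<odot> a) = p \<odot> a" "\<And>p q. p \<in> P \<Longrightarrow> q \<in> P \<Longrightarrow> p \<noteq> q \<Longrightarrow> p \<odot> q = 0"
    "norm (a - (\<Sum>p\<in>P. c p *\<^sub>R p)) \<le> \<eta>"
proof -
  obtain P lo where P0: "finite P" "\<forall>p\<in>P. p \<odot> p = p \<and> p \<noteq> 0 \<and> f \<odot> p = p \<and> p \<odot> (p \<odot> a) = p \<odot> a \<and>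
      lo p *\<^sub>R p \<sqsubseteq> p \<odot> a \<and> p \<odot> a \<sqsubseteq> (lo p + \<eta>) *\<^sub>R p"
      "\<forall>p\<in>P. \<forall>q\<in>P. p \<noteq> q \<longrightarrow> p \<odot> q = 0" "\<Sum>P = f"
    using spectral_approx[OF f a \<eta>] by (elim exE conjE) (rule that; assumption)
  have P: "finite P" "\<And>p. p \<in> P \<Longrightarrow> p \<odot> p = p" "\<And>p. p \<in> P \<Longrightarrow> p \<noteq> 0"
    "\<And>p. p \<in> P \<Longrightarrow> f \<odot> p = p" "\<And>p. p \<in> P \<Longrightarrow> p \<odot> (p \<odot> a) = p \<odot> a"
    "\<And>p. p \<in> P \<Longrightarrow> lo p *\<^sub>R p \<sqsubseteq> p \<odot> a" "\<And>p. p \<in> P \<Longrightarrow> p \<odot> a \<sqsubseteq> (lo p + \<eta>) *\<^sub>R p"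
    "\<And>p q. p \<in> P \<Longrightarrow> q \<in> P \<Longrightarrow> p \<noteq> q \<Longrightarrow> p \<odot> q = 0" "\<Sum>P = f"
    using P0 by simp_all
  have asum: "a = (\<Sum>p\<in>P. p \<odot> a)" using sum_left[of "\<lambda>x. x" P a] a P(9) by simp
  have e: "a - (\<Sum>p\<in>P. lo p *\<^sub>R p) = (\<Sum>p\<in>P. (p \<odot> a - lo p *\<^sub>R p))"
    unfolding sum_subtractf using asum by simp
  have 1: "pos (a - (\<Sum>p\<in>P. lo p *\<^sub>R p))"
    unfolding e by (rule pos_sum) (use P(6) in \<open>simp add: le_def\<close>)
  have "pos (\<Sum>p\<in>P. ((lo p + \<eta>) *\<^sub>R p - p \<odot> a))"
    by (rule pos_sum) (use P(7) in \<open>simp add: le_def\<close>)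
  moreover have "(\<Sum>p\<in>P. ((lo p + \<eta>) *\<^sub>R p - p \<odot> a)) = \<eta> *\<^sub>R f - (a - (\<Sum>p\<in>P. lo p *\<^sub>R p))"
    unfolding e sum_subtractf scaleR_add_left sum.distrib by (simp add: scaleR_sum_right[symmetric] P(9))
  ultimately have 2: "a - (\<Sum>p\<in>P. lo p *\<^sub>R p) \<sqsubseteq> \<eta> *\<^sub>R f" by (simp add: le_def)
  have "pos (\<eta> *\<^sub>R f)" using pos_scale[OF pos_idem[OF f]] \<eta> by simp
  then have "- (\<eta> *\<^sub>R f) \<sqsubseteq> 0" by (simp add: le_def)
  then have "- (\<eta> *\<^sub>R f) \<sqsubseteq> a - (\<Sum>p\<in>P. lo p *\<^sub>R p)" using 1 le_trans unfolding pos_le by blast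
  then have "norm (a - (\<Sum>p\<in>P. lo p *\<^sub>R p)) \<le> \<eta>" using norm_le_corner[OF f _ 2] \<eta> by simp
  then show ?thesis using that[of P lo] P by blast
qed

end

section \<open>Monotone completeness from the predual\<close>

text \<open>An order interval of length \<open>K\<close> is the ball of radius \<open>K / 2\<close>
  about its midpoint. The supremum is a common point of intervals that start at the terms and
  intervals that end at the upper bounds; finitely many of these all contain a late term.\<close>

lemma (in jbu) predual_imp_jbw:
  assumes V: "predual (V :: ('a \<Rightarrow>\<^sub>L real) set)"
  shows "jbw jm one"
proof
  fix a :: "nat \<Rightarrow> 'a" and u0 assume inc: "incr a" and u0: "\<And>n. a n \<sqsubseteq> u0"
  have ball: "x \<in> cball (c + (K/2) *\<^sub>R \<one>) (K/2) \<longleftrightarrow> c \<sqsubseteq> x \<and> x \<sqsubseteq> c + K *\<^sub>R \<one>" if K: "K \<ge> 0" for x c K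
  proof -
    have "x \<in> cball (c + (K/2) *\<^sub>R \<one>) (K/2) \<longleftrightarrow> norm (x - (c + (K/2) *\<^sub>R \<one>)) \<le> K/2"
      by (simp add: dist_norm norm_minus_commute)
    also have "\<dots> \<longleftrightarrow> - ((K/2) *\<^sub>R \<one>) \<sqsubseteq> x - (c + (K/2) *\<^sub>R \<one>) \<and> x - (c + (K/2) *\<^sub>R \<one>) \<sqsubseteq> (K/2) *\<^sub>R \<one>"
      by (rule norm_le_iff) (use K in simp)
    also have "\<dots> \<longleftrightarrow> c \<sqsubseteq> x \<and> x \<sqsubseteq> c + K *\<^sub>R \<one>"
    proof -
      have "x - (c + (K/2) *\<^sub>R \<one>) - - ((K/2) *\<^sub>R \<one>) = x - c" by simp
      moreover have "(K/2) *\<^sub>R \<one> - (x - (c + (K/2) *\<^sub>R \<one>)) = c + K *\<^sub>R \<one> - x"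
        by (rule vec_eqI) simp
      ultimately show ?thesis unfolding le_def by (simp only: simp_thms)
    qed
    finally show ?thesis .
  qed
  define Ub where "Ub = {u. \<forall>n. a n \<sqsubseteq> u}"
  define K where "K u = norm (u - a 0)" for u
  have K: "K u \<ge> 0" "u \<sqsubseteq> a 0 + K u *\<^sub>R \<one>" "u - K u *\<^sub>R \<one> \<sqsubseteq> a 0" for u
  proof -
    have "u - a 0 \<sqsubseteq> K u *\<^sub>R \<one>" unfolding K_def by (rule le_norm)
    then show "u \<sqsubseteq> a 0 + K u *\<^sub>R \<one>" "u - K u *\<^sub>R \<one> \<sqsubseteq> a 0" unfolding le_def by (simp_all add: algebra_simps)
  qed (simp add: K_def)
  \<comment> \<open>\<open>Inl n\<close> encodes that \<open>x\<close> dominates \<open>a n\<close>,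
    and \<open>Inr u\<close> that \<open>u\<close> dominates \<open>x\<close>. The other end of each
    interval is loose enough to keep all late terms.\<close>
  define c where "c i = (case i of Inl n \<Rightarrow> a n | Inr u \<Rightarrow> u - K u *\<^sub>R \<one>)" for i :: "nat + 'a"
  define M where "M i = (case i of Inl n \<Rightarrow> K u0 | Inr u \<Rightarrow> K u)" for i :: "nat + 'a"
  let ?I = "Inl ` UNIV \<union> Inr ` Ub :: (nat + 'a) set"
  have M: "M i \<ge> 0" for i using K(1) by (auto simp: M_def split: sum.splits)
  have aub: "a n \<sqsubseteq> u" "a 0 \<sqsubseteq> a n" if "u \<in> Ub" for u n using that incr_le[OF inc, of 0 n] by (auto simp: Ub_def)
  have "\<exists>x. \<forall>i\<in>?I. x \<in> cball (c i + (M i / 2) *\<^sub>R \<one>) (M i / 2)"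
  proof (rule cball_fip[OF V, of _ _ _ "Inl 0"])
    fix J assume J: "finite J" "J \<subseteq> ?I"
    define N where "N = {n. Inl n \<in> J}"
    have "finite N" unfolding N_def using J(1) by (intro finite_vimageI[of J Inl, unfolded vimage_def]) auto
    then obtain m where m: "\<And>n. n \<in> N \<Longrightarrow> n \<le> m"
      unfolding finite_nat_set_iff_bounded_le by auto
    show "\<exists>x. \<forall>i\<in>J. x \<in> cball (c i + (M i / 2) *\<^sub>R \<one>) (M i / 2)"
    proof (intro exI[of _ "a m"] ballI)
      fix i assume i: "i \<in> J"
      have "c i \<sqsubseteq> a m \<and> a m \<sqsubseteq> c i + M i *\<^sub>R \<one>"
      proof (cases i)
        case (Inl n)
        then have n: "n \<le> m" using i m by (simp add: N_def)
        have "u0 \<in> Ub" using u0 by (simp add: Ub_def)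
        have "a m \<sqsubseteq> u0" using u0 .
        also have "u0 \<sqsubseteq> a 0 + K u0 *\<^sub>R \<one>" by (rule K)
        also have "a 0 + K u0 *\<^sub>R \<one> \<sqsubseteq> a n + K u0 *\<^sub>R \<one>" using incr_le[OF inc, of 0 n] by (intro le_add) auto
        finally show ?thesis using incr_le[OF inc n] by (simp add: Inl c_def M_def)
      next
        case (Inr u)
        then have u: "u \<in> Ub" using i J(2) by auto
        have "u - K u *\<^sub>R \<one> \<sqsubseteq> a m" using le_trans[OF K(3) aub(2)[OF u]] .
        then show ?thesis using aub(1)[OF u] by (simp add: Inr c_def M_def)
      qed
      then show "a m \<in> cball (c i + (M i / 2) *\<^sub>R \<one>) (M i / 2)" using ball[OF M] by blast
    qed
  qed simp
  then obtain e where e: "\<And>i. i \<in> ?I \<Longrightarrow> c i \<sqsubseteq> e \<and> e \<sqsubseteq> c i + M i *\<^sub>R \<one>" using ball[OF M] by blast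
  have "is_sup a e"
    unfolding is_sup_def
  proof (intro conjI allI impI)
    fix n show "a n \<sqsubseteq> e" using e[of "Inl n"] by (simp add: c_def)
  next
    fix u assume "\<forall>n. a n \<sqsubseteq> u"
    then have "Inr u \<in> ?I" by (simp add: Ub_def)
    then show "e \<sqsubseteq> u" using e[of "Inr u"] by (simp add: c_def M_def)
  qed
  then show "\<exists>e. is_sup a e" by blast
qed

lemma JBW_imp_jbw:
  fixes jm :: "'a::banach \<Rightarrow> 'a \<Rightarrow> 'a"
  assumes "JBW_algebra jm"
  obtains e where "jbw jm e"
proof -
  from assms obtain V :: "('a \<Rightarrow>\<^sub>L real) set" where V: "predual V" and J: "JB_algebra jm"
    unfolding JBW_algebra_def by auto
  interpret jb jm using J by unfold_locales
  obtain e where e: "\<And>a. jm e a = a" using predual_imp_unit[OF V] by blast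
  interpret jbu jm e using e by unfold_locales
  show ?thesis using that predual_imp_jbw[OF V] by blast
qed

section \<open>Exchanging idempotents\<close>

context jbu
begin

text \<open>The diagonal and the off-diagonal block of the equation \<open>q \<odot> q = q\<close>,
  with \<open>q\<close> seen as a two by two block matrix along \<open>p\<close>.\<close>

lemma idem_parts:
  assumes p: "p \<odot> p = p" and q: "q \<odot> q = q"
  shows "p \<odot> (H p q \<odot> H p q) = U p q - U p q \<odot> U p q"
    and "U p q \<odot> H p q + Z p q \<odot> H p q = (1/2) *\<^sub>R H p q"
proof -
  define h z k where "h = U p q" and "z = H p q" and "k = Z p q"
  have qq: "q = h + z + k" using peirce_split h_def z_def k_def by metis
  have e: "p \<odot> h = h" "p \<odot> z = (1/2) *\<^sub>R z" "p \<odot> k = 0"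
    by (simp_all add: h_def z_def k_def U_E1 H_Eh Z_E0 p)
  have m: "p \<odot> (h \<odot> h) = h \<odot> h" "p \<odot> (h \<odot> z) = (1/2) *\<^sub>R (h \<odot> z)"
    "p \<odot> (k \<odot> z) = (1/2) *\<^sub>R (k \<odot> z)" "h \<odot> k = 0" "p \<odot> (k \<odot> k) = 0"
    "p \<odot> (p \<odot> (z \<odot> z)) = p \<odot> (z \<odot> z)"
    using e by (simp_all add: E1_E1[OF p] E1_Eh[OF p] E0_Eh[OF p] E1_E0[OF p] E0_E0[OF p] Eh_Eh[OF p])
  have q2: "q \<odot> q = h \<odot> h + z \<odot> z + k \<odot> k + 2 *\<^sub>R (h \<odot> z) + 2 *\<^sub>R (k \<odot> z)"
    unfolding qq using m(4) by (simp add: bil comm[of z h] comm[of z k] comm[of k h] scaleR_2)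
  have "U p (q \<odot> q) = h \<odot> h + p \<odot> (z \<odot> z)"
    unfolding q2 using p m by (simp add: U_lin U_of_E1 U_of_Eh U_of_E0 U_even)
  then have "h = h \<odot> h + p \<odot> (z \<odot> z)" using q by (simp only: h_def)
  then show "p \<odot> (H p q \<odot> H p q) = U p q - U p q \<odot> U p q"
    unfolding h_def z_def by (metis add_diff_cancel_left')
  have "H p (q \<odot> q) = 2 *\<^sub>R (h \<odot> z) + 2 *\<^sub>R (k \<odot> z)"
    unfolding q2 using p m by (simp add: H_lin H_of_E1 H_of_Eh H_of_E0 H_even)
  then have "z = 2 *\<^sub>R (h \<odot> z) + 2 *\<^sub>R (k \<odot> z)" using q by (simp only: z_def)
  then have "h \<odot> z + k \<odot> z = (1/2) *\<^sub>R z" by (rule vec_lin1) simp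
  then show "U p q \<odot> H p q + Z p q \<odot> H p q = (1/2) *\<^sub>R H p q"
    unfolding h_def z_def k_def .
qed

lemma orth_of_U:
  assumes p: "p \<odot> p = p" and q: "q \<odot> q = q" and u: "U p q = 0"
  shows "p \<odot> q = 0"
proof -
  have "p \<odot> (H p q \<odot> H p q) = 0" using idem_parts(1)[OF p q] u by (simp add: bil)
  then have "H p q = 0" using Eh_zero[OF p H_Eh[OF p]] by blast
  then have "q = Z p q" using peirce_split[of q p] u by simp
  then show ?thesis using Z_E0[OF p] by metis
qed

lemma E1_mult_even:
  assumes p: "p \<odot> p = p" and a: "p \<odot> a = a" and x: "p \<odot> (p \<odot> x) = p \<odot> x"
  shows "a \<odot> x = a \<odot> (p \<odot> x)"
  using E1_E0[OF p a even_split[OF p x]] by (simp add: bil)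

lemma E1_trans:
  assumes "r \<odot> r = r" "e \<odot> r = r" "r \<odot> g = g"
  shows "e \<odot> g = g"
proof -
  have "r \<odot> (e - r) = 0" using assms by (simp add: bil comm[of r e])
  then have "g \<odot> (e - r) = 0" using E1_E0[OF assms(1,3)] by blast
  then show ?thesis using assms(3) by (simp add: bil comm[of g])
qed

lemma U_sub:
  assumes r: "r \<odot> r = r" and s: "s \<odot> s = s" "r \<odot> s = s"
  shows "U s (U r x) = U s x"
proof -
  have "U s (H r x) = 0"
    using E1_special[OF r s(2) s(2) H_Eh[OF r], of x] s(1) by (simp add: U_idem[OF s(1)] scaleR_2)
  moreover have "U s (Z r x) = 0"
    using E1_E0[OF r s(2) Z_E0[OF r]] by (simp add: U_idem[OF s(1)] bil)
  moreover have "U s x = U s (U r x) + U s (H r x) + U s (Z r x)"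
    using peirce_split[of x r] by (metis U_lin(1))
  ultimately show ?thesis by simp
qed

text \<open>The right side is a quarter of \<open>U g\<close> applied to the corner of
  \<open>z \<odot> z\<close>. In the block picture, where \<open>z\<close> consists of a block
  \<open>b\<close> and its adjoint, \<open>g \<odot> z\<close> has the block
  \<open>g b / 2\<close>.\<close>

lemma corner_sq:
  assumes r: "r \<odot> r = r" and z: "r \<odot> z = (1/2) *\<^sub>R z" and g: "r \<odot> g = g"
  shows "r \<odot> ((g \<odot> z) \<odot> (g \<odot> z)) = (1/2) *\<^sub>R (g \<odot> (g \<odot> (r \<odot> (z \<odot> z)))) - (1/4) *\<^sub>R ((g \<odot> g) \<odot> (r \<odot> (z \<odot> z)))"
proof -
  let ?u = "r \<odot> (z \<odot> z)"
  have half: "r \<odot> ((a \<odot> z) \<odot> z) = (1/2) *\<^sub>R (a \<odot> ?u)" if a: "r \<odot> a = a" for a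
  proof -
    have "a \<odot> (z \<odot> z) = a \<odot> ?u" by (rule E1_mult_even[OF r a Eh_Eh[OF r z z]])
    then have "r \<odot> ((a \<odot> z) \<odot> z) + r \<odot> ((a \<odot> z) \<odot> z) = a \<odot> ?u"
      using Eh_derivation[OF r a z z] comm[of z "a \<odot> z"] by simp
    then show ?thesis by (rule vec_lin1) simp
  qed
  have gz: "r \<odot> (g \<odot> z) = (1/2) *\<^sub>R (g \<odot> z)" by (rule E1_Eh[OF r g z])
  have ggz: "g \<odot> (g \<odot> z) = (1/2) *\<^sub>R ((g \<odot> g) \<odot> z)" using E1_special[OF r g g z] by (simp add: scaleR_2)
  have 1: "g \<odot> ((g \<odot> z) \<odot> z) = (1/2) *\<^sub>R (g \<odot> (g \<odot> ?u))"
    using E1_mult_even[OF r g Eh_Eh[OF r gz z]] half[OF g] by (simp add: bil)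
  have 2: "r \<odot> ((g \<odot> (g \<odot> z)) \<odot> z) = (1/4) *\<^sub>R ((g \<odot> g) \<odot> ?u)"
    unfolding ggz using half[OF E1_E1[OF r g g]] by (simp add: bil)
  show ?thesis
    by (rule vec_lin1[OF Eh_derivation[OF r g gz z]]) (simp add: 1 2)
qed

text \<open>Polar decomposition, with \<open>g\<close> the inverse square root of the corner
  \<open>r \<odot> (z \<odot> z)\<close>. The factor 2 makes up for the 1/2 by which the Jordan
  product with \<open>g\<close> differs from the block product.\<close>

lemma normalise:
  assumes r: "r \<odot> r = r" and z: "r \<odot> z = (1/2) *\<^sub>R z" and S: "loc_unit r S" and u: "r \<odot> (z \<odot> z) \<in> S"
    and \<delta>: "\<delta> > 0" "\<delta> *\<^sub>R r \<sqsubseteq> r \<odot> (z \<odot> z)"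
  obtains g g' where "g \<in> S" "g' \<in> S" "g \<odot> g' = r" "r \<odot> (2 *\<^sub>R (g \<odot> z)) = (1/2) *\<^sub>R (2 *\<^sub>R (g \<odot> z))"
    "r \<odot> ((2 *\<^sub>R (g \<odot> z)) \<odot> (2 *\<^sub>R (g \<odot> z))) = r"
proof -
  note D = loc_unitD[OF S]
  let ?u = "r \<odot> (z \<odot> z)"
  obtain k where k: "k \<in> S" "?u \<odot> k = r" "pos k" using loc_inverse[OF S u \<delta>] by metis
  obtain g where g: "g \<in> S" "g \<odot> g = k" using loc_pos_sqrt[OF S k(1,3)] by metis
  have rg: "r \<odot> g = g" using D(3)[OF g(1)] .
  have ggu: "g \<odot> (g \<odot> ?u) = r" using oca_assoc[OF D(1) g(1) g(1) u] g(2) k(2) by (simp add: comm[of ?u])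
  have gg: "(g \<odot> g) \<odot> ?u = r" using g(2) k(2) by (simp add: comm[of ?u])
  have "r \<odot> ((g \<odot> z) \<odot> (g \<odot> z)) = (1/4) *\<^sub>R r"
    unfolding corner_sq[OF r z rg] ggu gg by (rule vec_eqI) simp
  then have "r \<odot> ((2 *\<^sub>R (g \<odot> z)) \<odot> (2 *\<^sub>R (g \<odot> z))) = r" by (simp add: bil)
  moreover have "r \<odot> (2 *\<^sub>R (g \<odot> z)) = (1/2) *\<^sub>R (2 *\<^sub>R (g \<odot> z))" using E1_Eh[OF r rg z] by (simp add: bil)
  moreover have "g \<odot> ?u \<in> S" using oca_mult[OF D(1)] g u by blast
  ultimately show ?thesis using that[OF g(1) _ ggu] by blast
qed

end

text \<open>With \<open>y = v \<odot> v - r\<close>, the reflection in the symmetry \<open>v + (\<one> - r - y)\<close> swaps \<open>r\<close> and the idempotent \<open>y\<close>.\<close>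

locale exchange = jbu jm one for jm :: "'a::banach \<Rightarrow> 'a \<Rightarrow> 'a" (infixl "\<odot>" 70) and one :: 'a ("\<one>") +
  fixes r v :: 'a
  assumes r: "r \<odot> r = r" and v: "r \<odot> v = (1/2) *\<^sub>R v" and vv: "r \<odot> (v \<odot> v) = r"
begin

definition e where "e = v \<odot> v"
definition y where "y = e - r"
text \<open>\<open>\<one> - 2 q\<close> is the symmetry \<open>v + (\<one> - e)\<close>, so \<sigma>
  is conjugation by it.\<close>

definition q where "q = (1/2) *\<^sub>R (\<one> - (v + (\<one> - e)))"

abbreviation \<sigma> :: "'a \<Rightarrow> 'a" where "\<sigma> \<equiv> refl q"

lemma re: "r \<odot> e = r" "e \<odot> r = r" using vv by (simp_all add: e_def comm[of "v \<odot> v"])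

lemma ve: "v \<odot> e = v" "e \<odot> v = v"
proof -
  have "v \<odot> r = (1/2) *\<^sub>R e \<odot> v" using Eh_cube[OF r v] vv by (simp add: e_def bil comm[of "v \<odot> v" v])
  then show "v \<odot> e = v" unfolding comm[of v r] comm[of v e] v
    by (rule vec_lin1) (simp add: bil)
  then show "e \<odot> v = v" by (simp add: comm)
qed

lemma ee: "e \<odot> e = e"
  using pw_mult[of v 1 1] ve by (simp add: e_def numeral_2_eq_2 numeral_3_eq_3)

lemma ry: "r \<odot> y = 0" "y \<odot> r = 0" by (simp_all add: y_def bil re r)
lemma yy: "y \<odot> y = y" by (simp add: y_def bil re r ee)
lemma ey: "e \<odot> y = y" "y \<odot> e = y" by (simp_all add: y_def bil re ee)
lemma yv: "y \<odot> v = (1/2) *\<^sub>R v"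
  unfolding y_def diff_left ve v by (rule vec_eqI) simp
lemma e_ry: "e = r + y" by (simp add: y_def)

lemma vc: "v \<odot> (\<one> - e) = 0" "(\<one> - e) \<odot> v = 0" by (simp_all add: bil unit unit_right ve)

lemma ss: "(v + (\<one> - e)) \<odot> (v + (\<one> - e)) = \<one>"
  using compl_idem[OF ee] vc by (simp add: add_left add_right e_def)

lemma qq: "q \<odot> q = q"
proof -
  have "q \<odot> q = (1/4) *\<^sub>R (\<one> - 2 *\<^sub>R (v + (\<one> - e)) + (v + (\<one> - e)) \<odot> (v + (\<one> - e)))"
    unfolding q_def by (rule vec_eqI) (simp add: bil unit unit_right; simp add: field_simps)
  then show ?thesis unfolding ss q_def by (rule vec_lin1) (simp; simp add: field_simps)
qed

lemma \<sigma>_eq: "\<sigma> x = 2 *\<^sub>R ((v + (\<one> - e)) \<odot> ((v + (\<one> - e)) \<odot> x)) - x"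
  unfolding refl_def H_def q_def by (rule vec_eqI) (simp add: bil unit unit_right; simp add: field_simps)

lemma \<sigma>_mult: "\<sigma> (x \<odot> z) = \<sigma> x \<odot> \<sigma> z" by (rule refl_mult[OF qq])
lemma \<sigma>_\<sigma>: "\<sigma> (\<sigma> x) = x" by (rule refl_refl[OF qq])
lemma \<sigma>_scale: "\<sigma> (c *\<^sub>R x) = c *\<^sub>R \<sigma> x" by (rule refl_lin)
lemma \<sigma>_inj: "\<sigma> x = \<sigma> z \<Longrightarrow> x = z" using \<sigma>_\<sigma> by metis

lemma Er_Ee: "r \<odot> \<beta> = \<beta> \<Longrightarrow> e \<odot> \<beta> = \<beta>" by (rule E1_trans[OF r re(2)])

lemma \<sigma>_r: "\<sigma> r = y"
proof -
  have 1: "(v + (\<one> - e)) \<odot> r = (1/2) *\<^sub>R v" by (simp add: bil unit re v comm[of v r])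
  have "(v + (\<one> - e)) \<odot> ((1/2) *\<^sub>R v) = (1/2) *\<^sub>R e" using vc by (simp add: add_left scaleR_right e_def)
  then show ?thesis unfolding \<sigma>_eq 1 by (simp add: y_def)
qed

lemma \<sigma>_y: "\<sigma> y = r" using \<sigma>_r \<sigma>_\<sigma> by metis

lemma \<sigma>_e: "\<sigma> e = e" unfolding e_ry refl_lin \<sigma>_r \<sigma>_y by (rule add.commute)

lemma \<sigma>_E0: "e \<odot> x = 0 \<Longrightarrow> \<sigma> x = x"
proof -
  assume x: "e \<odot> x = 0"
  have "v \<odot> x = 0" using E1_E0[OF ee ve(2) x] .
  then have "(v + (\<one> - e)) \<odot> x = x" by (simp add: bil unit x)
  then show ?thesis by (simp add: \<sigma>_eq scaleR_2)
qed

lemma vv_Eh: "e \<odot> x = (1/2) *\<^sub>R x \<Longrightarrow> v \<odot> (v \<odot> x) = (1/4) *\<^sub>R x"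
proof -
  assume x: "e \<odot> x = (1/2) *\<^sub>R x"
  then have "(1/2) *\<^sub>R x = v \<odot> (v \<odot> x) + v \<odot> (v \<odot> x)"
    using E1_special[OF ee ve(2) ve(2) x] unfolding e_def by simp
  then show ?thesis by (rule vec_lin1) simp
qed

lemma \<sigma>_Eh: "e \<odot> x = (1/2) *\<^sub>R x \<Longrightarrow> \<sigma> x = 2 *\<^sub>R (v \<odot> x)"
proof -
  assume x: "e \<odot> x = (1/2) *\<^sub>R x"
  have vx: "e \<odot> (v \<odot> x) = (1/2) *\<^sub>R (v \<odot> x)" by (rule E1_Eh[OF ee ve(2) x])
  show ?thesis unfolding \<sigma>_eq
    by (rule vec_eqI) (simp add: bil unit x vx vv_Eh[OF x]; simp add: field_simps)
qed

text \<open>In the matrix picture \<alpha> is placed off the diagonal: \<open>v\<close> is the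
  off-diagonal unit, and the factor 2 gives \<open>\<rho> r = v\<close>.\<close>

definition \<rho> where "\<rho> \<alpha> = 2 *\<^sub>R (\<alpha> \<odot> v)"

lemma \<rho>_lin: "\<rho> (a + b) = \<rho> a + \<rho> b" "\<rho> (a - b) = \<rho> a - \<rho> b" "\<rho> (c *\<^sub>R a) = c *\<^sub>R \<rho> a"
  by (auto simp: \<rho>_def bil algebra_simps)

context
  fixes \<beta> assumes \<beta>: "r \<odot> \<beta> = \<beta>"
begin

lemma \<rho>_Eh: "r \<odot> \<rho> \<beta> = (1/2) *\<^sub>R \<rho> \<beta>"
  unfolding \<rho>_def using E1_Eh[OF r \<beta> v] by (simp add: bil)

lemma \<rho>_e: "e \<odot> \<rho> \<beta> = \<rho> \<beta>"
  unfolding \<rho>_def using E1_E1[OF ee Er_Ee[OF \<beta>] ve(2)] by (simp add: bil)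

lemma r_v\<rho>: "r \<odot> (v \<odot> \<rho> \<beta>) = \<beta>"
proof -
  have "\<beta> \<odot> (v \<odot> v) = \<beta>" using E1_mult_even[OF r \<beta>, of e] re r \<beta> by (simp add: e_def comm[of \<beta> r])
  then have "r \<odot> ((\<beta> \<odot> v) \<odot> v) + r \<odot> ((\<beta> \<odot> v) \<odot> v) = \<beta>"
    using Eh_derivation[OF r \<beta> v v] comm[of v "\<beta> \<odot> v"] by simp
  then show ?thesis unfolding \<rho>_def by (rule vec_lin1) (simp add: bil comm[of v "\<beta> \<odot> v"])
qed

lemma \<sigma>_E1: "\<sigma> \<beta> = v \<odot> \<rho> \<beta> - \<beta>"
proof -
  have 1: "(v + (\<one> - e)) \<odot> \<beta> = (1/2) *\<^sub>R \<rho> \<beta>"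
    by (simp add: bil unit Er_Ee[OF \<beta>] \<rho>_def comm[of v \<beta>])
  have 2: "(v + (\<one> - e)) \<odot> \<rho> \<beta> = v \<odot> \<rho> \<beta>" by (simp add: bil unit \<rho>_e)
  show ?thesis unfolding \<sigma>_eq 1 by (simp add: scaleR_right 2)
qed

lemma r_\<sigma>: "r \<odot> \<sigma> \<beta> = 0" unfolding \<sigma>_E1 by (simp add: bil r_v\<rho> \<beta>)

text \<open>Rests on \<open>v \<odot> (v \<odot> \<rho> \<beta>) = \<rho> \<beta>\<close>, which is
  the polarised cube relation \<open>Eh_cube_lin\<close> at \<open>v\<close>.\<close>

lemma \<sigma>_\<rho>: "\<sigma> (\<rho> \<beta>) = \<rho> \<beta>"
proof -
  have v\<beta>: "v \<odot> \<beta> = (1/2) *\<^sub>R \<rho> \<beta>" by (simp add: \<rho>_def comm[of v \<beta>])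
  have c: "\<rho> \<beta> \<odot> r + 2 *\<^sub>R (v \<odot> \<beta>) = (1/2) *\<^sub>R (\<rho> \<beta> \<odot> e) + v \<odot> (v \<odot> \<rho> \<beta>)"
    using Eh_cube_lin[OF r v \<rho>_Eh] by (simp add: vv r_v\<rho> e_def)
  have vv\<rho>: "v \<odot> (v \<odot> \<rho> \<beta>) = \<rho> \<beta>"
    by (rule vec_lin1[OF c]) (simp add: comm[of "\<rho> \<beta>"] \<rho>_Eh \<rho>_e v\<beta>)
  have 2: "(v + (\<one> - e)) \<odot> \<rho> \<beta> = v \<odot> \<rho> \<beta>" by (simp add: bil unit \<rho>_e)
  have 3: "(\<one> - e) \<odot> (v \<odot> \<rho> \<beta>) = 0" using E1_E1[OF ee ve(2) \<rho>_e] by (simp add: bil unit)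
  have "(v + (\<one> - e)) \<odot> (v \<odot> \<rho> \<beta>) = \<rho> \<beta>" unfolding add_left 3 vv\<rho> by simp
  then show ?thesis unfolding \<sigma>_eq 2 by (simp add: scaleR_2)
qed

end

lemma e_\<sigma>: "e \<odot> x = x \<Longrightarrow> e \<odot> \<sigma> x = \<sigma> x"
  using \<sigma>_mult[of e x] \<sigma>_e by simp

context
  fixes S assumes S: "loc_unit r S"
begin

lemma tab1: "\<alpha> \<in> S \<Longrightarrow> \<beta> \<in> S \<Longrightarrow> \<alpha> \<odot> \<rho> \<beta> = (1/2) *\<^sub>R \<rho> (\<alpha> \<odot> \<beta>)"
proof -
  assume s: "\<alpha> \<in> S" "\<beta> \<in> S"
  note D = loc_unitD[OF S]
  have "(\<alpha> \<odot> \<beta>) \<odot> v = \<alpha> \<odot> (\<beta> \<odot> v) + \<beta> \<odot> (\<alpha> \<odot> v)" using E1_special[OF r D(3)[OF s(1)] D(3)[OF s(2)] v] .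
  then show ?thesis unfolding \<rho>_def oca_lcomm[OF D(1) s(2,1)] by (simp add: bil scaleR_2)
qed

text \<open>The corner of the product under \<open>r\<close> comes from the derivation rule; the
  corner under \<open>y\<close> is its image under \<sigma>, because \<sigma> fixes both
  factors.\<close>

lemma tab2: "\<alpha> \<in> S \<Longrightarrow> \<beta> \<in> S \<Longrightarrow> \<rho> \<alpha> \<odot> \<rho> \<beta> = \<alpha> \<odot> \<beta> + \<sigma> (\<alpha> \<odot> \<beta>)"
proof -
  assume s: "\<alpha> \<in> S" "\<beta> \<in> S"
  note D = loc_unitD[OF S]
  have ra: "r \<odot> \<alpha> = \<alpha>" "r \<odot> \<beta> = \<beta>" "r \<odot> (\<alpha> \<odot> \<beta>) = \<alpha> \<odot> \<beta>" using D s by (auto simp: oca_mult)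
  let ?W = "\<rho> \<alpha> \<odot> \<rho> \<beta>"
  have \<beta>v: "\<rho> \<beta> \<odot> v = \<beta> + \<sigma> \<beta>" unfolding \<sigma>_E1[OF ra(2)] by (simp add: comm)
  have a\<sigma>: "\<alpha> \<odot> \<sigma> \<beta> = 0" using E1_E0[OF r ra(1) r_\<sigma>[OF ra(2)]] .
  have d: "r \<odot> (\<rho> \<beta> \<odot> (\<alpha> \<odot> v)) + r \<odot> ((\<alpha> \<odot> \<rho> \<beta>) \<odot> v) = \<alpha> \<odot> \<beta>"
    using Eh_derivation[OF r ra(1) \<rho>_Eh[OF ra(2)] v] unfolding \<beta>v add_right a\<sigma> by simp
  have t: "r \<odot> ((\<alpha> \<odot> \<rho> \<beta>) \<odot> v) = (1/2) *\<^sub>R (\<alpha> \<odot> \<beta>)"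
    unfolding tab1[OF s] using r_v\<rho>[OF ra(3)] by (simp add: bil comm[of _ v])
  have "?W = 2 *\<^sub>R (\<rho> \<beta> \<odot> (\<alpha> \<odot> v))" by (simp add: \<rho>_def[of \<alpha>] bil comm[of "\<alpha> \<odot> v"])
  then have rW: "r \<odot> ?W = \<alpha> \<odot> \<beta>"
    by (simp only: scaleR_right) (rule vec_lin2[OF d t], simp)
  have "\<sigma> ?W = ?W" unfolding \<sigma>_mult \<sigma>_\<rho>[OF ra(1)] \<sigma>_\<rho>[OF ra(2)] ..
  then have "y \<odot> ?W = \<sigma> (\<alpha> \<odot> \<beta>)" using \<sigma>_mult[of r ?W] rW \<sigma>_r by simp
  moreover have "e \<odot> ?W = ?W" by (rule E1_E1[OF ee \<rho>_e[OF ra(1)] \<rho>_e[OF ra(2)]])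
  ultimately show ?thesis using rW unfolding e_ry add_left by simp
qed

lemma tab3: "\<alpha> \<in> S \<Longrightarrow> \<beta> \<in> S \<Longrightarrow> \<sigma> \<alpha> \<odot> \<rho> \<beta> = (1/2) *\<^sub>R \<rho> (\<alpha> \<odot> \<beta>)"
proof -
  assume s: "\<alpha> \<in> S" "\<beta> \<in> S"
  note D = loc_unitD[OF S]
  have ra: "r \<odot> \<beta> = \<beta>" "r \<odot> (\<alpha> \<odot> \<beta>) = \<alpha> \<odot> \<beta>" using D s by (auto simp: oca_mult)
  have "\<sigma> \<alpha> \<odot> \<rho> \<beta> = \<sigma> (\<alpha> \<odot> \<rho> \<beta>)" unfolding \<sigma>_mult \<sigma>_\<rho>[OF ra(1)] ..
  then show ?thesis unfolding tab1[OF s] \<sigma>_scale \<sigma>_\<rho>[OF ra(2)] .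
qed

lemma tab4: "\<alpha> \<in> S \<Longrightarrow> \<beta> \<in> S \<Longrightarrow> \<alpha> \<odot> \<sigma> \<beta> = 0"
  using E1_E0[OF r loc_unitD(3)[OF S] r_\<sigma>[OF loc_unitD(3)[OF S]]] .

end

text \<open>\<open>mat A \<alpha> B\<close> stands for the symmetric matrix with rows \<open>(A, \<alpha>)\<close> and \<open>(\<alpha>, B)\<close>.\<close>

definition mat where "mat A \<alpha> B = A + \<rho> \<alpha> + \<sigma> B"

lemma mat_mult:
  assumes S: "loc_unit r S" and s: "A \<in> S" "\<alpha> \<in> S" "B \<in> S" "A' \<in> S" "\<alpha>' \<in> S" "B' \<in> S"
  shows "mat A \<alpha> B \<odot> mat A' \<alpha>' B' = mat (A \<odot> A' + \<alpha> \<odot> \<alpha>')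
    ((1/2) *\<^sub>R (A \<odot> \<alpha>' + A' \<odot> \<alpha> + B \<odot> \<alpha>' + B' \<odot> \<alpha>)) (B \<odot> B' + \<alpha> \<odot> \<alpha>')"
proof -
  note t = tab1[OF S] tab2[OF S] tab3[OF S] tab4[OF S]
  have c: "\<rho> \<alpha> \<odot> A' = A' \<odot> \<rho> \<alpha>" "\<rho> \<alpha> \<odot> \<sigma> B' = \<sigma> B' \<odot> \<rho> \<alpha>" "\<sigma> B \<odot> A' = A' \<odot> \<sigma> B" by (rule comm)+
  have 1: "A \<odot> \<rho> \<alpha>' = (1/2) *\<^sub>R \<rho> (A \<odot> \<alpha>')" "A' \<odot> \<rho> \<alpha> = (1/2) *\<^sub>R \<rho> (A' \<odot> \<alpha>)"
    "\<sigma> B \<odot> \<rho> \<alpha>' = (1/2) *\<^sub>R \<rho> (B \<odot> \<alpha>')" "\<sigma> B' \<odot> \<rho> \<alpha> = (1/2) *\<^sub>R \<rho> (B' \<odot> \<alpha>)"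
    "A \<odot> \<sigma> B' = 0" "A' \<odot> \<sigma> B = 0" "\<rho> \<alpha> \<odot> \<rho> \<alpha>' = \<alpha> \<odot> \<alpha>' + \<sigma> (\<alpha> \<odot> \<alpha>')"
    "\<sigma> B \<odot> \<sigma> B' = \<sigma> (B \<odot> B')"
    using t s \<sigma>_mult by simp_all
  show ?thesis unfolding mat_def add_left add_right c 1 \<rho>_lin refl_lin
    by (rule vec_eqI) simp
qed

end

section \<open>Room for a third idempotent\<close>

context jbw
begin

lemma half_idem:
  assumes "e \<odot> e = e" "s \<odot> s = s" "e \<odot> s = s" "e \<odot> b = (1/2) *\<^sub>R b"
  shows "s \<odot> (s \<odot> b) = (1/2) *\<^sub>R (s \<odot> b)"
proof -
  have "s \<odot> b = s \<odot> (s \<odot> b) + s \<odot> (s \<odot> b)" using E1_special[OF assms(1,3,3,4)] assms(2) by simp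
  then show ?thesis by (rule vec_lin1) simp
qed

text \<open>For \<open>c = U r p\<close> the half component of \<open>p\<close> has squared corner
  \<open>c - c \<odot> c\<close>, which is at least \<open>\<delta> (1 - \<delta>)\<close> times
  \<open>r\<close>. So it can be normalised, and it then swaps \<open>r\<close> with the idempotent
  that \<open>p\<close> links to it.\<close>

lemma frame:
  assumes r: "r \<odot> r = r" "r \<noteq> 0" and p: "p \<odot> p = p"
    and \<delta>: "\<delta> > 0" "\<delta> *\<^sub>R r \<sqsubseteq> U r p" "U r p \<sqsubseteq> (1 - \<delta>) *\<^sub>R r"
  obtains g g' where "g \<in> gen r (U r p)" "g' \<in> gen r (U r p)" "g \<odot> g' = r"
    "exchange jm one r (2 *\<^sub>R (g \<odot> H r p))"
proof -
  let ?c = "U r p" and ?z = "H r p" and ?S = "gen r (U r p)"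
  have S: "loc_unit r ?S" by (rule loc_unit_gen[OF r(1) U_E1[OF r(1)]])
  note D = loc_unitD[OF S] and li = oca_lin[OF loc_unitD(1)[OF S]] and mu = oca_mult[OF loc_unitD(1)[OF S]]
  have c: "?c \<in> ?S" by (rule gen_self)
  have d1: "\<delta> \<le> 1 - \<delta>" using corner_scalar_le[OF r le_trans[OF \<delta>(2,3)]] .
  have u: "r \<odot> (?z \<odot> ?z) = ?c - ?c \<odot> ?c" using idem_parts(1)[OF r(1) p] .
  have "pos ((?c - \<delta> *\<^sub>R r) \<odot> ((1 - \<delta>) *\<^sub>R r - ?c))"
    by (rule loc_pos_mult[OF S]) (use c D \<delta> in \<open>auto simp: li le_def\<close>)
  moreover have "(?c - \<delta> *\<^sub>R r) \<odot> ((1 - \<delta>) *\<^sub>R r - ?c) = ?c - ?c \<odot> ?c - (\<delta> * (1 - \<delta>)) *\<^sub>R r"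
    by (rule vec_eqI) (simp add: bil r U_E1[OF r(1)] comm[of ?c r]; simp add: algebra_simps)
  ultimately have "(\<delta> * (1 - \<delta>)) *\<^sub>R r \<sqsubseteq> r \<odot> (?z \<odot> ?z)" unfolding u le_def by simp
  moreover have "\<delta> * (1 - \<delta>) > 0" using \<delta>(1) d1 by simp
  moreover have "r \<odot> (?z \<odot> ?z) \<in> ?S" unfolding u using c by (simp add: li mu)
  ultimately obtain g g' where "g \<in> ?S" "g' \<in> ?S" "g \<odot> g' = r"
    "r \<odot> (2 *\<^sub>R (g \<odot> ?z)) = (1/2) *\<^sub>R (2 *\<^sub>R (g \<odot> ?z))"
    "r \<odot> ((2 *\<^sub>R (g \<odot> ?z)) \<odot> (2 *\<^sub>R (g \<odot> ?z))) = r"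
    using normalise[OF r(1) H_Eh[OF r(1)] S] by metis
  then show ?thesis using that[of g g'] r(1) by (metis exchange.intro exchange_axioms.intro jbu_axioms)
qed

text \<open>\<open>v \<odot> v\<close> is the block of \<open>r\<close> and its partner. It absorbs
  the components of \<open>p\<close> in the 1-space and the half space of \<open>r\<close>, and
  \<open>Z r p\<close> acts on \<open>v\<close> as 1/2 minus \<open>U r p\<close>, so that it does
  not lead out of the block.\<close>

lemma frame_even:
  assumes r: "r \<odot> r = r" and p: "p \<odot> p = p" and g: "g \<in> gen r (U r p)" "g' \<in> gen r (U r p)" "g \<odot> g' = r"
    and X: "exchange jm one r v" and v: "v = 2 *\<^sub>R (g \<odot> H r p)"
  shows "(v \<odot> v) \<odot> ((v \<odot> v) \<odot> p) = (v \<odot> v) \<odot> p"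
proof -
  interpret X: exchange jm one r v by (rule X)
  let ?c = "U r p" and ?z = "H r p" and ?k = "Z r p"
  have S: "loc_unit r (gen r ?c)" by (rule loc_unit_gen[OF r U_E1[OF r]])
  note D = loc_unitD[OF S]
  have c: "r \<odot> ?c = ?c" "r \<odot> ?z = (1/2) *\<^sub>R ?z" "r \<odot> ?k = 0" by (simp_all add: U_E1 H_Eh Z_E0 r)
  have rg: "r \<odot> g = g" "r \<odot> g' = g'" using D(3) g by auto
  have ec: "X.e \<odot> ?c = ?c" by (rule X.Er_Ee[OF c(1)])
  have z: "?z = 2 *\<^sub>R (g' \<odot> v)"
  proof -
    have "(g' \<odot> g) \<odot> ?z = 2 *\<^sub>R (g' \<odot> (g \<odot> ?z))"
      using E1_special[OF r rg(2,1) c(2)] oca_lcomm[OF D(1) g(1,2), of ?z] by (simp add: scaleR_2)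
    then have "(1/2) *\<^sub>R ?z = 2 *\<^sub>R (g' \<odot> (g \<odot> ?z))" using g(3) c(2) by (simp add: comm[of g' g])
    then show ?thesis unfolding v by (rule vec_lin1) (simp add: bil)
  qed
  have ez: "X.e \<odot> ?z = ?z"
    unfolding z using E1_E1[OF X.ee X.Er_Ee[OF rg(2)] X.ve(2)] by (simp add: bil)
  have kv: "?k \<odot> v = (1/2) *\<^sub>R v - ?c \<odot> v"
  proof -
    have kz: "?k \<odot> ?z = (1/2) *\<^sub>R ?z - ?c \<odot> ?z"
      using idem_parts(2)[OF r p] by (rule vec_lin1) simp
    have 1: "?k \<odot> (g \<odot> ?z) = g \<odot> (?k \<odot> ?z)" using ocD[OF oc_E1_E0[OF r rg(1) c(3)]] by simp
    have 2: "g \<odot> (?c \<odot> ?z) = ?c \<odot> (g \<odot> ?z)" using oca_lcomm[OF D(1) g(1) gen_self] .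
    show ?thesis unfolding v by (rule vec_eqI) (simp add: bil 1 kz 2)
  qed
  have ekv: "X.e \<odot> (?k \<odot> v) = ?k \<odot> v"
    unfolding kv using E1_E1[OF X.ee ec X.ve(2)] X.ve(2) by (simp add: bil)
  have Xe: "X.e \<odot> (v \<odot> (?k \<odot> v)) = v \<odot> (?k \<odot> v)" by (rule E1_E1[OF X.ee X.ve(2) ekv])
  let ?r' = "\<one> - r"
  have r': "?r' \<odot> ?r' = ?r'" by (rule compl_idem[OF r])
  have k': "?r' \<odot> ?k = ?k" by (simp add: bil unit c(3))
  have v': "?r' \<odot> v = (1/2) *\<^sub>R v" by (rule vec_eqI) (simp add: bil unit X.v)
  have kvv: "?k \<odot> (v \<odot> v) = 2 *\<^sub>R (?r' \<odot> (v \<odot> (?k \<odot> v)))"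
    using Eh_derivation[OF r' k' v' v'] by (simp add: comm[of "?k \<odot> v" v] scaleR_2)
  have "X.e \<odot> (?r' \<odot> (v \<odot> (?k \<odot> v))) = ?r' \<odot> (v \<odot> (?k \<odot> v))"
    using Xe E1_E1[OF X.ee X.re(2) Xe] by (simp add: diff_left diff_right unit)
  then have ek: "X.e \<odot> (X.e \<odot> ?k) = X.e \<odot> ?k"
    using kvv by (simp add: X.e_def comm[of "v \<odot> v" ?k] scaleR_right)
  have "p = ?c + ?z + ?k" by (rule peirce_split)
  then have "X.e \<odot> p = ?c + ?z + X.e \<odot> ?k" using ec ez by (metis add_right)
  then have "X.e \<odot> (X.e \<odot> p) = X.e \<odot> p" using ec ez ek by (simp add: add_right)
  then show ?thesis by (simp add: X.e_def)
qed

text \<open>A half component relative to the block \<open>v \<odot> v\<close> links the block to its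
  complement. After a swap by \<sigma>, if necessary, the link \<open>b\<close> starts at
  \<open>r\<close>. On a corner \<open>s\<close> where its square is bounded below it can be
  normalised, and the partner of \<open>s\<close> so obtained lies outside the block.\<close>

lemma room_step:
  assumes X: "exchange jm one r v" and a: "H (v \<odot> v) a \<noteq> 0"
  obtains s w where "s \<odot> s = s" "s \<noteq> 0" "r \<odot> s = s" "exchange jm one s w" "(v \<odot> v) \<odot> (w \<odot> w - s) = 0"
proof -
  interpret X: exchange jm one r v by (rule X)
  note ee = X.ee and r = X.r
  have "\<exists>b. b \<noteq> 0 \<and> r \<odot> b = (1/2) *\<^sub>R b \<and> X.e \<odot> b = (1/2) *\<^sub>R b"
  proof (cases "r \<odot> H X.e a = 0")
    case False
    let ?b = "r \<odot> H X.e a"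
    have "r \<odot> ?b = (1/2) *\<^sub>R ?b" by (rule half_idem[OF ee r X.re(2) H_Eh[OF ee]])
    moreover have "X.e \<odot> ?b = (1/2) *\<^sub>R ?b" by (rule E1_Eh[OF ee X.re(2) H_Eh[OF ee]])
    ultimately show ?thesis using False by blast
  next
    case True
    let ?b = "H X.e a"
    have eb: "X.e \<odot> ?b = (1/2) *\<^sub>R ?b" by (rule H_Eh[OF ee])
    then have "X.y \<odot> ?b = (1/2) *\<^sub>R ?b" using True by (simp add: X.y_def bil)
    then have "r \<odot> X.\<sigma> ?b = (1/2) *\<^sub>R X.\<sigma> ?b" using X.\<sigma>_mult[of X.y ?b] by (simp add: X.\<sigma>_y X.\<sigma>_scale)
    moreover have "X.e \<odot> X.\<sigma> ?b = (1/2) *\<^sub>R X.\<sigma> ?b" using X.\<sigma>_mult[of X.e ?b] eb by (simp add: X.\<sigma>_e X.\<sigma>_scale)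
    moreover have "X.\<sigma> ?b \<noteq> 0" using a X.\<sigma>_\<sigma>[of ?b] by (auto simp: X.e_def refl_lin)
    ultimately show ?thesis by blast
  qed
  then obtain b where b: "b \<noteq> 0" "r \<odot> b = (1/2) *\<^sub>R b" "X.e \<odot> b = (1/2) *\<^sub>R b" by blast
  define u where "u = r \<odot> (b \<odot> b)"
  have ru: "r \<odot> u = u" using Eh_Eh[OF r b(2,2)] by (simp add: u_def)
  have u0: "u \<noteq> 0" using Eh_zero[OF r b(2)] b(1) by (auto simp: u_def)
  have r0: "r \<noteq> 0" using u0 ru by (auto simp: bil)
  have pu: "pos u" using U_pos[OF r pos_sq[of b]] U_even[OF r Eh_Eh[OF r b(2,2)]] by (simp add: u_def)
  define M where "M = norm u"
  have M: "M > 0" using u0 by (simp add: M_def)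
  \<comment> \<open>Tolerance \<open>M / 4\<close> leaves \<kappa> of modulus at least
    \<open>3 M / 4\<close>; positivity of \<open>u\<close> fixes its sign, so
    \<open>s \<odot> u\<close> stays above \<open>M / 2\<close>.\<close>
  obtain s \<kappa> where s: "s \<odot> s = s" "s \<noteq> 0" "r \<odot> s = s" "s \<odot> (s \<odot> u) = s \<odot> u"
    "norm (s \<odot> u - \<kappa> *\<^sub>R s) \<le> M/4" "\<bar>\<kappa>\<bar> \<ge> M - M/4"
    using approx_scalar[OF r r0 ru, of "M/4"] M by (auto simp: M_def)
  have ssu: "s \<odot> (s \<odot> u - \<kappa> *\<^sub>R s) = s \<odot> u - \<kappa> *\<^sub>R s" by (simp add: bil s)
  note nb = corner_norm_le[OF s(1) ssu s(5)]
  have psu: "pos (s \<odot> u)" using U_pos[OF s(1) pu] U_even[OF s(1) s(4)] by simp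
  have "0 *\<^sub>R s \<sqsubseteq> s \<odot> u" using psu by (simp add: pos_le)
  moreover have "s \<odot> u \<sqsubseteq> (M/4 + \<kappa>) *\<^sub>R s" using nb(2) by (simp add: le_def scaleR_add_left algebra_simps)
  ultimately have "0 \<le> M/4 + \<kappa>" using corner_scalar_le[OF s(1,2)] le_trans by blast
  then have \<kappa>: "\<kappa> \<ge> 3 * M / 4" using s(6) M by linarith
  have low: "(M/2) *\<^sub>R s \<sqsubseteq> s \<odot> u"
  proof -
    have "(M/2) *\<^sub>R s \<sqsubseteq> (\<kappa> - M/4) *\<^sub>R s" using \<kappa> by (intro le_scale_left pos_idem s) linarith
    moreover have "(\<kappa> - M/4) *\<^sub>R s \<sqsubseteq> s \<odot> u" using nb(1) by (simp add: le_def scaleR_diff_left algebra_simps)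
    ultimately show ?thesis by (rule le_trans)
  qed
  define x where "x = 2 *\<^sub>R (s \<odot> b)"
  have sx: "s \<odot> x = (1/2) *\<^sub>R x" using half_idem[OF r s(1,3) b(2)] by (simp add: x_def bil)
  have "r \<odot> ((s \<odot> b) \<odot> (s \<odot> b)) = (1/4) *\<^sub>R (s \<odot> u)"
    unfolding corner_sq[OF r b(2) s(3)] u_def[symmetric] by (rule vec_eqI) (simp add: s)
  then have rxx: "r \<odot> (x \<odot> x) = s \<odot> u" by (simp add: x_def bil)
  have rx: "r \<odot> x = (1/2) *\<^sub>R x" unfolding x_def using E1_Eh[OF r s(3) b(2)] by (simp add: bil)
  have sxx: "s \<odot> (x \<odot> x) = s \<odot> u"
    using E1_mult_even[OF r s(3) Eh_Eh[OF r rx rx]] rxx s(4) by simp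
  have S: "loc_unit s (gen s (s \<odot> u))" by (rule loc_unit_gen[OF s(1,4)])
  obtain g where g: "g \<in> gen s (s \<odot> u)" "s \<odot> (2 *\<^sub>R (g \<odot> x)) = (1/2) *\<^sub>R (2 *\<^sub>R (g \<odot> x))"
    "s \<odot> ((2 *\<^sub>R (g \<odot> x)) \<odot> (2 *\<^sub>R (g \<odot> x))) = s"
    using normalise[OF s(1) sx S, of "M/2"] low M gen_self unfolding sxx by (metis half_gt_zero)
  define w where "w = 2 *\<^sub>R (g \<odot> x)"
  have Y: "exchange jm one s w" using g s(1) unfolding w_def by unfold_locales
  interpret Y: exchange jm one s w by (rule Y)
  let ?q = "\<one> - X.e"
  have q: "?q \<odot> ?q = ?q" by (rule compl_idem[OF ee])
  have es: "X.e \<odot> s = s" by (rule X.Er_Ee[OF s(3)])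
  have eg: "X.e \<odot> g = g" using E1_trans[OF s(1) es] loc_unitD(3)[OF S g(1)] by blast
  have eq0: "X.e \<odot> ?q = 0" by (simp add: bil unit_right ee)
  have qb: "?q \<odot> b = (1/2) *\<^sub>R b" by (rule vec_eqI) (simp add: bil unit b(3))
  have "?q \<odot> (s \<odot> b) = s \<odot> (?q \<odot> b)" using ocD[OF oc_E1_E0[OF ee es eq0]] by simp
  then have qx: "?q \<odot> x = (1/2) *\<^sub>R x" unfolding x_def by (simp only: scaleR_right qb scaleR_scaleR mult.commute)
  have "?q \<odot> (g \<odot> x) = g \<odot> (?q \<odot> x)" using ocD[OF oc_E1_E0[OF ee eg eq0]] by simp
  then have qw: "?q \<odot> w = (1/2) *\<^sub>R w" unfolding w_def by (simp only: scaleR_right qx scaleR_scaleR mult.commute)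
  let ?f = "s + ?q"
  have sq: "s \<odot> ?q = 0" "?q \<odot> s = 0" using es by (simp_all add: bil unit unit_right comm[of s X.e])
  have f: "?f \<odot> ?f = ?f" unfolding add_left add_right sq q s(1) by simp
  have fw: "?f \<odot> w = w" unfolding add_left Y.v qw by (rule vec_eqI) simp
  have "?f \<odot> (w \<odot> w) = w \<odot> w" by (rule E1_E1[OF f fw fw])
  then have "?f \<odot> Y.y = Y.y" unfolding Y.y_def Y.e_def diff_right add_left[of s ?q s] sq s(1) by simp
  then have "?q \<odot> Y.y = Y.y" unfolding add_left Y.ry by simp
  then have "X.e \<odot> Y.y = 0" by (simp add: diff_left unit)
  then show ?thesis using that[OF s(1,2,3) Y] by (simp add: X.e_def Y.y_def Y.e_def)
qed

lemma central_if_no_half: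
  assumes e: "e \<odot> e = e" and h: "\<And>a. H e a = 0"
  shows "central jm e"
  unfolding central_def using oc_even[OF e] H_even_iff[OF e] h ocD by metis

text \<open>Suppose there is no room. For each \<open>s\<close> below \<open>r\<close> the block of
  \<open>s\<close> and \<open>p\<close> must then be central, since otherwise
  \<open>room_step\<close>, with the part \<open>t\<close> of \<open>p\<close> inside the block,
  provides room. Central blocks make the corner of \<open>r\<close> associative, and
  \<open>r\<close> and its partner form a summand of type \<open>I\<^sub>2\<close>.\<close>

lemma room:
  assumes I2: "\<not> has_type_I2_summand jm"
    and r: "r \<odot> r = r" "r \<noteq> 0" and p: "p \<odot> p = p"
    and \<delta>: "\<delta> > 0" "\<delta> *\<^sub>R r \<sqsubseteq> U r p" "U r p \<sqsubseteq> (1 - \<delta>) *\<^sub>R r"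
  shows "\<exists>s w t. s \<odot> s = s \<and> s \<noteq> 0 \<and> r \<odot> s = s \<and> exchange jm one s w \<and> t \<odot> t = t \<and> p \<odot> t = t \<and>
    (p - t) \<odot> s = 0 \<and> t \<odot> (w \<odot> w - s) = 0"
proof (rule ccontr)
  assume no: "\<not> ?thesis"
  let ?c = "U r p"
  have cen: "\<exists>g v. s \<odot> g = g \<and> v = 2 *\<^sub>R (g \<odot> H s p) \<and> exchange jm one s v \<and> central jm (v \<odot> v)"
    if s: "s \<odot> s = s" "s \<noteq> 0" "r \<odot> s = s" for s
  proof -
    have "U s r = s" using U_even[OF s(1), of r] s by (simp add: comm[of s r])
    then have b: "\<delta> *\<^sub>R s \<sqsubseteq> U s p" "U s p \<sqsubseteq> (1 - \<delta>) *\<^sub>R s"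
      using U_le[OF s(1) \<delta>(2)] U_le[OF s(1) \<delta>(3)] by (simp_all add: U_lin U_sub[OF r(1) s(1,3)])
    obtain g g' where g: "g \<in> gen s (U s p)" "g' \<in> gen s (U s p)" "g \<odot> g' = s"
        "exchange jm one s (2 *\<^sub>R (g \<odot> H s p))"
      using frame[OF s(1,2) p \<delta>(1) b] by metis
    define v where "v = 2 *\<^sub>R (g \<odot> H s p)"
    have X: "exchange jm one s v" using g(4) by (simp add: v_def)
    interpret X: exchange jm one s v by (rule X)
    have ev: "X.e \<odot> (X.e \<odot> p) = X.e \<odot> p" using frame_even[OF s(1) p g(1,2,3) X v_def] by (simp add: X.e_def)
    have "H X.e a = 0" for a
    proof (rule ccontr)
      assume "H X.e a \<noteq> 0"
      then obtain t w where t: "t \<odot> t = t" "t \<noteq> 0" "s \<odot> t = t" "exchange jm one t w" "X.e \<odot> (w \<odot> w - t) = 0"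
        using room_step[OF X] unfolding X.e_def by metis
      have et: "X.e \<odot> t = t" by (rule X.Er_Ee[OF t(3)])
      have 1: "(X.e \<odot> p) \<odot> (X.e \<odot> p) = X.e \<odot> p" using even_mult(1)[OF X.ee ev ev] p by simp
      have 2: "p \<odot> (X.e \<odot> p) = X.e \<odot> p" using ocD[OF oc_even[OF X.ee ev], of p] p by simp
      have 3: "(p - X.e \<odot> p) \<odot> t = 0"
        using E1_E0[OF X.ee et even_split[OF X.ee ev]] by (simp add: comm)
      have 4: "(X.e \<odot> p) \<odot> (w \<odot> w - t) = 0" by (rule E1_E0[OF X.ee ev t(5)])
      have 5: "r \<odot> t = t" by (rule E1_trans[OF s(1,3) t(3)])
      show False using no t(1,2,4) 1 2 3 4 5 by blast
    qed
    then have "central jm X.e" by (rule central_if_no_half[OF X.ee])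
    moreover have "s \<odot> g = g" using loc_unitD(3)[OF loc_unit_gen[OF s(1) U_E1[OF s(1)]] g(1)] .
    ultimately have "s \<odot> g = g \<and> v = 2 *\<^sub>R (g \<odot> H s p) \<and> exchange jm one s v \<and> central jm (v \<odot> v)"
      using X v_def unfolding X.e_def by blast
    then show ?thesis by blast
  qed
  \<comment> \<open>The centre of the corner of \<open>r\<close>, taken as an algebra of its
    own.\<close>
  define C where "C = {x. r \<odot> x = x \<and> (\<forall>a b. r \<odot> a = a \<longrightarrow> r \<odot> b = b \<longrightarrow> x \<odot> (a \<odot> b) = a \<odot> (x \<odot> b))}"
  have sC: "subspace C" unfolding C_def subspace_def by (auto simp: bil)
  have cC: "closed C"
  proof -
    have "C = {x. r \<odot> x = x} \<inter> (\<Inter>a\<in>{a. r \<odot> a = a}. \<Inter>b\<in>{b. r \<odot> b = b}. {x. x \<odot> (a \<odot> b) = a \<odot> (x \<odot> b)})"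
      unfolding C_def by auto
    moreover have "closed {x. r \<odot> x = x}" by (intro closed_eq_cont continuous_intros)
    moreover have "closed {x. x \<odot> (a \<odot> b) = a \<odot> (x \<odot> b)}" for a b by (intro closed_eq_cont continuous_intros)
    ultimately show ?thesis by (simp only:) (intro closed_Int closed_INT ballI; assumption)
  qed
  \<comment> \<open>If \<open>s\<close> is even for \<open>r - s\<close> and \<open>c\<close> is
    even for \<open>s\<close>, the complement \<open>r - s\<close> is orthogonal to the central
    block of \<open>s\<close>; hence \<open>s\<close> is \<open>r\<close> times a central
    idempotent.\<close>
  have evC: "s \<in> C" if s: "s \<odot> s = s" "r \<odot> s = s" and sc: "s \<odot> (s \<odot> ?c) = s \<odot> ?c" for s
  proof (cases "s = 0")
    case True
    then show ?thesis using sC subspace_0 by blast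
  next
    case False
    obtain g v where g: "s \<odot> g = g" "v = 2 *\<^sub>R (g \<odot> H s p)" and X: "exchange jm one s v" and ce: "central jm (v \<odot> v)"
      using cen[OF s(1) False s(2)] by blast
    interpret X: exchange jm one s v by (rule X)
    let ?f = "r - s" and ?z = "H r p"
    have sf: "s \<odot> ?f = 0" using s by (simp add: bil comm[of s r])
    have ff: "?f \<odot> ?f = ?f" using r(1) s by (simp add: bil comm[of s r])
    have rf: "r \<odot> ?f = ?f" by (simp add: bil r s)
    have rz: "r \<odot> ?z = (1/2) *\<^sub>R ?z" by (rule H_Eh[OF r(1)])
    have ssz: "s \<odot> (s \<odot> ?z) = (1/2) *\<^sub>R (s \<odot> ?z)" by (rule half_idem[OF r(1) s rz])
    have "H s p = H s ?c + H s ?z + H s (Z r p)" using peirce_split[of p r] by (metis H_lin(1))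
    also have "H s ?c = 0" by (rule H_even[OF sc])
    also have "H s (Z r p) = 0" using E1_E0[OF r(1) s(2) Z_E0[OF r(1)]] by (simp add: H_def bil)
    also have "H s ?z = 2 *\<^sub>R (s \<odot> ?z)" unfolding H_def[of s] by (rule vec_eqI) (simp add: ssz)
    finally have hz: "H s p = 2 *\<^sub>R (s \<odot> ?z)" by simp
    have fs: "?f \<odot> s = 0" using sf comm[of s ?f] by simp
    have i1: "?f \<odot> (s \<odot> ?z) = s \<odot> (?f \<odot> ?z)" using ocD[OF oc_E1_E0[OF s(1,1) sf]] by simp
    have i2: "(?f \<odot> s) \<odot> ?z = ?f \<odot> (s \<odot> ?z) + s \<odot> (?f \<odot> ?z)" by (rule E1_special[OF r(1) rf s(2) rz])
    have "?f \<odot> (s \<odot> ?z) + ?f \<odot> (s \<odot> ?z) = 0" using i2 unfolding fs zero_left i1[symmetric] by (rule sym)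
    then have fz: "?f \<odot> H s p = 0" by (simp only: hz scaleR_2 add_right)
    have fg: "?f \<odot> g = 0" using E1_E0[OF s(1) g(1) sf] by (simp add: comm)
    have fv: "?f \<odot> v = 0" unfolding g(2) using E0_E0[OF ff fg fz] by (simp add: bil)
    have "?f \<odot> X.e = 0" unfolding X.e_def by (rule E0_E0[OF ff fv fv])
    then have re: "r \<odot> X.e = s" using X.re(1) by (simp add: bil)
    have se: "s \<odot> a = X.e \<odot> a" if a: "r \<odot> a = a" for a
    proof -
      have "X.e \<odot> (a \<odot> r) = a \<odot> (X.e \<odot> r)" using ce unfolding central_def X.e_def by blast
      then show ?thesis using a re by (simp add: comm[of a r] comm[of X.e r] comm[of a s])
    qed
    have "s \<odot> (a \<odot> b) = a \<odot> (s \<odot> b)" if ab: "r \<odot> a = a" "r \<odot> b = b" for a b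
      unfolding se[OF E1_E1[OF r(1) ab]] se[OF ab(2)] using ce unfolding central_def X.e_def by blast
    then show ?thesis unfolding C_def using s(2) by blast
  qed
  have inC: "x \<in> C" if rx: "r \<odot> x = x" and
      ev: "\<And>s. s \<odot> s = s \<Longrightarrow> r \<odot> s = s \<Longrightarrow> s \<odot> (s \<odot> x) = s \<odot> x \<Longrightarrow> s \<odot> (s \<odot> ?c) = s \<odot> ?c" for x
  proof -
    have "x \<in> closure C"
      unfolding closure_approachable
    proof (intro allI impI)
      fix \<eta> :: real assume "\<eta> > 0"
      then obtain P k where P: "finite P" "\<And>p. p \<in> P \<Longrightarrow> p \<odot> p = p" "\<And>p. p \<in> P \<Longrightarrow> r \<odot> p = p"
        "\<And>p. p \<in> P \<Longrightarrow> p \<odot> (p \<odot> x) = p \<odot> x" "norm (x - (\<Sum>p\<in>P. k p *\<^sub>R p)) \<le> \<eta>/2"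
        using approx_simple[OF r(1) rx, of "\<eta>/2"] by (metis half_gt_zero)
      have "(\<Sum>p\<in>P. k p *\<^sub>R p) \<in> C"
        by (intro subspace_sum[OF sC] subspace_scale[OF sC] evC) (use P ev in auto)
      moreover have "dist (\<Sum>p\<in>P. k p *\<^sub>R p) x < \<eta>"
        using P(5) \<open>\<eta> > 0\<close> by (simp add: dist_norm norm_minus_commute)
      ultimately show "\<exists>y\<in>C. dist y x < \<eta>" by blast
    qed
    then show ?thesis using cC by simp
  qed
  \<comment> \<open>Once \<open>c\<close> is central in the corner, every idempotent of the corner
    meets the condition of \<open>evC\<close>, and by approximation every element is
    central.\<close>
  have "?c \<in> C" by (rule inC[OF U_E1[OF r(1)]])
  then have cC': "?c \<odot> (a \<odot> b) = a \<odot> (?c \<odot> b)" if "r \<odot> a = a" "r \<odot> b = b" for a b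
    using that unfolding C_def by blast
  have c_even: "s \<odot> (s \<odot> ?c) = s \<odot> ?c" if s: "s \<odot> s = s" "r \<odot> s = s" for s
    unfolding comm[of s ?c] using cC'[OF s(2,2)] unfolding s(1) by (rule sym)
  have allC: "x \<in> C" if "r \<odot> x = x" for x by (rule inC[OF that]) (use c_even in blast)
  have ass: "(x \<odot> y) \<odot> z = x \<odot> (y \<odot> z)" if "r \<odot> x = x" "r \<odot> y = y" "r \<odot> z = z" for x y z
  proof -
    have "z \<odot> (x \<odot> y) = x \<odot> (z \<odot> y)" using allC[OF that(3)] that unfolding C_def by blast
    then show ?thesis by (simp add: comm)
  qed
  obtain v where X: "exchange jm one r v" and ce: "central jm (v \<odot> v)" using cen[OF r r(1)] by blast
  interpret X: exchange jm one r v by (rule X)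
  have ab1: "abelian_proj jm r"
    unfolding abelian_proj_def is_proj_def U_eq_Uop[symmetric]
    using r(1) ass U_E1[OF r(1)] by auto
  have ab2: "abelian_proj jm X.y"
    unfolding abelian_proj_def is_proj_def U_eq_Uop[symmetric]
  proof (intro conjI ballI)
    show "X.y \<odot> X.y = X.y" by (rule X.yy)
    fix a b c assume abc: "a \<in> range (U X.y)" "b \<in> range (U X.y)" "c \<in> range (U X.y)"
    have e1: "r \<odot> X.\<sigma> x = X.\<sigma> x" if "x \<in> range (U X.y)" for x
    proof -
      have "X.y \<odot> x = x" using that U_E1[OF X.yy] by auto
      then show ?thesis using X.\<sigma>_mult[of X.y x] X.\<sigma>_y by simp
    qed
    have "X.\<sigma> ((a \<odot> b) \<odot> c) = X.\<sigma> (a \<odot> (b \<odot> c))"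
      unfolding X.\<sigma>_mult by (rule ass) (use abc e1 in blast)+
    then show "(a \<odot> b) \<odot> c = a \<odot> (b \<odot> c)" by (rule X.\<sigma>_inj)
  qed
  have cp: "central_proj jm X.e" unfolding central_proj_def is_proj_def using X.ee ce X.e_def by simp
  have supp: "proj_le jm X.e w" if w: "central_proj jm w" and wv: "w \<odot> v = v" for w
  proof -
    have "w \<odot> (v \<odot> v) = v \<odot> (w \<odot> v)" using w unfolding central_proj_def central_def by blast
    then show ?thesis unfolding proj_le_def using wv by (simp add: X.e_def comm[of "v \<odot> v" w])
  qed
  have wv: "w \<odot> v = v" if w: "central_proj jm w" "proj_le jm s w" and sv: "s \<odot> v = (1/2) *\<^sub>R v" for s w
  proof -
    have "w \<odot> (v \<odot> s) = v \<odot> (w \<odot> s)" using w unfolding central_proj_def central_def by blast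
    moreover have "w \<odot> s = s" using w(2) by (simp add: proj_le_def comm[of w s])
    ultimately have "w \<odot> ((1/2) *\<^sub>R v) = (1/2) *\<^sub>R v" using sv by (simp add: comm[of v s])
    then show ?thesis by (simp add: bil)
  qed
  have cs1: "central_support jm r X.e"
    unfolding central_support_def using cp X.re supp wv X.v by (auto simp: proj_le_def)
  have cs2: "central_support jm X.y X.e"
    unfolding central_support_def using cp X.ey supp wv X.yv by (auto simp: proj_le_def)
  have "X.e \<noteq> 0" using X.re(1) r(2) by (auto simp: bil)
  then have "has_type_I2_summand jm"
    unfolding has_type_I2_summand_def
    using cp ab1 ab2 cs1 cs2 X.ry(1) X.e_ry by metis
  then show False using I2 by blast
qed

section \<open>Orthogonal idempotents with a prescribed scalar compression\<close>

text \<open>Within the block, \<open>n = \<one> - p\<close> is the diagonal matrix \<open>N\<close>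
  with entries \<open>h\<close> and \<open>r\<close>. Let \<open>k\<close> invert \<open>h\<close>,
  let \<open>\<theta> = 1 - \<mu>'\<close>, and let \<xi> be the column with entries
  \<open>sqrt \<theta> k\<close> and \<gamma>, where \<open>\<gamma>^2 = r - \<theta> k\<close>. It
  is normalised for \<open>N\<close>, so the matrix \<open>J = \<xi> \<xi>^T\<close> satisfies
  \<open>J N J = J\<close>. Then \<open>w = n J n\<close> is idempotent, lies under
  \<open>n\<close>, and has corner \<open>h (\<theta> k^2) h = \<theta> r\<close>.\<close>

lemma dilation:
  assumes X: "exchange jm one r v" and p: "p \<odot> p = p" "p \<odot> (v \<odot> v - r) = 0"
    and \<mu>: "U r p \<sqsubseteq> \<mu> *\<^sub>R r" "\<mu> < \<mu>'" "\<mu>' < 1"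
  obtains w where "w \<odot> w = w" "p \<odot> w = 0" "U r w = (1 - \<mu>') *\<^sub>R r"
proof -
  interpret X: exchange jm one r v by (rule X)
  note r = X.r
  define n where "n = \<one> - p"
  have n: "n \<odot> n = n" unfolding n_def by (rule compl_idem[OF p(1)])
  define h where "h = U r n"
  define z where "z = H r n"
  define l where "l = Z r n"
  have hp: "h = r - U r p" by (simp add: h_def n_def U_lin U_one[OF r])
  have rh: "r \<odot> h = h" by (simp add: h_def U_E1[OF r])
  define S where "S = gen r h"
  have S: "loc_unit r S" unfolding S_def by (rule loc_unit_gen[OF r rh])
  note D = loc_unitD[OF S] and li = oca_lin[OF loc_unitD(1)[OF S]] and mu = oca_mult[OF loc_unitD(1)[OF S]]
  note as = oca_assoc[OF loc_unitD(1)[OF S]] and lc = oca_lcomm[OF loc_unitD(1)[OF S]]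
  have hS: "h \<in> S" unfolding S_def by (rule gen_self)
  have m1: "1 - \<mu> > 0" using \<mu> by simp
  have hl: "(1 - \<mu>) *\<^sub>R r \<sqsubseteq> h" using \<mu>(1) unfolding hp le_def by (simp add: scaleR_diff_left algebra_simps)
  obtain k where k: "k \<in> S" "h \<odot> k = r" "pos k" "k \<sqsubseteq> (1/(1 - \<mu>)) *\<^sub>R r" using loc_inverse[OF S hS m1 hl] by metis
  define \<theta> where "\<theta> = 1 - \<mu>'"
  have \<theta>: "\<theta> > 0" "\<theta> < 1 - \<mu>" using \<mu> by (auto simp: \<theta>_def)
  define A where "A = \<theta> *\<^sub>R (k \<odot> k)"
  define m where "m = \<theta> *\<^sub>R k"
  define B where "B = r - m"
  have mB: "m \<in> S" "B \<in> S" "A \<in> S" using k D by (auto simp: m_def B_def A_def li mu)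
  have pB: "pos B"
  proof -
    have "m \<sqsubseteq> \<theta> *\<^sub>R ((1/(1 - \<mu>)) *\<^sub>R r)" unfolding m_def using k(4) \<theta> by (intro le_scale) auto
    also have "\<theta> *\<^sub>R ((1/(1 - \<mu>)) *\<^sub>R r) \<sqsubseteq> 1 *\<^sub>R r"
      unfolding scaleR_scaleR using \<theta> m1 by (intro le_scale_left pos_idem r) (simp add: field_simps)
    finally show ?thesis by (simp add: B_def le_def)
  qed
  obtain \<gamma> where \<gamma>: "\<gamma> \<in> S" "\<gamma> \<odot> \<gamma> = B" using loc_pos_sqrt[OF S mB(2) pB] by metis
  define \<alpha> where "\<alpha> = sqrt \<theta> *\<^sub>R (k \<odot> \<gamma>)"
  have aS: "\<alpha> \<in> S" using k \<gamma> by (simp add: \<alpha>_def li mu)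
  have rS: "r \<odot> x = x" "x \<odot> r = x" if "x \<in> S" for x using D(3)[OF that] comm by metis+
  have Ah: "A \<odot> h = m" "h \<odot> A = m"
  proof -
    have "h \<odot> (k \<odot> k) = k" using as[OF hS k(1) k(1)] k(2) rS[OF k(1)] by simp
    then show "h \<odot> A = m" by (simp add: A_def m_def bil)
    then show "A \<odot> h = m" by (simp add: comm)
  qed
  have aa: "\<alpha> \<odot> \<alpha> = A \<odot> B"
    using oca_mult4[OF D(1) k(1) \<gamma>(1) k(1) \<gamma>(1)] \<theta> by (simp add: \<alpha>_def A_def bil \<gamma>(2))
  have hAB: "h \<odot> (A \<odot> B) = m \<odot> B" using as[OF hS mB(3,2)] Ah by simp
  have sum1: "A \<odot> m + A \<odot> B = A" "m \<odot> \<alpha> + B \<odot> \<alpha> = \<alpha>" "B \<odot> B + m \<odot> B = B"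
    using rS[OF mB(3)] rS[OF aS] rS[OF mB(2)] unfolding B_def
    by (simp_all add: bil comm[of m r] comm[of m "r - m"])
  have aha: "\<alpha> \<odot> (h \<odot> \<alpha>) = m \<odot> B" using lc[OF aS hS, of \<alpha>] aa hAB by simp
  have Aha: "A \<odot> (h \<odot> \<alpha>) = m \<odot> \<alpha>" "h \<odot> (A \<odot> \<alpha>) = m \<odot> \<alpha>"
    using as[OF mB(3) hS aS] as[OF hS mB(3) aS] Ah by simp_all
  have Bha: "B \<odot> (h \<odot> \<alpha>) = h \<odot> (B \<odot> \<alpha>)" using lc[OF mB(2) hS] .
  have AAh: "(A \<odot> A) \<odot> h = A \<odot> m" using as[OF mB(3,3) hS] Ah by simp
  define J where "J = X.mat A \<alpha> B"
  have 0: "(0::'a) \<in> S" by (rule li)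
  have N: "h + X.y = X.mat h 0 r" by (simp add: X.mat_def X.\<rho>_def bil X.\<sigma>_r)
  have JN: "J \<odot> (h + X.y) = X.mat m ((1/2) *\<^sub>R (h \<odot> \<alpha> + \<alpha>)) B"
    unfolding N J_def X.mat_mult[OF S mB(3) aS mB(2) hS 0 D(2)] using Ah rS[OF aS] rS[OF mB(2)]
    by (simp add: bil comm[of \<alpha> 0])
  have half: "(1/2) *\<^sub>R (h \<odot> \<alpha> + \<alpha>) \<in> S" using hS aS by (simp add: li mu)
  have JJN: "J \<odot> (J \<odot> (h + X.y)) = X.mat (A \<odot> m + (1/2) *\<^sub>R (m \<odot> B + A \<odot> B))
     ((1/2) *\<^sub>R ((1/2) *\<^sub>R (m \<odot> \<alpha> + A \<odot> \<alpha>) + m \<odot> \<alpha> + (1/2) *\<^sub>R (h \<odot> (B \<odot> \<alpha>) + B \<odot> \<alpha>) + B \<odot> \<alpha>))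
     (B \<odot> B + (1/2) *\<^sub>R (m \<odot> B + A \<odot> B))"
    unfolding JN unfolding J_def X.mat_mult[OF S mB(3) aS mB(2) mB(1) half mB(2)]
    by (simp add: bil aha Aha Bha aa)
  have JJ: "J \<odot> J = X.mat (A \<odot> A + A \<odot> B) (A \<odot> \<alpha> + B \<odot> \<alpha>) (B \<odot> B + A \<odot> B)"
  proof -
    have "(1/2) *\<^sub>R (A \<odot> \<alpha> + A \<odot> \<alpha> + B \<odot> \<alpha> + B \<odot> \<alpha>) = A \<odot> \<alpha> + B \<odot> \<alpha>" by (rule vec_eqI) simp
    then show ?thesis unfolding J_def X.mat_mult[OF S mB(3) aS mB(2) mB(3) aS mB(2)] aa by simp
  qed
  have JJ_S: "A \<odot> A + A \<odot> B \<in> S" "A \<odot> \<alpha> + B \<odot> \<alpha> \<in> S" "B \<odot> B + A \<odot> B \<in> S" using mB aS by (auto simp: li mu)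
  have JJ_N: "(J \<odot> J) \<odot> (h + X.y) = X.mat (A \<odot> m + m \<odot> B)
     ((1/2) *\<^sub>R (m \<odot> \<alpha> + h \<odot> (B \<odot> \<alpha>) + A \<odot> \<alpha> + B \<odot> \<alpha>)) (B \<odot> B + A \<odot> B)"
    unfolding JJ N X.mat_mult[OF S JJ_S hS 0 D(2)] using rS[OF JJ_S(2)] rS[OF JJ_S(3)] AAh hAB Aha
    by (simp add: bil comm[of _ h] algebra_simps)
  have mat_comb: "2 *\<^sub>R X.mat a1 b1 c1 - X.mat a2 b2 c2 = X.mat (2 *\<^sub>R a1 - a2) (2 *\<^sub>R b1 - b2) (2 *\<^sub>R c1 - c2)"
    for a1 b1 c1 a2 b2 c2
    unfolding X.mat_def by (rule vec_eqI) (simp add: X.\<rho>_lin refl_lin)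
  have UJN: "U J (h + X.y) = J"
  proof -
    have a: "2 *\<^sub>R (A \<odot> m + (1/2) *\<^sub>R (m \<odot> B + A \<odot> B)) - (A \<odot> m + m \<odot> B) = A"
      by (rule vec_lin1[OF sum1(1)]) (simp; simp add: field_simps)
    have b: "2 *\<^sub>R ((1/2) *\<^sub>R ((1/2) *\<^sub>R (m \<odot> \<alpha> + A \<odot> \<alpha>) + m \<odot> \<alpha> + (1/2) *\<^sub>R (h \<odot> (B \<odot> \<alpha>) + B \<odot> \<alpha>) + B \<odot> \<alpha>))
       - (1/2) *\<^sub>R (m \<odot> \<alpha> + h \<odot> (B \<odot> \<alpha>) + A \<odot> \<alpha> + B \<odot> \<alpha>) = \<alpha>"
      by (rule vec_lin1[OF sum1(2)]) (simp; simp add: field_simps)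
    have c: "2 *\<^sub>R (B \<odot> B + (1/2) *\<^sub>R (m \<odot> B + A \<odot> B)) - (B \<odot> B + A \<odot> B) = B"
      by (rule vec_lin1[OF sum1(3)]) (simp; simp add: field_simps)
    show ?thesis unfolding U_def JJN JJ_N mat_comb a b c by (simp only: J_def)
  qed
  have eJ: "X.e \<odot> J = J"
    unfolding J_def X.mat_def add_right
    using X.Er_Ee[OF rS(1)[OF mB(3)]] X.\<rho>_e[OF rS(1)[OF aS]] X.e_\<sigma>[OF X.Er_Ee[OF rS(1)[OF mB(2)]]] by simp
  have UJ0: "U J x = 0" if "X.e \<odot> x = (1/2) *\<^sub>R x \<or> X.e \<odot> x = 0" for x
    using that
  proof
    assume "X.e \<odot> x = (1/2) *\<^sub>R x"
    then show ?thesis using E1_special[OF X.ee eJ eJ, of x] by (simp add: U_def scaleR_2)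
  next
    assume x: "X.e \<odot> x = 0"
    show ?thesis using E1_E0[OF X.ee eJ x] E1_E0[OF X.ee E1_E1[OF X.ee eJ eJ] x] by (simp add: U_def bil)
  qed
  have py: "p \<odot> X.y = 0" using p(2) by (simp add: X.y_def X.e_def)
  have yn: "X.y \<odot> n = X.y" by (simp add: n_def bil unit_right comm[of X.y p] py)
  have nsplit: "n = h + z + l" unfolding h_def z_def l_def by (rule peirce_split)
  have e3: "r \<odot> z = (1/2) *\<^sub>R z" "r \<odot> l = 0" by (simp_all add: z_def l_def H_Eh Z_E0 r)
  have oc_yr: "oc X.y r" by (rule oc_E0[OF X.yy X.ry(2)])
  have yz: "X.y \<odot> z = 0"
    unfolding z_def H_def using ocD[OF oc_yr, of n] ocD[OF oc_yr, of "r \<odot> n"] yn X.ry by (simp add: bil)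
  have yh: "X.y \<odot> h = 0" using E1_E0[OF r rh X.ry(1)] by (simp add: comm)
  have yl: "X.y \<odot> l = X.y" using yn unfolding nsplit add_right yz yh by simp
  \<comment> \<open>\<open>n\<close> differs from \<open>h + X.y\<close> by terms in the half space
    and the 0-space of the block, which \<open>U J\<close> kills.\<close>
  have UJn: "U J n = J"
  proof -
    have "X.e \<odot> z = (1/2) *\<^sub>R z" unfolding X.e_ry add_left e3 yz by simp
    moreover have "X.e \<odot> (l - X.y) = 0" unfolding X.e_ry add_left diff_right e3 yl X.ry X.yy by simp
    ultimately have "U J z = 0" "U J (l - X.y) = 0" using UJ0 by auto
    moreover have "n = (h + X.y) + z + (l - X.y)" unfolding nsplit by simp
    ultimately have "U J n = U J (h + X.y)" by (metis U_lin(1) add.right_neutral)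
    then show ?thesis using UJN by simp
  qed
  define w where "w = U n J"
  have ww: "w \<odot> w = w" unfolding w_def U_U_idem[OF n, symmetric] UJn ..
  have "n \<odot> w = w" unfolding w_def by (rule U_E1[OF n])
  then have pw: "p \<odot> w = 0" by (simp add: n_def bil unit)
  have oc_yn: "oc X.y n" by (rule oc_even[OF X.yy]) (simp add: yn X.yy)
  \<comment> \<open>Multiplication by \<open>X.y\<close> commutes with those by \<open>n\<close> and
    \<open>r\<close>, so an eigenvector remains one; but the corner of \<open>r\<close> is
    annihilated by \<open>X.y\<close>, which excludes a nonzero eigenvalue.\<close>
  have vanish: "U r (U n x) = 0" if x: "X.y \<odot> x = c *\<^sub>R x" "c \<noteq> 0" for x c
  proof -
    have "X.y \<odot> U n x = c *\<^sub>R U n x"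
      unfolding U_idem[OF n] by (simp add: bil ocD[OF oc_yn] x(1) scaleR_diff_right)
    then have "X.y \<odot> U r (U n x) = c *\<^sub>R U r (U n x)"
      unfolding U_idem[OF r] by (simp add: bil ocD[OF oc_yr] scaleR_diff_right)
    moreover have "X.y \<odot> U r (U n x) = 0"
      unfolding comm[of X.y "U r (U n x)"] by (rule E1_E0[OF r U_E1[OF r] X.ry(1)])
    ultimately show ?thesis using x(2) by simp
  qed
  have v1: "U r (U n (X.\<rho> \<alpha>)) = 0"
  proof (rule vanish[of _ "1/2"])
    show "X.y \<odot> X.\<rho> \<alpha> = (1/2) *\<^sub>R X.\<rho> \<alpha>"
      unfolding X.y_def diff_left X.\<rho>_e[OF rS(1)[OF aS]] X.\<rho>_Eh[OF rS(1)[OF aS]] by (rule vec_eqI) simp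
  qed simp
  have v2: "U r (U n (X.\<sigma> B)) = 0"
  proof (rule vanish[of _ 1])
    show "X.y \<odot> X.\<sigma> B = 1 *\<^sub>R X.\<sigma> B" using X.\<sigma>_mult[of r B] rS[OF mB(2)] X.\<sigma>_r by simp
  qed simp
  have "U r w = U r (U n A)" unfolding w_def J_def X.mat_def by (simp add: U_lin v1 v2)
  also have "\<dots> = U h A" unfolding h_def by (rule U_fundamental_idem[OF r n rS(1)[OF mB(3)]])
  also have "\<dots> = h \<odot> m"
  proof -
    have "(h \<odot> h) \<odot> A = h \<odot> m" using as[OF hS hS mB(3)] Ah by simp
    then show ?thesis unfolding U_def Ah by (simp add: scaleR_2)
  qed
  also have "\<dots> = \<theta> *\<^sub>R r" by (simp add: m_def bil k(2))
  finally show ?thesis using that[OF ww pw] by (simp add: \<theta>_def)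
qed

end

section \<open>Measures on the lines of three-space\<close>

text \<open>Each factor \<open>1 + \<i> t\<close> is a move perpendicular to the radius. The
  argument \<beta> is spread over \<open>n\<close> moves with \<open>s = tan (\<beta> / n)\<close>;
  together they stretch by \<open>1 / cos (\<beta> / n) ^ n\<close>, close to 1, and the remaining
  stretch \<open>1 + t^2\<close> is a move followed by the opposite one.\<close>

lemma complex_factor:
  fixes w :: complex
  assumes w: "norm w > 1"
  obtains s t n where "w = (1 + \<i> * of_real s) ^ n * ((1 + \<i> * of_real t) * (1 - \<i> * of_real t))"
proof -
  define \<beta> where "\<beta> = Arg w"
  have w0: "w \<noteq> 0" using w by auto
  have wpol: "w = of_real (norm w) * cis \<beta>" using rcis_cmod_Arg[of w] by (simp add: rcis_def \<beta>_def)
  \<comment> \<open>The first bound keeps the cosine positive; the second makes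
    \<open>cos x ^ n\<close> at least \<open>1 / norm w\<close> through Bernoulli's
    inequality.\<close>
  obtain n :: nat where n: "real n > max (\<beta>\<^sup>2) (\<beta>\<^sup>2 / (2 * (1 - 1 / norm w)))" "n > 0"
    by (metis max.strict_boundedE neq0_conv of_nat_0 reals_Archimedean2 zero_le_power2 not_less)
  define x where "x = \<beta> / real n"
  have cx: "cos x \<ge> 1 - x\<^sup>2 / 2"
  proof -
    have "cos x = 1 - 2 * (sin (x/2))\<^sup>2" using cos_double_sin[of "x/2"] by simp
    moreover have "(sin (x/2))\<^sup>2 \<le> (x/2)\<^sup>2" using abs_sin_x_le_abs_x[of "x/2"] abs_le_square_iff by blast
    ultimately show ?thesis by (simp add: power_divide)
  qed
  have x2: "real n * x\<^sup>2 = \<beta>\<^sup>2 / real n" using n(2) by (simp add: x_def power2_eq_square)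
  have b1: "\<beta>\<^sup>2 / real n < 1" using n by simp
  have b2: "\<beta>\<^sup>2 / real n < 2 * (1 - 1 / norm w)"
  proof -
    define K where "K = 2 * (1 - 1 / norm w)"
    have "1 / norm w < 1" using w by (subst divide_less_eq_1_pos) auto
    then have K: "K > 0" by (simp add: K_def)
    have "\<beta>\<^sup>2 / K < real n" using n(1) by (simp add: K_def)
    then have "\<beta>\<^sup>2 < real n * K" using pos_divide_less_eq[OF K] by blast
    then have "\<beta>\<^sup>2 / real n < K" using pos_divide_less_eq[of "real n" "\<beta>\<^sup>2" K] n(2) by (simp add: mult.commute)
    then show ?thesis by (simp add: K_def)
  qed
  have "x\<^sup>2 \<le> real n * x\<^sup>2" using n(2) mult_right_mono[of 1 "real n" "x\<^sup>2"] by simp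
  then have x1: "x\<^sup>2 < 1" using x2 b1 by linarith
  have cpos: "cos x > 0" using cx x1 by linarith
  have "1 + real n * (- (x\<^sup>2 / 2)) \<le> (1 + (- (x\<^sup>2 / 2))) ^ n" by (rule Bernoulli_inequality) (use x1 in simp)
  also have "\<dots> \<le> cos x ^ n" using cx x1 by (intro power_mono) auto
  finally have "1 - \<beta>\<^sup>2 / real n / 2 \<le> cos x ^ n" using x2 by simp
  moreover have "q \<le> C" if "1 - t / 2 \<le> C" "t < 2 * (1 - q)" for q C t :: real
  proof -
    have "t < 2 - 2 * q" using that(2) by (simp add: right_diff_distrib)
    then have "q < 1 - t / 2" by (simp add: field_simps)
    then show ?thesis using that(1) by (rule less_imp_le[OF less_le_trans])
  qed
  ultimately have "1 / norm w \<le> cos x ^ n" using b2 by blast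
  then have \<kappa>: "norm w * cos x ^ n \<ge> 1" using w0 by (simp add: divide_le_eq mult.commute)
  define t where "t = sqrt (norm w * cos x ^ n - 1)"
  have t: "1 + t\<^sup>2 = norm w * cos x ^ n" using \<kappa> by (simp add: t_def)
  have "1 + \<i> * of_real (tan x) = cis x / of_real (cos x)"
    using cpos by (simp add: complex_eq_iff tan_def Re_divide Im_divide power2_eq_square)
  have "(1 + \<i> * of_real (tan x)) ^ n = cis \<beta> / of_real (cos x ^ n)"
  proof -
    have "real n * x = \<beta>" using n(2) by (simp add: x_def)
    then have "cis x ^ n = cis \<beta>" using Complex.DeMoivre[of x n] by simp
    then show ?thesis unfolding \<open>1 + \<i> * of_real (tan x) = cis x / of_real (cos x)\<close> by (simp add: power_divide)
  qed
  moreover have "(1 + \<i> * of_real t) * (1 - \<i> * of_real t) = of_real (1 + t\<^sup>2)"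
    by (simp add: algebra_simps power2_eq_square complex_eq_iff)
  ultimately have "(1 + \<i> * of_real (tan x)) ^ n * ((1 + \<i> * of_real t) * (1 - \<i> * of_real t)) = w"
    unfolding t using cpos wpol by (simp add: mult.commute)
  then show ?thesis using that by metis
qed

lemma norm_orthonormal_comb:
  fixes s t :: "'c::real_inner"
  assumes "norm s = 1" "norm t = 1" "s \<bullet> t = 0" "x\<^sup>2 + y\<^sup>2 = 1"
  shows "norm (x *\<^sub>R s + y *\<^sub>R t) = 1" "norm (x *\<^sub>R t - y *\<^sub>R s) = 1"
proof -
  have i: "s \<bullet> s = 1" "t \<bullet> t = 1" "t \<bullet> s = 0" using assms by (auto simp: norm_eq_1 inner_commute)
  show "norm (x *\<^sub>R s + y *\<^sub>R t) = 1" "norm (x *\<^sub>R t - y *\<^sub>R s) = 1"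
    unfolding norm_eq_1 using i assms(3,4)
    by (simp_all add: inner_add_left inner_add_right inner_diff_left inner_diff_right power2_eq_square)
qed

lemma (in jbu) sum_mono_le: "(\<And>i. i \<in> I \<Longrightarrow> f i \<sqsubseteq> h i) \<Longrightarrow> sum f I \<sqsubseteq> sum h I"
  unfolding le_def sum_subtractf[symmetric] by (rule pos_sum) simp

text \<open>A measure on the lines of three-space (unit vectors \<open>(a, \<zeta>)\<close> with \<open>\<zeta>\<close> the equatorial component)
  that is concentrated on the north pole. In gnomonic coordinates \<open>P = \<zeta>/a\<close>, moving \<open>P\<close> along the line
  perpendicular to its radius decreases the measure, and such moves reach every point farther from the
  origin; hence the measure is monotone in the height, and additivity over frames makes it linear in \<open>a\<^sup>2\<close>.\<close>

locale polar_measure = jbu jm one for jm :: "'b::banach \<Rightarrow> 'b \<Rightarrow> 'b" (infixl "\<odot>" 70) and one :: 'b ("\<one>") +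
  fixes F :: "real \<times> complex \<Rightarrow> 'b" and g :: 'b
  assumes F_pos: "norm s = 1 \<Longrightarrow> pos (F s)"
    and F_even: "F (- s) = F s"
    and F_rot: "norm s = 1 \<Longrightarrow> norm t = 1 \<Longrightarrow> s \<bullet> t = 0 \<Longrightarrow> x\<^sup>2 + y\<^sup>2 = 1 \<Longrightarrow>
        F (x *\<^sub>R s + y *\<^sub>R t) + F (x *\<^sub>R t - y *\<^sub>R s) = F s + F t"
    and F_frame: "a\<^sup>2 + \<rho>\<^sup>2 = 1 \<Longrightarrow> norm \<eta> = 1 \<Longrightarrow>
        F (a, of_real \<rho> * \<eta>) + F (0, \<i> * \<eta>) + F (\<rho>, - of_real a * \<eta>) = g"
    and F_pole: "F (1, 0) = g" and F_eq: "norm \<eta> = 1 \<Longrightarrow> F (0, \<eta>) = 0"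
begin

lemma norm_pair: "norm (a, \<zeta>) = 1 \<longleftrightarrow> a\<^sup>2 + (norm \<zeta>)\<^sup>2 = 1" for a :: real and \<zeta> :: complex
  by (simp add: norm_prod_def)

lemma polar: obtains \<rho> \<eta> where "(\<zeta>::complex) = of_real \<rho> * \<eta>" "\<rho> = norm \<zeta>" "norm \<eta> = 1"
proof (cases "\<zeta> = 0")
  case True
  then show ?thesis using that[of 0 1] by simp
next
  case False
  then show ?thesis using that[of "norm \<zeta>" "\<zeta> / of_real (norm \<zeta>)"] by (simp add: norm_divide)
qed

text \<open>The frame through \<open>(a, \<zeta>)\<close> that contains an equatorial vector, whose
  value is 0.\<close>

lemma F_compl:
  assumes "norm (a, \<zeta>) = 1"
  obtains z where "norm z = 1" "(fst z)\<^sup>2 = 1 - a\<^sup>2" "F (a, \<zeta>) + F z = g"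
proof -
  obtain \<rho> \<eta> where p: "\<zeta> = of_real \<rho> * \<eta>" "\<rho> = norm \<zeta>" "norm \<eta> = 1" by (rule polar)
  have 1: "a\<^sup>2 + \<rho>\<^sup>2 = 1" using assms unfolding norm_pair p(2) .
  show ?thesis
  proof (rule that[of "(\<rho>, - of_real a * \<eta>)"])
    show "norm (\<rho>, - of_real a * \<eta>) = 1" unfolding norm_pair using 1 p(3) by (simp add: norm_mult)
    show "F (a, \<zeta>) + F (\<rho>, - of_real a * \<eta>) = g" unfolding p(1) using F_frame[OF 1 p(3)] F_eq[of "\<i> * \<eta>"] p(3) by (simp add: norm_mult)
  qed (use 1 in simp)
qed

lemma F_le_g: "norm s = 1 \<Longrightarrow> F s \<sqsubseteq> g"
proof (cases s)
  case (Pair a \<zeta>)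
  assume "norm s = 1"
  then have "norm (a, \<zeta>) = 1" by (simp add: Pair)
  then obtain z where z: "norm z = 1" "F (a, \<zeta>) + F z = g" by (rule F_compl)
  show ?thesis using F_pos[OF z(1)] unfolding le_def Pair z(2)[symmetric] by simp
qed

text \<open>Rotate in the plane spanned by the given vector and an equatorial one of value 0: the
  two new values add up to the old one, and the second is positive.\<close>

lemma F_tilt:
  assumes s: "a\<^sup>2 + \<rho>\<^sup>2 = 1" "norm \<eta> = 1" and xy: "x\<^sup>2 + y\<^sup>2 = 1"
  shows "F (x *\<^sub>R (a, of_real \<rho> * \<eta>) + y *\<^sub>R (0, \<i> * \<eta>)) \<sqsubseteq> F (a, of_real \<rho> * \<eta>)"
proof -
  let ?s = "(a, of_real \<rho> * \<eta>)" and ?q = "(0::real, \<i> * \<eta>)"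
  have n: "norm ?s = 1" "norm ?q = 1" unfolding norm_pair using s by (auto simp: norm_mult)
  have o: "?s \<bullet> ?q = 0" by (simp add: inner_complex_def algebra_simps)
  have n2: "norm (x *\<^sub>R ?q - y *\<^sub>R ?s) = 1" by (rule norm_orthonormal_comb(2)[OF n o xy])
  have "F (x *\<^sub>R ?s + y *\<^sub>R ?q) + F (x *\<^sub>R ?q - y *\<^sub>R ?s) = F ?s"
    using F_rot[OF n o xy] F_eq[of "\<i> * \<eta>"] s(2) by (simp add: norm_mult)
  then have "F ?s - F (x *\<^sub>R ?s + y *\<^sub>R ?q) = F (x *\<^sub>R ?q - y *\<^sub>R ?s)" by (simp only: eq_diff_eq diff_eq_eq add.commute)
  then show ?thesis unfolding le_def using F_pos[OF n2] by simp
qed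

definition G :: "complex \<Rightarrow> 'b" where "G P = F ((1 / sqrt (1 + (norm P)\<^sup>2)) *\<^sub>R (1, P))"

lemma G_unit:
  assumes "norm (a, \<zeta>) = 1" "a > 0"
  shows "F (a, \<zeta>) = G (\<zeta> / of_real a)" "1 + (norm (\<zeta> / of_real a))\<^sup>2 = 1 / a\<^sup>2"
proof -
  have 1: "a\<^sup>2 + (norm \<zeta>)\<^sup>2 = 1" using assms norm_pair by blast
  show 2: "1 + (norm (\<zeta> / of_real a))\<^sup>2 = 1 / a\<^sup>2"
    using assms(2) 1 by (simp add: norm_divide power_divide field_simps)
  have "1 / sqrt (1 / a\<^sup>2) = a" using assms(2) by (simp add: real_sqrt_divide)
  then show "F (a, \<zeta>) = G (\<zeta> / of_real a)" unfolding G_def 2 using assms(2) by (simp add: scaleR_conv_of_real)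
qed

lemma G_step: "G (P * (1 + \<i> * of_real t)) \<sqsubseteq> G P"
proof -
  obtain \<rho> \<eta> where p: "P = of_real \<rho> * \<eta>" "\<rho> = norm P" "norm \<eta> = 1" by (rule polar)
  \<comment> \<open>\<open>M\<close> and \<open>N\<close> are the lengths of \<open>(1, P)\<close>
    and \<open>(1, P (1 + \<i> t))\<close>; \<open>M / N\<close> and \<open>t \<rho> / N\<close> are
    cosine and sine of the tilt.\<close>
  define M where "M = sqrt (1 + \<rho>\<^sup>2)"
  define N where "N = sqrt (1 + \<rho>\<^sup>2 + (t * \<rho>)\<^sup>2)"
  have M: "M > 0" "M\<^sup>2 = 1 + \<rho>\<^sup>2" unfolding M_def by (auto simp: add_pos_nonneg)
  have N: "N > 0" "N\<^sup>2 = 1 + \<rho>\<^sup>2 + (t * \<rho>)\<^sup>2"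
    unfolding N_def by (auto simp: add_pos_nonneg intro!: real_sqrt_pow2 add_nonneg_nonneg)
  have nP: "1 + (norm (P * (1 + \<i> * of_real t)))\<^sup>2 = N\<^sup>2"
  proof -
    have "(norm (1 + \<i> * of_real t))\<^sup>2 = 1 + t\<^sup>2" by (simp add: cmod_power2)
    then show ?thesis unfolding norm_mult power_mult_distrib N(2) p(2)[symmetric] by (simp add: algebra_simps)
  qed
  have 1: "(1/M)\<^sup>2 + (\<rho>/M)\<^sup>2 = 1"
    using M(1) by (simp add: power_divide add_divide_distrib[symmetric] M(2)[symmetric])
  have MN: "M\<^sup>2 + (t * \<rho>)\<^sup>2 = N\<^sup>2" by (simp add: M N)
  have 2: "(M/N)\<^sup>2 + (t*\<rho>/N)\<^sup>2 = 1"
    unfolding power_divide add_divide_distrib[symmetric] MN using N(1) by simp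
  have i: "F ((M/N) *\<^sub>R (1/M, of_real (\<rho>/M) * \<eta>) + (t*\<rho>/N) *\<^sub>R (0, \<i> * \<eta>)) \<sqsubseteq> F (1/M, of_real (\<rho>/M) * \<eta>)"
    by (rule F_tilt[OF 1 p(3) 2])
  have e1: "(M/N) *\<^sub>R (1/M, of_real (\<rho>/M) * \<eta>) + (t*\<rho>/N) *\<^sub>R (0, \<i> * \<eta>) = (1/N) *\<^sub>R (1, P * (1 + \<i> * of_real t))"
    using M N by (simp add: p(1) scaleR_conv_of_real field_simps)
  have e2: "(1/M, of_real (\<rho>/M) * \<eta>) = (1/M) *\<^sub>R (1, P)" by (simp add: p(1) scaleR_conv_of_real)
  have sN: "sqrt (N\<^sup>2) = N" using N(1) by simp
  show ?thesis unfolding G_def nP p(2)[symmetric] sN M_def[symmetric] e1[symmetric] e2[symmetric] by (rule i)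
qed

lemma G_mono:
  assumes "P \<noteq> 0" "norm P < norm Q"
  shows "G Q \<sqsubseteq> G P"
proof -
  have "norm (Q / P) > 1" using assms by (simp add: norm_divide)
  then obtain s t n where w: "Q / P = (1 + \<i> * of_real s) ^ n * ((1 + \<i> * of_real t) * (1 - \<i> * of_real t))"
    using complex_factor by blast
  have pw: "G (P * (1 + \<i> * of_real s) ^ n) \<sqsubseteq> G P" for n
  proof (induction n)
    case (Suc n)
    have "G (P * (1 + \<i> * of_real s) ^ n * (1 + \<i> * of_real s)) \<sqsubseteq> G (P * (1 + \<i> * of_real s) ^ n)" by (rule G_step)
    moreover have "P * (1 + \<i> * of_real s) ^ Suc n = P * (1 + \<i> * of_real s) ^ n * (1 + \<i> * of_real s)"
      by (simp add: mult_ac)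
    ultimately show ?case using le_trans[OF _ Suc] by (simp only:)
  qed simp
  let ?R = "P * (1 + \<i> * of_real s) ^ n"
  have "G (?R * (1 + \<i> * of_real t) * (1 + \<i> * of_real (- t))) \<sqsubseteq> G (?R * (1 + \<i> * of_real t))" by (rule G_step)
  moreover have "G (?R * (1 + \<i> * of_real t)) \<sqsubseteq> G ?R" by (rule G_step)
  moreover have "Q = ?R * (1 + \<i> * of_real t) * (1 + \<i> * of_real (- t))"
  proof -
    have "Q = P * (Q / P)" using assms(1) by simp
    then show ?thesis unfolding w by (simp add: mult.assoc)
  qed
  ultimately show ?thesis using le_trans[OF le_trans pw[of n]] by simp
qed

text \<open>The gnomonic chart covers the open upper hemisphere and \<open>G_mono\<close> excludes
  its pole, so equator and pole are treated apart; the lower hemisphere is folded up by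
  \<open>F_even\<close>.\<close>

lemma F_mono:
  assumes s: "norm s = 1" and t: "norm t = 1" and h: "(fst t)\<^sup>2 < (fst s)\<^sup>2"
  shows "F t \<sqsubseteq> F s"
proof -
  have pos_case: "F (a', \<zeta>') \<sqsubseteq> F (a, \<zeta>)"
    if n: "norm (a, \<zeta>) = 1" "norm (a', \<zeta>') = 1" and a: "a > 0" "a' \<ge> 0" "a'\<^sup>2 < a\<^sup>2" for a \<zeta> a' \<zeta>'
  proof (cases "a' = 0")
    case True
    then have "norm \<zeta>' = 1" using n(2) by (simp add: norm_prod_def)
    then show ?thesis using True F_eq F_pos[OF n(1)] by (simp add: pos_le)
  next
    case False
    then have a': "a' > 0" using a by simp
    show ?thesis
    proof (cases "\<zeta> = 0")
      case True
      then have "a = 1" using n(1) a(1) by (simp add: norm_prod_def)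
      then show ?thesis using True F_pole F_le_g[OF n(2)] by simp
    next
      case False
      have "1 / a\<^sup>2 < 1 / a'\<^sup>2" using a a' by (simp add: frac_less2)
      then have "(norm (\<zeta> / of_real a))\<^sup>2 < (norm (\<zeta>' / of_real a'))\<^sup>2"
        using G_unit(2)[OF n(1) a(1)] G_unit(2)[OF n(2) a'] by linarith
      then have "norm (\<zeta> / of_real a) < norm (\<zeta>' / of_real a')" by (rule power2_less_imp_less) simp
      then show ?thesis using G_mono[of "\<zeta> / of_real a"] False a(1) G_unit(1)[OF n(1) a(1)] G_unit(1)[OF n(2) a'] by simp
    qed
  qed
  have flip: "\<exists>a \<zeta>. norm (a, \<zeta>) = 1 \<and> a \<ge> 0 \<and> a\<^sup>2 = (fst u)\<^sup>2 \<and> F (a, \<zeta>) = F u" if "norm u = 1" for u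
  proof (cases "fst u \<ge> 0")
    case True
    then show ?thesis using that by (intro exI[of _ "fst u"] exI[of _ "snd u"]) simp
  next
    case False
    have "(- fst u, - snd u) = - u" by (simp add: prod_eq_iff)
    then show ?thesis using that False F_even[of u] by (intro exI[of _ "- fst u"] exI[of _ "- snd u"]) simp
  qed
  obtain a \<zeta> where a: "norm (a, \<zeta>) = 1" "a \<ge> 0" "a\<^sup>2 = (fst s)\<^sup>2" "F (a, \<zeta>) = F s" using flip[OF s] by blast
  obtain a' \<zeta>' where a': "norm (a', \<zeta>') = 1" "a' \<ge> 0" "a'\<^sup>2 = (fst t)\<^sup>2" "F (a', \<zeta>') = F t" using flip[OF t] by blast
  have "a > 0" using a h by (metis less_eq_real_def not_less zero_le_power2 zero_power2)
  then show ?thesis using pos_case[OF a(1) a'(1) _ a'(2)] a a' h by simp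
qed

text \<open>In the plane orthogonal to \<omega>, rotating the highest vector towards the equator
  attains every squared height up to \<open>1 - (fst \<omega>)^2\<close>. With the third vector
  \<open>z\<close> of the frame, \<open>F \<omega> + F y\<close> is \<open>g - F z\<close>, the
  value at a complement of \<open>z\<close>.\<close>

lemma F_add:
  assumes \<omega>: "norm \<omega> = 1" and \<alpha>: "\<alpha> \<ge> 0" "(fst \<omega>)\<^sup>2 + \<alpha> \<le> 1"
  obtains y \<omega>' where "norm y = 1" "(fst y)\<^sup>2 = \<alpha>" "norm \<omega>' = 1" "(fst \<omega>')\<^sup>2 = (fst \<omega>)\<^sup>2 + \<alpha>" "F \<omega> + F y = F \<omega>'"
proof -
  obtain a \<zeta> where az: "\<omega> = (a, \<zeta>)" by (cases \<omega>)
  obtain \<rho> \<eta> where p: "\<zeta> = of_real \<rho> * \<eta>" "\<rho> = norm \<zeta>" "norm \<eta> = 1" by (rule polar)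
  have 1: "a\<^sup>2 + \<rho>\<^sup>2 = 1" using \<omega> unfolding az norm_pair p(2) .
  have \<alpha>\<rho>: "\<alpha> \<le> \<rho>\<^sup>2" using \<alpha>(2) 1 az by simp
  show ?thesis
  proof (cases "\<rho> = 0")
    case True
    then have "\<alpha> = 0" using \<alpha> \<alpha>\<rho> by simp
    then show ?thesis using that[of "(0, 1)" \<omega>] \<omega> F_eq[of 1] by (simp add: norm_prod_def)
  next
    case False
    then have \<rho>: "\<rho> > 0" using p(2) by simp
    define x where "x = sqrt \<alpha> / \<rho>"
    have x2: "x\<^sup>2 = \<alpha> / \<rho>\<^sup>2" using \<alpha>(1) by (simp add: x_def power_divide)
    have "x\<^sup>2 \<le> 1" using \<alpha>\<rho> \<rho> unfolding x2 by simp
    define y where "y = sqrt (1 - x\<^sup>2)"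
    have xy: "x\<^sup>2 + y\<^sup>2 = 1" using \<open>x\<^sup>2 \<le> 1\<close> by (simp add: y_def)
    let ?\<nu> = "(\<rho>, - of_real a * \<eta>)" and ?q = "(0::real, \<i> * \<eta>)"
    have n: "norm ?\<nu> = 1" "norm ?q = 1" unfolding norm_pair using 1 p(3) by (auto simp: norm_mult)
    have o: "?\<nu> \<bullet> ?q = 0" by (simp add: inner_complex_def algebra_simps)
    define u where "u = x *\<^sub>R ?\<nu> + y *\<^sub>R ?q"
    define z where "z = x *\<^sub>R ?q - y *\<^sub>R ?\<nu>"
    have nu: "norm u = 1" unfolding u_def by (rule norm_orthonormal_comb(1)[OF n o xy])
    have nz: "norm z = 1" unfolding z_def by (rule norm_orthonormal_comb(2)[OF n o xy])
    have fu: "(fst u)\<^sup>2 = \<alpha>" using \<rho> x2 by (simp add: u_def power_mult_distrib)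
    have fz: "(fst z)\<^sup>2 = 1 - a\<^sup>2 - \<alpha>"
    proof -
      have "(fst z)\<^sup>2 = (1 - x\<^sup>2) * \<rho>\<^sup>2" using xy by (simp add: z_def power_mult_distrib)
      also have "\<dots> = \<rho>\<^sup>2 - \<alpha>" using \<rho> by (simp add: x2 left_diff_distrib)
      finally show ?thesis using 1 by simp
    qed
    have "F u + F z = F ?\<nu> + F ?q" unfolding u_def z_def by (rule F_rot[OF n o xy])
    moreover have "F \<omega> + F ?q + F ?\<nu> = g" using F_frame[OF 1 p(3)] unfolding az p(1) by simp
    moreover have "w + u + z = g" if "u + z = n + q" "w + q + n = g" for u z n q w g :: 'b
      using that by (metis add.assoc add.commute)
    ultimately have s: "F \<omega> + F u + F z = g" by blast
    obtain b \<xi> where "z = (b, \<xi>)" by (cases z)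
    then obtain \<omega>' where w': "norm \<omega>' = 1" "(fst \<omega>')\<^sup>2 = 1 - (fst z)\<^sup>2" "F z + F \<omega>' = g"
      using F_compl[of b \<xi>] nz by auto
    have "F \<omega> + F u = F \<omega>'" using s unfolding w'(3)[symmetric] by (simp add: add.commute)
    then show ?thesis using that[OF nu fu w'(1)] w'(2) fz az by simp
  qed
qed

lemma F_sum:
  assumes u: "u \<ge> 0" "u \<le> 1" and k: "real k * u \<le> 1"
  shows "\<exists>\<omega> y. norm \<omega> = 1 \<and> (fst \<omega>)\<^sup>2 = real k * u \<and> F \<omega> = (\<Sum>j<k. F (y j)) \<and> (\<forall>j. norm (y j) = 1 \<and> (fst (y j))\<^sup>2 = u)"
  using k
proof (induction k)
  case 0
  show ?case
    using u by (intro exI[of _ "(0, 1)"] exI[of _ "\<lambda>_. (sqrt u, of_real (sqrt (1 - u)))"])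
      (auto simp: norm_prod_def F_eq)
next
  case (Suc k)
  have "real k * u \<le> 1" using Suc.prems u by (simp add: algebra_simps)
  then obtain \<omega> y where w: "norm \<omega> = 1" "(fst \<omega>)\<^sup>2 = real k * u" "F \<omega> = (\<Sum>j<k. F (y j))"
    "\<forall>j. norm (y j) = 1 \<and> (fst (y j))\<^sup>2 = u" using Suc.IH by blast
  have "(fst \<omega>)\<^sup>2 + u \<le> 1" using Suc.prems w(2) by (simp add: algebra_simps)
  then obtain z \<omega>' where z: "norm z = 1" "(fst z)\<^sup>2 = u" "norm \<omega>' = 1" "(fst \<omega>')\<^sup>2 = (fst \<omega>)\<^sup>2 + u" "F \<omega> + F z = F \<omega>'"
    using F_add[OF w(1) u(1)] by blast
  show ?case
  proof (intro exI[of _ \<omega>'] exI[of _ "y(k := z)"] conjI)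
    show "(fst \<omega>')\<^sup>2 = real (Suc k) * u" using z(4) w(2) by (simp add: algebra_simps)
    have "(\<Sum>j<k. F ((y(k := z)) j)) = (\<Sum>j<k. F (y j))" by (intro sum.cong) auto
    then show "F \<omega>' = (\<Sum>j<Suc k. F ((y(k := z)) j))" using z(5) w(3) by simp
  qed (use z w in auto)
qed

lemma pos_g: "pos g" using F_pos[of "(1, 0)"] F_pole by (simp add: norm_prod_def)

text \<open>By \<open>F_sum\<close> there are \<open>N\<close> vectors of squared height
  \<open>1 / N\<close> whose values sum to at most \<open>g\<close>, and each of these values
  dominates \<open>F x\<close>.\<close>

lemma F_small:
  assumes x: "norm x = 1" and N: "N > 0" "(fst x)\<^sup>2 < 1 / real N"
  shows "F x \<sqsubseteq> (1 / real N) *\<^sub>R g"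
proof -
  have "1 / real N \<ge> 0" "1 / real N \<le> 1" "real N * (1 / real N) \<le> 1" using N by auto
  then obtain \<omega> y where w: "norm \<omega> = 1" "F \<omega> = (\<Sum>j<N. F (y j))" "\<forall>j. norm (y j) = 1 \<and> (fst (y j))\<^sup>2 = 1 / real N"
    using F_sum by blast
  have "(\<Sum>j<N. F x) \<sqsubseteq> (\<Sum>j<N. F (y j))" by (rule sum_mono_le) (use F_mono[OF _ x] w(3) N in simp)
  then have "real N *\<^sub>R F x \<sqsubseteq> g" using w F_le_g[OF w(1)] le_trans by (simp add: scaleR_conv_of_real sum_constant_scaleR)
  then have "(1 / real N) *\<^sub>R (real N *\<^sub>R F x) \<sqsubseteq> (1 / real N) *\<^sub>R g" by (rule le_scale) simp
  then show ?thesis using N by simp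
qed

lemma F_upper:
  assumes x: "norm x = 1"
  shows "F x \<sqsubseteq> (fst x)\<^sup>2 *\<^sub>R g"
proof (cases "(fst x)\<^sup>2 < 1")
  case False
  have "(fst x)\<^sup>2 + (norm (snd x))\<^sup>2 = 1" using x norm_pair[of "fst x" "snd x"] by simp
  moreover have "(norm (snd x))\<^sup>2 \<ge> 0" by simp
  ultimately have "(fst x)\<^sup>2 = 1" using False by linarith
  then show ?thesis using F_le_g[OF x] by simp
next
  case True
  define a where "a = (fst x)\<^sup>2"
  have a: "0 \<le> a" "a < 1" using True by (auto simp: a_def)
  have "F x \<sqsubseteq> a *\<^sub>R g"
  proof (rule le_eps[of _ _ g])
    fix \<epsilon> :: real assume e: "\<epsilon> > 0"
    obtain N :: nat where N1: "1 / \<epsilon> < real N" using reals_Archimedean2 by blast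
    have "0 < 1 / \<epsilon>" using e by simp
    then have N0: "real N > 0" using N1 by linarith
    have N: "N > 0" "1 / real N < \<epsilon>" using N0 N1 e by (simp_all add: field_simps)
    define m where "m = nat \<lfloor>a * real N\<rfloor> + 1"
    have m: "a * real N < real m" "real m \<le> a * real N + 1" using a N by (auto simp: m_def) linarith+
    have mN: "m \<le> N"
    proof -
      have "a * real N < real N" using a N by simp
      then have "\<lfloor>a * real N\<rfloor> < int N" by linarith
      then show ?thesis using a N unfolding m_def by (simp add: nat_less_iff Suc_le_eq)
    qed
    have m0: "m > 0" by (simp add: m_def)
    \<comment> \<open>Strictly below \<open>1 / N\<close>, so that \<open>F_small\<close> applies at
      squared height \<open>u\<close>, while \<open>m * u\<close> is still above
      \<open>a\<close>.\<close>
    define u where "u = (a / real m + 1 / real N) / 2"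
    have am: "a / real m < 1 / real N" using m(1) m0 N(1) by (simp add: field_simps)
    have am0: "0 \<le> a / real m" using a by simp
    have avg: "b < (b + c) / 2" "(b + c) / 2 < c" if "b < c" for b c :: real using that by simp_all
    have u1: "a / real m < u" unfolding u_def by (rule avg[OF am])
    have u2: "u < 1 / real N" unfolding u_def by (rule avg[OF am])
    have u3: "0 \<le> u" using am0 u1 by (rule less_imp_le[OF le_less_trans])
    note u = u1 u2 u3
    have mu: "real m * u \<le> 1"
    proof -
      have "real m * u \<le> real N * (1 / real N)" using u mN by (intro mult_mono) auto
      then show ?thesis using N by simp
    qed
    have "1 / real N \<le> 1" using N(1) by simp
    then have u4: "u \<le> 1" using u(2) by linarith
    obtain \<omega> y where w: "norm \<omega> = 1" "(fst \<omega>)\<^sup>2 = real m * u" "F \<omega> = (\<Sum>j<m. F (y j))"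
        "\<forall>j. norm (y j) = 1 \<and> (fst (y j))\<^sup>2 = u"
      using F_sum[OF u(3) u4 mu] by blast
    have "F x \<sqsubseteq> F \<omega>"
    proof (rule F_mono[OF w(1) x])
      show "(fst x)\<^sup>2 < (fst \<omega>)\<^sup>2" using u(1) m0 unfolding w(2) a_def[symmetric] by (simp add: field_simps)
    qed
    also have "F \<omega> \<sqsubseteq> (\<Sum>j<m. (1 / real N) *\<^sub>R g)" unfolding w(3) by (rule sum_mono_le) (use F_small w(4) u(2) N in simp)
    also have "(\<Sum>j<m. (1 / real N) *\<^sub>R g) = (real m / real N) *\<^sub>R g" by (simp add: sum_constant_scaleR)
    also have "(real m / real N) *\<^sub>R g \<sqsubseteq> (a + \<epsilon>) *\<^sub>R g"
    proof (rule le_scale_left[OF pos_g])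
      have "real m / real N \<le> a + 1 / real N" using m(2) N by (simp add: field_simps)
      then show "real m / real N \<le> a + \<epsilon>" using N(2) by linarith
    qed
    finally show "F x \<sqsubseteq> a *\<^sub>R g + \<epsilon> *\<^sub>R g" by (simp add: scaleR_add_left)
  qed
  then show ?thesis by (simp add: a_def)
qed

text \<open>The upper bound for a complementary vector is the lower bound for
  \<open>x\<close>.\<close>

theorem F_eq_height:
  assumes x: "norm x = 1"
  shows "F x = (fst x)\<^sup>2 *\<^sub>R g"
proof (rule le_antisym[OF F_upper[OF x]])
  obtain z where z: "norm z = 1" "(fst z)\<^sup>2 = 1 - (fst x)\<^sup>2" "F x + F z = g"
    using F_compl[of "fst x" "snd x"] x by auto
  have "F z \<sqsubseteq> (1 - (fst x)\<^sup>2) *\<^sub>R g" using F_upper[OF z(1)] z(2) by simp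
  moreover have "F z = g - F x" using z(3) by (metis add_diff_cancel_left')
  ultimately show "(fst x)\<^sup>2 *\<^sub>R g \<sqsubseteq> F x" unfolding le_def by (simp add: scaleR_diff_left algebra_simps)
qed

end

text \<open>A copy of the symmetric three by three matrices: \<open>x\<close> exchanges \<open>r\<close> with \<open>e\<^sub>2\<close>, \<open>v\<close> exchanges \<open>r\<close> with \<open>e\<^sub>3\<close>.\<close>

locale sym3 = X: exchange jm one r x + Y: exchange jm one r v
  for jm :: "'a::banach \<Rightarrow> 'a \<Rightarrow> 'a" (infixl "\<odot>" 70) and one :: 'a ("\<one>") and r x v :: 'a +
  assumes orth: "Y.y \<odot> x = 0"
begin

lemma e23: "Y.y \<odot> X.y = 0" "X.y \<odot> Y.y = 0"
proof -
  have "Y.y \<odot> X.e = 0" unfolding X.e_def by (rule X.E0_E0[OF Y.yy orth orth])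
  then show "Y.y \<odot> X.y = 0" by (simp add: X.y_def X.bil Y.ry)
  then show "X.y \<odot> Y.y = 0" by (simp add: X.comm)
qed

lemma e2v: "X.y \<odot> v = 0"
proof -
  have "Y.e \<odot> X.y = 0" unfolding Y.e_ry X.add_left X.ry e23 by simp
  then have "v \<odot> X.y = 0" using X.E1_E0[OF Y.ee Y.ve(2)] by blast
  then show ?thesis by (simp add: X.comm)
qed

text \<open>The image of \<open>v\<close> under the swap of \<open>r\<close> and \<open>X.y\<close>,
  hence the off-diagonal unit between the second and the third idempotent.\<close>

definition x23 where "x23 = 2 *\<^sub>R (x \<odot> v)"

lemma ev: "X.e \<odot> v = (1/2) *\<^sub>R v" unfolding X.e_ry X.add_left Y.v e2v by simp
lemma ex: "Y.e \<odot> x = (1/2) *\<^sub>R x" unfolding Y.e_ry X.add_left X.v orth by simp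
lemma \<sigma>v: "X.\<sigma> v = x23" unfolding x23_def by (rule X.\<sigma>_Eh[OF ev])
lemma \<sigma>e3: "X.\<sigma> Y.y = Y.y"
  by (rule X.\<sigma>_E0) (simp add: X.e_ry X.add_left Y.ry e23)

lemma table:
  "r \<odot> r = r" "r \<odot> X.y = 0" "r \<odot> Y.y = 0" "r \<odot> x = (1/2) *\<^sub>R x" "r \<odot> v = (1/2) *\<^sub>R v" "r \<odot> x23 = 0"
  "X.y \<odot> X.y = X.y" "X.y \<odot> Y.y = 0" "X.y \<odot> x = (1/2) *\<^sub>R x" "X.y \<odot> v = 0" "X.y \<odot> x23 = (1/2) *\<^sub>R x23"
  "Y.y \<odot> Y.y = Y.y" "Y.y \<odot> x = 0" "Y.y \<odot> v = (1/2) *\<^sub>R v" "Y.y \<odot> x23 = (1/2) *\<^sub>R x23"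
  "x \<odot> x = r + X.y" "x \<odot> v = (1/2) *\<^sub>R x23" "x \<odot> x23 = (1/2) *\<^sub>R v"
  "v \<odot> v = r + Y.y" "v \<odot> x23 = (1/2) *\<^sub>R x" "x23 \<odot> x23 = X.y + Y.y"
proof -
  show "r \<odot> r = r" "r \<odot> X.y = 0" "r \<odot> Y.y = 0" "r \<odot> x = (1/2) *\<^sub>R x" "r \<odot> v = (1/2) *\<^sub>R v"
    by (rule X.r X.ry Y.ry X.v Y.v)+
  show "X.y \<odot> X.y = X.y" "X.y \<odot> Y.y = 0" "X.y \<odot> x = (1/2) *\<^sub>R x" "X.y \<odot> v = 0"
    by (rule X.yy e23 X.yv e2v)+
  show "Y.y \<odot> Y.y = Y.y" "Y.y \<odot> x = 0" "Y.y \<odot> v = (1/2) *\<^sub>R v" by (rule Y.yy orth Y.yv)+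
  show "r \<odot> x23 = 0" using X.\<sigma>_mult[of X.y v] unfolding X.\<sigma>_y \<sigma>v e2v by (simp add: X.refl_lin)
  show "X.y \<odot> x23 = (1/2) *\<^sub>R x23" using X.\<sigma>_mult[of r v] unfolding X.\<sigma>_r \<sigma>v Y.v X.\<sigma>_scale by simp
  show "Y.y \<odot> x23 = (1/2) *\<^sub>R x23" using X.\<sigma>_mult[of Y.y v] unfolding \<sigma>e3 \<sigma>v Y.yv X.\<sigma>_scale by simp
  show "x \<odot> x = r + X.y" using X.e_ry X.e_def by metis
  show "x \<odot> v = (1/2) *\<^sub>R x23" by (simp add: x23_def)
  show "x \<odot> x23 = (1/2) *\<^sub>R v" unfolding x23_def X.scaleR_right X.vv_Eh[OF ev] by simp
  show "v \<odot> v = r + Y.y" using Y.e_ry Y.e_def by metis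
  show "v \<odot> x23 = (1/2) *\<^sub>R x" unfolding x23_def X.scaleR_right X.comm[of x v] Y.vv_Eh[OF ex] by simp
  have "x23 \<odot> x23 = X.\<sigma> (v \<odot> v)" unfolding X.\<sigma>_mult \<sigma>v ..
  also have "\<dots> = X.y + Y.y" using Y.e_ry unfolding Y.e_def by (simp add: X.refl_lin X.\<sigma>_r \<sigma>e3)
  finally show "x23 \<odot> x23 = X.y + Y.y" .
qed

text \<open>The symmetric matrix with diagonal \<open>a\<close>, \<open>b\<close>, \<open>c\<close>
  and entries \<open>d\<close>, \<open>f\<close>, \<open>h\<close> in positions (1,2), (1,3),
  (2,3).\<close>

definition B where "B a b c d f h = a *\<^sub>R r + b *\<^sub>R X.y + c *\<^sub>R Y.y + d *\<^sub>R x + f *\<^sub>R v + h *\<^sub>R x23"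

lemma B_cong: "a = a' \<Longrightarrow> b = b' \<Longrightarrow> c = c' \<Longrightarrow> d = d' \<Longrightarrow> f = f' \<Longrightarrow> h = h' \<Longrightarrow> B a b c d f h = B a' b' c' d' f' h'"
  by simp

lemma B_lin: "c *\<^sub>R B a1 b1 c1 d1 f1 h1 = B (c*a1) (c*b1) (c*c1) (c*d1) (c*f1) (c*h1)"
  "B a1 b1 c1 d1 f1 h1 + B a2 b2 c2 d2 f2 h2 = B (a1+a2) (b1+b2) (c1+c2) (d1+d2) (f1+f2) (h1+h2)"
  unfolding B_def by (simp_all add: scaleR_add_left scaleR_add_right algebra_simps)

lemmas comms = X.comm[of X.y r] X.comm[of Y.y r] X.comm[of Y.y X.y]
     X.comm[of x r] X.comm[of v r] X.comm[of x23 r] X.comm[of x X.y] X.comm[of v X.y] X.comm[of x23 X.y]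
     X.comm[of x Y.y] X.comm[of v Y.y] X.comm[of x23 Y.y] X.comm[of v x] X.comm[of x23 x] X.comm[of x23 v]

lemma B_basis:
  "B a b c d f h \<odot> r = B a 0 0 (d/2) (f/2) 0"
  "B a b c d f h \<odot> X.y = B 0 b 0 (d/2) 0 (h/2)"
  "B a b c d f h \<odot> Y.y = B 0 0 c 0 (f/2) (h/2)"
  "B a b c d f h \<odot> x = B d d 0 ((a+b)/2) (h/2) (f/2)"
  "B a b c d f h \<odot> v = B f 0 f (h/2) ((a+c)/2) (d/2)"
  "B a b c d f h \<odot> x23 = B 0 h h (f/2) (d/2) ((b+c)/2)"
  unfolding B_def
  by ((rule vec_eqI, simp add: X.bil table comms; simp add: field_simps)+)

lemma B_mult: "B a b c d f h \<odot> B a' b' c' d' f' h' =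
   B (a*a' + d*d' + f*f') (b*b' + d*d' + h*h') (c*c' + f*f' + h*h')
     ((a*d' + b*d' + d*a' + d*b' + f*h' + h*f')/2) ((a*f' + c*f' + f*a' + f*c' + d*h' + h*d')/2)
     ((b*h' + c*h' + h*b' + h*c' + d*f' + f*d')/2)"
proof -
  have "B a b c d f h \<odot> B a' b' c' d' f' h' = a' *\<^sub>R (B a b c d f h \<odot> r) + b' *\<^sub>R (B a b c d f h \<odot> X.y)
      + c' *\<^sub>R (B a b c d f h \<odot> Y.y) + d' *\<^sub>R (B a b c d f h \<odot> x) + f' *\<^sub>R (B a b c d f h \<odot> v)
      + h' *\<^sub>R (B a b c d f h \<odot> x23)"
    unfolding B_def[of a' b' c' d' f' h'] by (simp only: X.add_right X.scaleR_right)
  then show ?thesis unfolding B_basis B_lin by (simp only:) (rule B_cong; simp add: field_simps)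
qed

text \<open>The rank one matrix \<open>s s^T\<close> of the vector
  \<open>(a, Re \<zeta>, Im \<zeta>)\<close>.\<close>

definition line :: "real \<times> complex \<Rightarrow> 'a"
  where "line s = (case s of (a, \<zeta>) \<Rightarrow> B (a*a) (Re \<zeta> * Re \<zeta>) (Im \<zeta> * Im \<zeta>) (a * Re \<zeta>) (a * Im \<zeta>) (Re \<zeta> * Im \<zeta>))"

text \<open>Every entry of the product contains the inner product \<open>k\<close> as a
  factor.\<close>

lemma line_orth:
  assumes "s \<bullet> t = 0"
  shows "line s \<odot> line t = 0"
proof -
  obtain a \<zeta> a' \<zeta>' where st: "s = (a, \<zeta>)" "t = (a', \<zeta>')" by (cases s, cases t)
  define k where "k = a * a' + Re \<zeta> * Re \<zeta>' + Im \<zeta> * Im \<zeta>'"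
  have k: "k = 0" using assms by (simp add: st inner_complex_def k_def)
  have "line s \<odot> line t = B (k*(a*a')) (k*(Re \<zeta> * Re \<zeta>')) (k*(Im \<zeta> * Im \<zeta>'))
     (k*(a*Re \<zeta>' + a'*Re \<zeta>)/2) (k*(a*Im \<zeta>' + a'*Im \<zeta>)/2) (k*(Re \<zeta>*Im \<zeta>' + Re \<zeta>'*Im \<zeta>)/2)"
    unfolding st line_def k_def prod.case B_mult by (rule B_cong) (simp_all add: field_simps)
  then show ?thesis unfolding k by (simp add: B_def)
qed

lemma line_idem:
  assumes "norm s = 1"
  shows "line s \<odot> line s = line s"
proof -
  obtain a \<zeta> where st: "s = (a, \<zeta>)" by (cases s)
  define k where "k = a * a + Re \<zeta> * Re \<zeta> + Im \<zeta> * Im \<zeta>"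
  have k: "k = 1"
  proof -
    have "s \<bullet> s = 1" using assms by (simp add: norm_eq_1)
    then show ?thesis by (simp add: st inner_complex_def k_def)
  qed
  have "line s \<odot> line s = B (k*(a*a)) (k*(Re \<zeta> * Re \<zeta>)) (k*(Im \<zeta> * Im \<zeta>))
     (k*(a*Re \<zeta>)) (k*(a*Im \<zeta>)) (k*(Re \<zeta>*Im \<zeta>))"
    unfolding st line_def k_def prod.case B_mult by (rule B_cong) (simp_all add: field_simps)
  then show ?thesis unfolding k st line_def by simp
qed

lemma line_rot:
  assumes "c\<^sup>2 + d\<^sup>2 = 1"
  shows "line (c *\<^sub>R s + d *\<^sub>R t) + line (c *\<^sub>R t - d *\<^sub>R s) = line s + line t"
proof -
  obtain a \<zeta> a' \<zeta>' where st: "s = (a, \<zeta>)" "t = (a', \<zeta>')" by (cases s, cases t)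
  have cd: "d * d = 1 - c * c" using assms by (simp add: power2_eq_square)
  have q: "(c*u + d*u')*(c*w + d*w') + (c*u' - d*u)*(c*w' - d*w) = u*w + u'*w'" for u u' w w' :: real
  proof -
    have "(c*u + d*u')*(c*w + d*w') + (c*u' - d*u)*(c*w' - d*w) = (c*c + d*d) * (u*w + u'*w')" by (simp add: algebra_simps)
    then show ?thesis by (simp add: cd)
  qed
  show ?thesis unfolding st line_def scaleR_Pair add_Pair diff_Pair prod.case B_lin(2)
    by (rule B_cong) (simp_all only: real_scaleR_def plus_complex.sel minus_complex.sel scaleR_complex.sel q)
qed

lemma line_frame:
  assumes a: "a\<^sup>2 + \<rho>\<^sup>2 = 1" and \<eta>: "norm \<eta> = 1"
  shows "line (a, of_real \<rho> * \<eta>) + line (0, \<i> * \<eta>) + line (\<rho>, - of_real a * \<eta>) = r + X.y + Y.y"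
proof -
  define b c where "b = Re \<eta>" and "c = Im \<eta>"
  have bc: "b * b = 1 - c * c" using \<eta> cmod_power2[of \<eta>] by (simp add: b_def c_def power2_eq_square)
  have ar: "\<rho> * \<rho> = 1 - a * a" using a by (simp add: power2_eq_square)
  have g: "\<rho> * u * (\<rho> * w) + a * u * (a * w) = u * w" for u w
  proof -
    have "\<rho> * u * (\<rho> * w) + a * u * (a * w) = (\<rho> * \<rho> + a * a) * (u * w)" by (simp add: algebra_simps)
    then show ?thesis by (simp add: ar)
  qed
  have L: "line (a, of_real \<rho> * \<eta>) = B (a*a) (\<rho>*b*(\<rho>*b)) (\<rho>*c*(\<rho>*c)) (a*(\<rho>*b)) (a*(\<rho>*c)) (\<rho>*b*(\<rho>*c))"
    "line (0, \<i> * \<eta>) = B 0 (c*c) (b*b) 0 0 (-(b*c))"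
    "line (\<rho>, - of_real a * \<eta>) = B (\<rho>*\<rho>) (a*b*(a*b)) (a*c*(a*c)) (-(a*(\<rho>*b))) (-(a*(\<rho>*c))) (a*b*(a*c))"
    unfolding line_def prod.case by (rule B_cong; simp add: b_def c_def)+
  have "line (a, of_real \<rho> * \<eta>) + line (0, \<i> * \<eta>) + line (\<rho>, - of_real a * \<eta>) = B 1 1 1 0 0 0"
    unfolding L B_lin(2)
  proof (rule B_cong)
    show "\<rho> * b * (\<rho> * b) + c * c + a * b * (a * b) = 1" using g[of b b] bc by linarith
    show "\<rho> * c * (\<rho> * c) + b * b + a * c * (a * c) = 1" using g[of c c] bc by linarith
    show "\<rho> * b * (\<rho> * c) + - (b * c) + a * b * (a * c) = 0" using g[of b c] by linarith
  qed (use ar in simp_all)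
  then show ?thesis by (simp add: B_def)
qed

lemma line_pole: "line (1, 0) = r" by (simp add: line_def B_def)

lemma line_even: "line (- s) = line s" by (cases s) (simp add: line_def)

lemma r_line: "r \<odot> line (0, \<eta>) = 0"
  by (simp add: line_def B_def X.bil table)

end

section \<open>Extending an orthoisomorphism of idempotents\<close>

lemma norm_comb_le:
  fixes z :: "'x::real_normed_vector"
  assumes g: "\<And>i. i \<in> I \<Longrightarrow> norm (g i - m i *\<^sub>R z) \<le> \<epsilon>'" and K: "(\<Sum>i\<in>I. \<bar>c i\<bar>) * \<epsilon>' \<le> \<epsilon>"
  shows "norm ((\<Sum>i\<in>I. c i *\<^sub>R g i) - (\<Sum>i\<in>I. c i * m i) *\<^sub>R z) \<le> \<epsilon>"
proof -
  have "(\<Sum>i\<in>I. c i *\<^sub>R g i) - (\<Sum>i\<in>I. c i * m i) *\<^sub>R z = (\<Sum>i\<in>I. c i *\<^sub>R (g i - m i *\<^sub>R z))"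
    by (simp add: scaleR_diff_right sum_subtractf scaleR_sum_left)
  also have "norm \<dots> \<le> (\<Sum>i\<in>I. \<bar>c i\<bar> * \<epsilon>')"
    by (rule sum_norm_le) (use g in \<open>auto intro: mult_left_mono\<close>)
  finally show ?thesis using K by (simp add: sum_distrib_right)
qed

lemma abs_le_of_norm_diff:
  fixes u s x :: "'x::real_normed_vector"
  shows "norm (u - m *\<^sub>R s) \<le> \<eta> \<Longrightarrow> norm s = 1 \<Longrightarrow> norm u \<le> norm x \<Longrightarrow> \<bar>m\<bar> \<le> norm x + \<eta>"
  using norm_triangle_ineq2[of "m *\<^sub>R s" u] by (simp add: norm_minus_commute)

context jbw
begin

lemma idem_diff: "p \<odot> p = p \<Longrightarrow> q \<odot> q = q \<Longrightarrow> q \<odot> p = p \<Longrightarrow> (q - p) \<odot> (q - p) = q - p"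
  by (simp add: bil comm[of p q])

lemma idem_le: "p \<odot> p = p \<Longrightarrow> q \<odot> q = q \<Longrightarrow> q \<odot> p = p \<Longrightarrow> p \<sqsubseteq> q"
  unfolding le_def by (rule pos_idem[OF idem_diff])

lemma norm_nz_idem: "p \<odot> p = p \<Longrightarrow> p \<noteq> 0 \<Longrightarrow> norm p = 1"
  using norm_sq[of p] by (simp add: power2_eq_square)

lemma U_sub_self: "s \<odot> s = s \<Longrightarrow> r \<odot> s = s \<Longrightarrow> U s r = s"
  by (simp add: U_def comm[of s r] scaleR_2)

lemma U_sub_norm:
  assumes r: "r \<odot> r = r" and s: "s \<odot> s = s" "r \<odot> s = s"
  shows "norm (U s x - m *\<^sub>R s) \<le> norm (U r x - m *\<^sub>R r)"
proof -
  have "U s (U r x - m *\<^sub>R r) = U s x - m *\<^sub>R s" by (simp add: U_lin U_sub[OF r s] U_sub_self[OF s])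
  then show ?thesis using U_norm[OF s(1), of "U r x - m *\<^sub>R r"] by simp
qed

text \<open>\<open>approx_scalar\<close> finds a corner where \<open>a\<close> is nearly a scalar of
  modulus almost \<open>norm a\<close>; the hypothesis, applied inside that corner, compares this
  scalar with \<open>m\<close>.\<close>

lemma norm_le_of_corners:
  assumes h: "\<And>r \<eta>. r \<odot> r = r \<Longrightarrow> r \<noteq> 0 \<Longrightarrow> \<eta> > 0 \<Longrightarrow>
      \<exists>s m. s \<odot> s = s \<and> s \<noteq> 0 \<and> r \<odot> s = s \<and> norm (U s a - m *\<^sub>R s) \<le> \<eta> \<and> \<bar>m\<bar> \<le> M + \<eta>"
    and M: "M \<ge> 0"
  shows "norm a \<le> M"
proof (cases "\<one> = 0")
  case True
  then have "a = 0" using unit[of a] by (simp add: zero_left)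
  then show ?thesis using M by simp
next
  case False
  have "norm a \<le> M + \<epsilon>" if e: "\<epsilon> > 0" for \<epsilon>
  proof -
    define \<eta> where "\<eta> = \<epsilon> / 4"
    have \<eta>: "\<eta> > 0" using e by (simp add: \<eta>_def)
    obtain p \<kappa> where p: "p \<odot> p = p" "p \<noteq> 0" "p \<odot> (p \<odot> a) = p \<odot> a" "norm (p \<odot> a - \<kappa> *\<^sub>R p) \<le> \<eta>" "\<bar>\<kappa>\<bar> \<ge> norm a - \<eta>"
      by (rule approx_scalar[OF unit False unit \<eta>]) (rule that; assumption)
    obtain s m where s: "s \<odot> s = s" "s \<noteq> 0" "p \<odot> s = s" "norm (U s a - m *\<^sub>R s) \<le> \<eta>" "\<bar>m\<bar> \<le> M + \<eta>"
      using h[OF p(1,2) \<eta>] by (elim exE conjE) (rule that; assumption)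
    have k: "norm (U s a - \<kappa> *\<^sub>R s) \<le> \<eta>"
      using U_sub_norm[OF p(1) s(1,3), of a \<kappa>] p(4) unfolding U_even[OF p(1,3)] by linarith
    have "\<bar>\<kappa> - m\<bar> = norm ((U s a - m *\<^sub>R s) - (U s a - \<kappa> *\<^sub>R s))"
      using norm_nz_idem[OF s(1,2)] by (simp add: scaleR_diff_left[symmetric])
    also have "\<dots> \<le> \<eta> + \<eta>" using s(4) k by (intro norm_triangle_le_diff) linarith
    finally show ?thesis using s(5) p(5) unfolding \<eta>_def by linarith
  qed
  then show ?thesis by (rule field_le_epsilon)
qed

lemma approx_simple_ex:
  assumes e: "\<epsilon> > 0"
  shows "\<exists>P c. finite P \<and> (\<forall>p\<in>P. p \<odot> p = p) \<and> (\<forall>p\<in>P. \<forall>q\<in>P. p \<noteq> q \<longrightarrow> p \<odot> q = 0) \<and>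
    norm (a - (\<Sum>p\<in>P. c p *\<^sub>R p)) \<le> \<epsilon>"
proof (rule approx_simple[OF unit unit[of a] e])
  fix P c
  assume "finite P" "\<And>p. p \<in> P \<Longrightarrow> p \<odot> p = p" "\<And>p q. p \<in> P \<Longrightarrow> q \<in> P \<Longrightarrow> p \<noteq> q \<Longrightarrow> p \<odot> q = 0"
    "norm (a - (\<Sum>p\<in>P. c p *\<^sub>R p)) \<le> \<epsilon>"
  then show ?thesis by (intro exI[of _ P] exI[of _ c]) simp
qed

text \<open>As the compression of \<open>t\<close> is exactly \<open>l\<close>, its half component
  is \<open>sqrt (l (1 - l))\<close> times an exchanging element \<open>x\<close>. The displayed
  element is the line through \<open>(sqrt l, sqrt (1 - l), 0)\<close>. Orthogonality of
  \<open>t\<close> to the partner of \<open>s\<close> under \<open>v\<close> makes the two partners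
  orthogonal.\<close>

lemma sym3_of_corner:
  assumes X: "exchange jm one s v" and t: "t \<odot> t = t" "t \<odot> (v \<odot> v - s) = 0"
    and l: "U s t = l *\<^sub>R s" "0 < l" "l < 1"
  obtains x where "sym3 jm one s x v"
    "t \<odot> (l *\<^sub>R s + (1 - l) *\<^sub>R (x \<odot> x - s) + sqrt (l * (1 - l)) *\<^sub>R x) =
      l *\<^sub>R s + (1 - l) *\<^sub>R (x \<odot> x - s) + sqrt (l * (1 - l)) *\<^sub>R x"
proof -
  interpret Y: exchange jm one s v by (rule X)
  note s = Y.r
  define \<kappa> where "\<kappa> = sqrt (l * (1 - l))"
  have \<kappa>: "\<kappa> > 0" "\<kappa> * \<kappa> = l * (1 - l)" using l by (simp_all add: \<kappa>_def)
  define z where "z = H s t"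
  define b where "b = Z s t"
  define x where "x = (1/\<kappa>) *\<^sub>R z"
  have zx: "z = \<kappa> *\<^sub>R x" using \<kappa>(1) by (simp add: x_def)
  have sz: "s \<odot> z = (1/2) *\<^sub>R z" unfolding z_def by (rule H_Eh[OF s])
  have sb: "s \<odot> b = 0" unfolding b_def by (rule Z_E0[OF s])
  have sx: "s \<odot> x = (1/2) *\<^sub>R x" by (simp add: x_def bil sz)
  have tt: "t = l *\<^sub>R s + \<kappa> *\<^sub>R x + b" using peirce_split[of t s] unfolding l(1) z_def[symmetric] b_def[symmetric] zx .
  have szz: "s \<odot> (z \<odot> z) = (\<kappa> * \<kappa>) *\<^sub>R s"
    using idem_parts(1)[OF s t(1)] unfolding z_def[symmetric] l(1) \<kappa>(2)
    by (simp add: bil s scaleR_diff_left right_diff_distrib)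
  have sxx: "s \<odot> (x \<odot> x) = s" using szz \<kappa>(1) unfolding x_def by (simp add: bil)
  have EX: "exchange jm one s x" by unfold_locales (rule s sx sxx)+
  interpret X: exchange jm one s x by (rule EX)
  have e3: "Y.y \<odot> s = 0" by (rule Y.ry)
  have e3t: "Y.y \<odot> t = 0" using t(2) unfolding Y.y_def Y.e_def by (simp add: comm)
  have e3z: "Y.y \<odot> z = 0"
  proof -
    have 1: "Y.y \<odot> (s \<odot> t) = 0" by (rule E0_E0[OF Y.yy e3 e3t])
    have 2: "Y.y \<odot> (s \<odot> (s \<odot> t)) = 0" by (rule E0_E0[OF Y.yy e3 1])
    show ?thesis unfolding z_def H_def by (simp add: bil 1 2)
  qed
  have S: "sym3 jm one s x v" by unfold_locales (simp add: x_def bil e3z)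
  have bx: "b \<odot> x = ((1 - l) / 2) *\<^sub>R x"
  proof -
    have "U s t \<odot> z + b \<odot> z = (1/2) *\<^sub>R z" using idem_parts(2)[OF s t(1)] unfolding z_def b_def .
    then have h: "(l / 2) *\<^sub>R z + b \<odot> z = (1/2) *\<^sub>R z" by (simp add: l(1) bil sz)
    have "b \<odot> z = ((1 - l) / 2) *\<^sub>R z" by (rule vec_lin1[OF h]) (simp add: field_simps)
    then show ?thesis by (simp add: x_def bil)
  qed
  have bxx: "b \<odot> (x \<odot> x) = (1 - l) *\<^sub>R X.y"
  proof -
    have c: "(\<one> - s) \<odot> (\<one> - s) = \<one> - s" by (rule compl_idem[OF s])
    have cb: "(\<one> - s) \<odot> b = b" by (simp add: bil unit sb)
    have cx: "(\<one> - s) \<odot> x = (1/2) *\<^sub>R x"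
      by (rule vec_eqI) (simp add: bil unit sx)
    have d: "(\<one> - s) \<odot> (x \<odot> (b \<odot> x)) + (\<one> - s) \<odot> ((b \<odot> x) \<odot> x) = b \<odot> (x \<odot> x)"
      by (rule Eh_derivation[OF c cb cx cx])
    have cxx: "(\<one> - s) \<odot> (x \<odot> x) = X.y" by (simp add: bil unit sxx X.y_def X.e_def)
    have d': "((1 - l) / 2) *\<^sub>R X.y + ((1 - l) / 2) *\<^sub>R X.y = b \<odot> (x \<odot> x)"
      using d unfolding bx scaleR_left scaleR_right cxx .
    show ?thesis using d'[symmetric] by (simp add: scaleR_add_left[symmetric])
  qed
  have by': "b \<odot> X.y = (1 - l) *\<^sub>R X.y"
    unfolding X.y_def[unfolded X.e_def] diff_right bxx comm[of b s] sb by (simp add: X.y_def X.e_def)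
  have xx: "x \<odot> x = s + X.y" using X.e_ry unfolding X.e_def .
  let ?L = "l *\<^sub>R s + (1 - l) *\<^sub>R X.y + \<kappa> *\<^sub>R x"
  have "t \<odot> ?L = (l * l + \<kappa> * \<kappa>) *\<^sub>R s + (\<kappa> * \<kappa> + (1 - l) * (1 - l)) *\<^sub>R X.y + \<kappa> *\<^sub>R x"
    unfolding tt add_left add_right scaleR_left scaleR_right s X.ry sx comm[of x s] comm[of x X.y] X.yv xx
      comm[of b s] sb bx by'
    by (rule vec_eqI) (simp; simp add: field_simps)
  also have "l * l + \<kappa> * \<kappa> = l" unfolding \<kappa>(2) by (simp add: field_simps)
  also have "\<kappa> * \<kappa> + (1 - l) * (1 - l) = 1 - l" unfolding \<kappa>(2) by (simp add: field_simps)
  finally have "t \<odot> ?L = ?L" .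
  then show ?thesis using that[OF S] unfolding X.y_def X.e_def \<kappa>_def by blast
qed

end

section \<open>Comparison of compressions in the two algebras\<close>

text \<open>The setting of Dye's theorem on orthoisomorphisms of projections; \<theta> is
  constrained on idempotents only.\<close>

locale dye = A: jbw jA oneA + B: jbw jB oneB
  for jA :: "'a::banach \<Rightarrow> 'a \<Rightarrow> 'a" (infixl "\<odot>" 70) and oneA :: 'a
    and jB :: "'b::banach \<Rightarrow> 'b \<Rightarrow> 'b" (infixl "\<otimes>" 70) and oneB :: 'b +
  fixes \<theta> :: "'a \<Rightarrow> 'b"
  assumes I2: "\<not> has_type_I2_summand jA"
    and \<theta>_idem: "p \<odot> p = p \<Longrightarrow> \<theta> p \<otimes> \<theta> p = \<theta> p"
    and \<theta>_orth: "p \<odot> p = p \<Longrightarrow> q \<odot> q = q \<Longrightarrow> p \<odot> q = 0 \<Longrightarrow> \<theta> p \<otimes> \<theta> q = 0"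
    and \<theta>_add: "p \<odot> p = p \<Longrightarrow> q \<odot> q = q \<Longrightarrow> p \<odot> q = 0 \<Longrightarrow> \<theta> (p + q) = \<theta> p + \<theta> q"
    and \<theta>_one: "\<theta> oneA = oneB"
    and \<theta>_nz: "p \<odot> p = p \<Longrightarrow> \<theta> p = 0 \<Longrightarrow> p = 0"
    and \<theta>_surj: "z \<otimes> z = z \<Longrightarrow> \<exists>p. p \<odot> p = p \<and> \<theta> p = z"
begin

lemma \<theta>_diff: "p \<odot> p = p \<Longrightarrow> q \<odot> q = q \<Longrightarrow> q \<odot> p = p \<Longrightarrow> \<theta> (q - p) = \<theta> q - \<theta> p"
  using \<theta>_add[of p "q - p"] A.idem_diff[of p q] by (simp add: A.bil A.comm[of p q])

lemma \<theta>_mono: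
  assumes "p \<odot> p = p" "q \<odot> q = q" "q \<odot> p = p"
  shows "\<theta> q \<otimes> \<theta> p = \<theta> p"
proof -
  have "\<theta> (q - p) \<otimes> \<theta> p = 0"
    by (rule \<theta>_orth[OF A.idem_diff[OF assms] assms(1)]) (simp add: A.bil assms)
  then show ?thesis using \<theta>_idem[OF assms(1)] unfolding \<theta>_diff[OF assms] by (simp add: B.bil)
qed

lemma \<theta>_le: "p \<odot> p = p \<Longrightarrow> q \<odot> q = q \<Longrightarrow> q \<odot> p = p \<Longrightarrow> B.le (\<theta> p) (\<theta> q)"
  using B.idem_le \<theta>_idem \<theta>_mono by blast

lemma \<theta>_le_one: "p \<odot> p = p \<Longrightarrow> B.le (\<theta> p) oneB"
  using \<theta>_le[of p oneA] \<theta>_one A.unit by simp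

text \<open>The compressions of \<open>\<theta> (line u)\<close> to \<open>\<theta> s\<close> form a
  measure with value \<open>\<theta> s\<close> at the pole and 0 on the equator, so at squared
  height \<open>l\<close> it is \<open>l *\<^sub>R \<theta> s\<close>. The line of that height given
  by \<open>sym3_of_corner\<close> lies under \<open>w\<close>.\<close>

lemma lower:
  assumes r: "r \<odot> r = r" "r \<noteq> 0" and w: "w \<odot> w = w" and l: "A.U r w = l *\<^sub>R r" "0 < l" "l < 1"
  shows "\<exists>s. s \<odot> s = s \<and> s \<noteq> 0 \<and> r \<odot> s = s \<and> B.le (l *\<^sub>R \<theta> s) (B.U (\<theta> s) (\<theta> w))"
proof -
  define \<delta> where "\<delta> = min l (1 - l)"
  have pr: "A.pos r" by (rule A.pos_idem[OF r(1)])
  have d: "\<delta> > 0" "A.le (\<delta> *\<^sub>R r) (A.U r w)" "A.le (A.U r w) ((1 - \<delta>) *\<^sub>R r)"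
    unfolding l(1) using l by (auto simp: \<delta>_def intro!: A.le_scale_left[OF pr])
  obtain s v t where s: "s \<odot> s = s" "s \<noteq> 0" "r \<odot> s = s" and X: "exchange jA oneA s v" and t: "t \<odot> t = t" "w \<odot> t = t"
    "(w - t) \<odot> s = 0" "t \<odot> (v \<odot> v - s) = 0"
    using A.room[OF I2 r w d] by (elim exE conjE) (rule that; assumption)
  have "A.U s (w - t) = 0" using A.U_of_E0[OF s(1)] t(3) by (simp add: A.comm)
  then have "A.U s t = A.U s (A.U r w)" by (simp add: A.U_lin A.U_sub[OF r(1) s(1,3)])
  then have ust: "A.U s t = l *\<^sub>R s" by (simp add: l(1) A.U_lin A.U_sub_self[OF s(1,3)])
  obtain x where S: "sym3 jA oneA s x v" and tL: "t \<odot> (l *\<^sub>R s + (1 - l) *\<^sub>R (x \<odot> x - s) + sqrt (l * (1 - l)) *\<^sub>R x) =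
      l *\<^sub>R s + (1 - l) *\<^sub>R (x \<odot> x - s) + sqrt (l * (1 - l)) *\<^sub>R x"
    by (rule A.sym3_of_corner[OF X t(1,4) ust l(2,3)])
  interpret S: sym3 jA oneA s x v by (rule S)
  note \<theta>s = \<theta>_idem[OF s(1)]
  have Us: "B.U (\<theta> s) (\<theta> s) = \<theta> s" by (rule B.U_of_E1[OF \<theta>s \<theta>s])
  let ?F = "\<lambda>u. B.U (\<theta> s) (\<theta> (S.line u))"
  interpret P: polar_measure jB oneB ?F "\<theta> s"
  proof unfold_locales
    fix u :: "real \<times> complex" assume u: "norm u = 1"
    show "B.pos (?F u)" by (rule B.U_pos[OF \<theta>s B.pos_idem[OF \<theta>_idem[OF S.line_idem[OF u]]]])
  next
    fix u show "?F (- u) = ?F u" by (simp add: S.line_even)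
  next
    fix u u' :: "real \<times> complex" and c d :: real
    assume u: "norm u = 1" "norm u' = 1" "u \<bullet> u' = 0" and cd: "c\<^sup>2 + d\<^sup>2 = 1"
    have n: "norm (c *\<^sub>R u + d *\<^sub>R u') = 1" "norm (c *\<^sub>R u' - d *\<^sub>R u) = 1"
      using norm_orthonormal_comb[OF u cd] by auto
    have i: "u \<bullet> u = 1" "u' \<bullet> u' = 1" "u' \<bullet> u = 0" using u by (auto simp: norm_eq_1 inner_commute)
    have o: "(c *\<^sub>R u + d *\<^sub>R u') \<bullet> (c *\<^sub>R u' - d *\<^sub>R u) = 0"
      using i u(3) by (simp add: inner_add_left inner_add_right inner_diff_left inner_diff_right)
    have "\<theta> (S.line (c *\<^sub>R u + d *\<^sub>R u')) + \<theta> (S.line (c *\<^sub>R u' - d *\<^sub>R u)) = \<theta> (S.line u) + \<theta> (S.line u')"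
      unfolding \<theta>_add[OF S.line_idem[OF n(1)] S.line_idem[OF n(2)] S.line_orth[OF o], symmetric]
        \<theta>_add[OF S.line_idem[OF u(1)] S.line_idem[OF u(2)] S.line_orth[OF u(3)], symmetric] S.line_rot[OF cd] ..
    then show "?F (c *\<^sub>R u + d *\<^sub>R u') + ?F (c *\<^sub>R u' - d *\<^sub>R u) = ?F u + ?F u'" by (simp add: B.U_lin(1)[symmetric])
  next
    fix a \<rho> :: real and \<eta> :: complex
    assume a: "a\<^sup>2 + \<rho>\<^sup>2 = 1" and \<eta>: "norm \<eta> = 1"
    let ?u = "(a, of_real \<rho> * \<eta>)" and ?v = "(0::real, \<i> * \<eta>)" and ?w = "(\<rho>, - of_real a * \<eta>)"
    have n: "norm ?u = 1" "norm ?v = 1" "norm ?w = 1"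
      using a \<eta> by (simp_all add: norm_prod_def norm_mult add.commute)
    have ee: "\<eta> \<bullet> \<eta> = 1" using \<eta> by (simp add: norm_eq_1)
    have o1: "?u \<bullet> ?v = 0" by (simp add: inner_complex_def algebra_simps)
    have o3: "?v \<bullet> ?w = 0" by (simp add: inner_complex_def algebra_simps)
    have o2: "?u \<bullet> ?w = 0"
    proof -
      have "(of_real \<rho> * \<eta>) \<bullet> (- of_real a * \<eta>) = - (\<rho> * a * (\<eta> \<bullet> \<eta>))"
        by (simp add: inner_complex_def algebra_simps)
      then show ?thesis by (simp add: ee)
    qed
    note i1 = S.line_idem[OF n(1)] and i2 = S.line_idem[OF n(2)] and i3 = S.line_idem[OF n(3)]
    note p12 = S.line_orth[OF o1] and p13 = S.line_orth[OF o2] and p23 = S.line_orth[OF o3]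
    have i12: "(S.line ?u + S.line ?v) \<odot> (S.line ?u + S.line ?v) = S.line ?u + S.line ?v"
      unfolding A.add_left A.add_right i1 i2 A.comm[of "S.line ?v" "S.line ?u"] p12 by simp
    have o12: "(S.line ?u + S.line ?v) \<odot> S.line ?w = 0" unfolding A.add_left p13 p23 by simp
    let ?E = "s + S.X.y + S.Y.y"
    have E: "\<theta> ?E = \<theta> (S.line ?u) + \<theta> (S.line ?v) + \<theta> (S.line ?w)"
      unfolding S.line_frame[OF a \<eta>, symmetric] \<theta>_add[OF i12 i3 o12] \<theta>_add[OF i1 i2 p12] ..
    have EE: "?E \<odot> ?E = ?E"
      unfolding S.line_frame[OF a \<eta>, symmetric] A.add_left[of "_ + _"] A.add_right[of _ "_ + _"] i12 i3 o12
        A.comm[of "S.line ?w" "S.line ?u + S.line ?v"] by simp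
    have Es: "?E \<odot> s = s" by (simp add: A.bil s S.X.ry S.Y.ry)
    have "B.U (\<theta> s) (\<theta> ?E) = \<theta> s" by (rule B.U_sub_self[OF \<theta>s \<theta>_mono[OF s(1) EE Es]])
    then show "?F ?u + ?F ?v + ?F ?w = \<theta> s" unfolding E by (simp add: B.U_lin)
  next
    show "?F (1, 0) = \<theta> s" by (simp add: S.line_pole Us)
  next
    fix \<eta> :: complex assume \<eta>: "norm \<eta> = 1"
    have n: "norm (0::real, \<eta>) = 1" using \<eta> by (simp add: norm_prod_def)
    show "?F (0, \<eta>) = 0"
      by (rule B.U_of_E0[OF \<theta>s \<theta>_orth[OF s(1) S.line_idem[OF n] S.r_line]])
  qed
  define u where "u = (sqrt l, complex_of_real (sqrt (1 - l)))"
  have nu: "norm u = 1" using l by (simp add: u_def norm_prod_def)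
  have L: "S.line u = l *\<^sub>R s + (1 - l) *\<^sub>R (x \<odot> x - s) + sqrt (l * (1 - l)) *\<^sub>R x"
    using l by (simp add: u_def S.line_def S.B_def S.X.y_def S.X.e_def real_sqrt_mult)
  have tl: "t \<odot> S.line u = S.line u" using tL unfolding L .
  have wl: "w \<odot> S.line u = S.line u" by (rule A.E1_trans[OF t(1,2) tl])
  have "B.le (?F u) (B.U (\<theta> s) (\<theta> w))" by (rule B.U_le[OF \<theta>s \<theta>_le[OF S.line_idem[OF nu] w wl]])
  moreover have "?F u = l *\<^sub>R \<theta> s" using P.F_eq_height[OF nu] l by (simp add: u_def)
  ultimately show ?thesis using s by (intro exI[of _ s]) simp
qed

text \<open>\<open>dilation\<close> gives \<open>w\<close> orthogonal to the relevant part
  \<open>t\<close> of \<open>p\<close>, with compression exactly \<open>1 - \<mu>'\<close>.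
  \<open>lower\<close> bounds the image of \<open>w\<close> from below, and since
  \<open>\<theta> (t + w)\<close> is at most the unit, this bounds the image of \<open>t\<close>
  from above.\<close>

lemma upper:
  assumes r: "r \<odot> r = r" "r \<noteq> 0" and p: "p \<odot> p = p" and \<mu>: "A.le (A.U r p) (\<mu> *\<^sub>R r)" "\<mu> < \<mu>'"
  shows "\<exists>s. s \<odot> s = s \<and> s \<noteq> 0 \<and> r \<odot> s = s \<and> B.le (B.U (\<theta> s) (\<theta> p)) (\<mu>' *\<^sub>R \<theta> s)"
proof -
  have nonneg: "\<mu> \<ge> 0" if s: "s \<odot> s = s" "s \<noteq> 0" "A.le (A.U s p) (\<mu> *\<^sub>R s)" for s
  proof -
    have "A.le (0 *\<^sub>R s) (A.U s p)" using A.U_pos[OF s(1) A.pos_idem[OF p]] by (simp add: A.pos_le)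
    then have "A.le (0 *\<^sub>R s) (\<mu> *\<^sub>R s)" using s(3) by (rule A.le_trans)
    then show ?thesis by (rule A.corner_scalar_le[OF s(1,2)])
  qed
  have \<mu>0: "\<mu> \<ge> 0" by (rule nonneg[OF r \<mu>(1)])
  note \<theta>r = \<theta>_idem[OF r(1)]
  consider "\<mu>' \<ge> 1" | "\<mu>' < 1" "A.U r p = 0" | "\<mu>' < 1" "A.U r p \<noteq> 0" by linarith
  then show ?thesis
  proof cases
    case 1
    have "B.le (B.U (\<theta> r) (\<theta> p)) (\<theta> r)" using B.U_le[OF \<theta>r \<theta>_le_one[OF p]] by (simp add: B.U_one[OF \<theta>r])
    also have "B.le (\<theta> r) (\<mu>' *\<^sub>R \<theta> r)" using B.le_scale_left[OF B.pos_idem[OF \<theta>r] 1] by simp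
    finally show ?thesis using r by (intro exI[of _ r]) simp
  next
    case 2
    have "B.U (\<theta> r) (\<theta> p) = 0"
      by (rule B.U_of_E0[OF \<theta>r \<theta>_orth[OF r(1) p A.orth_of_U[OF r(1) p 2(2)]]])
    moreover have "B.le 0 (\<mu>' *\<^sub>R \<theta> r)" using B.pos_scale[OF B.pos_idem[OF \<theta>r]] \<mu>0 \<mu>(2) by (simp add: B.pos_le)
    ultimately show ?thesis using r by (intro exI[of _ r]) simp
  next
    case 3
    define a where "a = A.U r p"
    \<comment> \<open>A quarter of the norm leaves \<open>\<kappa> \<ge> 3 * \<eta>\<close>, so
      \<open>U f p\<close> is at least \<open>2 * \<eta>\<close> times \<open>f\<close>: the bound
      away from 0 that \<open>room\<close> asks for.\<close>
    define \<eta> where "\<eta> = norm a / 4"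
    have \<eta>: "\<eta> > 0" using 3(2) by (simp add: \<eta>_def a_def)
    have ra: "r \<odot> a = a" unfolding a_def by (rule A.U_E1[OF r(1)])
    obtain f \<kappa> where f: "f \<odot> f = f" "f \<noteq> 0" "r \<odot> f = f" "f \<odot> (f \<odot> a) = f \<odot> a" "norm (f \<odot> a - \<kappa> *\<^sub>R f) \<le> \<eta>"
        "\<bar>\<kappa>\<bar> \<ge> norm a - \<eta>"
      by (rule A.approx_scalar[OF r ra \<eta>])
    have fp: "A.U f p = f \<odot> a"
      using A.U_sub[OF r(1) f(1,3), of p] A.U_even[OF f(1,4)] by (simp add: a_def)
    have ff: "f \<odot> (f \<odot> a - \<kappa> *\<^sub>R f) = f \<odot> a - \<kappa> *\<^sub>R f" by (simp add: A.bil f)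
    have b: "A.le (- (\<eta> *\<^sub>R f)) (A.U f p - \<kappa> *\<^sub>R f)" "A.le (A.U f p - \<kappa> *\<^sub>R f) (\<eta> *\<^sub>R f)"
      unfolding fp using A.corner_norm_le[OF f(1) ff f(5)] by auto
    have pf: "A.pos f" by (rule A.pos_idem[OF f(1)])
    have "A.le 0 (A.U f p)" using A.U_pos[OF f(1) A.pos_idem[OF p]] by (simp add: A.pos_le)
    then have "A.le (0 - \<eta> *\<^sub>R f) (A.U f p - (A.U f p - \<kappa> *\<^sub>R f))" using b(2) by (rule A.le_diff)
    then have "A.le ((- \<eta>) *\<^sub>R f) (\<kappa> *\<^sub>R f)" by simp
    then have "- \<eta> \<le> \<kappa>" by (rule A.corner_scalar_le[OF f(1,2)])
    then have \<kappa>: "\<kappa> \<ge> 3 * \<eta>" using f(6) \<eta> by (simp add: \<eta>_def)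
    have low: "A.le ((\<kappa> - \<eta>) *\<^sub>R f) (A.U f p)"
      using b(1) by (simp add: A.le_def algebra_simps)
    have up: "A.le (A.U f p) (\<mu> *\<^sub>R f)"
      using A.U_le[OF f(1) \<mu>(1)] by (simp add: A.U_lin A.U_sub[OF r(1) f(1,3)] A.U_sub_self[OF f(1,3)])
    define \<delta> where "\<delta> = min (2 * \<eta>) (1 - \<mu>)"
    have d1: "\<delta> > 0" using \<eta> \<mu>(2) 3(1) by (simp add: \<delta>_def)
    have d2: "A.le (\<delta> *\<^sub>R f) (A.U f p)"
      by (rule A.le_trans[OF A.le_scale_left[OF pf] low]) (use \<kappa> in \<open>simp add: \<delta>_def\<close>)
    have d3: "A.le (A.U f p) ((1 - \<delta>) *\<^sub>R f)"
      by (rule A.le_trans[OF up A.le_scale_left[OF pf]]) (simp add: \<delta>_def)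
    obtain s v t where s: "s \<odot> s = s" "s \<noteq> 0" "f \<odot> s = s" and X: "exchange jA oneA s v" and t: "t \<odot> t = t" "p \<odot> t = t"
      "(p - t) \<odot> s = 0" "t \<odot> (v \<odot> v - s) = 0"
      using A.room[OF I2 f(1,2) p d1 d2 d3] by (elim exE conjE) (rule that; assumption)
    have "A.U s (p - t) = 0" using A.U_of_E0[OF s(1)] t(3) by (simp add: A.comm)
    then have ust: "A.U s t = A.U s p" by (simp add: A.U_lin)
    have usp: "A.le (A.U s p) (\<mu> *\<^sub>R s)"
      using A.U_le[OF s(1) up] by (simp add: A.U_lin A.U_sub[OF f(1) s(1,3)] A.U_sub_self[OF s(1,3)])
    obtain w where w: "w \<odot> w = w" "t \<odot> w = 0" "A.U s w = (1 - \<mu>') *\<^sub>R s"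
      by (rule A.dilation[OF X t(1,4) usp[folded ust] \<mu>(2) 3(1)])
    have l: "0 < 1 - \<mu>'" "1 - \<mu>' < 1" using 3(1) \<mu>0 \<mu>(2) by auto
    obtain k where k: "k \<odot> k = k" "k \<noteq> 0" "s \<odot> k = k" "B.le ((1 - \<mu>') *\<^sub>R \<theta> k) (B.U (\<theta> k) (\<theta> w))"
      using lower[OF s(1,2) w(1,3) l] by (elim exE conjE) (rule that; assumption)
    note \<theta>k = \<theta>_idem[OF k(1)]
    have tw: "(t + w) \<odot> (t + w) = t + w" by (simp add: A.bil t w A.comm[of w t])
    have "B.le (B.U (\<theta> k) (\<theta> t) + B.U (\<theta> k) (\<theta> w)) (\<theta> k)"
      using B.U_le[OF \<theta>k \<theta>_le_one[OF tw]] unfolding \<theta>_add[OF t(1) w(1,2)] by (simp add: B.U_lin B.U_one[OF \<theta>k])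
    then have "B.le (B.U (\<theta> k) (\<theta> t) + B.U (\<theta> k) (\<theta> w) - B.U (\<theta> k) (\<theta> w)) (\<theta> k - (1 - \<mu>') *\<^sub>R \<theta> k)"
      using k(4) by (rule B.le_diff)
    then have t': "B.le (B.U (\<theta> k) (\<theta> t)) (\<mu>' *\<^sub>R \<theta> k)" by (simp add: scaleR_diff_left)
    have pt: "(p - t) \<odot> (p - t) = p - t" by (rule A.idem_diff[OF t(1) p t(2)])
    have "k \<odot> (p - t) = 0" by (rule A.E1_E0[OF s(1) k(3)]) (use t(3) in \<open>simp add: A.comm\<close>)
    then have "B.U (\<theta> k) (\<theta> (p - t)) = 0" by (intro B.U_of_E0[OF \<theta>k] \<theta>_orth[OF k(1) pt])
    then have "B.U (\<theta> k) (\<theta> p) = B.U (\<theta> k) (\<theta> t)" unfolding \<theta>_diff[OF t(1) p t(2)] by (simp add: B.U_lin)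
    moreover have "r \<odot> k = k" by (rule A.E1_trans[OF f(1,3)]) (rule A.E1_trans[OF s(1,3) k(3)])
    ultimately show ?thesis using k t' by (intro exI[of _ k]) simp
  qed
qed

text \<open>\<open>upper\<close> is applied to \<open>p\<close> and then, on a smaller corner, to
  its complement; the first bound survives the passage to the smaller corner.\<close>

lemma approx:
  assumes r: "r \<odot> r = r" "r \<noteq> 0" and p: "p \<odot> p = p" and e: "\<epsilon> > 0"
  shows "\<exists>s m. s \<odot> s = s \<and> s \<noteq> 0 \<and> r \<odot> s = s \<and> norm (A.U s p - m *\<^sub>R s) \<le> \<epsilon> \<and>
    norm (B.U (\<theta> s) (\<theta> p) - m *\<^sub>R \<theta> s) \<le> \<epsilon>"
proof -
  define a where "a = A.U r p"
  have ra: "r \<odot> a = a" unfolding a_def by (rule A.U_E1[OF r(1)])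
  have e2: "\<epsilon> / 2 > 0" using e by simp
  obtain f \<kappa> where f: "f \<odot> f = f" "f \<noteq> 0" "r \<odot> f = f" "f \<odot> (f \<odot> a) = f \<odot> a" "norm (f \<odot> a - \<kappa> *\<^sub>R f) \<le> \<epsilon> / 2"
    by (rule A.approx_scalar[OF r ra e2]) (rule that; assumption)
  have fp: "A.U f p = f \<odot> a"
    using A.U_sub[OF r(1) f(1,3), of p] A.U_even[OF f(1,4)] by (simp add: a_def)
  have ff: "f \<odot> (f \<odot> a - \<kappa> *\<^sub>R f) = f \<odot> a - \<kappa> *\<^sub>R f" by (simp add: A.bil f)
  have b: "A.le (- ((\<epsilon>/2) *\<^sub>R f)) (A.U f p - \<kappa> *\<^sub>R f)" "A.le (A.U f p - \<kappa> *\<^sub>R f) ((\<epsilon>/2) *\<^sub>R f)"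
    unfolding fp using A.corner_norm_le[OF f(1) ff f(5)] by auto
  have up: "A.le (A.U f p) ((\<kappa> + \<epsilon>/2) *\<^sub>R f)" using b(2) by (simp add: A.le_def scaleR_add_left diff_diff_eq2 add.commute)
  have lt: "\<kappa> + \<epsilon>/2 < \<kappa> + \<epsilon>" using e by simp
  obtain s where s: "s \<odot> s = s" "s \<noteq> 0" "f \<odot> s = s" "B.le (B.U (\<theta> s) (\<theta> p)) ((\<kappa> + \<epsilon>) *\<^sub>R \<theta> s)"
    using upper[OF f(1,2) p up lt] by (elim exE conjE) (rule that; assumption)
  have "A.le (A.U s (- ((\<epsilon>/2) *\<^sub>R f))) (A.U s (A.U f p - \<kappa> *\<^sub>R f))" by (rule A.U_le[OF s(1) b(1)])
  then have lo: "A.le (- ((\<epsilon>/2) *\<^sub>R s)) (A.U s p - \<kappa> *\<^sub>R s)"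
    by (simp add: A.U_lin A.U_sub[OF f(1) s(1,3)] A.U_sub_self[OF s(1,3)])
  have cp: "(oneA - p) \<odot> (oneA - p) = oneA - p" by (rule A.compl_idem[OF p])
  have cle: "A.le (A.U s (oneA - p)) ((1 - \<kappa> + \<epsilon>/2) *\<^sub>R s)"
  proof -
    have "(1 - \<kappa> + \<epsilon>/2) *\<^sub>R s - A.U s (oneA - p) = A.U s p - \<kappa> *\<^sub>R s - - ((\<epsilon>/2) *\<^sub>R s)"
      unfolding A.U_lin A.U_one[OF s(1)] by (rule vec_eqI) (simp; simp add: field_simps)
    then show ?thesis using lo by (simp add: A.le_def)
  qed
  have clt: "1 - \<kappa> + \<epsilon>/2 < 1 - \<kappa> + \<epsilon>" using e by simp
  obtain k where k: "k \<odot> k = k" "k \<noteq> 0" "s \<odot> k = k" "B.le (B.U (\<theta> k) (\<theta> (oneA - p))) ((1 - \<kappa> + \<epsilon>) *\<^sub>R \<theta> k)"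
    using upper[OF s(1,2) cp cle clt] by (elim exE conjE) (rule that; assumption)
  note \<theta>k = \<theta>_idem[OF k(1)] and sk = \<theta>_mono[OF k(1) s(1) k(3)]
  have rk: "r \<odot> k = k" "f \<odot> k = k" using A.E1_trans[OF f(1,3)] A.E1_trans[OF s(1,3) k(3)] by auto
  have "norm (A.U k p - \<kappa> *\<^sub>R k) \<le> \<epsilon>"
    using A.U_sub_norm[OF f(1) k(1) rk(2), of p \<kappa>] f(5) e unfolding fp by linarith
  moreover have "norm (B.U (\<theta> k) (\<theta> p) - \<kappa> *\<^sub>R \<theta> k) \<le> \<epsilon>"
  proof (rule B.norm_le_corner[OF \<theta>k])
    have "\<theta> (oneA - p) = oneB - \<theta> p" using \<theta>_diff[of p oneA] p A.unit \<theta>_one by simp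
    then have q: "B.U (\<theta> k) (\<theta> (oneA - p)) = \<theta> k - B.U (\<theta> k) (\<theta> p)" by (simp add: B.U_lin B.U_one[OF \<theta>k])
    have "B.U (\<theta> k) (\<theta> p) - \<kappa> *\<^sub>R \<theta> k - - (\<epsilon> *\<^sub>R \<theta> k) = (1 - \<kappa> + \<epsilon>) *\<^sub>R \<theta> k - (\<theta> k - B.U (\<theta> k) (\<theta> p))"
      by (rule vec_eqI) (simp add: field_simps)
    then show "B.le (- (\<epsilon> *\<^sub>R \<theta> k)) (B.U (\<theta> k) (\<theta> p) - \<kappa> *\<^sub>R \<theta> k)" using k(4) unfolding q B.le_def by (simp only:)
    have "B.le (B.U (\<theta> k) (\<theta> p)) ((\<kappa> + \<epsilon>) *\<^sub>R \<theta> k)"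
      using B.U_le[OF \<theta>k s(4)] by (simp add: B.U_lin B.U_sub[OF \<theta>_idem[OF s(1)] \<theta>k sk] B.U_sub_self[OF \<theta>k sk])
    then show "B.le (B.U (\<theta> k) (\<theta> p) - \<kappa> *\<^sub>R \<theta> k) (\<epsilon> *\<^sub>R \<theta> k)"
      by (simp add: B.le_def scaleR_add_left diff_diff_eq2 add.commute)
    show "\<epsilon> \<ge> 0" using e by simp
  qed
  ultimately show ?thesis using k rk by (intro exI[of _ k] exI[of _ \<kappa>]) simp
qed

text \<open>The corner is shrunk for one idempotent after the other; earlier estimates persist by
  \<open>U_sub_norm\<close>.\<close>

lemma approx_family:
  assumes "finite I" "r \<odot> r = r" "r \<noteq> 0" "\<And>i. i \<in> I \<Longrightarrow> f i \<odot> f i = f i" "\<epsilon> > 0"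
  shows "\<exists>s m. s \<odot> s = s \<and> s \<noteq> 0 \<and> r \<odot> s = s \<and> (\<forall>i\<in>I. norm (A.U s (f i) - m i *\<^sub>R s) \<le> \<epsilon> \<and>
    norm (B.U (\<theta> s) (\<theta> (f i)) - m i *\<^sub>R \<theta> s) \<le> \<epsilon>)"
  using assms(1,4)
proof (induction I)
  case empty
  then show ?case using assms by auto
next
  case (insert j I)
  obtain s m where s: "s \<odot> s = s" "s \<noteq> 0" "r \<odot> s = s" "\<forall>i\<in>I. norm (A.U s (f i) - m i *\<^sub>R s) \<le> \<epsilon> \<and>
    norm (B.U (\<theta> s) (\<theta> (f i)) - m i *\<^sub>R \<theta> s) \<le> \<epsilon>"
    using insert.IH insert.prems by (metis insertI2)
  have fj: "f j \<odot> f j = f j" using insert.prems by simp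
  obtain k c where k: "k \<odot> k = k" "k \<noteq> 0" "s \<odot> k = k" "norm (A.U k (f j) - c *\<^sub>R k) \<le> \<epsilon>"
    "norm (B.U (\<theta> k) (\<theta> (f j)) - c *\<^sub>R \<theta> k) \<le> \<epsilon>"
    using approx[OF s(1,2) fj assms(5)] by (elim exE conjE) (rule that; assumption)
  note sk = \<theta>_mono[OF k(1) s(1) k(3)]
  have "norm (A.U k (f i) - (m(j := c)) i *\<^sub>R k) \<le> \<epsilon> \<and> norm (B.U (\<theta> k) (\<theta> (f i)) - (m(j := c)) i *\<^sub>R \<theta> k) \<le> \<epsilon>"
    if i: "i \<in> insert j I" for i
  proof (cases "i = j")
    case False
    then have "i \<in> I" using i by simp
    then show ?thesis using False s(4) A.U_sub_norm[OF s(1) k(1,3), of "f i" "m i"]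
        B.U_sub_norm[OF \<theta>_idem[OF s(1)] \<theta>_idem[OF k(1)] sk, of "\<theta> (f i)" "m i"] by fastforce
  qed (use k in simp)
  moreover have "r \<odot> k = k" by (rule A.E1_trans[OF s(1,3) k(3)])
  ultimately show ?case using k by (intro exI[of _ k] exI[of _ "m(j := c)"]) blast
qed

lemma approx_comb:
  assumes I: "finite I" and r: "r \<odot> r = r" "r \<noteq> 0" and f: "\<And>i. i \<in> I \<Longrightarrow> f i \<odot> f i = f i" and e: "\<epsilon> > 0"
  shows "\<exists>s m. s \<odot> s = s \<and> s \<noteq> 0 \<and> r \<odot> s = s \<and> norm (A.U s (\<Sum>i\<in>I. c i *\<^sub>R f i) - m *\<^sub>R s) \<le> \<epsilon> \<and>
    norm (B.U (\<theta> s) (\<Sum>i\<in>I. c i *\<^sub>R \<theta> (f i)) - m *\<^sub>R \<theta> s) \<le> \<epsilon>"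
proof -
  define K where "K = (\<Sum>i\<in>I. \<bar>c i\<bar>)"
  have K: "K \<ge> 0" by (simp add: K_def sum_nonneg)
  define \<epsilon>' where "\<epsilon>' = \<epsilon> / (K + 1)"
  have e': "\<epsilon>' > 0" using e K by (simp add: \<epsilon>'_def)
  have Ke: "K * \<epsilon>' \<le> \<epsilon>" using e K by (simp add: \<epsilon>'_def field_simps)
  obtain s m where s: "s \<odot> s = s" "s \<noteq> 0" "r \<odot> s = s" "\<forall>i\<in>I. norm (A.U s (f i) - m i *\<^sub>R s) \<le> \<epsilon>' \<and>
    norm (B.U (\<theta> s) (\<theta> (f i)) - m i *\<^sub>R \<theta> s) \<le> \<epsilon>'"
  proof -
    have "\<exists>s m. s \<odot> s = s \<and> s \<noteq> 0 \<and> r \<odot> s = s \<and> (\<forall>i\<in>I. norm (A.U s (f i) - m i *\<^sub>R s) \<le> \<epsilon>' \<and>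
      norm (B.U (\<theta> s) (\<theta> (f i)) - m i *\<^sub>R \<theta> s) \<le> \<epsilon>')" by (rule approx_family) (use I r f e' in simp_all)
    then show ?thesis by (elim exE conjE) (rule that; assumption)
  qed
  define M where "M = (\<Sum>i\<in>I. c i * m i)"
  have "norm (A.U s (\<Sum>i\<in>I. c i *\<^sub>R f i) - M *\<^sub>R s) \<le> \<epsilon>" "norm (B.U (\<theta> s) (\<Sum>i\<in>I. c i *\<^sub>R \<theta> (f i)) - M *\<^sub>R \<theta> s) \<le> \<epsilon>"
    unfolding A.U_sum B.U_sum A.U_lin B.U_lin M_def by (rule norm_comb_le; use s(4) Ke in \<open>simp add: K_def\<close>)+
  then show ?thesis using s by (intro exI[of _ s] exI[of _ M]) blast
qed

text \<open>The idempotents may be in general position, which is what makes the linear extension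
  well defined. On small corners both combinations are close to the same scalar, and norms can be
  read off from such corners.\<close>

lemma norm_comb:
  assumes I: "finite I" and f: "\<And>i. i \<in> I \<Longrightarrow> f i \<odot> f i = f i"
  shows "norm (\<Sum>i\<in>I. c i *\<^sub>R \<theta> (f i)) = norm (\<Sum>i\<in>I. c i *\<^sub>R f i)" (is "norm ?b = norm ?a")
proof (rule antisym)
  have ap: "\<exists>s m. s \<odot> s = s \<and> s \<noteq> 0 \<and> r \<odot> s = s \<and> norm (A.U s ?a - m *\<^sub>R s) \<le> \<eta> \<and>
      norm (B.U (\<theta> s) ?b - m *\<^sub>R \<theta> s) \<le> \<eta>" if "r \<odot> r = r" "r \<noteq> 0" "\<eta> > 0" for r \<eta>
    by (rule approx_comb) (use I f that in simp_all)
  show "norm ?a \<le> norm ?b"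
  proof (rule A.norm_le_of_corners)
    fix r :: 'a and \<eta> :: real assume r: "r \<odot> r = r" "r \<noteq> 0" and e: "\<eta> > 0"
    obtain s m where s: "s \<odot> s = s" "s \<noteq> 0" "r \<odot> s = s" "norm (A.U s ?a - m *\<^sub>R s) \<le> \<eta>" "norm (B.U (\<theta> s) ?b - m *\<^sub>R \<theta> s) \<le> \<eta>"
      using ap[OF r e] by (elim exE conjE) (rule that; assumption)
    have "\<theta> s \<noteq> 0" using \<theta>_nz[OF s(1)] s(2) by blast
    then have "\<bar>m\<bar> \<le> norm ?b + \<eta>"
      by (intro abs_le_of_norm_diff[OF s(5)] B.norm_nz_idem \<theta>_idem s(1) B.U_norm)
    then show "\<exists>s m. s \<odot> s = s \<and> s \<noteq> 0 \<and> r \<odot> s = s \<and> norm (A.U s ?a - m *\<^sub>R s) \<le> \<eta> \<and> \<bar>m\<bar> \<le> norm ?b + \<eta>"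
      using s by blast
  qed simp
  show "norm ?b \<le> norm ?a"
  proof (rule B.norm_le_of_corners)
    fix q :: 'b and \<eta> :: real assume q: "q \<otimes> q = q" "q \<noteq> 0" and e: "\<eta> > 0"
    obtain r where r: "r \<odot> r = r" "\<theta> r = q" using \<theta>_surj[OF q(1)] by blast
    have "\<theta> (0 + 0) = \<theta> 0 + \<theta> 0" by (rule \<theta>_add) (simp_all add: A.zero_left)
    then have r0: "r \<noteq> 0" using q(2) r(2) by auto
    obtain s m where s: "s \<odot> s = s" "s \<noteq> 0" "r \<odot> s = s" "norm (A.U s ?a - m *\<^sub>R s) \<le> \<eta>" "norm (B.U (\<theta> s) ?b - m *\<^sub>R \<theta> s) \<le> \<eta>"
      using ap[OF r(1) r0 e] by (elim exE conjE) (rule that; assumption)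
    have "\<theta> s \<noteq> 0" using \<theta>_nz[OF s(1)] s(2) by blast
    moreover have "\<bar>m\<bar> \<le> norm ?a + \<eta>" by (intro abs_le_of_norm_diff[OF s(4)] A.norm_nz_idem s(1,2) A.U_norm)
    moreover have "q \<otimes> \<theta> s = \<theta> s" using \<theta>_mono[OF s(1) r(1) s(3)] r(2) by simp
    ultimately show "\<exists>s m. s \<otimes> s = s \<and> s \<noteq> 0 \<and> q \<otimes> s = s \<and> norm (B.U s ?b - m *\<^sub>R s) \<le> \<eta> \<and> \<bar>m\<bar> \<le> norm ?a + \<eta>"
      using s(5) \<theta>_idem[OF s(1)] by blast
  qed simp
qed

section \<open>The linear extension as a closed relation\<close>

text \<open>The extension is built as a linear relation. Equality of norms makes its closure
  single-valued in both directions, so no representation as a combination of idempotents has to be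
  chosen.\<close>

definition W :: "('a \<times> 'b) set" where "W = span {(p, \<theta> p) | p. p \<odot> p = p}"

lemma W_mem:
  assumes "\<And>p. p \<in> P \<Longrightarrow> p \<odot> p = p"
  shows "((\<Sum>p\<in>P. c p *\<^sub>R p), (\<Sum>p\<in>P. c p *\<^sub>R \<theta> p)) \<in> W"
proof -
  have "(\<Sum>p\<in>P. c p *\<^sub>R (p, \<theta> p)) \<in> W" unfolding W_def
    by (intro span_sum span_scale span_base) (use assms in blast)
  then show ?thesis by (simp add: prod_eq_iff fst_sum snd_sum sum_prod)
qed

lemma W_norm:
  assumes z: "z \<in> closure W"
  shows "norm (snd z) = norm (fst z)"
proof -
  have "W \<subseteq> {z. norm (snd z) = norm (fst z)}"
  proof
    fix z assume "z \<in> W"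
    then obtain t c where t: "finite t" "t \<subseteq> {(p, \<theta> p) | p. p \<odot> p = p}" "z = (\<Sum>a\<in>t. c a *\<^sub>R a)"
      unfolding W_def span_explicit by blast
    have "snd z = (\<Sum>a\<in>t. c a *\<^sub>R \<theta> (fst a))" unfolding t(3) snd_sum using t(2) by (intro sum.cong) auto
    moreover have "fst z = (\<Sum>a\<in>t. c a *\<^sub>R fst a)" unfolding t(3) fst_sum by simp
    moreover have "norm (\<Sum>a\<in>t. c a *\<^sub>R \<theta> (fst a)) = norm (\<Sum>a\<in>t. c a *\<^sub>R fst a)"
      by (rule norm_comb[OF t(1)]) (use t(2) in auto)
    ultimately show "z \<in> {z. norm (snd z) = norm (fst z)}" by simp
  qed
  moreover have "closed {z::'a\<times>'b. norm (snd z) = norm (fst z)}"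
    by (intro closed_Collect_eq continuous_intros)
  ultimately have "closure W \<subseteq> {z. norm (snd z) = norm (fst z)}" by (rule closure_minimal)
  then show ?thesis using z by blast
qed

lemma W_subspace: "subspace (closure W)"
  by (rule subspace_closure) (simp add: W_def)

text \<open>For pairs in \<open>V\<close> whose first entries converge, the second entries form a
  Cauchy sequence because the relation is isometric.\<close>

lemma graph_surj:
  fixes V :: "('c::banach \<times> 'd::banach) set"
  assumes V: "subspace V" "closed V" and n: "\<And>z. z \<in> V \<Longrightarrow> norm (snd z) = norm (fst z)"
    and d: "\<And>\<epsilon>. \<epsilon> > 0 \<Longrightarrow> \<exists>z\<in>V. norm (a - fst z) \<le> \<epsilon>"
  shows "\<exists>b. (a, b) \<in> V"
proof -
  have "\<forall>n. \<exists>z\<in>V. norm (a - fst z) \<le> 1 / real (Suc n)" using d by simp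
  then obtain z where z: "\<And>n. z n \<in> V" "\<And>n. norm (a - fst (z n)) \<le> 1 / real (Suc n)" by metis
  have f: "(\<lambda>n. fst (z n)) \<longlonglongrightarrow> a"
  proof (rule Lim_null_comparison[THEN LIM_zero_cancel])
    show "\<forall>\<^sub>F n in sequentially. norm (fst (z n) - a) \<le> 1 / real (Suc n)"
      using z(2) by (simp add: norm_minus_commute)
    show "(\<lambda>n. 1 / real (Suc n)) \<longlonglongrightarrow> 0" using LIMSEQ_inverse_real_of_nat by (simp add: divide_inverse)
  qed
  have e: "dist (snd (z m)) (snd (z n)) = dist (fst (z m)) (fst (z n))" for m n
    using n[OF subspace_diff[OF V(1) z(1)[of m] z(1)[of n]]] by (simp add: dist_norm)
  have "Cauchy (\<lambda>n. snd (z n))" using LIMSEQ_imp_Cauchy[OF f] unfolding Cauchy_def e .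
  then obtain b where b: "(\<lambda>n. snd (z n)) \<longlonglongrightarrow> b" using Cauchy_convergent_iff convergent_def by blast
  have "(\<lambda>n. (fst (z n), snd (z n))) \<longlonglongrightarrow> (a, b)" by (rule tendsto_Pair[OF f b])
  then have "(a, b) \<in> V" using closed_sequentially[OF V(2)] z(1) by auto
  then show ?thesis by blast
qed

theorem extends: "\<exists>\<psi>. jordan_iso jA jB \<psi> \<and> (\<forall>p. p \<odot> p = p \<longrightarrow> \<psi> p = \<theta> p)"
proof -
  note sub = W_subspace and cl = closed_closure[of W]
  have ex: "\<exists>b. (a, b) \<in> closure W" for a
  proof (rule graph_surj[OF sub cl W_norm])
    fix \<epsilon> :: real assume e: "\<epsilon> > 0"
    obtain P c where P0: "finite P" "\<forall>p\<in>P. p \<odot> p = p" "\<forall>p\<in>P. \<forall>q\<in>P. p \<noteq> q \<longrightarrow> p \<odot> q = 0"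
        "norm (a - (\<Sum>p\<in>P. c p *\<^sub>R p)) \<le> \<epsilon>"
        using A.approx_simple_ex[OF e, of a] by (elim exE conjE) (rule that; assumption)
      have P: "finite P" "\<And>p. p \<in> P \<Longrightarrow> p \<odot> p = p" "\<And>p q. p \<in> P \<Longrightarrow> q \<in> P \<Longrightarrow> p \<noteq> q \<Longrightarrow> p \<odot> q = 0"
        using P0 by simp_all
    show "\<exists>z\<in>closure W. norm (a - fst z) \<le> \<epsilon>"
      using P0(4) W_mem[OF P(2), where c = c] closure_subset[of W] by (intro bexI[of _ "((\<Sum>p\<in>P. c p *\<^sub>R p), (\<Sum>p\<in>P. c p *\<^sub>R \<theta> p))"]) auto
  qed
  have uniq: "b = b'" if "(a, b) \<in> closure W" "(a, b') \<in> closure W" for a b b'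
    using W_norm[OF subspace_diff[OF sub that]] by simp
  have uniq': "a = a'" if "(a, b) \<in> closure W" "(a', b) \<in> closure W" for a a' b
    using W_norm[OF subspace_diff[OF sub that]] by simp
  have ex': "\<exists>a. (a, b) \<in> closure W" for b
  proof -
    \<comment> \<open>Surjectivity of the extension is totality of the converse relation.\<close>
    let ?V = "prod.swap -` closure W"
    have sw: "prod.swap (0::'b \<times> 'a) = 0" "prod.swap (x + y) = prod.swap x + prod.swap y"
      "prod.swap (c *\<^sub>R x) = c *\<^sub>R prod.swap x" for x y :: "'b \<times> 'a" and c by (auto simp: prod_eq_iff)
    have V1: "subspace ?V"
      by (rule subspaceI) (auto simp: sw subspace_0[OF sub] subspace_add[OF sub] subspace_scale[OF sub])
    have "continuous_on UNIV (prod.swap :: 'b \<times> 'a \<Rightarrow> 'a \<times> 'b)" by (rule continuous_on_swap)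
    then have V2: "closed ?V" using cl by (simp add: closed_vimage)
    have "\<exists>a. (b, a) \<in> ?V"
    proof (rule graph_surj[OF V1 V2])
      fix z assume "z \<in> ?V" then show "norm (snd z) = norm (fst z)" using W_norm[of "prod.swap z"] by simp
    next
      fix \<epsilon> :: real assume e: "\<epsilon> > 0"
      obtain Q c where Q0: "finite Q" "\<forall>p\<in>Q. p \<otimes> p = p" "\<forall>p\<in>Q. \<forall>q\<in>Q. p \<noteq> q \<longrightarrow> p \<otimes> q = 0"
        "norm (b - (\<Sum>p\<in>Q. c p *\<^sub>R p)) \<le> \<epsilon>"
        using B.approx_simple_ex[OF e, of b] by (elim exE conjE) (rule that; assumption)
      have Q: "finite Q" "\<And>p. p \<in> Q \<Longrightarrow> p \<otimes> p = p" "\<And>p q. p \<in> Q \<Longrightarrow> q \<in> Q \<Longrightarrow> p \<noteq> q \<Longrightarrow> p \<otimes> q = 0"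
        using Q0 by simp_all
      have "\<forall>q\<in>Q. \<exists>p. p \<odot> p = p \<and> \<theta> p = q" using \<theta>_surj Q(2) by blast
      then obtain g where g: "\<And>q. q \<in> Q \<Longrightarrow> g q \<odot> g q = g q" "\<And>q. q \<in> Q \<Longrightarrow> \<theta> (g q) = q" by metis
      have "(\<Sum>q\<in>Q. c q *\<^sub>R (g q, \<theta> (g q))) \<in> W" unfolding W_def
        by (intro span_sum span_scale span_base) (use g in blast)
      moreover have "snd (\<Sum>q\<in>Q. c q *\<^sub>R (g q, \<theta> (g q))) = (\<Sum>q\<in>Q. c q *\<^sub>R q)"
        unfolding snd_sum by (intro sum.cong) (auto simp: g)
      ultimately show "\<exists>z\<in>?V. norm (b - fst z) \<le> \<epsilon>" using Q0(4) closure_subset[of W]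
        by (intro bexI[of _ "prod.swap (\<Sum>q\<in>Q. c q *\<^sub>R (g q, \<theta> (g q)))"]) auto
    qed
    then show ?thesis by simp
  qed
  define \<psi> where "\<psi> a = (THE b. (a, b) \<in> closure W)" for a
  have \<psi>: "(a, \<psi> a) \<in> closure W" for a unfolding \<psi>_def by (rule theI') (use ex uniq in blast)
  have \<psi>I: "(a, b) \<in> closure W \<Longrightarrow> \<psi> a = b" for a b using uniq \<psi> by blast
  have lin: "linear \<psi>"
  proof (rule linearI)
    show "\<psi> (x + y) = \<psi> x + \<psi> y" for x y using subspace_add[OF sub \<psi>[of x] \<psi>[of y]] by (intro \<psi>I) simp
    show "\<psi> (c *\<^sub>R x) = c *\<^sub>R \<psi> x" for c x using subspace_scale[OF sub \<psi>[of x]] by (intro \<psi>I) simp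
  qed
  have bij: "bij \<psi>"
  proof (rule bijI)
    show "inj \<psi>"
    proof (rule injI)
      fix x y assume "\<psi> x = \<psi> y"
      then have "(y, \<psi> x) \<in> closure W" using \<psi>[of y] by simp
      then show "x = y" by (rule uniq'[OF \<psi>[of x]])
    qed
    have "\<exists>a. b = \<psi> a" for b using ex'[of b] \<psi>I by metis
    then show "surj \<psi>" by (simp add: surj_def)
  qed
  have "norm (\<psi> x) = norm x" for x using W_norm[OF \<psi>[of x]] by simp
  then have "bounded_linear \<psi>" using lin by (intro bounded_linear_intro[of _ 1]) (auto simp: linear_add linear_scale)
  then have cont: "(\<lambda>n. \<psi> (X n)) \<longlonglongrightarrow> \<psi> l" if "X \<longlonglongrightarrow> l" for X l using that by (rule bounded_linear.tendsto)
  \<comment> \<open>Orthogonal combinations of idempotents are dense, and on them both squares are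
    computed termwise; products follow by polarisation.\<close>
  have sq: "\<psi> (a \<odot> a) = \<psi> a \<otimes> \<psi> a" for a
  proof -
    have "\<exists>x. norm (a - x) \<le> 1 / real (Suc n) \<and> \<psi> (x \<odot> x) = \<psi> x \<otimes> \<psi> x" for n
    proof -
      have e: "1 / real (Suc n) > 0" by simp
      obtain P c where P0: "finite P" "\<forall>p\<in>P. p \<odot> p = p" "\<forall>p\<in>P. \<forall>q\<in>P. p \<noteq> q \<longrightarrow> p \<odot> q = 0"
        "norm (a - (\<Sum>p\<in>P. c p *\<^sub>R p)) \<le> 1 / real (Suc n)"
        using A.approx_simple_ex[OF e, of a] by (elim exE conjE) (rule that; assumption)
      have P: "finite P" "\<And>p. p \<in> P \<Longrightarrow> p \<odot> p = p" "\<And>p q. p \<in> P \<Longrightarrow> q \<in> P \<Longrightarrow> p \<noteq> q \<Longrightarrow> p \<odot> q = 0"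
        using P0 by simp_all
      have psum: "\<psi> (\<Sum>p\<in>P. d p *\<^sub>R p) = (\<Sum>p\<in>P. d p *\<^sub>R \<theta> p)" for d
        using W_mem[OF P(2), where c = d] closure_subset[of W] by (intro \<psi>I) blast
      have 1: "(\<Sum>p\<in>P. c p *\<^sub>R p) \<odot> (\<Sum>p\<in>P. c p *\<^sub>R p) = (\<Sum>p\<in>P. (c p * c p) *\<^sub>R p)"
      proof -
        have "(\<Sum>p\<in>P. c p *\<^sub>R p) \<odot> (\<Sum>p\<in>P. c p *\<^sub>R p) = (\<Sum>p\<in>P. \<Sum>q\<in>P. (c p * c q) *\<^sub>R (p \<odot> q))"
          by (simp add: A.sum_left A.sum_right A.scaleR_left A.scaleR_right scaleR_sum_right)
            (intro sum.cong refl, simp add: A.comm mult.commute)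
        also have "\<dots> = (\<Sum>p\<in>P. \<Sum>q\<in>P. if q = p then (c p * c p) *\<^sub>R p else 0)"
          by (intro sum.cong refl) (auto simp: P(2,3))
        finally show ?thesis using P(1) by simp
      qed
      have 2: "(\<Sum>p\<in>P. c p *\<^sub>R \<theta> p) \<otimes> (\<Sum>p\<in>P. c p *\<^sub>R \<theta> p) = (\<Sum>p\<in>P. (c p * c p) *\<^sub>R \<theta> p)"
      proof -
        have "(\<Sum>p\<in>P. c p *\<^sub>R \<theta> p) \<otimes> (\<Sum>p\<in>P. c p *\<^sub>R \<theta> p) = (\<Sum>p\<in>P. \<Sum>q\<in>P. (c p * c q) *\<^sub>R (\<theta> p \<otimes> \<theta> q))"
          by (simp add: B.sum_left B.sum_right B.scaleR_left B.scaleR_right scaleR_sum_right)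
            (intro sum.cong refl, simp add: B.comm mult.commute)
        also have "\<dots> = (\<Sum>p\<in>P. \<Sum>q\<in>P. if q = p then (c p * c p) *\<^sub>R \<theta> p else 0)"
          by (intro sum.cong refl) (auto simp: P(2,3) \<theta>_idem \<theta>_orth)
        finally show ?thesis using P(1) by simp
      qed
      show ?thesis using P0(4) by (intro exI[of _ "\<Sum>p\<in>P. c p *\<^sub>R p"]) (simp add: 1 2 psum)
    qed
    then obtain x where x: "\<And>n. norm (a - x n) \<le> 1 / real (Suc n)" "\<And>n. \<psi> (x n \<odot> x n) = \<psi> (x n) \<otimes> \<psi> (x n)" by metis
    have X: "x \<longlonglongrightarrow> a"
    proof (rule Lim_null_comparison[THEN LIM_zero_cancel])
      show "\<forall>\<^sub>F n in sequentially. norm (x n - a) \<le> 1 / real (Suc n)" using x(1) by (simp add: norm_minus_commute)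
      show "(\<lambda>n. 1 / real (Suc n)) \<longlonglongrightarrow> 0" using LIMSEQ_inverse_real_of_nat by (simp add: divide_inverse)
    qed
    have "(\<lambda>n. \<psi> (x n \<odot> x n)) \<longlonglongrightarrow> \<psi> (a \<odot> a)" by (rule cont[OF A.tendsto[OF X X]])
    moreover have "(\<lambda>n. \<psi> (x n \<odot> x n)) \<longlonglongrightarrow> \<psi> a \<otimes> \<psi> a" unfolding x(2) by (rule B.tendsto[OF cont[OF X] cont[OF X]])
    ultimately show ?thesis by (rule LIMSEQ_unique)
  qed
  have mul: "\<psi> (x \<odot> y) = \<psi> x \<otimes> \<psi> y" for x y
  proof -
    have h: "\<psi> ((x + y) \<odot> (x + y)) = \<psi> (x + y) \<otimes> \<psi> (x + y)" by (rule sq)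
    have "\<psi> (x \<odot> x) + \<psi> (x \<odot> y) + (\<psi> (x \<odot> y) + \<psi> (y \<odot> y)) = \<psi> x \<otimes> \<psi> x + \<psi> x \<otimes> \<psi> y + (\<psi> x \<otimes> \<psi> y + \<psi> y \<otimes> \<psi> y)"
      using h by (simp add: A.add_left A.add_right B.add_left B.add_right linear_add[OF lin] A.comm[of y x] B.comm[of "\<psi> y" "\<psi> x"] add_ac)
    then have h2: "\<psi> (x \<odot> y) + \<psi> (x \<odot> y) = \<psi> x \<otimes> \<psi> y + \<psi> x \<otimes> \<psi> y" unfolding sq by (simp add: add_ac)
    show ?thesis by (rule vec_lin1[OF h2]) simp
  qed
  have "\<psi> p = \<theta> p" if "p \<odot> p = p" for p
    using W_mem[of "{p}" "\<lambda>_. 1"] that closure_subset[of W] by (intro \<psi>I) auto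
  then show ?thesis using bij lin mul unfolding jordan_iso_def by blast
qed

end

section \<open>Order isomorphisms of the associative subalgebras\<close>

lemma span_image_explicit:
  assumes "x \<in> span (p ` L)"
  shows "\<exists>F c. finite F \<and> F \<subseteq> L \<and> x = (\<Sum>l\<in>F. c l *\<^sub>R p l)"
proof -
  obtain t c where t: "finite t" "t \<subseteq> p ` L" "x = (\<Sum>a\<in>t. c a *\<^sub>R a)"
    using assms unfolding span_explicit by blast
  obtain F where F: "F \<subseteq> L" "inj_on p F" "t = p ` F" using t(2) unfolding subset_image_inj by (elim exE conjE) (rule that; assumption)
  have "finite F" using t(1) unfolding F(3) by (rule finite_imageD[OF _ F(2)])
  moreover have "x = (\<Sum>l\<in>F. c (p l) *\<^sub>R p l)" unfolding t(3) F(3) by (rule sum.reindex_cong[OF F(2) refl]) simp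
  ultimately show ?thesis using F(1) by (intro exI[of _ F] exI[of _ "\<lambda>l. c (p l)"]) simp
qed

lemma finite_separated:
  fixes K :: "real set"
  assumes "finite K"
  shows "\<exists>\<eta>>0. \<forall>x\<in>K. \<forall>y\<in>K. x < y \<longrightarrow> x + \<eta> < y"
proof -
  have "finite ((\<lambda>(x, y). x - y) ` (K \<times> K))" using assms by simp
  then obtain d where d: "d > 0" "\<forall>z\<in>(\<lambda>(x, y). x - y) ` (K \<times> K). z \<noteq> 0 \<longrightarrow> d \<le> dist 0 z"
    using finite_set_avoid[of _ "0::real"] by blast
  have "x + d / 2 < y" if xy: "x \<in> K" "y \<in> K" "x < y" for x y
  proof -
    have m: "x - y \<in> (\<lambda>(x, y). x - y) ` (K \<times> K)" using xy by force
    have "d \<le> dist 0 (x - y)" using bspec[OF d(2) m] xy(3) by simp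
    then show ?thesis using xy(3) d(1) by (simp add: dist_real_def)
  qed
  then show ?thesis using d(1) by (intro exI[of _ "d / 2"]) auto
qed

section \<open>Lines spanned by idempotents\<close>

context jb
begin

lemma oca_gen0: "oca (gen 0 a)"
  by (rule oca_gen) (simp_all add: zero_left)

lemma gen0_minimal: "C \<in> AS jm \<Longrightarrow> a \<in> C \<Longrightarrow> gen 0 a \<subseteq> C"
  by (rule gen_minimal) (auto simp: AS_def subspace_0)

lemma span_AS:
  assumes p: "p \<odot> p = p"
  shows "span {p} \<in> AS jm"
proof -
  have s: "span {p} = range (\<lambda>k. k *\<^sub>R p)" by (rule span_singleton)
  have cl: "closed (span {p})"
  proof (cases "p = 0")
    case False
    have "complete (range (\<lambda>k. k *\<^sub>R p))"
      using False by (intro complete_isometric_image[of "norm p"] bounded_linear_scaleR_left) (auto simp: complete_UNIV)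
    then show ?thesis unfolding s by (rule complete_imp_closed)
  qed simp
  have "x \<odot> y \<in> span {p}" if "x \<in> span {p}" "y \<in> span {p}" for x y
    using that unfolding s by (auto simp: bil p)
  moreover have "(x \<odot> y) \<odot> z = x \<odot> (y \<odot> z)" if "x \<in> span {p}" "y \<in> span {p}" "z \<in> span {p}" for x y z
    using that unfolding s by (auto simp: bil p mult_ac)
  ultimately show ?thesis unfolding AS_def using cl by simp
qed

lemma span_idem_inj:
  assumes p: "p \<odot> p = p" and q: "q \<odot> q = q" and s: "span {p} = span {q}"
  shows "p = q"
proof -
  have "p \<in> span {q}" using s span_base[of p "{p}"] by simp
  then obtain c where c: "p = c *\<^sub>R q" unfolding span_singleton by blast
  have "(c * c) *\<^sub>R q = c *\<^sub>R q" using p unfolding c by (simp add: bil q)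
  then consider "c = 0" | "c = 1" | "q = 0" by auto
  then show ?thesis
  proof cases
    case 1
    then have "span {q} = {0}" using s c by simp
    then show ?thesis using span_base[of q "{q}"] c 1 by simp
  qed (use c in auto)
qed

lemma orth_sub_span: "orth_sub jm (span {p}) (span {q}) \<longleftrightarrow> p \<odot> q = 0"
proof
  assume "orth_sub jm (span {p}) (span {q})"
  then show "p \<odot> q = 0" unfolding orth_sub_def using span_base[of p "{p}"] span_base[of q "{q}"] by blast
next
  assume "p \<odot> q = 0"
  then show "orth_sub jm (span {p}) (span {q})" unfolding orth_sub_def span_singleton by (auto simp: bil)
qed

lemma span_idem_atom:
  assumes D: "D \<in> AS jm" "D \<subseteq> span {p}"
  shows "D = {0} \<or> D = span {p}"
proof (cases "D \<subseteq> {0}")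
  case True
  then show ?thesis using D(1) subspace_0[of D] by (auto simp: AS_def)
next
  case False
  have sub: "subspace D" using D(1) by (simp add: AS_def)
  obtain x where x: "x \<in> D" "x \<noteq> 0" using False by blast
  then obtain c where c: "x = c *\<^sub>R p" using D(2) unfolding span_singleton by blast
  have "(1/c) *\<^sub>R x \<in> D" by (rule subspace_scale[OF sub x(1)])
  then have "p \<in> D" using x(2) c by auto
  then have "span {p} \<subseteq> D" using sub by (simp add: span_minimal)
  then show ?thesis using D(2) by blast
qed

end

section \<open>Functional calculus without unit\<close>

context jbu
begin

lemma sq_zero: "a \<odot> a = 0 \<Longrightarrow> a = 0"
  using norm_sq[of a] by simp

lemma neg_sq_zero: "pos (- (a \<odot> a)) \<Longrightarrow> a = 0"
  by (rule sq_zero[OF pos_antisym[OF pos_sq]])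

text \<open>Multiplication by \<open>f\<close> sends the generators, the unit and the powers of
  \<open>f\<close>, to powers of \<open>f\<close>; it leads from the unital algebra back to the one
  without unit.\<close>

lemma gen_one_mult:
  assumes "x \<in> gen \<one> f"
  shows "f \<odot> x \<in> gen 0 f"
proof -
  let ?V = "(\<lambda>x. f \<odot> x) -` gen 0 f"
  note li = oca_lin[OF oca_gen0[of f]]
  have 1: "subspace ?V" by (rule subspaceI) (auto simp: bil li)
  have "continuous_on UNIV (\<lambda>x. f \<odot> x)" by (intro continuous_intros)
  then have 2: "closed ?V" using oca_closed[OF oca_gen0[of f]] by (simp add: closed_vimage)
  have p: "f \<odot> pw f n \<in> gen 0 f" for n
  proof -
    have "pw f n \<in> span (insert 0 (range (pw f)))" by (rule span_base) simp
    then have "pw f n \<in> gen 0 f" unfolding gen_def by (rule subsetD[OF closure_subset])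
    then show ?thesis by (rule oca_mult[OF oca_gen0 gen_self])
  qed
  have 3: "insert \<one> (range (pw f)) \<subseteq> ?V" using gen_self[of f 0] p by (auto simp: unit_right)
  show ?thesis using subsetD[OF closure_span_subset[OF 1 2 3] assms[unfolded gen_def]] by simp
qed

text \<open>The hypotheses are satisfied by the positive part of \<open>f - l\<close>, a function of
  \<open>f\<close> that vanishes at 0 because \<open>l \<ge> 0\<close>. It is the limit of
  \<open>f w / (w + l + \<epsilon>)\<close>, with error \<epsilon> times
  \<open>w / (w + l + \<epsilon>)\<close>.\<close>

lemma pos_part_gen:
  assumes w: "w \<in> gen \<one> f" "pos w" and l: "l \<ge> 0" and fw: "f \<odot> w = w \<odot> w + l *\<^sub>R w"
  shows "w \<in> gen 0 f"
proof -
  note S = loc_unit_gen1[of f]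
  note D = loc_unitD[OF S] and li = oca_lin[OF loc_unitD(1)[OF S]] and mu = oca_mult[OF loc_unitD(1)[OF S]]
  have "\<exists>y\<in>gen 0 f. dist y w < e" if e: "e > 0" for e
  proof -
    define \<epsilon> where "\<epsilon> = e / 2"
    have \<epsilon>: "\<epsilon> > 0" using e by (simp add: \<epsilon>_def)
    let ?k = "w + (l + \<epsilon>) *\<^sub>R \<one>"
    have k: "?k \<in> gen \<one> f" using w D(2) li by simp
    have ke: "?k - \<epsilon> *\<^sub>R \<one> = w + l *\<^sub>R \<one>" by (simp add: scaleR_add_left)
    have ek: "\<epsilon> *\<^sub>R \<one> \<sqsubseteq> ?k" unfolding le_def ke by (rule pos_add[OF w(2) pos_scale[OF pos_one l]])
    obtain g where g: "g \<in> gen \<one> f" "?k \<odot> g = \<one>" "pos g" by (rule loc_inverse[OF S k \<epsilon> ek])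
    have wg: "w \<odot> g = \<one> - (l + \<epsilon>) *\<^sub>R g" using g(2) by (simp add: add_left scaleR_left unit eq_diff_eq)
    have pwg: "pos (w \<odot> g)" by (rule loc_pos_mult[OF S w g(1,3)])
    have "w \<odot> g \<sqsubseteq> \<one>" unfolding le_def wg using pos_scale[OF g(3), of "l + \<epsilon>"] l \<epsilon> by simp
    then have n: "norm (w \<odot> g) \<le> 1" using norm_mono[OF pwg] norm_one_le by fastforce
    have f: "f \<in> gen \<one> f" by (rule gen_self)
    have "f \<odot> (w \<odot> g) = (f \<odot> w) \<odot> g" by (rule oca_assoc[OF D(1) f w(1) g(1), symmetric])
    also have "\<dots> = w \<odot> (w \<odot> g) + l *\<^sub>R (w \<odot> g)"
      unfolding fw add_left scaleR_left oca_assoc[OF D(1) w(1) w(1) g(1)] ..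
    also have "w \<odot> (w \<odot> g) = w - (l + \<epsilon>) *\<^sub>R (w \<odot> g)" by (subst wg) (simp add: diff_right scaleR_right unit_right)
    finally have "f \<odot> (w \<odot> g) - w = - (\<epsilon> *\<^sub>R (w \<odot> g))" by (simp add: scaleR_add_left)
    then have "dist (f \<odot> (w \<odot> g)) w \<le> \<epsilon>" using n \<epsilon> by (simp add: dist_norm)
    then have "dist (f \<odot> (w \<odot> g)) w < e" using e by (simp add: \<epsilon>_def)
    then show ?thesis using gen_one_mult[OF mu[OF w(1) g(1)]] by blast
  qed
  then show ?thesis using closed_approachable[OF oca_closed[OF oca_gen0[of f]]] by blast
qed

text \<open>If \<open>w - v\<close> exceeds \<open>w' - v'\<close> by a constant \<eta>, then
  \<open>u = w' \<odot> v\<close> vanishes, since \<open>u w' = - (u v + \<eta> u)\<close> is both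
  positive and negative. Hence \<open>w\<close> acts on \<open>w'\<close> as
  \<open>w' + \<eta>\<close>. A similar sign argument shows that \<open>w - w'\<close> has no
  negative part.\<close>

lemma parts_mono:
  assumes S: "loc_unit \<one> S" and m: "w \<in> S" "v \<in> S" "w' \<in> S" "v' \<in> S"
    and p: "pos w" "pos v" "pos w'" "pos v'" and o: "w \<odot> v = 0" "w' \<odot> v' = 0"
    and e: "w - v = w' - v' + \<eta> *\<^sub>R \<one>" "\<eta> \<ge> 0"
  shows "w' \<odot> (w - w' - \<eta> *\<^sub>R \<one>) = 0" "w' \<sqsubseteq> w"
proof -
  note D = loc_unitD[OF S] and li = oca_lin[OF loc_unitD(1)[OF S]] and mu = oca_mult[OF loc_unitD(1)[OF S]]
  note lc = oca_lcomm[OF loc_unitD(1)[OF S]] and pm = loc_pos_mult[OF S]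
  define u where "u = w' \<odot> v"
  have u: "u \<in> S" "pos u" unfolding u_def by (rule mu[OF m(3,2)]) (rule pm[OF m(3) p(3) m(2) p(2)])
  have uv: "u \<odot> w = 0" "u \<odot> v' = 0"
  proof -
    have "w \<odot> u = 0" unfolding u_def lc[OF m(1,3)] o by (simp add: zero_right)
    then show "u \<odot> w = 0" by (simp add: comm)
    have "v' \<odot> u = v \<odot> (w' \<odot> v')" unfolding u_def comm[of w' v] lc[OF m(4,2)] comm[of v' w'] ..
    then show "u \<odot> v' = 0" by (simp add: comm[of u v'] o zero_right)
  qed
  have "u \<odot> (w - v) = u \<odot> (w' - v' + \<eta> *\<^sub>R \<one>)" by (simp add: e(1))
  then have h: "- (u \<odot> v) = u \<odot> w' + \<eta> *\<^sub>R u" by (simp add: bil uv unit_right)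
  have neg: "- (u \<odot> w') = u \<odot> v + \<eta> *\<^sub>R u" by (rule vec_lin1[OF h]) (simp; linarith)
  have "pos (- (u \<odot> w'))" unfolding neg by (intro pos_add pm u m p pos_scale e(2))
  then have uw: "u \<odot> w' = 0" by (rule pos_antisym[OF pm[OF u m(3) p(3)]])
  have "u \<odot> u = 0"
  proof -
    have "u = v \<odot> w'" unfolding u_def by (rule comm)
    then have "u \<odot> u = u \<odot> (v \<odot> w')" by simp
    then show ?thesis unfolding lc[OF u(1) m(2)] uw zero_right .
  qed
  then have u0: "w' \<odot> v = 0" unfolding u_def by (rule sq_zero)
  have "w' \<odot> (w - v) = w' \<odot> (w' - v' + \<eta> *\<^sub>R \<one>)" by (simp add: e(1))
  then have ww: "w' \<odot> w = w' \<odot> w' + \<eta> *\<^sub>R w'" by (simp add: bil u0 o unit_right)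
  then show "w' \<odot> (w - w' - \<eta> *\<^sub>R \<one>) = 0" by (simp add: bil unit_right)
  have d: "w - w' \<in> S" using m by (intro li)
  obtain a n where an: "a \<in> S" "n \<in> S" "pos a" "pos n" "a \<odot> n = 0" "w - w' = a - n" by (rule pos_neg_parts[OF S d])
  have wd: "w' \<odot> (w - w') = \<eta> *\<^sub>R w'" by (simp add: bil ww)
  have nd: "n \<odot> (w - w') = - (n \<odot> n)" unfolding an(6) by (simp add: bil comm[of n a] an)
  have "n \<odot> (w' \<odot> (w - w')) = w' \<odot> (n \<odot> (w - w'))" by (rule lc[OF an(2) m(3)])
  then have q: "\<eta> *\<^sub>R (n \<odot> w') = - (w' \<odot> (n \<odot> n))" unfolding wd nd by (simp add: bil)
  have "pos (- (w' \<odot> (n \<odot> n)))" unfolding q[symmetric] by (intro pos_scale pm an m p e(2))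
  then have "w' \<odot> (n \<odot> n) = 0" by (rule pos_antisym[OF pm[OF m(3) p(3) mu[OF an(2) an(2)] pos_sq]])
  then have nq: "n \<odot> (w' \<odot> n) = 0" unfolding lc[OF an(2) m(3)] .
  have "(w' \<odot> n) \<odot> (w' \<odot> n) = w' \<odot> (n \<odot> (w' \<odot> n))" by (rule oca_assoc[OF D(1) m(3) an(2) mu[OF m(3) an(2)]])
  then have "(w' \<odot> n) \<odot> (w' \<odot> n) = 0" by (simp only: nq zero_right)
  then have w'n: "w' \<odot> n = 0" by (rule sq_zero)
  have "n \<odot> w = - (n \<odot> n)" using nd by (simp add: diff_right comm[of n w'] w'n)
  then have "pos (- (n \<odot> n))" using pm[OF an(2,4) m(1) p(1)] by simp
  then have "n = 0" by (rule neg_sq_zero)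
  then show "w' \<sqsubseteq> w" unfolding le_def an(6) using an(3) by simp
qed

lemma idem_sum:
  assumes I: "finite I" and b: "\<And>i. i \<in> I \<Longrightarrow> b i \<odot> b i = b i" "\<And>i j. i \<in> I \<Longrightarrow> j \<in> I \<Longrightarrow> i \<noteq> j \<Longrightarrow> b i \<odot> b j = 0"
  shows "sum b I \<odot> sum b I = sum b I"
proof -
  have "sum b I \<odot> b j = b j" if j: "j \<in> I" for j
  proof -
    have "sum b I \<odot> b j = (\<Sum>i\<in>I. if i = j then b j else 0)" unfolding sum_left
      by (intro sum.cong refl) (use b j in auto)
    then show ?thesis using I j by simp
  qed
  then show ?thesis by (simp add: sum_right)
qed

end

section \<open>Spectral families of a positive element\<close>

text \<open>\<open>w l\<close> stands for the positive part of \<open>f - l\<close>, and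
  \<open>p l\<close> for its support. Ramps \<open>w l - w m\<close> at levels from 0 on lie in
  \<open>gen 0 f\<close>, the idempotents in general do not; the ramp inequalities connect the
  two.\<close>

locale spectral_family = jbw jm one for jm :: "'a::banach \<Rightarrow> 'a \<Rightarrow> 'a" (infixl "\<odot>" 70) and one :: 'a ("\<one>") +
  fixes f :: 'a and w p :: "real \<Rightarrow> 'a"
  assumes p_idem: "p l \<odot> p l = p l"
    and p_mult: "l \<le> m \<Longrightarrow> p l \<odot> p m = p m"
    and w_gen: "l \<ge> 0 \<Longrightarrow> w l \<in> gen 0 f"
    and ramp_lower: "l < m \<Longrightarrow> (m - l) *\<^sub>R p m \<sqsubseteq> w l - w m"
    and ramp_upper: "l < m \<Longrightarrow> w l - w m \<sqsubseteq> (m - l) *\<^sub>R p l"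
    and w_0: "w 0 = f" and w_top: "l \<ge> norm f \<Longrightarrow> w l = 0"

lemma (in jbw) spectral_family_exists:
  assumes f: "pos f"
  obtains w p where "spectral_family jm one f w p"
proof -
  define S where "S = gen \<one> f"
  have S: "loc_unit \<one> S" unfolding S_def by (rule loc_unit_gen1)
  note D = loc_unitD[OF S] and li = oca_lin[OF loc_unitD(1)[OF S]] and pm = loc_pos_mult[OF S]
  have fS: "f \<in> S" unfolding S_def by (rule gen_self)
  \<comment> \<open>All data of one level are bundled so that they can be chosen simultaneously for
    every level.\<close>
  define Q where "Q l w v e a \<longleftrightarrow> (w \<in> S \<and> v \<in> S \<and> pos w \<and> pos v \<and> w \<odot> v = 0 \<and> f - l *\<^sub>R \<one> = w - v) \<and>
     (e \<odot> e = e \<and> is_sup a e \<and> incr a) \<and> (\<forall>n. a n \<in> S \<and> pos (a n) \<and> a n \<sqsubseteq> \<one> \<and> a n \<sqsubseteq> real n *\<^sub>R w) \<and>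
     (\<forall>x C. x \<in> S \<longrightarrow> pos x \<longrightarrow> x \<sqsubseteq> C *\<^sub>R w \<longrightarrow> e \<odot> x = x) \<and> (\<forall>u. u \<in> S \<longrightarrow> w \<odot> u = 0 \<longrightarrow> e \<odot> u = 0)"
    for l w v e and a :: "nat \<Rightarrow> 'a"
  have "\<exists>w v e a. Q l w v e a" for l
  proof -
    have "f - l *\<^sub>R \<one> \<in> S" using fS D(2) by (intro li)
    then obtain w v where w: "w \<in> S" "v \<in> S" "pos w" "pos v" "w \<odot> v = 0" "f - l *\<^sub>R \<one> = w - v" by (rule pos_neg_parts[OF S])
    show ?thesis
    proof (rule support[OF S w(1,3)])
      fix e a
      assume "e \<odot> e = e" "is_sup a e" "incr a" "\<And>n. a n \<in> S" "\<And>n. pos (a n)" "\<And>n. a n \<sqsubseteq> \<one>"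
        "\<And>n. a n \<sqsubseteq> real n *\<^sub>R w" "\<And>x C. x \<in> S \<Longrightarrow> pos x \<Longrightarrow> x \<sqsubseteq> C *\<^sub>R w \<Longrightarrow> e \<odot> x = x"
        "\<And>v. v \<in> S \<Longrightarrow> w \<odot> v = 0 \<Longrightarrow> e \<odot> v = 0"
      then have "Q l w v e a" unfolding Q_def using w by blast
      then show ?thesis by blast
    qed
  qed
  then obtain w v e a where Q: "\<And>l. Q l (w l) (v l) (e l) (a l)" by metis
  have q: "w l \<in> S" "v l \<in> S" "pos (w l)" "pos (v l)" "w l \<odot> v l = 0" "f - l *\<^sub>R \<one> = w l - v l"
    "e l \<odot> e l = e l" "is_sup (a l) (e l)" "incr (a l)" "a l n \<in> S" "pos (a l n)" "a l n \<sqsubseteq> \<one>" "a l n \<sqsubseteq> real n *\<^sub>R w l" for l n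
    using Q[of l] unfolding Q_def by blast+
  have qe: "x \<in> S \<Longrightarrow> pos x \<Longrightarrow> x \<sqsubseteq> C *\<^sub>R w l \<Longrightarrow> e l \<odot> x = x" for l x C using Q[of l] unfolding Q_def by blast
  have qz: "u \<in> S \<Longrightarrow> w l \<odot> u = 0 \<Longrightarrow> e l \<odot> u = 0" for l u using Q[of l] unfolding Q_def by blast
  have step: "w l - v l = w m - v m + (m - l) *\<^sub>R \<one>" for l m
    unfolding q(6)[symmetric] by (simp add: scaleR_diff_left)
  have step': "v m - w m = v l - w l + (m - l) *\<^sub>R \<one>" for l m
  proof -
    have "v m - w m = - (f - m *\<^sub>R \<one>)" "v l - w l = - (f - l *\<^sub>R \<one>)" unfolding q(6) by simp_all
    then show ?thesis by (simp add: scaleR_diff_left)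
  qed
  have mono: "w m \<odot> (w l - w m - (m - l) *\<^sub>R \<one>) = 0" "w m \<sqsubseteq> w l" if "l \<le> m" for l m
    using parts_mono[OF S q(1,2) q(1,2) q(3,4) q(3,4) q(5) q(5) step] that by auto
  have monov: "v l \<sqsubseteq> v m" if "l \<le> m" for l m
    by (rule parts_mono(2)[OF S q(2,1) q(2,1) q(4,3) q(4,3) _ _ step']) (use that q(5) in \<open>simp_all add: comm[of "v _" "w _"]\<close>)
  have wf: "f \<odot> w l = w l \<odot> w l + l *\<^sub>R w l" for l
  proof -
    have "w l \<odot> (f - l *\<^sub>R \<one>) = w l \<odot> (w l - v l)" by (simp add: q(6))
    then show ?thesis by (simp add: bil q(5) unit_right comm[of f "w l"] diff_eq_eq)
  qed
  have ramp: "e m \<odot> (w l - w m) = (m - l) *\<^sub>R e m" "e l \<odot> (w l - w m) = w l - w m" "w l - w m \<sqsubseteq> (m - l) *\<^sub>R \<one>"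
    if lm: "l < m" for l m
  proof -
    have lm': "l \<le> m" using lm by simp
    have "w l - w m - (m - l) *\<^sub>R \<one> \<in> S" using q(1) D(2) by (intro li)
    then have "e m \<odot> (w l - w m - (m - l) *\<^sub>R \<one>) = 0" by (rule qz[OF _ mono(1)[OF lm']])
    then show "e m \<odot> (w l - w m) = (m - l) *\<^sub>R e m" unfolding diff_right[of _ "w l - w m"] scaleR_right unit_right by simp
    have "e l \<odot> w l = w l" by (rule qe[of _ 1]) (simp_all add: q)
    moreover have "e l \<odot> w m = w m" by (rule qe[of _ 1]) (simp_all add: q mono(2)[OF lm'])
    ultimately show "e l \<odot> (w l - w m) = w l - w m" by (simp add: diff_right)
    have "(m - l) *\<^sub>R \<one> - (w l - w m) = v m - v l"
      using step[of l m] by (simp add: algebra_simps)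
    then show "w l - w m \<sqsubseteq> (m - l) *\<^sub>R \<one>" using monov[OF lm'] by (simp add: le_def)
  qed
  have "spectral_family jm one f w e"
  proof unfold_locales
    fix l m :: real
    show "e l \<odot> e l = e l" by (rule q(7))
    show "e l \<odot> e m = e m" if lm: "l \<le> m"
    proof -
      have "a m n \<sqsubseteq> real n *\<^sub>R w l" for n
        by (rule le_trans[OF q(13) le_scale[OF mono(2)[OF lm]]]) simp
      then have "e l \<odot> a m n = a m n" for n by (rule qe[OF q(10,11)])
      then have "(\<one> - e l) \<odot> a m n = 0" for n by (simp add: diff_left unit)
      then have "(\<one> - e l) \<odot> e m = 0" by (rule sup_mult_eq[OF q(8,9,11,12)])
      then show ?thesis by (simp add: diff_left unit)
    qed
    show "w l \<in> gen 0 f" if "l \<ge> 0"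
      by (rule pos_part_gen[OF q(1)[unfolded S_def] q(3) that wf])
    \<comment> \<open>Compressing the positive ramp by the complement of \<open>e m\<close> gives
      exactly the difference of the two sides.\<close>
    show "(m - l) *\<^sub>R e m \<sqsubseteq> w l - w m" if lm: "l < m"
    proof -
      let ?c = "\<one> - e m" and ?t = "w l - w m"
      have c: "?c \<odot> ?c = ?c" by (rule compl_idem[OF q(7)])
      have ct: "?c \<odot> ?t = ?t - (m - l) *\<^sub>R e m" by (simp only: diff_left[of "\<one>"] unit ramp(1)[OF lm])
      have "?c \<odot> (?c \<odot> ?t) = ?c \<odot> ?t"
        unfolding ct by (simp only: diff_left[of "\<one>"] unit diff_right[of "e m" ?t] ramp(1)[OF lm] scaleR_right q(7)) simp
      then have "U ?c ?t = ?t - (m - l) *\<^sub>R e m" using U_even[OF c] ct by simp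
      moreover have "pos ?t" using mono(2)[of l m] lm by (simp add: le_def)
      ultimately show ?thesis using U_pos[OF c, of ?t] by (simp add: le_def)
    qed
    show "w l - w m \<sqsubseteq> (m - l) *\<^sub>R e l" if lm: "l < m"
      using U_le[OF q(7)[of l] ramp(3)[OF lm]] unfolding U_of_E1[OF q(7) ramp(2)[OF lm]] by (simp add: U_lin U_one[OF q(7)])
    show "w 0 = f"
    proof -
      have fw: "f = w 0 - v 0" using q(6)[of 0] by simp
      have "v 0 \<odot> f = - (v 0 \<odot> v 0)" by (subst fw) (simp add: diff_right comm[of "v 0" "w 0"] q(5))
      then have "pos (- (v 0 \<odot> v 0))" using pm[OF q(2,4) fS f] by metis
      then have "v 0 = 0" by (rule neg_sq_zero)
      then show ?thesis using fw by simp
    qed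
    show "w l = 0" if l: "norm f \<le> l"
    proof -
      have "f \<sqsubseteq> l *\<^sub>R \<one>" by (rule le_trans[OF le_norm(1) le_scale_left[OF pos_one l]])
      then have "pos (l *\<^sub>R \<one> - f)" by (simp add: le_def)
      moreover have "l *\<^sub>R \<one> - f \<in> S" using fS D(2) by (intro li)
      ultimately have "pos (w l \<odot> (l *\<^sub>R \<one> - f))" using pm[OF q(1,3)] by blast
      moreover have "l *\<^sub>R \<one> - f = v l - w l" using q(6)[of l] by (metis minus_diff_eq)
      ultimately have "pos (- (w l \<odot> w l))" by (simp add: diff_right q(5))
      then show ?thesis by (rule neg_sq_zero)
    qed
  qed
  then show ?thesis by (rule that)
qed

context spectral_family
begin

lemma p_comm: "l \<le> m \<Longrightarrow> p m \<odot> p l = p m"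
  using p_mult comm by metis

definition N :: "real set \<Rightarrow> 'a set" where "N L = closure (span (p ` L))"

lemma N_oca: "oca (N L)"
  unfolding N_def
proof (rule oca_closure_span)
  fix x y assume "x \<in> p ` L" "y \<in> p ` L"
  then obtain l m where lm: "l \<in> L" "m \<in> L" "x = p l" "y = p m" by blast
  have sub: "p ` L \<subseteq> closure (span (p ` L))" using closure_subset[of "span (p ` L)"] span_superset[of "p ` L"] by blast
  show "x \<odot> y \<in> closure (span (p ` L))"
    using lm sub p_mult[of l m] p_comm[of m l] by (cases "l \<le> m") auto
  show "oc x y"
    using lm oc_E1[OF p_idem p_mult[of l m]] oc_E1[OF p_idem p_mult[of m l]] oc_sym[of x y] by (cases "l \<le> m") auto
qed

text \<open>Without spectrum between the two levels, the two bounds of the ramp coincide and the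
  ramp is a multiple of \<open>p l\<close>.\<close>

lemma p_in_gen: 
  assumes l: "0 \<le> l" "l < m" and e: "p l = p m"
  shows "p l \<in> gen 0 f"
proof -
  have "w l - w m = (m - l) *\<^sub>R p l" using le_antisym[OF ramp_upper[OF l(2)]] ramp_lower[OF l(2)] e by simp
  then have "p l = (1 / (m - l)) *\<^sub>R (w l - w m)" using l by simp
  moreover have "w l - w m \<in> gen 0 f" using w_gen l by (intro oca_lin[OF oca_gen0]) auto
  ultimately show ?thesis using oca_lin(4)[OF oca_gen0] by metis
qed

text \<open>Riemann sums of step \<open>\<delta> = s / n\<close>: the ramps telescope to
  \<open>f\<close>, and bounding each of them encloses \<open>f\<close> between the sums over right
  and over left end points, which differ by at most \<delta>.\<close>

lemma f_in_N:
  assumes s: "s > 0"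
  shows "f \<in> N {s * q | q. q \<in> \<rat> \<and> q > 0}"
proof -
  let ?L = "{s * q | q. q \<in> \<rat> \<and> q > (0::real)}"
  have "\<exists>y\<in>span (p ` ?L). dist y f < e" if e: "e > 0" for e
  proof -
    obtain n :: nat where n: "s / e < real n" using reals_Archimedean2 by blast
    have "0 < s / e" using s e by simp
    then have n0: "real n > 0" using n by linarith
    define \<delta> where "\<delta> = s / real n"
    have d: "\<delta> > 0" using s n0 by (simp add: \<delta>_def)
    have de: "\<delta> < e" using n n0 e s by (simp add: \<delta>_def field_simps)
    obtain k :: nat where k: "norm f / \<delta> < real k" using reals_Archimedean2 by blast
    then have kd: "norm f \<le> real k * \<delta>" using d by (simp add: field_simps)
    \<comment> \<open>\<open>Suc i\<close> avoids the level 0, which does not belong to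
      \<open>?L\<close>.\<close>
    define y where "y = (\<Sum>i<k. \<delta> *\<^sub>R p (real (Suc i) * \<delta>))"
    have y: "y \<in> span (p ` ?L)" unfolding y_def
    proof (intro span_sum span_scale span_base imageI)
      fix i
      have "real (Suc i) * \<delta> = s * (real (Suc i) / real n)" by (simp add: \<delta>_def)
      moreover have "real (Suc i) / real n \<in> \<rat>" by simp
      moreover have "real (Suc i) / real n > 0" using n0 by simp
      ultimately show "real (Suc i) * \<delta> \<in> ?L" by blast
    qed
    have tel: "(\<Sum>i<k. w (real i * \<delta>) - w (real (Suc i) * \<delta>)) = f"
      unfolding sum_lessThan_telescope'[of "\<lambda>i. w (real i * \<delta>)"] using w_0 w_top[OF kd] by simp
    have sd: "real i * \<delta> < real (Suc i) * \<delta>" "real (Suc i) * \<delta> - real i * \<delta> = \<delta>" for i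
      using d by (simp_all add: distrib_right)
    have lo: "y \<sqsubseteq> f" unfolding y_def tel[symmetric]
      by (rule sum_mono_le) (use ramp_lower[OF sd(1)] sd(2) in simp)
    have "f \<sqsubseteq> (\<Sum>i<k. \<delta> *\<^sub>R p (real i * \<delta>))" unfolding tel[symmetric]
      by (rule sum_mono_le) (use ramp_upper[OF sd(1)] sd(2) in simp)
    also have "(\<Sum>i<k. \<delta> *\<^sub>R p (real i * \<delta>)) = y + \<delta> *\<^sub>R (p 0 - p (real k * \<delta>))"
    proof -
      have "(\<Sum>i<k. \<delta> *\<^sub>R p (real i * \<delta>)) - y = \<delta> *\<^sub>R (\<Sum>i<k. p (real i * \<delta>) - p (real (Suc i) * \<delta>))"
        unfolding y_def scaleR_sum_right scaleR_diff_right sum_subtractf ..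
      then show ?thesis unfolding sum_lessThan_telescope'[of "\<lambda>i. p (real i * \<delta>)"] by (simp add: diff_eq_eq add.commute)
    qed
    finally have up: "f \<sqsubseteq> y + \<delta> *\<^sub>R (p 0 - p (real k * \<delta>))" .
    have b: "p 0 - p (real k * \<delta>) \<sqsubseteq> \<one>"
    proof -
      have i: "(p 0 - p (real k * \<delta>)) \<odot> (p 0 - p (real k * \<delta>)) = p 0 - p (real k * \<delta>)"
        by (rule idem_diff[OF p_idem p_idem p_mult]) (use d in simp)
      show ?thesis by (rule idem_le[OF i unit unit])
    qed
    have pf: "pos (f - y)" using lo by (simp add: le_def)
    have "f - y \<sqsubseteq> \<delta> *\<^sub>R (p 0 - p (real k * \<delta>))" using up by (simp add: le_def algebra_simps)
    also have "\<dots> \<sqsubseteq> \<delta> *\<^sub>R \<one>" using b d by (intro le_scale) simp_all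
    finally have "norm (f - y) \<le> norm (\<delta> *\<^sub>R \<one>)" by (rule norm_mono[OF pf])
    also have "\<dots> \<le> \<delta>" using norm_one_le d by simp
    finally show ?thesis using y de by (intro bexI[of _ y]) (simp_all add: dist_norm norm_minus_commute)
  qed
  then show ?thesis unfolding N_def closure_approachable by blast
qed

text \<open>An element common to both spans is nearly continuous in \<open>f\<close>: a jump at \<open>l \<in> L\<close> of the first
  approximant cannot be matched by the second one, so it is small unless \<open>l\<close> borders a gap of the
  spectrum, and then \<open>p l\<close> is itself a continuous function of \<open>f\<close>. Ramps replace the small jumps.\<close>

lemma N_inter:
  assumes L: "\<And>l. l \<in> L \<Longrightarrow> l > 0" "\<And>l. l \<in> M \<Longrightarrow> l > 0" "L \<inter> M = {}"
  shows "N L \<inter> N M \<subseteq> gen 0 f"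
proof
  fix a assume a: "a \<in> N L \<inter> N M"
  note gl = oca_lin[OF oca_gen0[of f]]
  have "\<exists>z\<in>gen 0 f. dist z a < e" if e: "e > 0" for e
  proof -
    \<comment> \<open>Five of these are spent: one from \<open>a\<close> to \<open>x\<close> and
      four from \<open>x\<close> to \<open>z\<close>.\<close>
    define \<epsilon> where "\<epsilon> = e / 6"
    have \<epsilon>: "\<epsilon> > 0" using e by (simp add: \<epsilon>_def)
    obtain x where x: "x \<in> span (p ` L)" "dist x a < \<epsilon>" using a \<epsilon> unfolding N_def Int_iff closure_approachable by blast
    obtain y where y: "y \<in> span (p ` M)" "dist y a < \<epsilon>" using a \<epsilon> unfolding N_def Int_iff closure_approachable by blast
    obtain F c where F: "finite F" "F \<subseteq> L" "x = (\<Sum>l\<in>F. c l *\<^sub>R p l)" using span_image_explicit[OF x(1)] by blast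
    obtain G d where G: "finite G" "G \<subseteq> M" "y = (\<Sum>l\<in>G. d l *\<^sub>R p l)" using span_image_explicit[OF y(1)] by blast
    have xy: "norm (x - y) \<le> 2 * \<epsilon>"
      using dist_triangle2[of x y a] x(2) y(2) by (simp add: dist_norm)
    have "finite (insert 0 (F \<union> G))" using F G by simp
    \<comment> \<open>Including the level 0 keeps \<open>l - \<eta>\<close> positive for every level
      \<open>l\<close> that occurs.\<close>
    then obtain \<eta> where \<eta>: "\<eta> > 0" "\<forall>u\<in>insert 0 (F \<union> G). \<forall>v\<in>insert 0 (F \<union> G). u < v \<longrightarrow> u + \<eta> < v"
      using finite_separated by blast
    have bsum: "(\<Sum>l\<in>K. h l *\<^sub>R p l) \<odot> b = (\<Sum>l\<in>K. if A l then h l else 0) *\<^sub>R b"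
      if "\<And>l. l \<in> K \<Longrightarrow> p l \<odot> b = (if A l then b else 0)" for K h A b
      unfolding sum_left scaleR_left scaleR_sum_left by (intro sum.cong refl) (simp add: that)
    have jump: "\<bar>c l\<bar> \<le> 4 * \<epsilon>" if l: "l \<in> F" "p l \<notin> gen 0 f" for l
    proof -
      have l0: "l > 0" "l \<in> F \<union> G" "l \<notin> G" using l F(2) G(2) L by blast+
      have ln: "\<eta> < l" using \<eta>(2) l0 by auto
      \<comment> \<open>The strips just above and just below \<open>l\<close>, both nonzero since
        otherwise \<open>p l\<close> would lie in \<open>gen 0 f\<close>. On each strip
        \<open>x\<close> and \<open>y\<close> act as scalars; crossing \<open>l\<close> changes the
        scalar of \<open>x\<close> by \<open>c l\<close> and leaves that of \<open>y\<close>
        unchanged.\<close>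
      define bp where "bp = p l - p (l + \<eta>)"
      define bm where "bm = p (l - \<eta>) - p l"
      have bp: "bp \<odot> bp = bp" "bp \<noteq> 0"
        unfolding bp_def using idem_diff[OF p_idem p_idem p_mult] p_in_gen[of l "l + \<eta>"] l l0 \<eta>(1) by auto
      have bm: "bm \<odot> bm = bm" "bm \<noteq> 0"
        unfolding bm_def using idem_diff[OF p_idem p_idem p_mult] p_in_gen[of "l - \<eta>" l] l ln \<eta>(1) by auto
      have pb: "p k \<odot> bp = (if k \<le> l then bp else 0)" if "k \<in> F \<union> G" for k
      proof (cases "k \<le> l")
        case True
        then show ?thesis unfolding bp_def diff_right using p_mult[of k l] p_mult[of k "l + \<eta>"] \<eta>(1) by simp
      next
        case False
        then have "l + \<eta> < k" using \<eta>(2) l0(2) that by auto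
        then show ?thesis unfolding bp_def diff_right using p_comm[of l k] p_comm[of "l + \<eta>" k] False by simp
      qed
      have mb: "p k \<odot> bm = (if k < l then bm else 0)" if "k \<in> F \<union> G" for k
      proof (cases "k < l")
        case True
        then have "k + \<eta> < l" using \<eta>(2) l0(2) that by auto
        then show ?thesis unfolding bm_def diff_right using p_mult[of k l] p_mult[of k "l - \<eta>"] True by simp
      next
        case False
        then show ?thesis unfolding bm_def diff_right using p_comm[of l k] p_comm[of "l - \<eta>" k] \<eta>(1) by simp
      qed
      let ?X = "\<lambda>A. \<Sum>k\<in>F. if A k then c k else 0" and ?Y = "\<lambda>A. \<Sum>k\<in>G. if A k then d k else 0"
      have bd: "\<bar>?X A - ?Y A\<bar> \<le> 2 * \<epsilon>" if b: "b \<odot> b = b" "b \<noteq> 0" "\<And>k. k \<in> F \<union> G \<Longrightarrow> p k \<odot> b = (if A k then b else 0)" for b A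
      proof -
        have "x \<odot> b = ?X A *\<^sub>R b" unfolding F(3) by (rule bsum) (use b(3) in simp)
        moreover have "y \<odot> b = ?Y A *\<^sub>R b" unfolding G(3) by (rule bsum) (use b(3) in simp)
        ultimately have "(x - y) \<odot> b = (?X A - ?Y A) *\<^sub>R b" by (simp add: diff_left scaleR_diff_left)
        then have "\<bar>?X A - ?Y A\<bar> = norm ((x - y) \<odot> b)" using norm_nz_idem[OF b(1,2)] by simp
        also have "\<dots> \<le> norm (x - y)" using norm_mult_le[of "x - y" b] norm_nz_idem[OF b(1,2)] by simp
        finally show ?thesis using xy by linarith
      qed
      have 1: "\<bar>?X (\<lambda>k. k \<le> l) - ?Y (\<lambda>k. k \<le> l)\<bar> \<le> 2 * \<epsilon>" by (rule bd[OF bp pb])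
      have 2: "\<bar>?X (\<lambda>k. k < l) - ?Y (\<lambda>k. k < l)\<bar> \<le> 2 * \<epsilon>" by (rule bd[OF bm mb])
      have 3: "?Y (\<lambda>k. k \<le> l) = ?Y (\<lambda>k. k < l)" by (intro sum.cong refl) (use l0(3) in auto)
      have "?X (\<lambda>k. k \<le> l) - ?X (\<lambda>k. k < l) = (\<Sum>k\<in>F. if k = l then c l else 0)"
        unfolding sum_subtractf[symmetric] by (intro sum.cong refl) auto
      then have "?X (\<lambda>k. k \<le> l) - ?X (\<lambda>k. k < l) = c l" using F(1) l(1) by simp
      then show ?thesis using 1 2 unfolding 3 by linarith
    qed
    define r where "r l = (if p l \<in> gen 0 f then p l else (1/\<eta>) *\<^sub>R (w l - w (l + \<eta>)))" for l
    have rg: "r l \<in> gen 0 f" if "l \<in> F" for l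
      unfolding r_def using that F(2) L(1) \<eta>(1) w_gen[of l] w_gen[of "l + \<eta>"] by (force intro!: gl)
    define z where "z = (\<Sum>l\<in>F. c l *\<^sub>R r l)"
    have zg: "z \<in> gen 0 f" unfolding z_def
      by (rule subspace_sum[OF oca_subspace[OF oca_gen0]]) (rule gl(4), erule rg)
    define b where "b l = p l - p (l + \<eta>)" for l
    have bi: "b l \<odot> b l = b l" for l unfolding b_def by (rule idem_diff[OF p_idem p_idem p_mult]) (use \<eta>(1) in simp)
    have dl: "pos (p l - r l) \<and> p l - r l \<sqsubseteq> b l" for l
    proof (cases "p l \<in> gen 0 f")
      case True
      then show ?thesis using pos_idem[OF bi[of l]] by (simp add: r_def pos_0 pos_le[symmetric])
    next
      case False
      have lt: "l < l + \<eta>" using \<eta>(1) by simp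
      have "(1/\<eta>) *\<^sub>R ((l + \<eta> - l) *\<^sub>R p (l + \<eta>)) \<sqsubseteq> (1/\<eta>) *\<^sub>R (w l - w (l + \<eta>))"
        by (rule le_scale[OF ramp_lower[OF lt]]) (use \<eta>(1) in simp)
      then have 1: "p (l + \<eta>) \<sqsubseteq> r l" using \<eta>(1) False by (simp add: r_def)
      have "(1/\<eta>) *\<^sub>R (w l - w (l + \<eta>)) \<sqsubseteq> (1/\<eta>) *\<^sub>R ((l + \<eta> - l) *\<^sub>R p l)"
        by (rule le_scale[OF ramp_upper[OF lt]]) (use \<eta>(1) in simp)
      then have 2: "r l \<sqsubseteq> p l" using \<eta>(1) False by (simp add: r_def)
      show ?thesis using 2 le_diff[OF le_refl[of "p l"] 1] by (simp add: le_def b_def)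
    qed
    have cl: "c l *\<^sub>R (p l - r l) \<sqsubseteq> (4 * \<epsilon>) *\<^sub>R b l \<and> (- (4 * \<epsilon>)) *\<^sub>R b l \<sqsubseteq> c l *\<^sub>R (p l - r l)" if l: "l \<in> F" for l
    proof -
      note pd = conjunct1[OF dl[of l]]
      have M: "(4 * \<epsilon>) *\<^sub>R (p l - r l) \<sqsubseteq> (4 * \<epsilon>) *\<^sub>R b l" by (rule le_scale[OF conjunct2[OF dl]]) (use \<epsilon> in simp)
      have M': "(- (4 * \<epsilon>)) *\<^sub>R b l \<sqsubseteq> (- (4 * \<epsilon>)) *\<^sub>R (p l - r l)" using le_neg[OF M] by (simp only: scaleR_minus_left)
      show ?thesis
      proof (cases "p l \<in> gen 0 f")
        case True
        then have "p l - r l = 0" by (simp add: r_def)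
        then show ?thesis using M M' by simp
      next
        case False
        have j: "c l \<le> 4 * \<epsilon>" "- (4 * \<epsilon>) \<le> c l" using jump[OF l False] by linarith+
        show ?thesis using le_trans[OF le_scale_left[OF pd j(1)] M] le_trans[OF M' le_scale_left[OF pd j(2)]] by blast
      qed
    qed
    have xz: "x - z = (\<Sum>l\<in>F. c l *\<^sub>R (p l - r l))" unfolding F(3) z_def sum_subtractf[symmetric] scaleR_diff_right ..
    have bo: "b l \<odot> b k = 0" if lk: "l \<in> F" "k \<in> F" "l \<noteq> k" for l k
    proof -
      have o: "b l \<odot> b k = 0" if lk: "l \<in> F" "k \<in> F" "l < k" for l k
      proof -
        have "l + \<eta> < k" using \<eta>(2) lk by auto
        then show ?thesis unfolding b_def using lk \<eta>(1)
          by (simp add: diff_left diff_right p_mult)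
      qed
      show ?thesis using o[OF lk(1,2)] o[OF lk(2,1)] lk(3) comm[of "b l" "b k"] by (cases "l < k") auto
    qed
    have bs: "sum b F \<odot> sum b F = sum b F" by (rule idem_sum[OF F(1) bi bo])
    have b1: "sum b F \<sqsubseteq> \<one>" by (rule idem_le[OF bs unit unit])
    have "x - z \<sqsubseteq> (\<Sum>l\<in>F. (4 * \<epsilon>) *\<^sub>R b l)" unfolding xz by (rule sum_mono_le) (use cl in blast)
    then have u: "x - z \<sqsubseteq> (4 * \<epsilon>) *\<^sub>R \<one>"
      using le_trans[OF _ le_scale[OF b1, of "4 * \<epsilon>"]] \<epsilon> by (simp add: scaleR_sum_right)
    have "(\<Sum>l\<in>F. (- (4 * \<epsilon>)) *\<^sub>R b l) \<sqsubseteq> x - z" unfolding xz by (rule sum_mono_le) (use cl in blast)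
    then have "- ((4 * \<epsilon>) *\<^sub>R sum b F) \<sqsubseteq> x - z" by (simp add: scaleR_sum_right sum_negf)
    then have v: "- ((4 * \<epsilon>) *\<^sub>R \<one>) \<sqsubseteq> x - z"
      using le_trans[OF le_neg[OF le_scale[OF b1, of "4 * \<epsilon>"]]] \<epsilon> by simp
    have "norm (x - z) \<le> 4 * \<epsilon>" using norm_le_iff[of "4 * \<epsilon>" "x - z"] u v \<epsilon> by simp
    then have "dist z a < e" using dist_triangle2[of z a x] x(2) \<epsilon>
      by (simp add: dist_norm norm_minus_commute \<epsilon>_def)
    then show ?thesis using zg by blast
  qed
  then show "a \<in> gen 0 f" using closed_approachable[OF oca_closed[OF oca_gen0[of f]]] by blast
qed

end

lemma irrational_exists: "\<exists>x::real. x > 0 \<and> x \<notin> \<rat>"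
proof -
  have "\<not> (UNIV :: real set) \<subseteq> \<rat>"
    using uncountable_UNIV_real countable_subset[OF _ countable_rat] by auto
  then obtain x :: real where x: "x \<notin> \<rat>" by blast
  then have "x \<noteq> 0" by auto
  then have "\<bar>x\<bar> > 0" by simp
  moreover have "\<bar>x\<bar> \<notin> \<rat>" using x by (metis Rats_minus_iff abs_real_def)
  ultimately show ?thesis by blast
qed

context jbw
begin

section \<open>Rigidity of order automorphisms fixing all lines\<close>

text \<open>Each \<open>N L\<close> is mapped into itself by \<tau>, because \<open>\<tau>'\<close>
  fixes the lines that span it and is undone by \<tau>. \<open>gen 0 f\<close> lies in
  \<open>N L\<close> for the positive rationals and for their multiples by an irrational, so its
  image lies in the intersection of the two.\<close>

lemma gen_invariant:
  assumes mem: "\<And>C. C \<in> AS jm \<Longrightarrow> \<tau> C \<in> AS jm" "\<And>C. C \<in> AS jm \<Longrightarrow> \<tau>' C \<in> AS jm"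
    and mono: "\<And>C D. C \<in> AS jm \<Longrightarrow> D \<in> AS jm \<Longrightarrow> C \<subseteq> D \<Longrightarrow> \<tau> C \<subseteq> \<tau> D"
      "\<And>C D. C \<in> AS jm \<Longrightarrow> D \<in> AS jm \<Longrightarrow> C \<subseteq> D \<Longrightarrow> \<tau>' C \<subseteq> \<tau>' D"
    and inv: "\<And>C. C \<in> AS jm \<Longrightarrow> \<tau> (\<tau>' C) = C"
    and fx: "\<And>p. p \<odot> p = p \<Longrightarrow> \<tau> (span {p}) = span {p}" "\<And>p. p \<odot> p = p \<Longrightarrow> \<tau>' (span {p}) = span {p}"
    and f: "pos f"
  shows "\<tau> (gen 0 f) \<subseteq> gen 0 f"
proof -
  obtain w p where sf: "spectral_family jm one f w p" by (rule spectral_family_exists[OF f])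
  interpret spectral_family jm one f w p by (rule sf)
  have NA: "N L \<in> AS jm" for L by (rule oca_AS[OF N_oca])
  have sub: "N L \<subseteq> \<omega> (N L)"
    if o: "\<And>C. C \<in> AS jm \<Longrightarrow> \<omega> C \<in> AS jm" "\<And>C D. C \<in> AS jm \<Longrightarrow> D \<in> AS jm \<Longrightarrow> C \<subseteq> D \<Longrightarrow> \<omega> C \<subseteq> \<omega> D"
      "\<And>p. p \<odot> p = p \<Longrightarrow> \<omega> (span {p}) = span {p}" for \<omega> L
  proof -
    have W: "subspace (\<omega> (N L))" "closed (\<omega> (N L))" using o(1)[OF NA] by (auto simp: AS_def)
    have "p l \<in> \<omega> (N L)" if l: "l \<in> L" for l
    proof -
      have "p l \<in> span (p ` L)" by (rule span_base) (use l in simp)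
      then have "p l \<in> N L" unfolding N_def by (rule subsetD[OF closure_subset])
      then have "span {p l} \<subseteq> N L" using oca_subspace[OF N_oca[of L]] by (simp add: span_minimal)
      then have "span {p l} \<subseteq> \<omega> (N L)" using o(2)[OF span_AS[OF p_idem] NA] o(3)[OF p_idem] by blast
      then show ?thesis using span_base[of "p l" "{p l}"] by blast
    qed
    then have "p ` L \<subseteq> \<omega> (N L)" by blast
    then have "closure (span (p ` L)) \<subseteq> \<omega> (N L)" by (rule closure_span_subset[OF W])
    then show ?thesis by (simp only: N_def)
  qed
  have eq: "\<tau> (N L) \<subseteq> N L" for L
    using mono(1)[OF NA mem(2)[OF NA] sub[OF mem(2) mono(2) fx(2)], of L] inv[OF NA, of L] by simp
  have gA: "gen 0 f \<in> AS jm" by (rule oca_AS[OF oca_gen0])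
  have in_N: "\<tau> (gen 0 f) \<subseteq> N {s * q | q. q \<in> \<rat> \<and> q > 0}" if s: "s > 0" for s
  proof -
    have "gen 0 f \<subseteq> N {s * q | q. q \<in> \<rat> \<and> q > 0}" by (rule gen0_minimal[OF NA f_in_N[OF s]])
    then show ?thesis using mono(1)[OF gA NA] eq by blast
  qed
  obtain \<alpha> :: real where \<alpha>: "\<alpha> > 0" "\<alpha> \<notin> \<rat>" using irrational_exists by blast
  have "N {1 * q | q. q \<in> \<rat> \<and> q > 0} \<inter> N {\<alpha> * q | q. q \<in> \<rat> \<and> q > 0} \<subseteq> gen 0 f"
  proof (rule N_inter)
    show "{1 * q | q. q \<in> \<rat> \<and> q > 0} \<inter> {\<alpha> * q | q. q \<in> \<rat> \<and> q > 0} = {}"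
    proof (rule ccontr)
      assume "\<not> ?thesis"
      then obtain q q' where q: "q \<in> \<rat>" "q' \<in> \<rat>" "q' > 0" "q = \<alpha> * q'" by auto
      then have "\<alpha> = q / q'" by simp
      then show False using \<alpha>(2) q Rats_divide by metis
    qed
  qed (use \<alpha>(1) in auto)
  then show ?thesis using in_N[of 1] in_N[OF \<alpha>(1)] by auto
qed

text \<open>Every element of \<open>C\<close> is a difference of two positive elements of
  \<open>C\<close>, and the subalgebras generated by those are fixed.\<close>

lemma order_auto_fixes:
  assumes mem: "\<And>C. C \<in> AS jm \<Longrightarrow> \<tau> C \<in> AS jm" "\<And>C. C \<in> AS jm \<Longrightarrow> \<tau>' C \<in> AS jm"
    and mono: "\<And>C D. C \<in> AS jm \<Longrightarrow> D \<in> AS jm \<Longrightarrow> C \<subseteq> D \<Longrightarrow> \<tau> C \<subseteq> \<tau> D"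
      "\<And>C D. C \<in> AS jm \<Longrightarrow> D \<in> AS jm \<Longrightarrow> C \<subseteq> D \<Longrightarrow> \<tau>' C \<subseteq> \<tau>' D"
    and inv: "\<And>C. C \<in> AS jm \<Longrightarrow> \<tau> (\<tau>' C) = C" "\<And>C. C \<in> AS jm \<Longrightarrow> \<tau>' (\<tau> C) = C"
    and fx: "\<And>p. p \<odot> p = p \<Longrightarrow> \<tau> (span {p}) = span {p}" "\<And>p. p \<odot> p = p \<Longrightarrow> \<tau>' (span {p}) = span {p}"
    and C: "C \<in> AS jm"
  shows "\<tau> C = C"
proof -
  have gA: "gen 0 g \<in> AS jm" for g by (rule oca_AS[OF oca_gen0])
  have main: "C \<subseteq> \<omega> C"
    if m: "\<And>C D. C \<in> AS jm \<Longrightarrow> D \<in> AS jm \<Longrightarrow> C \<subseteq> D \<Longrightarrow> \<omega> C \<subseteq> \<omega> D" "\<omega> C \<in> AS jm"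
      and g: "\<And>g. pos g \<Longrightarrow> gen 0 g \<subseteq> \<omega> (gen 0 g)" for \<omega>
  proof
    fix x assume x: "x \<in> C"
    obtain w v where w: "w \<in> gen \<one> x" "v \<in> gen \<one> x" "pos w" "pos v" "w \<odot> v = 0" "x = w - v"
      by (rule pos_neg_parts[OF loc_unit_gen1 gen_self])
    have sub: "subspace C" "subspace (\<omega> C)" using C m(2) by (auto simp: AS_def)
    have "x \<odot> w = w \<odot> w + 0 *\<^sub>R w" by (subst w(6)) (simp add: diff_left comm[of v w] w(5))
    then have "w \<in> gen 0 x" by (rule pos_part_gen[OF w(1,3) order_refl])
    then have wC: "w \<in> C" using gen0_minimal[OF C x] by blast
    have "v = w - x" using w(6) by simp
    then have vC: "v \<in> C" using subspace_diff[OF sub(1) wC x] by simp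
    have in\<omega>: "h \<in> \<omega> C" if h: "h \<in> C" "pos h" for h
      using m(1)[OF gA C gen0_minimal[OF C h(1)]] g[OF h(2)] gen_self[of h 0] by blast
    show "x \<in> \<omega> C" unfolding w(6) by (rule subspace_diff[OF sub(2) in\<omega>[OF wC w(3)] in\<omega>[OF vC w(4)]])
  qed
  have 1: "gen 0 g \<subseteq> \<tau> (gen 0 g)" if g: "pos g" for g
  proof -
    have "\<tau>' (gen 0 g) \<subseteq> gen 0 g" by (rule gen_invariant[of \<tau>' \<tau>]) ((rule mem mono inv fx g; assumption)+)
    then have "\<tau> (\<tau>' (gen 0 g)) \<subseteq> \<tau> (gen 0 g)" by (rule mono(1)[OF mem(2)[OF gA] gA])
    then show ?thesis by (simp only: inv(1)[OF gA])
  qed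
  have 2: "gen 0 g \<subseteq> \<tau>' (gen 0 g)" if g: "pos g" for g
  proof -
    have "\<tau> (gen 0 g) \<subseteq> gen 0 g" by (rule gen_invariant[of \<tau> \<tau>']) ((rule mem mono inv fx g; assumption)+)
    then have "\<tau>' (\<tau> (gen 0 g)) \<subseteq> \<tau>' (gen 0 g)" by (rule mono(2)[OF mem(1)[OF gA] gA])
    then show ?thesis by (simp only: inv(2)[OF gA])
  qed
  have a: "C \<subseteq> \<tau> C" by (rule main[OF mono(1) mem(1)[OF C] 1])
  have "C \<subseteq> \<tau>' C" by (rule main[OF mono(2) mem(2)[OF C] 2])
  then have "\<tau> C \<subseteq> \<tau> (\<tau>' C)" by (rule mono(1)[OF C mem(2)[OF C]])
  then show ?thesis using a inv(1)[OF C] by blast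
qed

text \<open>A minimal subalgebra has no zero divisors, so for positive \<open>f\<close> of norm one either \<open>(f - l)\<^sub>+\<close> or
  \<open>f \<odot> (f - l)\<^sub>-\<close> vanishes.\<close>

lemma atom_idem:
  assumes C: "C \<in> AS jm" "C \<noteq> {0}" and at: "\<And>D. D \<in> AS jm \<Longrightarrow> D \<subseteq> C \<Longrightarrow> D = {0} \<or> D = C"
  shows "\<exists>p. p \<odot> p = p \<and> C = span {p}"
proof -
  have cs: "subspace C" "closed C" "\<And>x y. x \<in> C \<Longrightarrow> y \<in> C \<Longrightarrow> x \<odot> y \<in> C"
    "\<And>x y z. x \<in> C \<Longrightarrow> y \<in> C \<Longrightarrow> z \<in> C \<Longrightarrow> (x \<odot> y) \<odot> z = x \<odot> (y \<odot> z)"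
    using C(1) by (auto simp: AS_def)
  have nzd: "g = 0 \<or> h = 0" if gh: "g \<in> C" "h \<in> C" "g \<odot> h = 0" for g h
  proof -
    \<comment> \<open>The annihilator of \<open>g\<close> in \<open>C\<close> is itself a
      subalgebra, so minimality leaves only \<open>{0}\<close> and \<open>C\<close>.\<close>
    let ?D = "C \<inter> {x. g \<odot> x = 0}"
    have 1: "subspace ?D" by (rule subspace_inter[OF cs(1)]) (rule subspaceI; simp add: bil)
    have "closed {x. g \<odot> x = 0}" by (intro closed_eq_cont continuous_intros)
    then have 2: "closed ?D" using cs(2) by blast
    have "?D \<in> AS jm" unfolding AS_def using 1 2 cs(3) cs(4)
      by (auto simp: cs(4)[OF gh(1), symmetric] zero_left)
    then have "?D = {0} \<or> ?D = C" using at by blast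
    then show ?thesis
    proof
      assume "?D = {0}" then show ?thesis using gh by blast
    next
      assume "?D = C" then have "g \<odot> g = 0" using gh(1) by blast
      then have "g = 0" by (rule sq_zero)
      then show ?thesis ..
    qed
  qed
  obtain a where a: "a \<in> C" "a \<noteq> 0" using C(2) subspace_0[OF cs(1)] by blast
  have aa: "a \<odot> a \<noteq> 0" using a(2) sq_zero[of a] by (rule contrapos_nn)
  define f where "f = (1 / norm (a \<odot> a)) *\<^sub>R (a \<odot> a)"
  have f: "f \<in> C" "pos f" "norm f = 1" unfolding f_def
    using subspace_scale[OF cs(1) cs(3)[OF a(1) a(1)]] pos_scale[OF pos_sq[of a]] aa by auto
  note S = loc_unit_gen1[of f]
  note D = loc_unitD[OF S] and li = oca_lin[OF loc_unitD(1)[OF S]]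
  have fS: "f \<in> gen \<one> f" by (rule gen_self)
  \<comment> \<open>\<open>C\<close> may lack the unit of the whole algebra, so the negative part
    \<open>v\<close> of \<open>f - l\<close> is brought into \<open>C\<close> by a factor
    \<open>f\<close>.\<close>
  have key: "l *\<^sub>R f \<sqsubseteq> f \<odot> f" if l: "0 < l" "l < 1" for l
  proof -
    have "f - l *\<^sub>R \<one> \<in> gen \<one> f" using fS D(2) by (intro li)
    then obtain w v where w: "w \<in> gen \<one> f" "v \<in> gen \<one> f" "pos w" "pos v" "w \<odot> v = 0" "f - l *\<^sub>R \<one> = w - v"
      by (rule pos_neg_parts[OF S])
    have "w \<odot> (f - l *\<^sub>R \<one>) = w \<odot> (w - v)" by (simp add: w(6))
    then have "f \<odot> w = w \<odot> w + l *\<^sub>R w" by (simp add: bil w(5) unit_right comm[of f w] diff_eq_eq)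
    then have "w \<in> gen 0 f" by (rule pos_part_gen[OF w(1,3) less_imp_le[OF l(1)]])
    then have wC: "w \<in> C" using gen0_minimal[OF C(1) f(1)] by blast
    have vC: "f \<odot> v \<in> C" using gen_one_mult[OF w(2)] gen0_minimal[OF C(1) f(1)] by blast
    have "w \<odot> (f \<odot> v) = 0" unfolding oca_lcomm[OF D(1) w(1) fS] w(5) by (simp add: zero_right)
    then consider "w = 0" | "f \<odot> v = 0" using nzd[OF wC vC] by blast
    then show ?thesis
    proof cases
      case 1
      then have "f \<sqsubseteq> l *\<^sub>R \<one>" using w(4,6) by (simp add: le_def) (metis minus_diff_eq minus_minus)
      then have "norm f \<le> norm (l *\<^sub>R \<one>)" by (rule norm_mono[OF f(2)])
      also have "\<dots> \<le> l" using norm_one_le l by simp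
      finally show ?thesis using f(3) l(2) by simp
    next
      case 2
      have "f \<odot> (f - l *\<^sub>R \<one>) = f \<odot> w" unfolding w(6) by (simp add: diff_right 2)
      then have "f \<odot> f - l *\<^sub>R f = f \<odot> w" by (simp add: bil unit_right)
      then show ?thesis unfolding le_def using loc_pos_mult[OF S fS f(2) w(1,3)] by simp
    qed
  qed
  have "f \<odot> f = f"
  proof (rule le_antisym)
    have "f \<sqsubseteq> \<one>" using le_norm(1)[of f] f(3) by simp
    then have "pos (f \<odot> (\<one> - f))" using loc_pos_mult[OF S fS f(2) li(3)[OF D(2) fS]] by (simp add: le_def)
    then show "f \<odot> f \<sqsubseteq> f" by (simp add: le_def diff_right unit_right)
    show "f \<sqsubseteq> f \<odot> f"
    proof (rule le_eps[of _ _ f])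
      fix \<epsilon> :: real assume e: "\<epsilon> > 0"
      \<comment> \<open>The maximum with \<open>1/2\<close> keeps the level in the open unit
        interval when \<epsilon> is large.\<close>
      have "(1 - \<epsilon>) *\<^sub>R f \<sqsubseteq> max (1 - \<epsilon>) (1/2) *\<^sub>R f" by (rule le_scale_left[OF f(2)]) simp
      also have "\<dots> \<sqsubseteq> f \<odot> f" by (rule key) (use e in auto)
      finally show "f \<sqsubseteq> f \<odot> f + \<epsilon> *\<^sub>R f" by (simp add: le_def scaleR_diff_left algebra_simps)
    qed
  qed
  moreover have "span {f} = C"
  proof -
    have "span {f} \<subseteq> C" using f(1) cs(1) by (simp add: span_minimal)
    then have "span {f} = {0} \<or> span {f} = C" using at[OF span_AS[OF \<open>f \<odot> f = f\<close>]] by blast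
    then show ?thesis
    proof
      assume "span {f} = {0}"
      then have "f = 0" using span_base[of f "{f}"] by blast
      then show ?thesis using f(3) by simp
    qed
  qed
  ultimately show ?thesis by (intro exI[of _ f]) simp
qed

text \<open>Taking for \<open>s\<close> the complements of \<open>e\<close> and of \<open>g\<close>
  shows that each of the two dominates the other.\<close>

lemma idem_eq_of_orth:
  assumes e: "e \<odot> e = e" and g: "g \<odot> g = g" and o: "\<And>s. s \<odot> s = s \<Longrightarrow> s \<odot> e = 0 \<longleftrightarrow> s \<odot> g = 0"
  shows "e = g"
proof -
  have "(\<one> - e) \<odot> g = 0" using o[OF compl_idem[OF e]] e by (simp add: diff_left unit)
  moreover have "(\<one> - g) \<odot> e = 0" using o[OF compl_idem[OF g]] g by (simp add: diff_left unit)
  ultimately show ?thesis by (simp add: diff_left unit comm[of g e])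
qed

end

section \<open>Transport of subalgebras by Jordan isomorphisms\<close>

lemma jordan_iso_inv:
  assumes "jordan_iso jA jB \<psi>"
  shows "jordan_iso jB jA (inv \<psi>)"
proof -
  have b: "bij \<psi>" "linear \<psi>" "\<And>x y. \<psi> (jA x y) = jB (\<psi> x) (\<psi> y)" using assms by (auto simp: jordan_iso_def)
  have f: "\<psi> (inv \<psi> y) = y" for y using b(1) by (simp add: bij_is_surj surj_f_inv_f)
  have g: "inv \<psi> (\<psi> x) = x" for x using b(1) by (simp add: bij_is_inj inv_f_f)
  have "linear (inv \<psi>)"
  proof (rule linearI)
    show "inv \<psi> (x + y) = inv \<psi> x + inv \<psi> y" for x y using g[of "inv \<psi> x + inv \<psi> y"] by (simp add: linear_add[OF b(2)] f)
    show "inv \<psi> (c *\<^sub>R x) = c *\<^sub>R inv \<psi> x" for c x using g[of "c *\<^sub>R inv \<psi> x"] by (simp add: linear_scale[OF b(2)] f)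
  qed
  moreover have "inv \<psi> (jB x y) = jA (inv \<psi> x) (inv \<psi> y)" for x y using g[of "jA (inv \<psi> x) (inv \<psi> y)"] by (simp add: b(3) f)
  ultimately show ?thesis using bij_imp_bij_inv[OF b(1)] by (simp add: jordan_iso_def)
qed

text \<open>Squares and the unit are preserved, hence the order, and the norm is the order unit
  norm.\<close>

lemma jordan_iso_norm_le:
  assumes A: "jbw jA oneA" and B: "jbw jB oneB" and iso: "jordan_iso jA jB \<psi>"
  shows "norm (\<psi> a) \<le> norm a"
proof -
  interpret A: jbw jA oneA by (rule A)
  interpret B: jbw jB oneB by (rule B)
  have b: "bij \<psi>" "linear \<psi>" "\<And>x y. \<psi> (jA x y) = jB (\<psi> x) (\<psi> y)" using iso by (auto simp: jordan_iso_def)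
  have one: "\<psi> oneA = oneB"
  proof -
    obtain u where u: "\<psi> u = oneB" using b(1) by (metis bij_pointE)
    have "jB (\<psi> oneA) (\<psi> u) = \<psi> u" unfolding b(3)[symmetric] A.unit ..
    then show ?thesis unfolding u B.unit_right .
  qed
  have "B.pos (\<psi> x)" if "A.pos x" for x using that unfolding A.pos_def B.pos_def by (auto simp: b(3))
  then have le: "B.le (\<psi> x) (\<psi> y)" if "A.le x y" for x y using that by (simp add: A.le_def B.le_def linear_diff[OF b(2), symmetric])
  have "B.le (- (norm a *\<^sub>R oneB)) (\<psi> a)" "B.le (\<psi> a) (norm a *\<^sub>R oneB)"
    using le[OF A.le_norm(2)[of a]] le[OF A.le_norm(1)[of a]]
    by (simp_all add: linear_neg[OF b(2)] linear_scale[OF b(2)] one)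
  then show ?thesis using B.norm_le_iff[of "norm a" "\<psi> a"] by simp
qed

lemma jordan_iso_AS:
  assumes A: "jbw jA oneA" and B: "jbw jB oneB" and iso: "jordan_iso jA jB \<psi>" and C: "C \<in> AS jA"
  shows "\<psi> ` C \<in> AS jB"
proof -
  have b: "bij \<psi>" "linear \<psi>" "\<And>x y. \<psi> (jA x y) = jB (\<psi> x) (\<psi> y)" using iso by (auto simp: jordan_iso_def)
  note iso' = jordan_iso_inv[OF iso]
  have lin': "linear (inv \<psi>)" using iso' by (simp add: jordan_iso_def)
  have "bounded_linear (inv \<psi>)"
    using jordan_iso_norm_le[OF B A iso'] lin'
    by (intro bounded_linear_intro[of _ 1]) (auto simp: linear_add linear_scale)
  then have c: "continuous_on UNIV (inv \<psi>)" by (rule linear_continuous_on)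
  have f: "\<psi> (inv \<psi> y) = y" for y using b(1) by (simp add: bij_is_surj surj_f_inv_f)
  have g: "inv \<psi> (\<psi> x) = x" for x using b(1) by (simp add: bij_is_inj inv_f_f)
  have "\<psi> ` C = inv \<psi> -` C" by (auto simp: g) (metis f imageI)
  then have "closed (\<psi> ` C)" using C c by (simp add: AS_def closed_vimage)
  moreover have "subspace (\<psi> ` C)" using C by (intro linear_subspace_image[OF b(2)]) (simp add: AS_def)
  ultimately show ?thesis using C unfolding AS_def by (auto simp: b(3)[symmetric])
qed

text \<open>Stated for the order relation alone, so that all its facts can be reused for the inverse
  map.\<close>

locale AS_iso = A: jbw jA oneA + B: jbw jB oneB
  for jA :: "'a::banach \<Rightarrow> 'a \<Rightarrow> 'a" (infixl "\<odot>" 70) and oneA :: 'a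
    and jB :: "'b::banach \<Rightarrow> 'b \<Rightarrow> 'b" (infixl "\<otimes>" 70) and oneB :: 'b +
  fixes \<phi> :: "'a set \<Rightarrow> 'b set"
  assumes bij: "bij_betw \<phi> (AS jA) (AS jB)"
    and ord: "C \<in> AS jA \<Longrightarrow> D \<in> AS jA \<Longrightarrow> \<phi> C \<subseteq> \<phi> D \<longleftrightarrow> C \<subseteq> D"
begin

lemma zero_AS: "{0} \<in> AS jA" "{0} \<in> AS jB"
  by (auto simp: AS_def A.zero_left B.zero_left)

lemma mem: "C \<in> AS jA \<Longrightarrow> \<phi> C \<in> AS jB"
  using bij bij_betwE by blast

lemma preimage: assumes "D \<in> AS jB" obtains C where "C \<in> AS jA" "\<phi> C = D"
proof -
  have "D \<in> \<phi> ` AS jA" using bij assms by (simp add: bij_betw_def)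
  then show ?thesis using that by (elim imageE) simp
qed

lemma \<phi>_zero: "\<phi> {0} = {0}"
proof -
  obtain C where C: "C \<in> AS jA" "\<phi> C = {0}" by (rule preimage[OF zero_AS(2)])
  have "{0} \<subseteq> C" using C(1) subspace_0[of C] by (auto simp: AS_def)
  then have "\<phi> {0} \<subseteq> {0}" using ord[OF zero_AS(1) C(1)] C(2) by simp
  moreover have "0 \<in> \<phi> {0}" using mem[OF zero_AS(1)] subspace_0[of "\<phi> {0}"] by (auto simp: AS_def)
  ultimately show ?thesis by blast
qed

text \<open>The line of a nonzero idempotent is an atom of the order, so its image is an atom and,
  by \<open>atom_idem\<close>, again a line; \<open>p = 0\<close> gives the least element.\<close>

lemma ex_idem:
  assumes p: "p \<odot> p = p"
  shows "\<exists>q. q \<otimes> q = q \<and> \<phi> (span {p}) = span {q}"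
proof (cases "p = 0")
  case True
  then show ?thesis using \<phi>_zero by (intro exI[of _ 0]) (simp add: B.zero_left)
next
  case False
  have P: "span {p} \<in> AS jA" by (rule A.span_AS[OF p])
  show ?thesis
  proof (rule B.atom_idem[OF mem[OF P]])
    show "\<phi> (span {p}) \<noteq> {0}"
    proof
      assume "\<phi> (span {p}) = {0}"
      then have "\<phi> (span {p}) \<subseteq> \<phi> {0}" by (simp add: \<phi>_zero)
      then have "span {p} \<subseteq> {0}" using ord[OF P zero_AS(1)] by simp
      then show False using span_base[of p "{p}"] False by blast
    qed
    fix D assume D: "D \<in> AS jB" "D \<subseteq> \<phi> (span {p})"
    obtain E where E: "E \<in> AS jA" "\<phi> E = D" by (rule preimage[OF D(1)])
    have "E \<subseteq> span {p}" using ord[OF E(1) P] D(2) E(2) by simp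
    then have "E = {0} \<or> E = span {p}" by (rule A.span_idem_atom[OF E(1)])
    then show "D = {0} \<or> D = \<phi> (span {p})" using E(2) \<phi>_zero by auto
  qed
qed

lemma inverse: "AS_iso jB oneB jA oneA (inv_into (AS jA) \<phi>)"
proof unfold_locales
  show "bij_betw (inv_into (AS jA) \<phi>) (AS jB) (AS jA)" by (rule bij_betw_inv_into[OF bij])
  fix C D assume C: "C \<in> AS jB" and D: "D \<in> AS jB"
  have i: "inv_into (AS jA) \<phi> E \<in> AS jA" "\<phi> (inv_into (AS jA) \<phi> E) = E" if "E \<in> AS jB" for E
    using bij that inv_into_into[of E \<phi> "AS jA"] f_inv_into_f[of E \<phi> "AS jA"] by (simp_all add: bij_betw_def)
  show "inv_into (AS jA) \<phi> C \<subseteq> inv_into (AS jA) \<phi> D \<longleftrightarrow> C \<subseteq> D"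
    using ord[OF i(1)[OF C] i(1)[OF D]] i(2)[OF C] i(2)[OF D] by simp
qed

end

theorem theorem3p1:
  fixes jA :: "'a::banach \<Rightarrow> 'a \<Rightarrow> 'a" and jB :: "'b::banach \<Rightarrow> 'b \<Rightarrow> 'b"
    and \<phi> :: "'a set \<Rightarrow> 'b set"
  assumes "JBW_algebra jA" and "JBW_algebra jB"
    and "\<not> has_type_I2_summand jA"
    and "bij_betw \<phi> (AS jA) (AS jB)"
    and "\<forall>C\<in>AS jA. \<forall>D\<in>AS jA. C \<subseteq> D \<longleftrightarrow> \<phi> C \<subseteq> \<phi> D"
    and "\<forall>C\<in>AS jA. \<forall>D\<in>AS jA. orth_sub jA C D \<longleftrightarrow> orth_sub jB (\<phi> C) (\<phi> D)"
  shows "\<exists>!\<psi>. jordan_iso jA jB \<psi> \<and> (\<forall>C\<in>AS jA. \<phi> C = \<psi> ` C)"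
proof -
  obtain oneA where A: "jbw jA oneA" by (rule JBW_imp_jbw[OF assms(1)])
  obtain oneB where B: "jbw jB oneB" by (rule JBW_imp_jbw[OF assms(2)])
  interpret A: jbw jA oneA by (rule A)
  interpret B: jbw jB oneB by (rule B)
  interpret F: AS_iso jA oneA jB oneB \<phi> by unfold_locales (use assms(4,5) in auto)
  define \<phi>' where "\<phi>' = inv_into (AS jA) \<phi>"
  interpret G: AS_iso jB oneB jA oneA \<phi>' unfolding \<phi>'_def by (rule F.inverse)
  have \<phi>\<phi>': "\<phi> (\<phi>' D) = D" if "D \<in> AS jB" for D
    unfolding \<phi>'_def using assms(4) that by (simp add: bij_betw_def f_inv_into_f)
  have \<phi>'\<phi>: "\<phi>' (\<phi> C) = C" if "C \<in> AS jA" for C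
    unfolding \<phi>'_def using assms(4) that by (simp add: bij_betw_def inv_into_f_f)
  define \<theta> where "\<theta> p = (SOME q. jB q q = q \<and> \<phi> (span {p}) = span {q})" for p
  have \<theta>: "jB (\<theta> p) (\<theta> p) = \<theta> p" "\<phi> (span {p}) = span {\<theta> p}" if "jA p p = p" for p
    using someI_ex[OF F.ex_idem[OF that]] unfolding \<theta>_def by auto
  \<comment> \<open>A line contains at most one nonzero idempotent, so the choice in the definition
    of \<theta> is forced.\<close>
  have \<theta>I: "\<theta> p = q" if "jA p p = p" "jB q q = q" "\<phi> (span {p}) = span {q}" for p q
    by (rule B.span_idem_inj[OF \<theta>(1)[OF that(1)] that(2)]) (use \<theta>(2)[OF that(1)] that(3) in simp)
  have \<theta>_surj: "\<exists>p. jA p p = p \<and> \<theta> p = q" if q: "jB q q = q" for q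
  proof -
    obtain p where p: "jA p p = p" "\<phi>' (span {q}) = span {p}" using G.ex_idem[OF q] by blast
    have "\<phi> (span {p}) = span {q}" using \<phi>\<phi>'[OF B.span_AS[OF q]] p(2) by simp
    then show ?thesis using \<theta>I[OF p(1) q] p(1) by blast
  qed
  have orth: "jB (\<theta> p) (\<theta> q) = 0 \<longleftrightarrow> jA p q = 0" if pq: "jA p p = p" "jA q q = q" for p q
  proof -
    have "orth_sub jA (span {p}) (span {q}) \<longleftrightarrow> orth_sub jB (\<phi> (span {p})) (\<phi> (span {q}))"
      using assms(6) A.span_AS pq by blast
    then show ?thesis unfolding \<theta>(2)[OF pq(1)] \<theta>(2)[OF pq(2)] A.orth_sub_span B.orth_sub_span by simp
  qed
  \<comment> \<open>An idempotent is determined by the idempotents orthogonal to it, and all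
    idempotents of \<open>jB\<close> are values of \<theta>; the unit and orthogonal sums are
    transferred in this way.\<close>
  have \<theta>_eq: "\<theta> e = g" if e: "jA e e = e" and g: "jB g g = g" and s: "\<And>s. jA s s = s \<Longrightarrow> jA s e = 0 \<longleftrightarrow> jB (\<theta> s) g = 0" for e g
  proof (rule B.idem_eq_of_orth[OF \<theta>(1)[OF e] g])
    fix t assume "jB t t = t"
    then obtain s where "jA s s = s" "\<theta> s = t" using \<theta>_surj by blast
    then show "jB t (\<theta> e) = 0 \<longleftrightarrow> jB t g = 0" using orth[OF _ e] s by blast
  qed
  have \<theta>_nz: "p = 0" if "jA p p = p" "\<theta> p = 0" for p
    using orth[OF that(1) that(1)] that by (simp add: B.zero_left)
  have \<theta>_one: "\<theta> oneA = oneB"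
  proof (rule \<theta>_eq[OF A.unit B.unit])
    fix s assume s: "jA s s = s"
    have "\<theta> 0 = 0" by (rule \<theta>I) (simp_all add: A.zero_left B.zero_left F.\<phi>_zero)
    then show "jA s oneA = 0 \<longleftrightarrow> jB (\<theta> s) oneB = 0" using \<theta>_nz[OF s] by (auto simp: A.unit_right B.unit_right)
  qed
  have \<theta>_add: "\<theta> (p + q) = \<theta> p + \<theta> q" if pq: "jA p p = p" "jA q q = q" "jA p q = 0" for p q
  proof (rule \<theta>_eq)
    have o: "jB (\<theta> p) (\<theta> q) = 0" using orth pq by blast
    show i: "jA (p + q) (p + q) = p + q" by (simp add: A.add_left A.add_right pq A.comm[of q p])
    show i': "jB (\<theta> p + \<theta> q) (\<theta> p + \<theta> q) = \<theta> p + \<theta> q"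
      by (simp add: B.add_left B.add_right \<theta>(1) pq o B.comm[of "\<theta> q" "\<theta> p"])
    fix s assume s: "jA s s = s"
    have 1: "jA s (p + q) = 0 \<longleftrightarrow> jA s p = 0 \<and> jA s q = 0"
    proof
      assume h: "jA s (p + q) = 0"
      have "jA (p + q) p = p" "jA (p + q) q = q" by (simp_all add: A.add_left pq A.comm[of q p])
      moreover have "jA (p + q) s = 0" using h by (simp add: A.comm)
      ultimately have "jA p s = 0" "jA q s = 0" using A.E1_E0[OF i, of p s] A.E1_E0[OF i, of q s] by simp_all
      then show "jA s p = 0 \<and> jA s q = 0" by (simp add: A.comm)
    qed (simp add: A.add_right)
    have 2: "jB t (\<theta> p + \<theta> q) = 0 \<longleftrightarrow> jB t (\<theta> p) = 0 \<and> jB t (\<theta> q) = 0" for t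
    proof
      assume h: "jB t (\<theta> p + \<theta> q) = 0"
      have "jB (\<theta> p + \<theta> q) (\<theta> p) = \<theta> p" "jB (\<theta> p + \<theta> q) (\<theta> q) = \<theta> q"
        by (simp_all add: B.add_left \<theta>(1) pq o B.comm[of "\<theta> q" "\<theta> p"])
      moreover have "jB (\<theta> p + \<theta> q) t = 0" using h by (simp add: B.comm)
      ultimately have "jB (\<theta> p) t = 0" "jB (\<theta> q) t = 0" using B.E1_E0[OF i', of "\<theta> p" t] B.E1_E0[OF i', of "\<theta> q" t] by simp_all
      then show "jB t (\<theta> p) = 0 \<and> jB t (\<theta> q) = 0" by (simp add: B.comm)
    qed (simp add: B.add_right)
    show "jA s (p + q) = 0 \<longleftrightarrow> jB (\<theta> s) (\<theta> p + \<theta> q) = 0" unfolding 1 2 using orth[OF s] pq by blast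
  qed
  interpret Y: dye jA oneA jB oneB \<theta>
    by unfold_locales (simp_all add: assms(3) \<theta>(1) orth \<theta>_add \<theta>_one \<theta>_nz \<theta>_surj)
  obtain \<psi> where \<psi>: "jordan_iso jA jB \<psi>" "\<And>p. jA p p = p \<Longrightarrow> \<psi> p = \<theta> p" using Y.extends by blast
  have b: "bij \<psi>" "linear \<psi>" using \<psi>(1) by (auto simp: jordan_iso_def)
  have span_img: "span {\<psi>' p} = \<psi>' ` span {p}" if "linear \<psi>'" for \<psi>' :: "'a \<Rightarrow> 'b" and p
    using linear_span_image[OF that, of "{p}"] by simp
  have inv_img: "inv \<psi> ` \<psi> ` C = C" "\<psi> ` inv \<psi> ` D = D" for C D
    using b(1) by (auto simp: image_inv_f_f bij_is_inj image_f_inv_f bij_is_surj)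
  note AS\<psi> = jordan_iso_AS[OF A B \<psi>(1)] and AS\<psi>' = jordan_iso_AS[OF B A jordan_iso_inv[OF \<psi>(1)]]
  have eq: "\<phi> C = \<psi> ` C" if C: "C \<in> AS jA" for C
  proof -
    have "inv \<psi> ` \<phi> C = C"
    proof (rule A.order_auto_fixes[of "\<lambda>C. inv \<psi> ` \<phi> C" "\<lambda>C. \<phi>' (\<psi> ` C)"])
      fix p assume p: "jA p p = p"
      have "\<phi> (span {p}) = \<psi> ` span {p}" using \<theta>(2)[OF p] span_img[OF b(2), of p] unfolding \<psi>(2)[OF p] by simp
      then show "inv \<psi> ` \<phi> (span {p}) = span {p}" "\<phi>' (\<psi> ` span {p}) = span {p}"
        using inv_img(1) \<phi>'\<phi>[OF A.span_AS[OF p]] by simp_all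
    next
      fix C D assume "C \<in> AS jA" "D \<in> AS jA" "C \<subseteq> D"
      then show "inv \<psi> ` \<phi> C \<subseteq> inv \<psi> ` \<phi> D" "\<phi>' (\<psi> ` C) \<subseteq> \<phi>' (\<psi> ` D)"
        using F.ord G.ord[OF AS\<psi> AS\<psi>] by (simp_all add: image_mono)
    qed (use C F.mem G.mem AS\<psi> AS\<psi>' inv_img \<phi>\<phi>' \<phi>'\<phi> in simp_all)
    then show ?thesis using inv_img(2) by metis
  qed
  show ?thesis
  proof (rule ex1I[of _ \<psi>])
    show "jordan_iso jA jB \<psi> \<and> (\<forall>C\<in>AS jA. \<phi> C = \<psi> ` C)" using \<psi>(1) eq by blast
    fix \<psi>' assume h: "jordan_iso jA jB \<psi>' \<and> (\<forall>C\<in>AS jA. \<phi> C = \<psi>' ` C)"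
    have b': "linear \<psi>'" "\<And>x y. \<psi>' (jA x y) = jB (\<psi>' x) (\<psi>' y)" using h by (auto simp: jordan_iso_def)
    \<comment> \<open>A competitor has to agree with \<theta> on idempotents, whose combinations are
      dense; both maps are contractive, so they coincide.\<close>
    have idem: "\<psi>' p = \<psi> p" if p: "jA p p = p" for p
    proof -
      have "\<phi> (span {p}) = span {\<psi>' p}" using h A.span_AS[OF p] span_img[OF b'(1)] by simp
      moreover have "jB (\<psi>' p) (\<psi>' p) = \<psi>' p" by (simp add: b'(2)[symmetric] p)
      ultimately show ?thesis using \<theta>I[OF p] \<psi>(2)[OF p] by metis
    qed
    show "\<psi>' = \<psi>"
    proof
      fix a
      have "norm (\<psi>' a - \<psi> a) \<le> 0 + e" if e: "e > 0" for e
      proof -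
        have e2: "e / 2 > 0" using e by simp
        obtain P c where P: "finite P" "\<forall>p\<in>P. jA p p = p" "norm (a - (\<Sum>p\<in>P. c p *\<^sub>R p)) \<le> e / 2"
          using A.approx_simple_ex[OF e2, of a] by (elim exE conjE) (rule that; assumption)
        let ?x = "\<Sum>p\<in>P. c p *\<^sub>R p"
        have "\<psi>' ?x = \<psi> ?x"
          unfolding linear_sum[OF b'(1)] linear_sum[OF b(2)] linear_scale[OF b'(1)] linear_scale[OF b(2)]
          by (intro sum.cong refl) (use P(2) idem in simp)
        then have "\<psi>' a - \<psi> a = \<psi>' (a - ?x) - \<psi> (a - ?x)" by (simp add: linear_diff[OF b'(1)] linear_diff[OF b(2)])
        also have "norm \<dots> \<le> norm (a - ?x) + norm (a - ?x)"
          using jordan_iso_norm_le[OF A B, of \<psi>' "a - ?x"] jordan_iso_norm_le[OF A B \<psi>(1), of "a - ?x"] h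
          by (intro order_trans[OF norm_triangle_ineq4] add_mono) auto
        finally show ?thesis using P(3) by linarith
      qed
      then have "norm (\<psi>' a - \<psi> a) \<le> 0" by (rule field_le_epsilon)
      then show "\<psi>' a = \<psi> a" by simp
    qed
  qed
qed

end
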